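(* Suppose $\mathcal K$ is nice and $B$ is a separable indecomposable ring of finite degree in $\mathcal K$. Then $B$ is quasi-Galois in $\mathcal K$ (with some group $\Gamma$) if and only if there exists a nonzero separable ring $A$ of finite degree in $\mathcal K$ such that $B$ is a splitting ring of $A$.
   Context: $(\mathcal K,\otimes,\mathbb 1)$ is an idempotent-complete symmetric monoidal category: $\mathcal K$ is additive, $\otimes$ is additive in each variable, and every $e:x\to x$ with $e^2=e$ yields a decomposition $x\cong x_1\oplus x_2$ under which $e$ becomes $\left(\begin{smallmatrix}1&0\\0&0\end{smallmatrix}\right)$. Rings. A ring in $\mathcal K$ is a commutative monoid $(A,\mu:A\otimes A\to A,\eta:\mathbb 1\to A)$ in $\mathcal K$. Ring morphisms are morphisms in $\mathcal K$ compatible with multiplication and unit. $A\otimes B$ is the ring with multiplication $\mu_A\otimes\mu_B$ precomposed with the swap of the two middle factors; $A\times B$ is $A\oplus B$ with componentwise multiplication. $A$ is separable if there is $\sigma:A\to A\otimes A$ with $\mu\sigma=1_A$ and $(1\otimes\mu)(\sigma\otimes1)=\sigma\mu=(\mu\otimes1)(1\otimes\sigma)$. An $A$-algebra is a ring $B$ with a ring morphism $A\to B$. A ring $A$ is indecomposable if it is nonzero and the only idempotent $A$-linear endomorphisms $A\to A$ are $1_A$ and $0$ (equivalently, $A$ is nonzero and is not a product of two nonzero rings). Modules. For $A$ separable, $A\text{-}\mathrm{Mod}_{\mathcal K}$ is the category of left $A$-modules in $\mathcal K$ with $A$-linear morphisms; it is idempotent-complete symmetric monoidal under $\otimes_A$,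 where $x\otimes_A y$ is the coequaliser of the two action maps $x\otimes A\otimes y\rightrightarrows x\otimes y$, with unit $\mathbb 1_A=A$. Extension-of-scalars $F_A:\mathcal K\to A\text{-}\mathrm{Mod}_{\mathcal K}$, $F_A(x)=A\otimes x$, is monoidal. $A$-algebras in $\mathcal K$ correspond to rings in $A\text{-}\mathrm{Mod}_{\mathcal K}$, and separability is the same in both senses. Degree. For a separable ring $A$ there is a separable $A$-algebra $A'$, unique up to isomorphism of $A$-algebras, with a ring isomorphism $h:A\otimes A\to A\times A'$ such that $\mathrm{pr}_1h=\mu$, where $A'$ is an $A$-algebra via $\mathrm{pr}_2h(1_A\otimes\eta)$. Define $A^{[0]}=\mathbb 1$, $A^{[1]}=A$, and inductively $A^{[n+1]}=(A^{[n]})'$, where $A^{[n]}$ is regarded as a ring in $A^{[n-1]}\text{-}\mathrm{Mod}_{\mathcal K}$. The degree $\deg(A)$ is $d$ if $A^{[d]}\ne0$ and $A^{[d+1]}=0$; it is infinite if $A^{[d]}\neq0$ for all $d\ge 0$. Quasi-Galois. Let $A$ be a nonzero ring and $\Gamma$ a finite group of ring automorphisms of $A$. $A$ is quasi-Galois in $\mathcal K$ with group $\Gamma$ if $\lambda_\Gamma:A\otimes A\to\prod_{\gamma\in\Gamma}A$, defined by $\mathrm{pr}_\gamma\lambda_\Gamma=\mu(1\otimes\gamma)$, is an isomorphism. An indecomposable ring is simply called quasi-Galois if it is so with some group $\Gamma$ (then $\Gamma$ necessarily consists of all its ring endomorphisms). Splitting. For separable rings $A,B$ of finite degree, $B$ splits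 $A$ if $F_B(A)\cong\mathbb 1_B^{\times\deg(A)}$ as rings in $B\text{-}\mathrm{Mod}_{\mathcal K}$. An indecomposable (separable, finite degree) ring $B$ is a splitting ring of $A$ if $B$ splits $A$ and any ring morphism $C\to B$, where $C$ is an indecomposable (separable, finite degree) ring splitting $A$, is an isomorphism. $\mathcal K$ is nice if for every separable ring $A$ of finite degree in $\mathcal K$ there are indecomposable rings $A_1,\dots,A_n$ in $\mathcal K$ with $A\cong A_1\times\dots\times A_n$. *)

theory Defs
  imports "HOL-Algebra.FiniteProduct"
begin

section \<open>Categories with addition and tensor product\<close>

text \<open>
  \<^term>\<open>Assoc K x y z\<close> goes from $(x \otimes y) \otimes z$ to $x \otimes (y \otimes z)$,
  \<^term>\<open>Lunit K x\<close> from $1 \otimes x$ to $x$, \<^term>\<open>Runit K x\<close> from $x \otimes 1$ to $x$ and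
  \<^term>\<open>Swap K x y\<close> from $x \otimes y$ to $y \otimes x$.  Every arrow determines its domain and
  codomain.  All operations are relevant only on objects and arrows for which they make sense.
\<close>

record ('o, 'm) smc =
  Obj :: "'o set"
  Arr :: "'m set"
  Dom :: "'m \<Rightarrow> 'o"
  Cod :: "'m \<Rightarrow> 'o"
  Comp :: "'m \<Rightarrow> 'm \<Rightarrow> 'm"  (infixl \<open>\<cdot>\<index>\<close> 70)
  Ide :: "'o \<Rightarrow> 'm"
  Plus :: "'m \<Rightarrow> 'm \<Rightarrow> 'm"  (infixl \<open>\<boxplus>\<index>\<close> 65)
  Zero :: "'o \<Rightarrow> 'o \<Rightarrow> 'm"
  TensO :: "'o \<Rightarrow> 'o \<Rightarrow> 'o"  (infixr \<open>\<boxtimes>\<index>\<close> 75)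
  TensA :: "'m \<Rightarrow> 'm \<Rightarrow> 'm"  (infixr \<open>\<boxdot>\<index>\<close> 75)
  Unity :: "'o"
  Assoc :: "'o \<Rightarrow> 'o \<Rightarrow> 'o \<Rightarrow> 'm"
  Lunit :: "'o \<Rightarrow> 'm"
  Runit :: "'o \<Rightarrow> 'm"
  Swap :: "'o \<Rightarrow> 'o \<Rightarrow> 'm"

record ('o, 'm) ring_data =
  Car :: "'o"
  Mul :: "'m"
  One :: "'m"

context
  fixes K :: "('o, 'm) smc" (structure)
begin

definition Hom :: "'o \<Rightarrow> 'o \<Rightarrow> 'm set" where
  "Hom x y = {f \<in> Arr K. Dom K f = x \<and> Cod K f = y}"

definition hom_group :: "'o \<Rightarrow> 'o \<Rightarrow> 'm monoid" where
  "hom_group x y = \<lparr>carrier = Hom x y, mult = Plus K, one = Zero K x y\<rparr>"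

definition inverse_arrows :: "'m \<Rightarrow> 'm \<Rightarrow> bool" where
  "inverse_arrows f g \<longleftrightarrow> f \<in> Arr K \<and> g \<in> Hom (Cod K f) (Dom K f) \<and>
     g \<cdot> f = Ide K (Dom K f) \<and> f \<cdot> g = Ide K (Cod K f)"

definition is_iso :: "'m \<Rightarrow> bool" where
  "is_iso f \<longleftrightarrow> (\<exists>g. inverse_arrows f g)"

definition inv_arr :: "'m \<Rightarrow> 'm" where
  "inv_arr f = (THE g. inverse_arrows f g)"

definition zero_object :: "'o \<Rightarrow> bool" where
  "zero_object z \<longleftrightarrow> z \<in> Obj K \<and>
     (\<forall>x\<in>Obj K. (\<exists>!f. f \<in> Hom x z) \<and> (\<exists>!f. f \<in> Hom z x))"

definition biproduct :: "'o \<Rightarrow> 'o \<Rightarrow> 'o \<Rightarrow> 'm \<Rightarrow> 'm \<Rightarrow> 'm \<Rightarrow> 'm \<Rightarrow> bool" where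
  "biproduct x1 x2 s i1 i2 p1 p2 \<longleftrightarrow>
     x1 \<in> Obj K \<and> x2 \<in> Obj K \<and> s \<in> Obj K \<and>
     i1 \<in> Hom x1 s \<and> i2 \<in> Hom x2 s \<and> p1 \<in> Hom s x1 \<and> p2 \<in> Hom s x2 \<and>
     p1 \<cdot> i1 = Ide K x1 \<and> p2 \<cdot> i2 = Ide K x2 \<and>
     p2 \<cdot> i1 = Zero K x1 x2 \<and> p1 \<cdot> i2 = Zero K x2 x1 \<and>
     (i1 \<cdot> p1) \<boxplus> (i2 \<cdot> p2) = Ide K s"

definition direct_sum :: "'i set \<Rightarrow> ('i \<Rightarrow> 'o) \<Rightarrow> 'o \<Rightarrow> ('i \<Rightarrow> 'm) \<Rightarrow> bool" where
  "direct_sum I X s \<pi> \<longleftrightarrow> finite I \<and> s \<in> Obj K \<and> (\<forall>i\<in>I. X i \<in> Obj K \<and> \<pi> i \<in> Hom s (X i)) \<and>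
     (\<exists>\<iota>. (\<forall>i\<in>I. \<iota> i \<in> Hom (X i) s) \<and>
        (\<forall>i\<in>I. \<forall>j\<in>I. \<pi> j \<cdot> \<iota> i = (if i = j then Ide K (X i) else Zero K (X i) (X j))) \<and>
        finprod (hom_group s s) (\<lambda>i. \<iota> i \<cdot> \<pi> i) I = Ide K s)"

definition coequalizer :: "'m \<Rightarrow> 'm \<Rightarrow> 'o \<Rightarrow> 'm \<Rightarrow> bool" where
  "coequalizer f g t q \<longleftrightarrow> f \<in> Arr K \<and> g \<in> Hom (Dom K f) (Cod K f) \<and> t \<in> Obj K \<and>
     q \<in> Hom (Cod K f) t \<and> q \<cdot> f = q \<cdot> g \<and>
     (\<forall>z\<in>Obj K. \<forall>k\<in>Hom (Cod K f) z. k \<cdot> f = k \<cdot> g \<longrightarrow> (\<exists>!u. u \<in> Hom t z \<and> u \<cdot> q = k))"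

text \<open>The canonical arrow from $(a \otimes b) \otimes (c \otimes d)$ to
  $(a \otimes c) \otimes (b \otimes d)$ swapping the two middle factors.\<close>

definition mid_swap :: "'o \<Rightarrow> 'o \<Rightarrow> 'o \<Rightarrow> 'o \<Rightarrow> 'm" where
  "mid_swap a b c d =
     inv_arr (Assoc K a c (b \<boxtimes> d)) \<cdot>
     (Ide K a \<boxdot> (Assoc K c b d \<cdot> (Swap K b c \<boxdot> Ide K d) \<cdot> inv_arr (Assoc K b c d))) \<cdot>
     Assoc K a b (c \<boxtimes> d)"

end

locale ordinary_category =
  fixes K :: "('o, 'm) smc" (structure)
  assumes dom_cod: "f \<in> Arr K \<Longrightarrow> Dom K f \<in> Obj K \<and> Cod K f \<in> Obj K"
    and comp_in_hom: "\<lbrakk>f \<in> Hom K x y; g \<in> Hom K y z\<rbrakk> \<Longrightarrow> g \<cdot> f \<in> Hom K x z"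
    and ide_in_hom: "x \<in> Obj K \<Longrightarrow> Ide K x \<in> Hom K x x"
    and comp_ide: "f \<in> Hom K x y \<Longrightarrow> f \<cdot> Ide K x = f"
    and ide_comp: "f \<in> Hom K x y \<Longrightarrow> Ide K y \<cdot> f = f"
    and comp_assoc: "\<lbrakk>f \<in> Hom K w x; g \<in> Hom K x y; h \<in> Hom K y z\<rbrakk>
      \<Longrightarrow> (h \<cdot> g) \<cdot> f = h \<cdot> (g \<cdot> f)"

locale additive_category = ordinary_category +
  assumes hom_comm_group: "\<lbrakk>x \<in> Obj K; y \<in> Obj K\<rbrakk> \<Longrightarrow> comm_group (hom_group K x y)"
    and comp_plus_left: "\<lbrakk>f \<in> Hom K x y; g \<in> Hom K y z; h \<in> Hom K y z\<rbrakk>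
      \<Longrightarrow> (g \<boxplus> h) \<cdot> f = (g \<cdot> f) \<boxplus> (h \<cdot> f)"
    and comp_plus_right: "\<lbrakk>f \<in> Hom K x y; g \<in> Hom K x y; h \<in> Hom K y z\<rbrakk>
      \<Longrightarrow> h \<cdot> (f \<boxplus> g) = (h \<cdot> f) \<boxplus> (h \<cdot> g)"
    and ex_zero_object: "\<exists>z. zero_object K z"
    and ex_biproduct: "\<lbrakk>x \<in> Obj K; y \<in> Obj K\<rbrakk>
      \<Longrightarrow> \<exists>s i1 i2 p1 p2. biproduct K x y s i1 i2 p1 p2"

locale symmetric_monoidal_category = ordinary_category +
  assumes unity_obj: "Unity K \<in> Obj K"
    and tens_obj: "\<lbrakk>x \<in> Obj K; y \<in> Obj K\<rbrakk> \<Longrightarrow> x \<boxtimes> y \<in> Obj K"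
    and tens_in_hom: "\<lbrakk>f \<in> Hom K x x'; g \<in> Hom K y y'\<rbrakk> \<Longrightarrow> f \<boxdot> g \<in> Hom K (x \<boxtimes> y) (x' \<boxtimes> y')"
    and tens_ide: "\<lbrakk>x \<in> Obj K; y \<in> Obj K\<rbrakk> \<Longrightarrow> Ide K x \<boxdot> Ide K y = Ide K (x \<boxtimes> y)"
    and interchange: "\<lbrakk>f \<in> Hom K x x'; f' \<in> Hom K x' x''; g \<in> Hom K y y'; g' \<in> Hom K y' y''\<rbrakk>
      \<Longrightarrow> (f' \<cdot> f) \<boxdot> (g' \<cdot> g) = (f' \<boxdot> g') \<cdot> (f \<boxdot> g)"
    and assoc_in_hom: "\<lbrakk>x \<in> Obj K; y \<in> Obj K; z \<in> Obj K\<rbrakk>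
      \<Longrightarrow> Assoc K x y z \<in> Hom K ((x \<boxtimes> y) \<boxtimes> z) (x \<boxtimes> (y \<boxtimes> z))"
    and assoc_iso: "\<lbrakk>x \<in> Obj K; y \<in> Obj K; z \<in> Obj K\<rbrakk> \<Longrightarrow> is_iso K (Assoc K x y z)"
    and assoc_natural: "\<lbrakk>f \<in> Hom K x x'; g \<in> Hom K y y'; h \<in> Hom K z z'\<rbrakk>
      \<Longrightarrow> Assoc K x' y' z' \<cdot> ((f \<boxdot> g) \<boxdot> h) = (f \<boxdot> (g \<boxdot> h)) \<cdot> Assoc K x y z"
    and lunit_in_hom: "x \<in> Obj K \<Longrightarrow> Lunit K x \<in> Hom K (Unity K \<boxtimes> x) x"
    and lunit_iso: "x \<in> Obj K \<Longrightarrow> is_iso K (Lunit K x)"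
    and lunit_natural: "f \<in> Hom K x y \<Longrightarrow> Lunit K y \<cdot> (Ide K (Unity K) \<boxdot> f) = f \<cdot> Lunit K x"
    and runit_in_hom: "x \<in> Obj K \<Longrightarrow> Runit K x \<in> Hom K (x \<boxtimes> Unity K) x"
    and runit_iso: "x \<in> Obj K \<Longrightarrow> is_iso K (Runit K x)"
    and runit_natural: "f \<in> Hom K x y \<Longrightarrow> Runit K y \<cdot> (f \<boxdot> Ide K (Unity K)) = f \<cdot> Runit K x"
    and swap_in_hom: "\<lbrakk>x \<in> Obj K; y \<in> Obj K\<rbrakk> \<Longrightarrow> Swap K x y \<in> Hom K (x \<boxtimes> y) (y \<boxtimes> x)"
    and swap_natural: "\<lbrakk>f \<in> Hom K x x'; g \<in> Hom K y y'\<rbrakk>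
      \<Longrightarrow> Swap K x' y' \<cdot> (f \<boxdot> g) = (g \<boxdot> f) \<cdot> Swap K x y"
    and swap_swap: "\<lbrakk>x \<in> Obj K; y \<in> Obj K\<rbrakk> \<Longrightarrow> Swap K y x \<cdot> Swap K x y = Ide K (x \<boxtimes> y)"
    and pentagon: "\<lbrakk>w \<in> Obj K; x \<in> Obj K; y \<in> Obj K; z \<in> Obj K\<rbrakk>
      \<Longrightarrow> Assoc K w x (y \<boxtimes> z) \<cdot> Assoc K (w \<boxtimes> x) y z =
          (Ide K w \<boxdot> Assoc K x y z) \<cdot> Assoc K w (x \<boxtimes> y) z \<cdot> (Assoc K w x y \<boxdot> Ide K z)"
    and triangle: "\<lbrakk>x \<in> Obj K; y \<in> Obj K\<rbrakk>
      \<Longrightarrow> (Ide K x \<boxdot> Lunit K y) \<cdot> Assoc K x (Unity K) y = Runit K x \<boxdot> Ide K y"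
    and hexagon: "\<lbrakk>x \<in> Obj K; y \<in> Obj K; z \<in> Obj K\<rbrakk>
      \<Longrightarrow> Assoc K y z x \<cdot> Swap K x (y \<boxtimes> z) \<cdot> Assoc K x y z =
          (Ide K y \<boxdot> Swap K x z) \<cdot> Assoc K y x z \<cdot> (Swap K x y \<boxdot> Ide K z)"

text \<open>In \<open>idempotent_split\<close>, the arrow $i_1 p_1$ is the one with matrix
  $(1, 0; 0, 0)$ in the decomposition of $x$ as $x_1 \oplus x_2$.\<close>

locale idempotent_complete_smc = additive_category K + symmetric_monoidal_category K
  for K :: "('o, 'm) smc" (structure) +
  assumes tens_plus_left: "\<lbrakk>f \<in> Hom K x x'; g \<in> Hom K x x'; h \<in> Hom K y y'\<rbrakk>
      \<Longrightarrow> (f \<boxplus> g) \<boxdot> h = (f \<boxdot> h) \<boxplus> (g \<boxdot> h)"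
    and tens_plus_right: "\<lbrakk>f \<in> Hom K x x'; g \<in> Hom K y y'; h \<in> Hom K y y'\<rbrakk>
      \<Longrightarrow> f \<boxdot> (g \<boxplus> h) = (f \<boxdot> g) \<boxplus> (f \<boxdot> h)"
    and idempotent_split: "\<lbrakk>e \<in> Hom K x x; e \<cdot> e = e\<rbrakk>
      \<Longrightarrow> \<exists>x1 x2 i1 i2 p1 p2. biproduct K x1 x2 x i1 i2 p1 p2 \<and> e = i1 \<cdot> p1"


section \<open>Rings\<close>

context
  fixes K :: "('o, 'm) smc" (structure)
begin

definition is_ring :: "('o, 'm) ring_data \<Rightarrow> bool" where
  "is_ring A \<longleftrightarrow> (let a = Car A; \<mu> = Mul A; \<eta> = One A in
     a \<in> Obj K \<and> \<mu> \<in> Hom K (a \<boxtimes> a) a \<and> \<eta> \<in> Hom K (Unity K) a \<and>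
     \<mu> \<cdot> (\<mu> \<boxdot> Ide K a) = \<mu> \<cdot> (Ide K a \<boxdot> \<mu>) \<cdot> Assoc K a a a \<and>
     \<mu> \<cdot> (\<eta> \<boxdot> Ide K a) = Lunit K a \<and>
     \<mu> \<cdot> (Ide K a \<boxdot> \<eta>) = Runit K a \<and>
     \<mu> \<cdot> Swap K a a = \<mu>)"

definition ring_mor :: "('o, 'm) ring_data \<Rightarrow> ('o, 'm) ring_data \<Rightarrow> 'm \<Rightarrow> bool" where
  "ring_mor A B f \<longleftrightarrow> is_ring A \<and> is_ring B \<and> f \<in> Hom K (Car A) (Car B) \<and>
     f \<cdot> Mul A = Mul B \<cdot> (f \<boxdot> f) \<and> f \<cdot> One A = One B"

definition ring_isom :: "('o, 'm) ring_data \<Rightarrow> ('o, 'm) ring_data \<Rightarrow> 'm \<Rightarrow> bool" where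
  "ring_isom A B f \<longleftrightarrow> ring_mor A B f \<and> is_iso K f"

definition nonzero :: "('o, 'm) ring_data \<Rightarrow> bool" where
  "nonzero A \<longleftrightarrow> \<not> zero_object K (Car A)"

definition unit_ring :: "('o, 'm) ring_data" where
  "unit_ring = \<lparr>Car = Unity K, Mul = Lunit K (Unity K), One = Ide K (Unity K)\<rparr>"

definition tens_ring :: "('o, 'm) ring_data \<Rightarrow> ('o, 'm) ring_data \<Rightarrow> ('o, 'm) ring_data" where
  "tens_ring A B =
     \<lparr>Car = Car A \<boxtimes> Car B,
      Mul = (Mul A \<boxdot> Mul B) \<cdot> mid_swap K (Car A) (Car B) (Car A) (Car B),
      One = (One A \<boxdot> One B) \<cdot> inv_arr K (Lunit K (Unity K))\<rparr>"

text \<open>That the projections are ring morphisms says that multiplication is componentwise.\<close>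

definition binary_product_ring ::
    "('o, 'm) ring_data \<Rightarrow> ('o, 'm) ring_data \<Rightarrow> ('o, 'm) ring_data \<Rightarrow> 'm \<Rightarrow> 'm \<Rightarrow> bool" where
  "binary_product_ring A B P p1 p2 \<longleftrightarrow>
     (\<exists>i1 i2. biproduct K (Car A) (Car B) (Car P) i1 i2 p1 p2) \<and>
     ring_mor P A p1 \<and> ring_mor P B p2"

definition product_ring ::
    "'i set \<Rightarrow> ('i \<Rightarrow> ('o, 'm) ring_data) \<Rightarrow> ('o, 'm) ring_data \<Rightarrow> ('i \<Rightarrow> 'm) \<Rightarrow> bool" where
  "product_ring I A P \<pi> \<longleftrightarrow> is_ring P \<and> direct_sum K I (\<lambda>i. Car (A i)) (Car P) \<pi> \<and>
     (\<forall>i\<in>I. ring_mor P (A i) (\<pi> i))"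

definition separable_ring :: "('o, 'm) ring_data \<Rightarrow> bool" where
  "separable_ring A \<longleftrightarrow> is_ring A \<and> (let a = Car A; \<mu> = Mul A in
     \<exists>\<sigma>\<in>Hom K a (a \<boxtimes> a). \<mu> \<cdot> \<sigma> = Ide K a \<and>
       (Ide K a \<boxdot> \<mu>) \<cdot> Assoc K a a a \<cdot> (\<sigma> \<boxdot> Ide K a) = \<sigma> \<cdot> \<mu> \<and>
       \<sigma> \<cdot> \<mu> = (\<mu> \<boxdot> Ide K a) \<cdot> inv_arr K (Assoc K a a a) \<cdot> (Ide K a \<boxdot> \<sigma>))"

definition indecomposable :: "('o, 'm) ring_data \<Rightarrow> bool" where
  "indecomposable A \<longleftrightarrow> is_ring A \<and> nonzero A \<and>
     (\<forall>e\<in>Hom K (Car A) (Car A).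
        e \<cdot> e = e \<and> e \<cdot> Mul A = Mul A \<cdot> (Ide K (Car A) \<boxdot> e) \<longrightarrow>
        e = Ide K (Car A) \<or> e = Zero K (Car A) (Car A))"

definition aut_group :: "('o, 'm) ring_data \<Rightarrow> 'm monoid" where
  "aut_group A = \<lparr>carrier = {f. ring_isom A A f}, mult = Comp K, one = Ide K (Car A)\<rparr>"

definition quasi_galois :: "('o, 'm) ring_data \<Rightarrow> 'm set \<Rightarrow> bool" where
  "quasi_galois A \<Gamma> \<longleftrightarrow> is_ring A \<and> nonzero A \<and> finite \<Gamma> \<and> subgroup \<Gamma> (aut_group A) \<and>
     (\<exists>P \<pi> \<Lambda>. product_ring \<Gamma> (\<lambda>\<gamma>. A) P \<pi> \<and>
        \<Lambda> \<in> Hom K (Car A \<boxtimes> Car A) (Car P) \<and>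
        (\<forall>\<gamma>\<in>\<Gamma>. \<pi> \<gamma> \<cdot> \<Lambda> = Mul A \<cdot> (Ide K (Car A) \<boxdot> \<gamma>)) \<and>
        is_iso K \<Lambda>)"

text \<open>\<open>C\<close> is the separable \<open>A\<close>-algebra $A'$ of the decomposition of $A \otimes A$
  as $A \times A'$, and \<open>k\<close> is its structure map $A \to A'$.\<close>

definition derived_ring :: "('o, 'm) ring_data \<Rightarrow> ('o, 'm) ring_data \<Rightarrow> 'm \<Rightarrow> bool" where
  "derived_ring A C k \<longleftrightarrow> separable_ring C \<and> ring_mor A C k \<and>
     (\<exists>P p1 p2 h. binary_product_ring A C P p1 p2 \<and> ring_isom (tens_ring A A) P h \<and>
        p1 \<cdot> h = Mul A \<and>
        k = p2 \<cdot> h \<cdot> (Ide K (Car A) \<boxdot> One A) \<cdot> inv_arr K (Runit K (Car A)))"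

end


section \<open>Modules over a ring\<close>

text \<open>A module is a pair of an object and an action; an arrow of modules is a triple of its domain,
  its codomain and the underlying arrow.  The tensor product over \<open>A\<close> is a chosen
  coequaliser; all structure on it is determined by the coequaliser property.\<close>

type_synonym ('o, 'm) modl = "'o \<times> 'm"
type_synonym ('o, 'm) mod_arr = "('o \<times> 'm) \<times> ('o \<times> 'm) \<times> 'm"

abbreviation und :: "('o, 'm) mod_arr \<Rightarrow> 'm" where
  "und F \<equiv> snd (snd F)"

context
  fixes K :: "('o, 'm) smc" (structure) and A :: "('o, 'm) ring_data"
begin

definition is_module :: "('o, 'm) modl \<Rightarrow> bool" where
  "is_module X \<longleftrightarrow> (let x = fst X; r = snd X; a = Car A in
     x \<in> Obj K \<and> r \<in> Hom K (a \<boxtimes> x) x \<and>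
     r \<cdot> (Mul A \<boxdot> Ide K x) = r \<cdot> (Ide K a \<boxdot> r) \<cdot> Assoc K a a x \<and>
     r \<cdot> (One A \<boxdot> Ide K x) = Lunit K x)"

definition linear :: "('o, 'm) modl \<Rightarrow> ('o, 'm) modl \<Rightarrow> 'm \<Rightarrow> bool" where
  "linear X Y f \<longleftrightarrow> f \<in> Hom K (fst X) (fst Y) \<and> f \<cdot> snd X = snd Y \<cdot> (Ide K (Car A) \<boxdot> f)"

text \<open>The two action maps from $(x \otimes A) \otimes y$ to $x \otimes y$; a left
  module over the commutative ring \<open>A\<close> acts on the right through the symmetry.\<close>

definition act_left :: "('o, 'm) modl \<Rightarrow> ('o, 'm) modl \<Rightarrow> 'm" where
  "act_left X Y = (snd X \<cdot> Swap K (fst X) (Car A)) \<boxdot> Ide K (fst Y)"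

definition act_right :: "('o, 'm) modl \<Rightarrow> ('o, 'm) modl \<Rightarrow> 'm" where
  "act_right X Y = (Ide K (fst X) \<boxdot> snd Y) \<cdot> Assoc K (fst X) (Car A) (fst Y)"

definition tens_coeq :: "('o, 'm) modl \<Rightarrow> ('o, 'm) modl \<Rightarrow> 'o \<times> 'm" where
  "tens_coeq X Y = (SOME tq. coequalizer K (act_left X Y) (act_right X Y) (fst tq) (snd tq))"

definition tens_quot :: "('o, 'm) modl \<Rightarrow> ('o, 'm) modl \<Rightarrow> 'm" where
  "tens_quot X Y = snd (tens_coeq X Y)"

definition mod_tens :: "('o, 'm) modl \<Rightarrow> ('o, 'm) modl \<Rightarrow> ('o, 'm) modl" where
  "mod_tens X Y = (let t = fst (tens_coeq X Y); a = Car A in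
     (t, THE r. r \<in> Hom K (a \<boxtimes> t) t \<and>
           r \<cdot> (Ide K a \<boxdot> tens_quot X Y) =
           tens_quot X Y \<cdot> (snd X \<boxdot> Ide K (fst Y)) \<cdot> inv_arr K (Assoc K a (fst X) (fst Y))))"

definition descend :: "('o, 'm) modl \<Rightarrow> ('o, 'm) modl \<Rightarrow> 'm \<Rightarrow> 'm \<Rightarrow> ('o, 'm) mod_arr" where
  "descend X Y q k = (X, Y, THE u. u \<in> Hom K (fst X) (fst Y) \<and> u \<cdot> q = k)"

definition Mod :: "(('o, 'm) modl, ('o, 'm) mod_arr) smc" where
  "Mod =
     \<lparr>Obj = {X. is_module X},
      Arr = {(X, Y, f). is_module X \<and> is_module Y \<and> linear X Y f},
      Dom = (\<lambda>(X, Y, f). X),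
      Cod = (\<lambda>(X, Y, f). Y),
      Comp = (\<lambda>(Y', Z, g) (X, Y, f). (X, Z, g \<cdot> f)),
      Ide = (\<lambda>X. (X, X, Ide K (fst X))),
      Plus = (\<lambda>(X, Y, f) (X', Y', g). (X, Y, f \<boxplus> g)),
      Zero = (\<lambda>X Y. (X, Y, Zero K (fst X) (fst Y))),
      TensO = mod_tens,
      TensA = (\<lambda>(X, X', f) (Y, Y', g).
        descend (mod_tens X Y) (mod_tens X' Y')
          (tens_quot X Y) (tens_quot X' Y' \<cdot> (f \<boxdot> g))),
      Unity = (Car A, Mul A),
      Assoc = (\<lambda>X Y Z.
        descend (mod_tens (mod_tens X Y) Z) (mod_tens X (mod_tens Y Z))
          (tens_quot (mod_tens X Y) Z \<cdot> (tens_quot X Y \<boxdot> Ide K (fst Z)))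
          (tens_quot X (mod_tens Y Z) \<cdot> (Ide K (fst X) \<boxdot> tens_quot Y Z) \<cdot>
             Assoc K (fst X) (fst Y) (fst Z))),
      Lunit = (\<lambda>X.
        descend (mod_tens (Car A, Mul A) X) X (tens_quot (Car A, Mul A) X) (snd X)),
      Runit = (\<lambda>X.
        descend (mod_tens X (Car A, Mul A)) X (tens_quot X (Car A, Mul A))
          (snd X \<cdot> Swap K (fst X) (Car A))),
      Swap = (\<lambda>X Y.
        descend (mod_tens X Y) (mod_tens Y X)
          (tens_quot X Y) (tens_quot Y X \<cdot> Swap K (fst X) (fst Y)))\<rparr>"

text \<open>The correspondence between \<open>A\<close>-algebras in \<open>K\<close> and rings in
  \<open>Mod\<close>: \<open>alg_to_mod R \<phi>\<close> is the ring in \<open>Mod\<close> given by the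
  \<open>A\<close>-algebra \<open>R\<close> with structure map \<open>\<phi>\<close>; conversely, a ring \<open>C\<close> in \<open>Mod\<close> is
  the \<open>A\<close>-algebra \<open>mod_to_ring C\<close> with structure map \<open>und (One C)\<close>.\<close>

definition alg_to_mod :: "('o, 'm) ring_data \<Rightarrow> 'm \<Rightarrow> (('o, 'm) modl, ('o, 'm) mod_arr) ring_data" where
  "alg_to_mod R \<phi> = (let X = (Car R, Mul R \<cdot> (\<phi> \<boxdot> Ide K (Car R))) in
     \<lparr>Car = X,
      Mul = descend (mod_tens X X) X (tens_quot X X) (Mul R),
      One = ((Car A, Mul A), X, \<phi>)\<rparr>)"

definition mod_to_ring :: "(('o, 'm) modl, ('o, 'm) mod_arr) ring_data \<Rightarrow> ('o, 'm) ring_data" where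
  "mod_to_ring C =
     \<lparr>Car = fst (Car C),
      Mul = und (Mul C) \<cdot> tens_quot (Car C) (Car C),
      One = und (One C) \<cdot> One A\<rparr>"

text \<open>Extension of scalars $F_A$ on objects and arrows, its monoidal structure maps
  $F_A(x) \otimes_A F_A(y) \to F_A(x \otimes y)$ and $A \to F_A(1)$, and the
  resulting functor on rings.\<close>

definition ext_obj :: "'o \<Rightarrow> ('o, 'm) modl" where
  "ext_obj x = (Car A \<boxtimes> x,
     (Mul A \<boxdot> Ide K x) \<cdot> inv_arr K (Assoc K (Car A) (Car A) x))"

definition ext_arr :: "'m \<Rightarrow> ('o, 'm) mod_arr" where
  "ext_arr f = (ext_obj (Dom K f), ext_obj (Cod K f), Ide K (Car A) \<boxdot> f)"

definition ext_tens :: "'o \<Rightarrow> 'o \<Rightarrow> ('o, 'm) mod_arr" where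
  "ext_tens x y = descend (mod_tens (ext_obj x) (ext_obj y)) (ext_obj (x \<boxtimes> y))
     (tens_quot (ext_obj x) (ext_obj y))
     ((Mul A \<boxdot> Ide K (x \<boxtimes> y)) \<cdot> mid_swap K (Car A) x (Car A) y)"

definition ext_unit :: "('o, 'm) mod_arr" where
  "ext_unit = ((Car A, Mul A), ext_obj (Unity K), inv_arr K (Runit K (Car A)))"

definition ext_ring :: "('o, 'm) ring_data \<Rightarrow> (('o, 'm) modl, ('o, 'm) mod_arr) ring_data" where
  "ext_ring R =
     \<lparr>Car = ext_obj (Car R),
      Mul = Comp Mod (ext_arr (Mul R)) (ext_tens (Car R) (Car R)),
      One = Comp Mod (ext_arr (One R)) ext_unit\<rparr>"

end


section \<open>Degree, splitting rings\<close>

context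
  fixes K :: "('o, 'm) smc" (structure)
begin

text \<open>\<open>T n\<close> is $A^{[n]}$ and \<open>\<phi> n\<close> is the structure map from
  $A^{[n]}$ to $A^{[n+1]}$.  The ring $A^{[n+2]}$ is obtained by applying the
  construction $A \mapsto A'$ in the category of $A^{[n]}$-modules to
  $A^{[n+1]}$.  Since $A'$ is unique only up to isomorphism, so is the tower.\<close>

definition degree_tower :: "('o, 'm) ring_data \<Rightarrow> (nat \<Rightarrow> ('o, 'm) ring_data) \<Rightarrow> (nat \<Rightarrow> 'm) \<Rightarrow> bool" where
  "degree_tower A T \<phi> \<longleftrightarrow> T 0 = unit_ring K \<and> T 1 = A \<and> \<phi> 0 = One A \<and>
     (\<forall>n. \<exists>C k. derived_ring (Mod K (T n)) (alg_to_mod K (T n) (T (n + 1)) (\<phi> n)) C k \<and>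
        T (n + 2) = mod_to_ring K (T n) C \<and> \<phi> (n + 1) = und k)"

definition has_degree :: "('o, 'm) ring_data \<Rightarrow> nat \<Rightarrow> bool" where
  "has_degree A d \<longleftrightarrow> (\<exists>T \<phi>. degree_tower A T \<phi> \<and>
     nonzero K (T d) \<and> \<not> nonzero K (T (d + 1)))"

definition finite_degree :: "('o, 'm) ring_data \<Rightarrow> bool" where
  "finite_degree A \<longleftrightarrow> (\<exists>d. has_degree A d)"

text \<open>Meaningful for separable rings of finite degree.\<close>

definition deg :: "('o, 'm) ring_data \<Rightarrow> nat" where
  "deg A = (THE d. has_degree A d)"

definition splits :: "('o, 'm) ring_data \<Rightarrow> ('o, 'm) ring_data \<Rightarrow> bool" where
  "splits B A \<longleftrightarrow>
     separable_ring K A \<and> finite_degree A \<and> separable_ring K B \<and> finite_degree B \<and>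
     (\<exists>P \<pi> h. product_ring (Mod K B) {..<deg A} (\<lambda>i. unit_ring (Mod K B)) P \<pi> \<and>
        ring_isom (Mod K B) (ext_ring K B A) P h)"

definition splitting_ring :: "('o, 'm) ring_data \<Rightarrow> ('o, 'm) ring_data \<Rightarrow> bool" where
  "splitting_ring B A \<longleftrightarrow> indecomposable K B \<and> splits B A \<and>
     (\<forall>C f. indecomposable K C \<and> splits C A \<and> ring_mor K C B f \<longrightarrow> is_iso K f)"

definition nice :: bool where
  "nice \<longleftrightarrow> (\<forall>A. separable_ring K A \<and> finite_degree A \<longrightarrow>
     (\<exists>(n::nat) As P \<pi> h. (\<forall>i<n. indecomposable K (As i)) \<and>
        product_ring K {..<n} As P \<pi> \<and> ring_isom K A P h))"

end

end

theory Submission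
  imports Defs "HOL-Algebra.Ring" "HOL-Library.FuncSet"
begin

text \<open>
  Work with the ring $\Gamma(R)$ of arrows $1 \to R$.  A separable ring $A$ has an idempotent in
  $\Gamma(A \otimes A)$ cutting out the diagonal; hence for ring morphisms $g, h : A \to R$ there is
  an idempotent $e \in \Gamma(R)$ such that $u g = u h$ iff $u e = 1$, for all $u : R \to S$.  Call
  $g$ and $h$ disjoint if $u g = u h$ forces $S = 0$.  Then $A'$ represents pairs of disjoint
  morphisms out of $A$, and $A^{[n]}$ represents $n$-tuples of pairwise disjoint ones, so the degree is
  the largest number of pairwise disjoint morphisms from $A$ to a nonzero ring.  With
  $d = \deg A$, a ring $B$ splits $A$ iff there are $d$ pairwise disjoint morphisms $A \to B$, and
  after passing to a nonzero quotient every morphism from $A$ to a $B$-algebra is one of them.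

  If $B$ is quasi-Galois with group $\Gamma$, it splits itself, and a morphism $f : C \to B$ from an
  indecomposable ring splitting $B$ has a section; the idempotent that equalises the section after
  $f$ with the identity of $C$ is nonzero, hence $1$, and $f$ is an isomorphism.

  Conversely, let $B$ be a splitting ring of $A$.  The $d$ disjoint morphisms $A \to B$ give
  $w : A^{[d]} \to B$, which factors through an indecomposable factor of $A^{[d]}$.  This factor
  splits $A$, so by minimality it is $B$ itself.  The $d$ morphisms $A \to B$ being the only ones,
  two morphisms $u, h : B \to R$ to a nonzero ring differ, over a nonzero quotient of $R$, by a
  permutation of them, and as $w$ is the projection to a factor this permutation comes from an
  endomorphism of $B$.  Hence $B \otimes B$ is the product of copies of $B$ indexed by the
  endomorphisms.
\<close>

section \<open>Symmetric monoidal categories\<close>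

text \<open>Two obstacles shape the development. Associators and symmetries are not identities, and
  in the module categories that carry the degree tower the tensor product is itself a chosen
  coequaliser. Equations are therefore checked on generalised elements, for which coherence is
  computed once. For a separable base the coequaliser is a retract of the plain tensor product, cut
  out by the separability idempotent; hence \<open>Mod K A\<close> is again an
  \<open>idempotent_complete_smc\<close>, and every result about \<open>K\<close> applies to it. The
  tower lives in changing categories, but its universal property is stated inside \<open>K\<close>,
  where it decides which members vanish, whatever choices were made. A ring with many idempotents
  may have a morphism that looks like different ones of the d given morphisms on different parts.
  Statements about points are therefore made after a further morphism to a nonzero ring. Niceness is
  needed to decompose A^{[d]}, which must have finite degree for this: a morphism out of it is a
  d-tuple and each entry has, after shrinking, at most d values, whence the bound d^d.\<close>

context ordinary_category
begin

abbreviation arr where "arr f \<equiv> f \<in> Arr K"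
abbreviation iso where "iso f \<equiv> is_iso K f"

lemma in_Hom: "f \<in> Hom K x y \<longleftrightarrow> arr f \<and> Dom K f = x \<and> Cod K f = y"
  by (simp add: Hom_def)

lemma arr_obj [simp]: "arr f \<Longrightarrow> Dom K f \<in> Obj K" "arr f \<Longrightarrow> Cod K f \<in> Obj K"
  using dom_cod by auto

lemma comp_typ [simp]:
  assumes "arr f" "arr g" "Cod K f = Dom K g"
  shows "arr (g \<cdot> f)" "Dom K (g \<cdot> f) = Dom K f" "Cod K (g \<cdot> f) = Cod K g"
  using comp_in_hom[of f "Dom K f" "Cod K f" g "Cod K g"] assms by (auto simp: Hom_def)

lemma ide_typ [simp]:
  assumes "x \<in> Obj K"
  shows "arr (Ide K x)" "Dom K (Ide K x) = x" "Cod K (Ide K x) = x"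
  using ide_in_hom[of x] assms by (auto simp: Hom_def)

lemma comp_ide' [simp]: "arr f \<Longrightarrow> Dom K f = x \<Longrightarrow> f \<cdot> Ide K x = f"
  using comp_ide[of f x "Cod K f"] by (auto simp: Hom_def)

lemma ide_comp' [simp]: "arr f \<Longrightarrow> Cod K f = x \<Longrightarrow> Ide K x \<cdot> f = f"
  using ide_comp[of f "Dom K f" x] by (auto simp: Hom_def)

lemma comp_assoc' [simp]:
  "\<lbrakk>arr f; arr g; arr h; Cod K f = Dom K g; Cod K g = Dom K h\<rbrakk> \<Longrightarrow> (h \<cdot> g) \<cdot> f = h \<cdot> (g \<cdot> f)"
  using comp_assoc[of f "Dom K f" "Cod K f" g "Cod K g" h "Cod K h"] by (auto simp: Hom_def)

lemma inverse_arrows_unique: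
  assumes "inverse_arrows K f g" "inverse_arrows K f h" shows "g = h"
proof -
  have "g \<cdot> (f \<cdot> h) = (g \<cdot> f) \<cdot> h"
    using assms by (intro comp_assoc'[symmetric]) (auto simp: inverse_arrows_def in_Hom)
  then show ?thesis using assms by (auto simp: inverse_arrows_def in_Hom)
qed

lemma inverse_arrows_inv:
  assumes "iso f" shows "inverse_arrows K f (inv_arr K f)"
  using assms unfolding is_iso_def inv_arr_def
  by (metis inverse_arrows_unique theI')

lemma iso_arr: "iso f \<Longrightarrow> arr f"
  by (auto simp: is_iso_def inverse_arrows_def)

lemma iso_inv [simp]:
  assumes "iso f"
  shows "arr (inv_arr K f)" "Dom K (inv_arr K f) = Cod K f" "Cod K (inv_arr K f) = Dom K f"
    "inv_arr K f \<cdot> f = Ide K (Dom K f)" "f \<cdot> inv_arr K f = Ide K (Cod K f)"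
  using inverse_arrows_inv[OF assms] by (auto simp: inverse_arrows_def in_Hom)

lemma isoI: "\<lbrakk>arr f; arr g; Dom K g = Cod K f; Cod K g = Dom K f; g \<cdot> f = Ide K (Dom K f); f \<cdot> g = Ide K (Cod K f)\<rbrakk>
  \<Longrightarrow> iso f"
  by (auto simp: is_iso_def inverse_arrows_def in_Hom)

lemma inv_eqI: "\<lbrakk>arr f; arr g; Dom K g = Cod K f; Cod K g = Dom K f; g \<cdot> f = Ide K (Dom K f); f \<cdot> g = Ide K (Cod K f)\<rbrakk>
  \<Longrightarrow> inv_arr K f = g"
  using inverse_arrows_unique[OF inverse_arrows_inv] isoI
  by (auto simp: inverse_arrows_def in_Hom)

lemma iso_inv_iso [simp]: "iso f \<Longrightarrow> iso (inv_arr K f)"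
  by (rule isoI[where g = f]) (auto simp: iso_arr)

lemma inv_cancel [simp]:
  assumes "iso h" "arr f"
  shows "Cod K f = Dom K h \<Longrightarrow> inv_arr K h \<cdot> (h \<cdot> f) = f"
    and "Cod K f = Cod K h \<Longrightarrow> h \<cdot> (inv_arr K h \<cdot> f) = f"
proof -
  note [simp] = iso_arr[OF assms(1)] assms
  show "inv_arr K h \<cdot> (h \<cdot> f) = f" if "Cod K f = Dom K h"
    using comp_assoc'[of f h "inv_arr K h"] that by simp
  show "h \<cdot> (inv_arr K h \<cdot> f) = f" if "Cod K f = Cod K h"
    using comp_assoc'[of f "inv_arr K h" h] that by simp
qed

lemma iso_comp:
  assumes "iso f" "iso g" "Cod K f = Dom K g" shows "iso (g \<cdot> f)"
  by (rule isoI[where g = "inv_arr K f \<cdot> inv_arr K g"]) (use assms in \<open>auto simp: iso_arr\<close>)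

lemma iso_epi:
  assumes "iso h" "arr f" "arr g" "Dom K f = Cod K h" "Dom K g = Cod K h" "f \<cdot> h = g \<cdot> h"
  shows "f = g"
proof -
  note [simp] = iso_arr[OF assms(1)] assms(1-5)
  have "(f \<cdot> h) \<cdot> inv_arr K h = (g \<cdot> h) \<cdot> inv_arr K h" using assms(6) by metis
  then show ?thesis by simp
qed

lemma iso_mono:
  assumes "iso h" "arr f" "arr g" "Cod K f = Dom K h" "Cod K g = Dom K h" "h \<cdot> f = h \<cdot> g"
  shows "f = g"
proof -
  note [simp] = iso_arr[OF assms(1)] assms(1-5)
  have "inv_arr K h \<cdot> (h \<cdot> f) = inv_arr K h \<cdot> (h \<cdot> g)" using assms(6) by metis
  then show ?thesis by simp
qed

end

section \<open>Unit coherence in symmetric monoidal categories\<close>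

context symmetric_monoidal_category
begin

lemma unity_obj' [simp]: "Unity K \<in> Obj K" by (rule unity_obj)
lemma tens_obj' [simp]: "x \<in> Obj K \<Longrightarrow> y \<in> Obj K \<Longrightarrow> x \<boxtimes> y \<in> Obj K" by (rule tens_obj)

lemma tens_typ [simp]:
  assumes "arr f" "arr g"
  shows "arr (f \<boxdot> g)" "Dom K (f \<boxdot> g) = Dom K f \<boxtimes> Dom K g" "Cod K (f \<boxdot> g) = Cod K f \<boxtimes> Cod K g"
  using tens_in_hom[of f "Dom K f" "Cod K f" g "Dom K g" "Cod K g"] assms by (auto simp: Hom_def)

lemma tens_ide' [simp]: "x \<in> Obj K \<Longrightarrow> y \<in> Obj K \<Longrightarrow> Ide K x \<boxdot> Ide K y = Ide K (x \<boxtimes> y)"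
  by (rule tens_ide)

lemma interchange' [simp]:
  assumes "arr f" "arr g" "arr f'" "arr g'" "Cod K f = Dom K f'" "Cod K g = Dom K g'"
  shows "(f' \<boxdot> g') \<cdot> (f \<boxdot> g) = (f' \<cdot> f) \<boxdot> (g' \<cdot> g)"
    and "arr h \<Longrightarrow> Cod K h = Dom K f \<boxtimes> Dom K g \<Longrightarrow> (f' \<boxdot> g') \<cdot> ((f \<boxdot> g) \<cdot> h) = ((f' \<cdot> f) \<boxdot> (g' \<cdot> g)) \<cdot> h"
proof -
  show *: "(f' \<boxdot> g') \<cdot> (f \<boxdot> g) = (f' \<cdot> f) \<boxdot> (g' \<cdot> g)"
    using interchange[of f "Dom K f" "Cod K f" f' "Cod K f'" g "Dom K g" "Cod K g" g' "Cod K g'"] assms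
    by (auto simp: Hom_def)
  show "arr h \<Longrightarrow> Cod K h = Dom K f \<boxtimes> Dom K g \<Longrightarrow> (f' \<boxdot> g') \<cdot> ((f \<boxdot> g) \<cdot> h) = ((f' \<cdot> f) \<boxdot> (g' \<cdot> g)) \<cdot> h"
    using assms by (simp del: comp_assoc' add: comp_assoc'[symmetric] *)
qed

lemma assoc_typ [simp]:
  assumes "x \<in> Obj K" "y \<in> Obj K" "z \<in> Obj K"
  shows "arr (Assoc K x y z)" "Dom K (Assoc K x y z) = (x \<boxtimes> y) \<boxtimes> z" "Cod K (Assoc K x y z) = x \<boxtimes> (y \<boxtimes> z)"
    "iso (Assoc K x y z)"
  using assoc_in_hom assoc_iso assms by (auto simp: Hom_def)

lemma lunit_typ [simp]:
  assumes "x \<in> Obj K"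
  shows "arr (Lunit K x)" "Dom K (Lunit K x) = Unity K \<boxtimes> x" "Cod K (Lunit K x) = x" "iso (Lunit K x)"
  using lunit_in_hom lunit_iso assms by (auto simp: Hom_def)

lemma runit_typ [simp]:
  assumes "x \<in> Obj K"
  shows "arr (Runit K x)" "Dom K (Runit K x) = x \<boxtimes> Unity K" "Cod K (Runit K x) = x" "iso (Runit K x)"
  using runit_in_hom runit_iso assms by (auto simp: Hom_def)

lemma swap_typ [simp]:
  assumes "x \<in> Obj K" "y \<in> Obj K"
  shows "arr (Swap K x y)" "Dom K (Swap K x y) = x \<boxtimes> y" "Cod K (Swap K x y) = y \<boxtimes> x"
    "iso (Swap K x y)" "Swap K y x \<cdot> Swap K x y = Ide K (x \<boxtimes> y)" "inv_arr K (Swap K x y) = Swap K y x"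
proof -
  show *: "arr (Swap K x y)" "Dom K (Swap K x y) = x \<boxtimes> y" "Cod K (Swap K x y) = y \<boxtimes> x"
    using swap_in_hom assms by (auto simp: Hom_def)
  have **: "arr (Swap K y x)" "Dom K (Swap K y x) = y \<boxtimes> x" "Cod K (Swap K y x) = x \<boxtimes> y"
    using swap_in_hom assms by (auto simp: Hom_def)
  show "iso (Swap K x y)" by (rule isoI[where g = "Swap K y x"]) (use * ** swap_swap assms in auto)
  show "inv_arr K (Swap K x y) = Swap K y x" by (rule inv_eqI) (use * ** swap_swap assms in auto)
  show "Swap K y x \<cdot> Swap K x y = Ide K (x \<boxtimes> y)" using swap_swap assms by auto
qed

lemma iso_tens: "iso f \<Longrightarrow> iso g \<Longrightarrow> iso (f \<boxdot> g)"
  by (rule isoI[where g = "inv_arr K f \<boxdot> inv_arr K g"]) (auto simp: iso_arr)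

lemma iso_ide [simp]: "x \<in> Obj K \<Longrightarrow> iso (Ide K x)"
  by (rule isoI[where g = "Ide K x"]) auto

lemma assoc_nat:
  assumes "arr f" "arr g" "arr h" "Cod K f = x" "Cod K g = y" "Cod K h = z"
  shows "Assoc K x y z \<cdot> ((f \<boxdot> g) \<boxdot> h) = (f \<boxdot> (g \<boxdot> h)) \<cdot> Assoc K (Dom K f) (Dom K g) (Dom K h)"
  using assoc_natural[of f "Dom K f" x g "Dom K g" y h "Dom K h" z] assms by (auto simp: Hom_def)

lemma lunit_nat: "arr f \<Longrightarrow> Cod K f = y \<Longrightarrow> Lunit K y \<cdot> (Ide K (Unity K) \<boxdot> f) = f \<cdot> Lunit K (Dom K f)"
  using lunit_natural[of f "Dom K f" y] by (auto simp: Hom_def)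

lemma runit_nat: "arr f \<Longrightarrow> Cod K f = y \<Longrightarrow> Runit K y \<cdot> (f \<boxdot> Ide K (Unity K)) = f \<cdot> Runit K (Dom K f)"
  using runit_natural[of f "Dom K f" y] by (auto simp: Hom_def)

lemma swap_nat: "arr f \<Longrightarrow> arr g \<Longrightarrow> Cod K f = x \<Longrightarrow> Cod K g = y \<Longrightarrow>
    Swap K x y \<cdot> (f \<boxdot> g) = (g \<boxdot> f) \<cdot> Swap K (Dom K f) (Dom K g)"
  using swap_natural[of f "Dom K f" x g "Dom K g" y] by (auto simp: Hom_def)

text \<open>Naturality of the unitors identifies \<open>f\<close> tensored with the unit with
  \<open>f\<close> itself, up to invertible arrows. The unit laws below are proved after such a
  tensoring, where pentagon, triangle and hexagon become applicable.\<close>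

lemma unit_faithful:
  assumes "arr f" "arr g" "Dom K f = Dom K g" "Cod K f = Cod K g"
  shows "f \<boxdot> Ide K (Unity K) = g \<boxdot> Ide K (Unity K) \<Longrightarrow> f = g"
    and "Ide K (Unity K) \<boxdot> f = Ide K (Unity K) \<boxdot> g \<Longrightarrow> f = g"
proof -
  assume "f \<boxdot> Ide K (Unity K) = g \<boxdot> Ide K (Unity K)"
  then have "f \<cdot> Runit K (Dom K f) = g \<cdot> Runit K (Dom K f)"
    using runit_nat[of f "Cod K f"] runit_nat[of g "Cod K f"] assms by simp
  then show "f = g" by (rule iso_epi[rotated -1]) (use assms in auto)
next
  assume "Ide K (Unity K) \<boxdot> f = Ide K (Unity K) \<boxdot> g"
  then have "f \<cdot> Lunit K (Dom K f) = g \<cdot> Lunit K (Dom K f)"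
    using lunit_nat[of f "Cod K f"] lunit_nat[of g "Cod K f"] assms by simp
  then show "f = g" by (rule iso_epi[rotated -1]) (use assms in auto)
qed

text \<open>After tensoring with the unit on the left, the pentagon for two units and the triangle,
  used for x \<otimes> y and for x, bring both sides to the same form; the invertible arrow
  \<open>?a\<close> is cancelled at the end.\<close>

lemma lunit_tens:
  assumes [simp]: "x \<in> Obj K" "y \<in> Obj K"
  shows "Lunit K (x \<boxtimes> y) \<cdot> Assoc K (Unity K) x y = Lunit K x \<boxdot> Ide K y"
proof (rule unit_faithful(2))
  let ?I = "Unity K"
  let ?a = "Assoc K ?I (?I \<boxtimes> x) y \<cdot> (Assoc K ?I ?I x \<boxdot> Ide K y)"
  have a: "iso ?a" by (intro iso_comp iso_tens) auto
  have "(Ide K ?I \<boxdot> (Lunit K (x \<boxtimes> y) \<cdot> Assoc K ?I x y)) \<cdot> ?a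
      = (Ide K ?I \<boxdot> Lunit K (x \<boxtimes> y)) \<cdot> ((Ide K ?I \<boxdot> Assoc K ?I x y) \<cdot> Assoc K ?I (?I \<boxtimes> x) y \<cdot> (Assoc K ?I ?I x \<boxdot> Ide K y))"
    by simp
  also have "\<dots> = (Ide K ?I \<boxdot> Lunit K (x \<boxtimes> y)) \<cdot> (Assoc K ?I ?I (x \<boxtimes> y) \<cdot> Assoc K (?I \<boxtimes> ?I) x y)"
    using pentagon[of ?I ?I x y] by simp
  also have "\<dots> = ((Ide K ?I \<boxdot> Lunit K (x \<boxtimes> y)) \<cdot> Assoc K ?I ?I (x \<boxtimes> y)) \<cdot> Assoc K (?I \<boxtimes> ?I) x y"
    by simp
  also have "\<dots> = (Runit K ?I \<boxdot> Ide K (x \<boxtimes> y)) \<cdot> Assoc K (?I \<boxtimes> ?I) x y"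
    by (subst triangle) auto
  also have "\<dots> = Assoc K ?I x y \<cdot> ((Runit K ?I \<boxdot> Ide K x) \<boxdot> Ide K y)"
    using assoc_nat[of "Runit K ?I" "Ide K x" "Ide K y" ?I x y] by simp
  also have "\<dots> = Assoc K ?I x y \<cdot> (((Ide K ?I \<boxdot> Lunit K x) \<cdot> Assoc K ?I ?I x) \<boxdot> Ide K y)"
    by (subst triangle) auto
  also have "\<dots> = (Assoc K ?I x y \<cdot> ((Ide K ?I \<boxdot> Lunit K x) \<boxdot> Ide K y)) \<cdot> (Assoc K ?I ?I x \<boxdot> Ide K y)"
    by simp
  also have "\<dots> = (Ide K ?I \<boxdot> (Lunit K x \<boxdot> Ide K y)) \<cdot> ?a"
    by (subst assoc_nat) auto
  finally show "Ide K ?I \<boxdot> (Lunit K (x \<boxtimes> y) \<cdot> Assoc K ?I x y) = Ide K ?I \<boxdot> (Lunit K x \<boxdot> Ide K y)"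
    by (rule iso_epi[OF a, rotated -1]) auto
qed auto

text \<open>Naturality of the left unitor l at the arrow l itself gives 1 \<otimes> l = l at I
  \<otimes> I, as l can be cancelled. Then \<open>lunit_tens\<close> and the triangle yield l
  \<otimes> 1 = r \<otimes> 1.\<close>

lemma lunit_unity_runit: "Lunit K (Unity K) = Runit K (Unity K)"
proof (rule unit_faithful(1))
  let ?I = "Unity K"
  have "Lunit K ?I \<cdot> (Ide K ?I \<boxdot> Lunit K ?I) = Lunit K ?I \<cdot> Lunit K (?I \<boxtimes> ?I)"
    by (subst lunit_nat) auto
  then have "Ide K ?I \<boxdot> Lunit K ?I = Lunit K (?I \<boxtimes> ?I)"
    by (rule iso_mono[rotated -1]) auto
  then show "Lunit K ?I \<boxdot> Ide K ?I = Runit K ?I \<boxdot> Ide K ?I"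
    using lunit_tens[of ?I ?I] triangle[of ?I ?I] by simp
qed auto

text \<open>The axioms link the symmetry to the unit only through the hexagon. Its instance at x, 1,
  1, with the unitors rewritten by \<open>lunit_tens\<close>, shows both sides after composition
  with the same invertible symmetry.\<close>

lemma lunit_swap:
  assumes [simp]: "x \<in> Obj K"
  shows "Lunit K x \<cdot> Swap K x (Unity K) = Runit K x"
proof (rule unit_faithful(1))
  let ?I = "Unity K"
  have "Swap K x ?I \<cdot> (Runit K x \<boxdot> Ide K ?I) = (Swap K x ?I \<cdot> (Ide K x \<boxdot> Lunit K ?I)) \<cdot> Assoc K x ?I ?I"
    using triangle[of x ?I] by simp
  also have "\<dots> = (Lunit K ?I \<boxdot> Ide K x) \<cdot> Swap K x (?I \<boxtimes> ?I) \<cdot> Assoc K x ?I ?I"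
    by (subst swap_nat) auto
  also have "\<dots> = Lunit K (?I \<boxtimes> x) \<cdot> (Assoc K ?I ?I x \<cdot> Swap K x (?I \<boxtimes> ?I) \<cdot> Assoc K x ?I ?I)"
    using lunit_tens[of ?I x, symmetric] by simp
  also have "\<dots> = Lunit K (?I \<boxtimes> x) \<cdot> ((Ide K ?I \<boxdot> Swap K x ?I) \<cdot> Assoc K ?I x ?I \<cdot> (Swap K x ?I \<boxdot> Ide K ?I))"
    using hexagon[of x ?I ?I] by simp
  also have "\<dots> = (Lunit K (?I \<boxtimes> x) \<cdot> (Ide K ?I \<boxdot> Swap K x ?I)) \<cdot> Assoc K ?I x ?I \<cdot> (Swap K x ?I \<boxdot> Ide K ?I)"
    by simp
  also have "\<dots> = Swap K x ?I \<cdot> (Lunit K (x \<boxtimes> ?I) \<cdot> Assoc K ?I x ?I) \<cdot> (Swap K x ?I \<boxdot> Ide K ?I)"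
    by (subst lunit_nat) auto
  also have "\<dots> = Swap K x ?I \<cdot> ((Lunit K x \<cdot> Swap K x ?I) \<boxdot> Ide K ?I)"
    by (subst lunit_tens) auto
  finally show "(Lunit K x \<cdot> Swap K x ?I) \<boxdot> Ide K ?I = Runit K x \<boxdot> Ide K ?I"
    by (intro iso_mono[of "Swap K x ?I" _ "Runit K x \<boxdot> Ide K ?I"]) auto
qed auto

lemma swap_unity: "Swap K (Unity K) (Unity K) = Ide K (Unity K \<boxtimes> Unity K)"
proof (rule iso_mono[of "Lunit K (Unity K)"])
  show "Lunit K (Unity K) \<cdot> Swap K (Unity K) (Unity K) = Lunit K (Unity K) \<cdot> Ide K (Unity K \<boxtimes> Unity K)"
    using lunit_swap[of "Unity K"] lunit_unity_runit by simp
qed auto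

end

section \<open>Shuffling labelled tensor products\<close>

text \<open>A context is a list of objects with pairwise different labels, sorted by label.  Its value is
  the tensor product of the objects, and \<open>shuffle S T\<close> below is the canonical isomorphism from the
  value of the merged context to the tensor product of the two values.\<close>

fun merge_ctx :: "(nat \<times> 'a) list \<Rightarrow> (nat \<times> 'a) list \<Rightarrow> (nat \<times> 'a) list" where
  "merge_ctx [] T = T"
| "merge_ctx (s # S) [] = s # S"
| "merge_ctx (s # S) (t # T) =
     (if fst s < fst t then s # merge_ctx S (t # T) else t # merge_ctx (s # S) T)"

lemma merge_ctx_Nil [simp]: "merge_ctx S [] = S" by (cases S) auto

lemma set_merge_ctx [simp]: "set (merge_ctx S T) = set S \<union> set T"
  by (induction S T rule: merge_ctx.induct) auto

lemma sorted_merge_ctx: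
  "\<lbrakk>sorted_wrt (<) (map fst S); sorted_wrt (<) (map fst T); fst ` set S \<inter> fst ` set T = {}\<rbrakk>
   \<Longrightarrow> sorted_wrt (<) (map fst (merge_ctx S T))"
proof (induction S T rule: merge_ctx.induct)
  case (3 s S t T)
  then have "fst s < fst t \<or> fst t < fst s" by auto
  with 3 show ?case by (auto simp: image_Un)
qed auto

lemma merge_ctx_commute:
  "fst ` set S \<inter> fst ` set T = {} \<Longrightarrow> merge_ctx S T = merge_ctx T S"
proof (induction S T rule: merge_ctx.induct)
  case (3 s S t T)
  then have "fst s \<noteq> fst t" by auto
  with 3 show ?case by auto
qed auto

lemma merge_ctx_Cons:
  "\<lbrakk>\<And>t T'. T = t # T' \<Longrightarrow> fst s < fst t\<rbrakk> \<Longrightarrow> merge_ctx (s # S) T = s # merge_ctx S T"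
  by (cases T) auto

context symmetric_monoidal_category
begin

declare image_Un [simp]

abbreviation \<alpha>i where "\<alpha>i x y z \<equiv> inv_arr K (Assoc K x y z)"

lemma assoc_nat_inv:
  assumes "arr f" "arr g" "arr h"
  shows "\<alpha>i (Cod K f) (Cod K g) (Cod K h) \<cdot> (f \<boxdot> (g \<boxdot> h))
    = ((f \<boxdot> g) \<boxdot> h) \<cdot> \<alpha>i (Dom K f) (Dom K g) (Dom K h)"
proof (rule iso_epi[of "Assoc K (Dom K f) (Dom K g) (Dom K h)"])
  show "(\<alpha>i (Cod K f) (Cod K g) (Cod K h) \<cdot> (f \<boxdot> g \<boxdot> h)) \<cdot> Assoc K (Dom K f) (Dom K g) (Dom K h)
    = (((f \<boxdot> g) \<boxdot> h) \<cdot> \<alpha>i (Dom K f) (Dom K g) (Dom K h)) \<cdot> Assoc K (Dom K f) (Dom K g) (Dom K h)"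
    using assms assoc_nat[of f g h, OF _ _ _ refl refl refl, symmetric] by simp
qed (use assms in auto)

text \<open>Composites are normalised to right-nested form, in which an equation for
  \<open>h \<cdot> g\<close> no longer matches a subterm. This variant lets it act inside a longer
  composite.\<close>

lemma comp_eq:
  "\<lbrakk>h \<cdot> g = r; arr g; arr h; Cod K g = Dom K h; arr f; Cod K f = Dom K g\<rbrakk> \<Longrightarrow> h \<cdot> (g \<cdot> f) = r \<cdot> f"
  using comp_assoc'[of f g h] by simp

lemma pentagon_inv:
  assumes [simp]: "x \<in> Obj K" "a \<in> Obj K" "b \<in> Obj K" "c \<in> Obj K"
  shows "Assoc K (x \<boxtimes> a) b c \<cdot> (\<alpha>i x a b \<boxdot> Ide K c) \<cdot> \<alpha>i x (a \<boxtimes> b) c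
     = \<alpha>i x a (b \<boxtimes> c) \<cdot> (Ide K x \<boxdot> Assoc K a b c)"
  by (rule iso_mono[of "Assoc K x a (b \<boxtimes> c)"]) (auto simp: comp_eq[OF pentagon])

text \<open>The second hexagon, obtained by inverting the first one, since the symmetry is its own
  inverse.\<close>

lemma swap_tens_left:
  assumes [simp]: "a \<in> Obj K" "b \<in> Obj K" "c \<in> Obj K"
  shows "Swap K (b \<boxtimes> c) a = Assoc K a b c \<cdot> (Swap K b a \<boxdot> Ide K c) \<cdot> \<alpha>i b a c \<cdot>
    (Ide K b \<boxdot> Swap K c a) \<cdot> Assoc K b c a" (is "_ = ?r")
proof (rule iso_epi[of "Swap K a (b \<boxtimes> c) \<cdot> Assoc K a b c"])
  have "?r \<cdot> Swap K a (b \<boxtimes> c) \<cdot> Assoc K a b c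
    = Assoc K a b c \<cdot> (Swap K b a \<boxdot> Ide K c) \<cdot> \<alpha>i b a c \<cdot>
    (Ide K b \<boxdot> Swap K c a) \<cdot> (Assoc K b c a \<cdot> Swap K a (b \<boxtimes> c) \<cdot> Assoc K a b c)"
    by simp
  also have "\<dots> = Assoc K a b c"
    using hexagon[of a b c] by simp
  finally show "Swap K (b \<boxtimes> c) a \<cdot> (Swap K a (b \<boxtimes> c) \<cdot> Assoc K a b c) = ?r \<cdot> (Swap K a (b \<boxtimes> c) \<cdot> Assoc K a b c)"
    using swap_typ(5)[of a "b \<boxtimes> c"] by (simp flip: comp_assoc')
qed (auto intro: iso_comp)

lemma swap_middle:
  assumes [simp]: "a \<in> Obj K" "b \<in> Obj K" "c \<in> Obj K"
  shows "Assoc K a b c \<cdot> (Swap K b a \<boxdot> Ide K c) \<cdot> \<alpha>i b a c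
    = Swap K (b \<boxtimes> c) a \<cdot> \<alpha>i b c a \<cdot> (Ide K b \<boxdot> Swap K a c)"
  by (simp add: swap_tens_left)

text \<open>Two ways of reversing three tensor factors, compared by the hexagon and naturality of
  the symmetry. It serves the case in which the last of three contexts holds the smallest
  label.\<close>

lemma swap_reverse:
  assumes [simp]: "a \<in> Obj K" "b \<in> Obj K" "c \<in> Obj K"
  shows "Assoc K a b c \<cdot> Swap K c (a \<boxtimes> b) \<cdot> (Ide K c \<boxdot> Swap K b a) \<cdot> Assoc K c b a
    = Swap K (b \<boxtimes> c) a \<cdot> (Swap K c b \<boxdot> Ide K a)"
proof -
  have "Assoc K a b c \<cdot> Swap K c (a \<boxtimes> b)
      = (Assoc K a b c \<cdot> Swap K c (a \<boxtimes> b) \<cdot> Assoc K c a b) \<cdot> \<alpha>i c a b" by simp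
  also have "\<dots> = (Ide K a \<boxdot> Swap K c b) \<cdot> Assoc K a c b \<cdot> (Swap K c a \<boxdot> Ide K b) \<cdot> \<alpha>i c a b"
    by (subst hexagon) auto
  finally have 1: "Assoc K a b c \<cdot> Swap K c (a \<boxtimes> b) = \<dots>" .
  have "Assoc K a b c \<cdot> Swap K c (a \<boxtimes> b) \<cdot> (Ide K c \<boxdot> Swap K b a) \<cdot> Assoc K c b a
    = (Ide K a \<boxdot> Swap K c b) \<cdot> Swap K (c \<boxtimes> b) a"
    unfolding 1 by (subst swap_tens_left) auto
  also have "\<dots> = Swap K (b \<boxtimes> c) a \<cdot> (Swap K c b \<boxdot> Ide K a)"
    by (subst swap_nat) auto
  finally show ?thesis .
qed

definition ok_ctx :: "(nat \<times> 'a) list \<Rightarrow> bool" where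
  "ok_ctx S \<longleftrightarrow> sorted_wrt (<) (map fst S) \<and> snd ` set S \<subseteq> Obj K"

primrec ctx_obj :: "(nat \<times> 'a) list \<Rightarrow> 'a" where
  "ctx_obj [] = Unity K"
| "ctx_obj (s # S) = snd s \<boxtimes> ctx_obj S"

text \<open>The clauses in which the right context supplies the head are the left ones conjugated by
  the symmetry. This makes \<open>shuffle_sym\<close> nearly definitional, and associativity has to
  be computed from the pentagon only when the first context holds the smallest label.\<close>

fun shuffle :: "(nat \<times> 'a) list \<Rightarrow> (nat \<times> 'a) list \<Rightarrow> 'b" where
  "shuffle [] T = inv_arr K (Lunit K (ctx_obj T))"
| "shuffle (s # S) [] = Swap K (Unity K) (ctx_obj (s # S)) \<cdot> inv_arr K (Lunit K (ctx_obj (s # S)))"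
| "shuffle (s # S) (t # T) =
     (if fst s < fst t
      then \<alpha>i (snd s) (ctx_obj S) (ctx_obj (t # T)) \<cdot> (Ide K (snd s) \<boxdot> shuffle S (t # T))
      else Swap K (ctx_obj (t # T)) (ctx_obj (s # S)) \<cdot> \<alpha>i (snd t) (ctx_obj T) (ctx_obj (s # S)) \<cdot>
        (Ide K (snd t) \<boxdot> (Swap K (ctx_obj (s # S)) (ctx_obj T) \<cdot> shuffle (s # S) T)))"

lemma ctx_obj_in [simp]: "snd ` set S \<subseteq> Obj K \<Longrightarrow> ctx_obj S \<in> Obj K"
  by (induction S) auto

lemma shuffle_typ [simp]:
  assumes "snd ` set S \<subseteq> Obj K" "snd ` set T \<subseteq> Obj K"
  shows "arr (shuffle S T)" "Dom K (shuffle S T) = ctx_obj (merge_ctx S T)"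
    "Cod K (shuffle S T) = ctx_obj S \<boxtimes> ctx_obj T" "iso (shuffle S T)"
proof -
  have "arr (shuffle S T) \<and> Dom K (shuffle S T) = ctx_obj (merge_ctx S T)
    \<and> Cod K (shuffle S T) = ctx_obj S \<boxtimes> ctx_obj T \<and> iso (shuffle S T)"
    using assms
  proof (induction S T rule: shuffle.induct)
    case (2 s S)
    then show ?case by (auto intro!: iso_comp)
  next
    case (3 s S t T)
    then show ?case by (auto intro!: iso_comp iso_tens)
  qed auto
  then show "arr (shuffle S T)" "Dom K (shuffle S T) = ctx_obj (merge_ctx S T)"
    "Cod K (shuffle S T) = ctx_obj S \<boxtimes> ctx_obj T" "iso (shuffle S T)" by auto
qed

lemma shuffle_Cons:
  assumes "snd ` set (s # S) \<subseteq> Obj K" "snd ` set T \<subseteq> Obj K" "T \<noteq> []"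
    "\<And>t T'. T = t # T' \<Longrightarrow> fst s < fst t"
  shows "shuffle (s # S) T = \<alpha>i (snd s) (ctx_obj S) (ctx_obj T) \<cdot> (Ide K (snd s) \<boxdot> shuffle S T)"
  using assms by (cases T) auto

lemma swap_cancel [simp]:
  assumes "x \<in> Obj K" "y \<in> Obj K" "arr f" "Cod K f = x \<boxtimes> y"
  shows "Swap K y x \<cdot> (Swap K x y \<cdot> f) = f"
  using comp_assoc'[of f "Swap K x y" "Swap K y x"] assms by simp

lemma shuffle_sym:
  assumes "snd ` set S \<subseteq> Obj K" "snd ` set T \<subseteq> Obj K" "fst ` set S \<inter> fst ` set T = {}"
  shows "Swap K (ctx_obj S) (ctx_obj T) \<cdot> shuffle S T = shuffle T S"
  using assms
proof (induction S T rule: shuffle.induct)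
  case (1 T)
  then show ?case by (cases T) (auto simp: swap_unity)
next
  case (2 s S)
  then show ?case by auto
next
  case (3 s S t T)
  show ?case
  proof (cases "fst s < fst t")
    case True
    then have "Swap K (ctx_obj S) (ctx_obj (t # T)) \<cdot> shuffle S (t # T) = shuffle (t # T) S"
      using 3 by auto
    then show ?thesis using True 3(3-)
      by (auto simp flip: \<open>Swap K (ctx_obj S) (ctx_obj (t # T)) \<cdot> shuffle S (t # T) = shuffle (t # T) S\<close>)
  next
    case False
    then have "fst t < fst s" using 3(5) by (metis disjoint_iff list.set_intros(1) image_eqI linorder_neqE_nat)
    moreover have "Swap K (ctx_obj (s # S)) (ctx_obj T) \<cdot> shuffle (s # S) T = shuffle T (s # S)"
      using 3 False by auto
    ultimately show ?thesis using False 3(3-) by simp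
  qed
qed

text \<open>The equation of merged contexts is included because without it the two composites need
  not have the same domain.\<close>

definition shuffle_assoc :: "(nat \<times> 'a) list \<Rightarrow> (nat \<times> 'a) list \<Rightarrow> (nat \<times> 'a) list \<Rightarrow> bool" where
  "shuffle_assoc S T U \<longleftrightarrow>
     merge_ctx (merge_ctx S T) U = merge_ctx S (merge_ctx T U) \<and>
     Assoc K (ctx_obj S) (ctx_obj T) (ctx_obj U) \<cdot> (shuffle S T \<boxdot> Ide K (ctx_obj U)) \<cdot> shuffle (merge_ctx S T) U
     = (Ide K (ctx_obj S) \<boxdot> shuffle T U) \<cdot> shuffle S (merge_ctx T U)"

lemma shuffle_assoc_Nil:
  assumes "snd ` set T \<subseteq> Obj K" "snd ` set U \<subseteq> Obj K"
  shows "shuffle_assoc [] T U"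
proof -
  let ?b = "ctx_obj T" and ?c = "ctx_obj U"
  have [simp]: "?b \<in> Obj K" "?c \<in> Obj K" using assms by auto
  have 1: "Assoc K (Unity K) ?b ?c \<cdot> ((inv_arr K (Lunit K ?b) \<boxdot> Ide K ?c) \<cdot> shuffle T U)
     = inv_arr K (Lunit K (?b \<boxtimes> ?c)) \<cdot> shuffle T U"
    by (rule iso_mono[of "Lunit K (?b \<boxtimes> ?c)"]) (use assms in \<open>auto simp: comp_eq[OF lunit_tens]\<close>)
  have 2: "(Ide K (Unity K) \<boxdot> shuffle T U) \<cdot> inv_arr K (Lunit K (ctx_obj (merge_ctx T U)))
    = inv_arr K (Lunit K (?b \<boxtimes> ?c)) \<cdot> shuffle T U"
    by (rule iso_mono[of "Lunit K (?b \<boxtimes> ?c)"])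
      (use assms in \<open>auto simp: comp_eq[OF lunit_nat] image_Un\<close>)
  from 1 2 show ?thesis by (simp add: shuffle_assoc_def assms)
qed

text \<open>The smallest label lies in the first context, so its object \<open>x\<close> is the
  outermost factor in both composites. The pentagon moves \<open>x\<close> out of the associator and
  leaves the claim for the shorter context \<open>S\<close>.\<close>

lemma shuffle_assoc_Cons:
  assumes S: "snd ` set (s # S) \<subseteq> Obj K" and T: "snd ` set T \<subseteq> Obj K" and U: "snd ` set U \<subseteq> Obj K"
    and "T \<noteq> []" "U \<noteq> []" "\<And>t. t \<in> set T \<union> set U \<Longrightarrow> fst s < fst t"
    and IH: "shuffle_assoc S T U"
  shows "shuffle_assoc (s # S) T U"
proof -
  define x a b c where "x = snd s" and "a = ctx_obj S" and "b = ctx_obj T" and "c = ctx_obj U"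
  define f g h k where "f = shuffle S T" and "g = shuffle (merge_ctx S T) U"
    and "h = shuffle S (merge_ctx T U)" and "k = shuffle T U"
  define ab bc where "ab = ctx_obj (merge_ctx S T)" and "bc = ctx_obj (merge_ctx T U)"
  have [simp]: "x \<in> Obj K" "a \<in> Obj K" "b \<in> Obj K" "c \<in> Obj K" "ab \<in> Obj K" "bc \<in> Obj K"
    using S T U by (auto simp: x_def a_def b_def c_def ab_def bc_def image_Un)
  have [simp]: "arr f" "arr g" "arr h" "arr k" "Dom K f = ab" "Cod K f = a \<boxtimes> b" "Cod K g = ab \<boxtimes> c"
     "Cod K h = a \<boxtimes> bc" "Dom K k = bc" "Cod K k = b \<boxtimes> c"
    using S T U by (auto simp: f_def g_def h_def k_def a_def b_def c_def ab_def bc_def image_Un)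
  from IH have m: "merge_ctx (merge_ctx S T) U = merge_ctx S (merge_ctx T U)"
    and e: "Assoc K a b c \<cdot> (f \<boxdot> Ide K c) \<cdot> g = (Ide K a \<boxdot> k) \<cdot> h"
    by (auto simp: shuffle_assoc_def a_def b_def c_def f_def g_def h_def k_def)
  have dg: "Dom K g = Dom K h" using m S T U by (auto simp: g_def h_def image_Un)
  have m1: "merge_ctx (s # S) T = s # merge_ctx S T" "merge_ctx (s # merge_ctx S T) U = s # merge_ctx (merge_ctx S T) U"
     "merge_ctx (s # S) (merge_ctx T U) = s # merge_ctx S (merge_ctx T U)"
    using assms(6) by (intro merge_ctx_Cons; metis UnI1 UnI2 list.set_intros(1) set_merge_ctx)+
  have ne: "merge_ctx T U \<noteq> []" using assms(4) by (metis set_empty set_merge_ctx Un_empty)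
  have lt: "fst s < fst t" if "merge_ctx T U = t # T'" for t T'
    using assms(6) that by (metis list.set_intros(1) set_merge_ctx)
  have m2: "shuffle (s # S) T = \<alpha>i x a b \<cdot> (Ide K x \<boxdot> f)"
     "shuffle (s # merge_ctx S T) U = \<alpha>i x ab c \<cdot> (Ide K x \<boxdot> g)"
     "shuffle (s # S) (merge_ctx T U) = \<alpha>i x a bc \<cdot> (Ide K x \<boxdot> h)"
    unfolding x_def f_def g_def h_def a_def b_def c_def ab_def bc_def
    by (rule shuffle_Cons; use assms(4-6) S T U ne lt in simp)+
  have "Assoc K (x \<boxtimes> a) b c \<cdot> ((\<alpha>i x a b \<cdot> (Ide K x \<boxdot> f)) \<boxdot> Ide K c) \<cdot> (\<alpha>i x ab c \<cdot> (Ide K x \<boxdot> g))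
     = Assoc K (x \<boxtimes> a) b c \<cdot> (\<alpha>i x a b \<boxdot> Ide K c) \<cdot> (((Ide K x \<boxdot> f) \<boxdot> Ide K c) \<cdot> \<alpha>i x ab c) \<cdot> (Ide K x \<boxdot> g)"
    by (simp add: dg)
  also have "((Ide K x \<boxdot> f) \<boxdot> Ide K c) \<cdot> \<alpha>i x ab c = \<alpha>i x (a \<boxtimes> b) c \<cdot> (Ide K x \<boxdot> (f \<boxdot> Ide K c))"
    using assoc_nat_inv[of "Ide K x" f "Ide K c"] by simp
  also have "Assoc K (x \<boxtimes> a) b c \<cdot> (\<alpha>i x a b \<boxdot> Ide K c) \<cdot> (\<alpha>i x (a \<boxtimes> b) c \<cdot> (Ide K x \<boxdot> (f \<boxdot> Ide K c))) \<cdot> (Ide K x \<boxdot> g)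
     = (Assoc K (x \<boxtimes> a) b c \<cdot> (\<alpha>i x a b \<boxdot> Ide K c) \<cdot> \<alpha>i x (a \<boxtimes> b) c) \<cdot> (Ide K x \<boxdot> (f \<boxdot> Ide K c)) \<cdot> (Ide K x \<boxdot> g)"
    by (simp add: dg)
  also have "\<dots> = \<alpha>i x a (b \<boxtimes> c) \<cdot> (Ide K x \<boxdot> (Assoc K a b c \<cdot> (f \<boxdot> Ide K c) \<cdot> g))"
    by (subst pentagon_inv) (auto simp: dg)
  also have "\<dots> = \<alpha>i x a (b \<boxtimes> c) \<cdot> (Ide K x \<boxdot> (Ide K a \<boxdot> k)) \<cdot> (Ide K x \<boxdot> h)"
    by (simp add: e)
  also have "\<dots> = (Ide K (x \<boxtimes> a) \<boxdot> k) \<cdot> \<alpha>i x a bc \<cdot> (Ide K x \<boxdot> h)"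
    by (simp add: comp_eq[OF assoc_nat_inv[of "Ide K x" "Ide K a" k, simplified, symmetric]])
  finally show ?thesis
    using m by (simp add: shuffle_assoc_def m1 m2 flip: x_def a_def b_def c_def k_def)
qed

text \<open>Reduction for the case that the smallest label lies in the second context: both
  hypotheses have \<open>T\<close> in front, and the hexagon in the form \<open>swap_middle\<close>
  leads from them to the order S, T, U.\<close>

lemma shuffle_assoc_middle:
  assumes S: "snd ` set S \<subseteq> Obj K" and T: "snd ` set T \<subseteq> Obj K" and U: "snd ` set U \<subseteq> Obj K"
    and d: "fst ` set S \<inter> fst ` set T = {}" "fst ` set S \<inter> fst ` set U = {}" "fst ` set T \<inter> fst ` set U = {}"
    and 1: "shuffle_assoc T S U" and 2: "shuffle_assoc T U S"
  shows "shuffle_assoc S T U"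
proof -
  have d': "fst ` set S \<inter> fst ` set (merge_ctx T U) = {}" using d by auto
  have mST: "merge_ctx S T = merge_ctx T S" and mSU: "merge_ctx S U = merge_ctx U S"
    and mS_TU: "merge_ctx S (merge_ctx T U) = merge_ctx (merge_ctx T U) S"
    using d d' by (metis merge_ctx_commute)+
  from 1 2 have m: "merge_ctx (merge_ctx S T) U = merge_ctx S (merge_ctx T U)"
    unfolding shuffle_assoc_def mST mS_TU mSU by simp
  let ?a = "ctx_obj S" and ?b = "ctx_obj T" and ?c = "ctx_obj U"
  have [simp]: "?b \<in> Obj K" "?c \<in> Obj K" "?a \<in> Obj K" using assms by auto
  note [simp] = S T U
  define g where "g = shuffle (merge_ctx S T) U"
  have g [simp]: "arr g" "Dom K g = ctx_obj (merge_ctx (merge_ctx S T) U)" "Cod K g = ctx_obj (merge_ctx S T) \<boxtimes> ?c"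
    by (auto simp: g_def image_Un)
  define h where "h = shuffle T (merge_ctx S U)"
  have h [simp]: "arr h" "Dom K h = ctx_obj (merge_ctx T (merge_ctx S U))" "Cod K h = ?b \<boxtimes> ctx_obj (merge_ctx S U)"
    by (auto simp: h_def image_Un)
  define p where "p = shuffle (merge_ctx T U) S"
  have p [simp]: "arr p" "Dom K p = ctx_obj (merge_ctx (merge_ctx T U) S)" "Cod K p = ctx_obj (merge_ctx T U) \<boxtimes> ?a"
    by (auto simp: p_def image_Un)
  have e1: "Assoc K ?b ?a ?c \<cdot> (shuffle T S \<boxdot> Ide K ?c) \<cdot> g = (Ide K ?b \<boxdot> shuffle S U) \<cdot> h"
    using 1 by (simp add: shuffle_assoc_def g_def h_def mST)
  have e2: "Assoc K ?b ?c ?a \<cdot> (shuffle T U \<boxdot> Ide K ?a) \<cdot> p = (Ide K ?b \<boxdot> shuffle U S) \<cdot> h"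
    using 2 by (simp add: shuffle_assoc_def p_def h_def mSU)
  have e2': "(shuffle T U \<boxdot> Ide K ?a) \<cdot> p = \<alpha>i ?b ?c ?a \<cdot> (Ide K ?b \<boxdot> shuffle U S) \<cdot> h"
    using arg_cong[OF e2, of "\<lambda>r. \<alpha>i ?b ?c ?a \<cdot> r"] by (simp add: mST mSU)
  have e1': "(shuffle T S \<boxdot> Ide K ?c) \<cdot> g = \<alpha>i ?b ?a ?c \<cdot> (Ide K ?b \<boxdot> shuffle S U) \<cdot> h"
    using arg_cong[OF e1, of "\<lambda>r. \<alpha>i ?b ?a ?c \<cdot> r"] by (simp add: mST)
  have sST: "shuffle S T = Swap K ?b ?a \<cdot> shuffle T S"
    using shuffle_sym[of T S] d by (simp add: Int_commute)
  have "Assoc K ?a ?b ?c \<cdot> (shuffle S T \<boxdot> Ide K ?c) \<cdot> g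
    = Assoc K ?a ?b ?c \<cdot> (Swap K ?b ?a \<boxdot> Ide K ?c) \<cdot> ((shuffle T S \<boxdot> Ide K ?c) \<cdot> g)"
    unfolding sST by (simp add: mST)
  also have "\<dots> = (Assoc K ?a ?b ?c \<cdot> (Swap K ?b ?a \<boxdot> Ide K ?c) \<cdot> \<alpha>i ?b ?a ?c) \<cdot> (Ide K ?b \<boxdot> shuffle S U) \<cdot> h"
    unfolding e1' using 1 by (simp add: shuffle_assoc_def image_Un)
  also have "\<dots> = Swap K (?b \<boxtimes> ?c) ?a \<cdot> (\<alpha>i ?b ?c ?a \<cdot> (Ide K ?b \<boxdot> (Swap K ?a ?c \<cdot> shuffle S U)) \<cdot> h)"
    by (subst swap_middle) auto
  also have "\<dots> = Swap K (?b \<boxtimes> ?c) ?a \<cdot> ((shuffle T U \<boxdot> Ide K ?a) \<cdot> p)"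
    using shuffle_sym[of S U] d by (simp add: e2' mSU)
  also have "Swap K (?b \<boxtimes> ?c) ?a \<cdot> ((shuffle T U \<boxdot> Ide K ?a) \<cdot> p) = (Swap K (?b \<boxtimes> ?c) ?a \<cdot> (shuffle T U \<boxdot> Ide K ?a)) \<cdot> p"
    by (simp add: image_Un)
  also have "\<dots> = (Ide K ?a \<boxdot> shuffle T U) \<cdot> (Swap K (ctx_obj (merge_ctx T U)) ?a \<cdot> p)"
    by (subst swap_nat) (auto simp: image_Un)
  also have "Swap K (ctx_obj (merge_ctx T U)) ?a \<cdot> p = shuffle S (merge_ctx T U)"
    unfolding p_def using shuffle_sym[of "merge_ctx T U" S] d' by (simp add: image_Un Int_commute)
  finally show ?thesis using m by (simp add: shuffle_assoc_def g_def)
qed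

text \<open>Reduction for the case that the smallest label lies in the third context: associativity
  for U, T, S is read backwards by means of \<open>swap_reverse\<close>.\<close>

lemma shuffle_assoc_reverse:
  assumes S: "snd ` set S \<subseteq> Obj K" and T: "snd ` set T \<subseteq> Obj K" and U: "snd ` set U \<subseteq> Obj K"
    and d: "fst ` set S \<inter> fst ` set T = {}" "fst ` set S \<inter> fst ` set U = {}" "fst ` set T \<inter> fst ` set U = {}"
    and 1: "shuffle_assoc U T S"
  shows "shuffle_assoc S T U"
proof -
  have d': "fst ` set S \<inter> fst ` set (merge_ctx T U) = {}" "fst ` set (merge_ctx S T) \<inter> fst ` set U = {}" using d by auto
  have mST: "merge_ctx S T = merge_ctx T S" and mTU: "merge_ctx T U = merge_ctx U T"
    and mS_TU: "merge_ctx S (merge_ctx U T) = merge_ctx (merge_ctx U T) S"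
    and mST_U: "merge_ctx (merge_ctx T S) U = merge_ctx U (merge_ctx T S)"
    using d d' by (metis merge_ctx_commute)+
  from 1 have m: "merge_ctx (merge_ctx S T) U = merge_ctx S (merge_ctx T U)"
    unfolding shuffle_assoc_def mST mTU mS_TU mST_U by simp
  let ?a = "ctx_obj S" and ?b = "ctx_obj T" and ?c = "ctx_obj U"
  have [simp]: "?b \<in> Obj K" "?c \<in> Obj K" "?a \<in> Obj K" using assms by auto
  note [simp] = S T U
  define p where "p = shuffle (merge_ctx U T) S"
  have p [simp]: "arr p" "Dom K p = ctx_obj (merge_ctx (merge_ctx U T) S)" "Cod K p = ctx_obj (merge_ctx U T) \<boxtimes> ?a"
    by (auto simp: p_def image_Un)
  define h where "h = shuffle U (merge_ctx T S)"
  have h [simp]: "arr h" "Dom K h = ctx_obj (merge_ctx U (merge_ctx T S))" "Cod K h = ?c \<boxtimes> ctx_obj (merge_ctx T S)"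
    by (auto simp: h_def image_Un)
  have e1: "Assoc K ?c ?b ?a \<cdot> (shuffle U T \<boxdot> Ide K ?a) \<cdot> p = (Ide K ?c \<boxdot> shuffle T S) \<cdot> h"
    using 1 by (simp add: shuffle_assoc_def p_def h_def)
  have "Assoc K ?a ?b ?c \<cdot> (shuffle S T \<boxdot> Ide K ?c) \<cdot> shuffle (merge_ctx S T) U
    = Assoc K ?a ?b ?c \<cdot> (shuffle S T \<boxdot> Ide K ?c) \<cdot> (Swap K ?c (ctx_obj (merge_ctx T S)) \<cdot> h)"
    unfolding h_def using shuffle_sym[of U "merge_ctx T S"] d' by (simp add: mST image_Un Int_commute)
  also have "\<dots> = Assoc K ?a ?b ?c \<cdot> ((shuffle S T \<boxdot> Ide K ?c) \<cdot> Swap K ?c (ctx_obj (merge_ctx T S))) \<cdot> h"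
    by (simp add: image_Un mST)
  also have "\<dots> = Assoc K ?a ?b ?c \<cdot> Swap K ?c (?a \<boxtimes> ?b) \<cdot> (Ide K ?c \<boxdot> Swap K ?b ?a) \<cdot> ((Ide K ?c \<boxdot> shuffle T S) \<cdot> h)"
    using shuffle_sym[of T S] d
    by (simp add: mST Int_commute comp_eq[OF swap_nat[of "Ide K ?c" "shuffle S T" ?c "?a \<boxtimes> ?b"]])
  also have "\<dots> = (Assoc K ?a ?b ?c \<cdot> Swap K ?c (?a \<boxtimes> ?b) \<cdot> (Ide K ?c \<boxdot> Swap K ?b ?a) \<cdot> Assoc K ?c ?b ?a) \<cdot> (shuffle U T \<boxdot> Ide K ?a) \<cdot> p"
    unfolding e1[symmetric] by (simp add: image_Un)
  also have "\<dots> = Swap K (?b \<boxtimes> ?c) ?a \<cdot> ((Swap K ?c ?b \<cdot> shuffle U T) \<boxdot> Ide K ?a) \<cdot> p"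
    by (subst swap_reverse) auto
  also have "\<dots> = (Swap K (?b \<boxtimes> ?c) ?a \<cdot> (shuffle T U \<boxdot> Ide K ?a)) \<cdot> p"
    using shuffle_sym[of U T] d by (simp add: Int_commute image_Un mTU)
  also have "\<dots> = (Ide K ?a \<boxdot> shuffle T U) \<cdot> (Swap K (ctx_obj (merge_ctx T U)) ?a \<cdot> p)"
    by (subst swap_nat) (auto simp: image_Un mTU)
  also have "Swap K (ctx_obj (merge_ctx T U)) ?a \<cdot> p = shuffle S (merge_ctx T U)"
    unfolding p_def using shuffle_sym[of "merge_ctx T U" S] d' by (simp add: image_Un Int_commute mTU)
  finally show ?thesis using m by (simp add: shuffle_assoc_def)
qed

text \<open>Induction on the total length. The contexts being sorted, the smallest of the three head
  labels is smaller than every other label, and it decides which context is moved to the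
  front.\<close>

lemma shuffle_assoc_all:
  assumes "ok_ctx S" "ok_ctx T" "ok_ctx U"
    "fst ` set S \<inter> fst ` set T = {}" "fst ` set S \<inter> fst ` set U = {}" "fst ` set T \<inter> fst ` set U = {}"
  shows "shuffle_assoc S T U"
  using assms
proof (induction "length S + length T + length U" arbitrary: S T U rule: less_induct)
  case less
  have first: "shuffle_assoc (s # S') T' U'"
    if "length (s # S') + length T' + length U' = length S + length T + length U" "T' \<noteq> []" "U' \<noteq> []"
      "ok_ctx (s # S')" "ok_ctx T'" "ok_ctx U'" "fst ` set (s # S') \<inter> fst ` set T' = {}"
      "fst ` set (s # S') \<inter> fst ` set U' = {}" "fst ` set T' \<inter> fst ` set U' = {}"
      "fst s < fst (hd T')" "fst s < fst (hd U')" for s S' T' U'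
  proof (rule shuffle_assoc_Cons)
    show "shuffle_assoc S' T' U'"
      using that by (intro less.hyps) (auto simp: ok_ctx_def)
    show "fst s < fst t" if "t \<in> set T' \<union> set U'" for t
    proof -
      have "fst (hd T') \<le> fst t" if "t \<in> set T'"
        using that \<open>ok_ctx T'\<close> by (cases T') (auto simp: ok_ctx_def)
      moreover have "fst (hd U') \<le> fst t" if "t \<in> set U'"
        using that \<open>ok_ctx U'\<close> by (cases U') (auto simp: ok_ctx_def)
      ultimately show ?thesis using that \<open>fst s < fst (hd T')\<close> \<open>fst s < fst (hd U')\<close> by fastforce
    qed
  qed (use that in \<open>auto simp: ok_ctx_def\<close>)
  have ok: "snd ` set S \<subseteq> Obj K" "snd ` set T \<subseteq> Obj K" "snd ` set U \<subseteq> Obj K"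
    using less.prems by (auto simp: ok_ctx_def)
  show ?case
  proof (cases "S = [] \<or> T = [] \<or> U = []")
    case True
    then consider "S = []" | "T = []" | "U = []" by auto
    then show ?thesis
    proof cases
      case 1
      then show ?thesis using shuffle_assoc_Nil ok by simp
    next
      case 2
      show ?thesis
        by (rule shuffle_assoc_middle) (use 2 shuffle_assoc_Nil ok less.prems in simp_all)
    next
      case 3
      show ?thesis
        by (rule shuffle_assoc_reverse) (use 3 shuffle_assoc_Nil ok less.prems in simp_all)
    qed
  next
    case False
    then obtain s S' t T' u U' where [simp]: "S = s # S'" "T = t # T'" "U = u # U'" by (meson neq_Nil_conv)
    have "fst s \<noteq> fst t" "fst t \<noteq> fst u" "fst s \<noteq> fst u" using less.prems by auto
    then consider "fst s < fst t" "fst s < fst u" | "fst t < fst s" "fst t < fst u" | "fst u < fst s" "fst u < fst t"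
      by linarith
    then show ?thesis
    proof cases
      case 1
      then have "shuffle_assoc (s # S') T U" using less.prems by (intro first) auto
      then show ?thesis by simp
    next
      case 2
      then have "shuffle_assoc (t # T') S U" "shuffle_assoc (t # T') U S" using less.prems by (intro first; auto)+
      then show ?thesis using shuffle_assoc_middle[of S T U] ok less.prems by simp
    next
      case 3
      then have "shuffle_assoc (u # U') T S" using less.prems by (intro first) auto
      then show ?thesis using shuffle_assoc_reverse[of S T U] ok less.prems by simp
    qed
  qed
qed

section \<open>Generalised elements\<close>

text \<open>An element of $x$ is an arrow to $x$ from the value of a context.  Because contexts are kept
  sorted, \<open>\<star>\<close> is strictly associative and commutative, so that no associator and no symmetry
  survives in an equation between elements.  A generic element is a split epimorphism; an arrow is
  determined by its value at one (lemma \<open>ext\<close>).\<close>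

definition el :: "(nat \<times> 'a) list \<times> 'b \<Rightarrow> bool" where
  "el a \<longleftrightarrow> ok_ctx (fst a) \<and> arr (snd a) \<and> Dom K (snd a) = ctx_obj (fst a)"

definition ob :: "(nat \<times> 'a) list \<times> 'b \<Rightarrow> 'a" where
  "ob a = Cod K (snd a)"

text \<open>Products of elements are formed only when their variables are different. A repeated
  variable would require a diagonal x \<rightarrow> x \<otimes> x, which a monoidal category does
  not offer.\<close>

definition disj :: "(nat \<times> 'a) list \<times> 'b \<Rightarrow> (nat \<times> 'a) list \<times> 'b \<Rightarrow> bool" where
  "disj a b \<longleftrightarrow> fst ` set (fst a) \<inter> fst ` set (fst b) = {}"

text \<open>Every context ends in the unit object, so the value of \<open>[(i, x)]\<close> is x
  \<otimes> 1; hence the unitor where an identity might be expected.\<close>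

definition var :: "nat \<Rightarrow> 'a \<Rightarrow> (nat \<times> 'a) list \<times> 'b" where
  "var i x = ([(i, x)], Runit K x)"

definition pt :: "(nat \<times> 'a) list \<times> 'b" where
  "pt = ([], Ide K (Unity K))"

definition star :: "(nat \<times> 'a) list \<times> 'b \<Rightarrow> (nat \<times> 'a) list \<times> 'b \<Rightarrow> (nat \<times> 'a) list \<times> 'b"  (infixr \<open>\<star>\<close> 75) where
  "a \<star> b = (merge_ctx (fst a) (fst b), (snd a \<boxdot> snd b) \<cdot> shuffle (fst a) (fst b))"

definition app :: "'b \<Rightarrow> (nat \<times> 'a) list \<times> 'b \<Rightarrow> (nat \<times> 'a) list \<times> 'b" where
  "app f a = (fst a, f \<cdot> snd a)"

definition gen :: "(nat \<times> 'a) list \<times> 'b \<Rightarrow> bool" where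
  "gen a \<longleftrightarrow> el a \<and> (\<exists>s. arr s \<and> Dom K s = ob a \<and> Cod K s = Dom K (snd a) \<and> snd a \<cdot> s = Ide K (ob a))"

lemma disj_sym: "disj a b \<longleftrightarrow> disj b a"
  by (auto simp: disj_def)

lemma disj_simps [simp]:
  "disj (app f a) b \<longleftrightarrow> disj a b" "disj b (app f a) \<longleftrightarrow> disj b a"
  "disj (a \<star> c) b \<longleftrightarrow> disj a b \<and> disj c b" "disj b (a \<star> c) \<longleftrightarrow> disj b a \<and> disj b c"
  "disj pt a" "disj a pt" "disj (var i x) (var j y) \<longleftrightarrow> i \<noteq> j"
  by (auto simp: disj_def app_def star_def pt_def var_def)

lemma el_obj [simp]: "el a \<Longrightarrow> ob a \<in> Obj K"
  by (simp add: el_def ob_def)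

lemma el_app [simp]:
  assumes "el a" "arr f" "Dom K f = ob a" shows "el (app f a)" "ob (app f a) = Cod K f"
  using assms by (auto simp: el_def ob_def app_def)

lemma el_star [simp]:
  assumes "el a" "el b" "disj a b" shows "el (a \<star> b)" "ob (a \<star> b) = ob a \<boxtimes> ob b"
  using assms by (auto simp: el_def ob_def star_def ok_ctx_def disj_def intro: sorted_merge_ctx)

lemma el_var [simp]: assumes "x \<in> Obj K" shows "el (var i x)" "ob (var i x) = x"
  using assms by (auto simp: el_def ob_def var_def ok_ctx_def)

lemma el_pt [simp]: "el pt" "ob pt = Unity K"
  by (auto simp: el_def ob_def pt_def ok_ctx_def)

lemma app_comp [simp]:
  "\<lbrakk>el a; arr f; arr g; Dom K f = ob a; Cod K f = Dom K g\<rbrakk> \<Longrightarrow> app (g \<cdot> f) a = app g (app f a)"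
  by (auto simp: app_def el_def ob_def)

lemma app_ide [simp]: "\<lbrakk>el a; ob a = x\<rbrakk> \<Longrightarrow> app (Ide K x) a = a"
  by (auto simp: app_def el_def ob_def)

lemma app_tens [simp]:
  assumes "el a" "el b" "disj a b" "arr f" "arr g" "Dom K f = ob a" "Dom K g = ob b"
  shows "app (f \<boxdot> g) (a \<star> b) = app f a \<star> app g b"
  using assms by (auto simp: app_def star_def el_def ob_def ok_ctx_def)

lemma app_swap [simp]:
  assumes "el a" "el b" "disj a b" "ob a = x" "ob b = y"
  shows "app (Swap K x y) (a \<star> b) = b \<star> a"
proof -
  have [simp]: "snd ` set (fst a) \<subseteq> Obj K" "snd ` set (fst b) \<subseteq> Obj K" "arr (snd a)" "arr (snd b)"
    "Dom K (snd a) = ctx_obj (fst a)" "Dom K (snd b) = ctx_obj (fst b)" "Cod K (snd a) = x" "Cod K (snd b) = y"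
    "x \<in> Obj K" "y \<in> Obj K"
    using assms by (auto simp: el_def ob_def ok_ctx_def)
  have "Swap K x y \<cdot> ((snd a \<boxdot> snd b) \<cdot> shuffle (fst a) (fst b))
    = (snd b \<boxdot> snd a) \<cdot> (Swap K (ctx_obj (fst a)) (ctx_obj (fst b)) \<cdot> shuffle (fst a) (fst b))"
    using assms by (simp add: comp_eq[OF swap_nat[of "snd a" "snd b" x y]])
  then show ?thesis
    using assms shuffle_sym[of "fst a" "fst b"] merge_ctx_commute[of "fst a" "fst b"]
    by (simp add: app_def star_def disj_def)
qed

text \<open>Here the associativity of shuffles is consumed. From now on an associator applied to
  elements merely moves brackets, and diagrams are replaced by rewriting.\<close>

lemma app_assoc [simp]:
  assumes "el a" "el b" "el c" "disj a b" "disj a c" "disj b c" "ob a = x" "ob b = y" "ob c = z"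
  shows "app (Assoc K x y z) ((a \<star> b) \<star> c) = a \<star> (b \<star> c)"
proof -
  have o: "ok_ctx (fst a)" "ok_ctx (fst b)" "ok_ctx (fst c)" using assms by (auto simp: el_def)
  have [simp]: "snd ` set (fst a) \<subseteq> Obj K" "snd ` set (fst b) \<subseteq> Obj K" "snd ` set (fst c) \<subseteq> Obj K"
    "arr (snd a)" "arr (snd b)" "arr (snd c)"
    "Dom K (snd a) = ctx_obj (fst a)" "Dom K (snd b) = ctx_obj (fst b)" "Dom K (snd c) = ctx_obj (fst c)"
    "Cod K (snd a) = x" "Cod K (snd b) = y" "Cod K (snd c) = z" "x \<in> Obj K" "y \<in> Obj K" "z \<in> Obj K"
    using assms by (auto simp: el_def ob_def ok_ctx_def)
  let ?S = "fst a" and ?T = "fst b" and ?U = "fst c"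
  have sa: "shuffle_assoc ?S ?T ?U"
    using assms o by (intro shuffle_assoc_all) (auto simp: disj_def)
  have m: "merge_ctx (merge_ctx ?S ?T) ?U = merge_ctx ?S (merge_ctx ?T ?U)"
    using sa by (simp add: shuffle_assoc_def)
  have "Assoc K x y z \<cdot> ((((snd a \<boxdot> snd b) \<cdot> shuffle ?S ?T) \<boxdot> snd c) \<cdot> shuffle (merge_ctx ?S ?T) ?U)
    = Assoc K x y z \<cdot> (((snd a \<boxdot> snd b) \<boxdot> snd c) \<cdot> ((shuffle ?S ?T \<boxdot> Ide K (ctx_obj ?U)) \<cdot> shuffle (merge_ctx ?S ?T) ?U))"
    by simp
  also have "\<dots> = (snd a \<boxdot> (snd b \<boxdot> snd c)) \<cdot> (Assoc K (ctx_obj ?S) (ctx_obj ?T) (ctx_obj ?U) \<cdot> ((shuffle ?S ?T \<boxdot> Ide K (ctx_obj ?U)) \<cdot> shuffle (merge_ctx ?S ?T) ?U))"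
    by (subst comp_eq[OF assoc_nat[of "snd a" "snd b" "snd c" x y z]]) auto
  also have "Assoc K (ctx_obj ?S) (ctx_obj ?T) (ctx_obj ?U) \<cdot> ((shuffle ?S ?T \<boxdot> Ide K (ctx_obj ?U)) \<cdot> shuffle (merge_ctx ?S ?T) ?U)
     = (Ide K (ctx_obj ?S) \<boxdot> shuffle ?T ?U) \<cdot> shuffle ?S (merge_ctx ?T ?U)"
    using sa by (simp add: shuffle_assoc_def)
  also have "(snd a \<boxdot> (snd b \<boxdot> snd c)) \<cdot> ((Ide K (ctx_obj ?S) \<boxdot> shuffle ?T ?U) \<cdot> shuffle ?S (merge_ctx ?T ?U))
     = (snd a \<boxdot> ((snd b \<boxdot> snd c) \<cdot> shuffle ?T ?U)) \<cdot> shuffle ?S (merge_ctx ?T ?U)"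
    by simp
  finally show ?thesis using m by (simp add: app_def star_def)
qed

lemma app_lunit [simp]:
  assumes "el a" "ob a = x" shows "app (Lunit K x) (pt \<star> a) = a"
proof -
  have [simp]: "snd ` set (fst a) \<subseteq> Obj K" "arr (snd a)" "Dom K (snd a) = ctx_obj (fst a)" "Cod K (snd a) = x"
    "x \<in> Obj K"
    using assms by (auto simp: el_def ob_def ok_ctx_def)
  show ?thesis
    by (simp add: app_def star_def pt_def comp_eq[OF lunit_nat])
qed

lemma app_runit [simp]:
  assumes "el a" "ob a = x" shows "app (Runit K x) (a \<star> pt) = a"
proof -
  have "app (Runit K x) (a \<star> pt) = app (Lunit K x \<cdot> Swap K x (Unity K)) (a \<star> pt)"
    using assms by (subst lunit_swap) auto
  then show ?thesis using assms el_obj[OF assms(1)] by simp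
qed

lemma app_inv [simp]: "\<lbrakk>el a; iso f; ob a = Dom K f\<rbrakk> \<Longrightarrow> app (inv_arr K f) (app f a) = a"
  "\<lbrakk>el a; iso f; ob a = Cod K f\<rbrakk> \<Longrightarrow> app f (app (inv_arr K f) a) = a"
  by (auto simp: app_def el_def ob_def iso_arr)

lemma app_inv_assoc [simp]:
  assumes "el a" "el b" "el c" "disj a b" "disj a c" "disj b c" "ob a = x" "ob b = y" "ob c = z"
  shows "app (\<alpha>i x y z) (a \<star> (b \<star> c)) = (a \<star> b) \<star> c"
proof -
  have "app (\<alpha>i x y z) (app (Assoc K x y z) ((a \<star> b) \<star> c)) = (a \<star> b) \<star> c"
    using assms by (intro app_inv) auto
  then show ?thesis using assms by (simp del: app_inv)
qed

lemma app_inv_lunit [simp]: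
  assumes "el a" "ob a = x" shows "app (inv_arr K (Lunit K x)) a = pt \<star> a"
proof -
  have "app (inv_arr K (Lunit K x)) (app (Lunit K x) (pt \<star> a)) = pt \<star> a"
    using assms by (intro app_inv) auto
  then show ?thesis using assms by (simp del: app_inv)
qed

lemma app_inv_runit [simp]:
  assumes "el a" "ob a = x" shows "app (inv_arr K (Runit K x)) a = a \<star> pt"
proof -
  have "app (inv_arr K (Runit K x)) (app (Runit K x) (a \<star> pt)) = a \<star> pt"
    using assms by (intro app_inv) auto
  then show ?thesis using assms by (simp del: app_inv)
qed

lemma mid_swap_typ [simp]:
  assumes "a \<in> Obj K" "b \<in> Obj K" "c \<in> Obj K" "d \<in> Obj K"
  shows "arr (mid_swap K a b c d)" "Dom K (mid_swap K a b c d) = (a \<boxtimes> b) \<boxtimes> (c \<boxtimes> d)"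
    "Cod K (mid_swap K a b c d) = (a \<boxtimes> c) \<boxtimes> (b \<boxtimes> d)"
  using assms by (auto simp: mid_swap_def)

lemma app_mid_swap [simp]:
  assumes "el a" "el b" "el c" "el d" "disj a b" "disj a c" "disj a d" "disj b c" "disj b d" "disj c d"
    "ob a = x" "ob b = y" "ob c = z" "ob d = t"
  shows "app (mid_swap K x y z t) ((a \<star> b) \<star> (c \<star> d)) = (a \<star> c) \<star> (b \<star> d)"
proof -
  have "x \<in> Obj K" "y \<in> Obj K" "z \<in> Obj K" "t \<in> Obj K" using assms el_obj by auto
  have 1: "app (Assoc K x y (z \<boxtimes> t)) ((a \<star> b) \<star> (c \<star> d)) = a \<star> (b \<star> (c \<star> d))"
    using assms by simp
  have 2: "app (\<alpha>i y z t) (b \<star> (c \<star> d)) = (b \<star> c) \<star> d"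
    using assms by simp
  have 3: "app (\<alpha>i x z (y \<boxtimes> t)) (a \<star> (c \<star> (b \<star> d))) = (a \<star> c) \<star> (b \<star> d)"
    using assms by (intro app_inv_assoc) (auto simp: disj_sym)
  have d: "disj c b" "disj d b" "disj d c" using assms by (auto simp: disj_sym)
  show ?thesis unfolding mid_swap_def
    using assms \<open>x \<in> Obj K\<close> \<open>y \<in> Obj K\<close> \<open>z \<in> Obj K\<close> \<open>t \<in> Obj K\<close> 1 2 3 d by simp
qed

lemma gen_el [simp]: "gen a \<Longrightarrow> el a" by (simp add: gen_def)

lemma gen_var [simp]: "x \<in> Obj K \<Longrightarrow> gen (var i x)"
  by (auto simp: gen_def var_def el_def ok_ctx_def ob_def intro!: exI[of _ "inv_arr K (Runit K x)"])

lemma gen_pt [simp]: "gen pt"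
  by (auto simp: gen_def pt_def el_def ok_ctx_def ob_def intro!: exI[of _ "Ide K (Unity K)"])

lemma gen_star [simp]:
  assumes "gen a" "gen b" "disj a b" shows "gen (a \<star> b)"
proof -
  from assms obtain s t where st: "arr s" "Dom K s = ob a" "Cod K s = Dom K (snd a)" "snd a \<cdot> s = Ide K (ob a)"
     "arr t" "Dom K t = ob b" "Cod K t = Dom K (snd b)" "snd b \<cdot> t = Ide K (ob b)"
    and e: "el a" "el b" by (auto simp: gen_def)
  have "el (a \<star> b)" using assms by simp
  moreover have "snd (a \<star> b) \<cdot> (inv_arr K (shuffle (fst a) (fst b)) \<cdot> (s \<boxdot> t)) = Ide K (ob (a \<star> b))"
    using st e assms(3) by (simp add: star_def el_def ok_ctx_def) (simp add: ob_def el_def)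
  ultimately show ?thesis unfolding gen_def
    using st e by (intro conjI exI[of _ "inv_arr K (shuffle (fst a) (fst b)) \<cdot> (s \<boxdot> t)"])
      (auto simp: star_def el_def ok_ctx_def ob_def)
qed

text \<open>Split epimorphisms preserve generic elements. Equations on a factor ring, or on a tensor
  product over \<open>A\<close>, can thus be tested on the images of elements upstairs.\<close>

lemma gen_app:
  assumes "gen a" "arr f" "Dom K f = ob a" "arr s" "Dom K s = Cod K f" "Cod K s = Dom K f" "f \<cdot> s = Ide K (Cod K f)"
  shows "gen (app f a)"
proof -
  from assms obtain t where t: "arr t" "Dom K t = ob a" "Cod K t = Dom K (snd a)" "snd a \<cdot> t = Ide K (ob a)"
    and e: "el a" by (auto simp: gen_def)
  have "(f \<cdot> snd a) \<cdot> (t \<cdot> s) = Ide K (Cod K f)"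
    using t e assms comp_eq[OF t(4), of s] by (simp add: ob_def el_def)
  then show ?thesis using t e assms
    by (auto simp: gen_def app_def el_def ob_def intro!: exI[of _ "t \<cdot> s"])
qed

lemma ext:
  assumes "app f a = app g a" "gen a" "arr f" "arr g" "Dom K f = ob a" "Dom K g = ob a"
  shows "f = g"
proof -
  from assms obtain s where s: "arr s" "Dom K s = ob a" "Cod K s = Dom K (snd a)" "snd a \<cdot> s = Ide K (ob a)"
    and e: "el a" by (auto simp: gen_def)
  have "f \<cdot> snd a = g \<cdot> snd a" using assms(1) by (simp add: app_def)
  then have "(f \<cdot> snd a) \<cdot> s = (g \<cdot> snd a) \<cdot> s" by simp
  then show ?thesis using s e assms by (simp add: el_def ob_def)
qed

section \<open>Rings and their coproducts\<close>

abbreviation rmul where "rmul A a b \<equiv> app (Mul A) (a \<star> b)"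
abbreviation rone where "rone A \<equiv> app (One A) pt"

lemma is_ring_typ [simp]:
  assumes "is_ring K A"
  shows "Car A \<in> Obj K" "arr (Mul A)" "Dom K (Mul A) = Car A \<boxtimes> Car A" "Cod K (Mul A) = Car A"
    "arr (One A)" "Dom K (One A) = Unity K" "Cod K (One A) = Car A"
  using assms by (auto simp: is_ring_def Let_def in_Hom)

lemma ring_unit_l [simp]:
  assumes "is_ring K A" "el a" "ob a = Car A"
  shows "rmul A (rone A) a = a"
proof -
  have "app (Mul A \<cdot> (One A \<boxdot> Ide K (Car A))) (pt \<star> a) = a"
    using assms(1) by (subst (asm) is_ring_def) (use assms in \<open>simp add: Let_def\<close>)
  then show ?thesis using assms by simp
qed

lemma ring_comm:
  assumes "is_ring K A" "el a" "el b" "ob a = Car A" "ob b = Car A" "disj a b"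
  shows "rmul A a b = rmul A b a"
proof -
  have "app (Mul A \<cdot> Swap K (Car A) (Car A)) (a \<star> b) = app (Mul A) (a \<star> b)"
    using assms(1) by (subst (asm) is_ring_def) (use assms in \<open>simp add: Let_def\<close>)
  then show ?thesis using assms by simp
qed

lemma ring_unit_r [simp]:
  assumes "is_ring K A" "el a" "ob a = Car A"
  shows "rmul A a (rone A) = a"
  using assms by (subst ring_comm) auto

lemma ring_assoc:
  assumes "is_ring K A" "el a" "el b" "el c" "ob a = Car A" "ob b = Car A" "ob c = Car A"
    "disj a b" "disj a c" "disj b c"
  shows "rmul A (rmul A a b) c = rmul A a (rmul A b c)"
proof -
  have "app (Mul A \<cdot> (Mul A \<boxdot> Ide K (Car A))) ((a \<star> b) \<star> c)
     = app (Mul A \<cdot> (Ide K (Car A) \<boxdot> Mul A) \<cdot> Assoc K (Car A) (Car A) (Car A)) ((a \<star> b) \<star> c)"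
    using assms(1) by (subst (asm) is_ring_def) (simp add: Let_def)
  then show ?thesis using assms by simp
qed

lemma ring_lcomm:
  assumes "is_ring K A" "el a" "el b" "el c" "ob a = Car A" "ob b = Car A" "ob c = Car A"
    "disj a b" "disj a c" "disj b c"
  shows "rmul A b (rmul A a c) = rmul A a (rmul A b c)"
proof -
  have "disj b a" using assms by (simp add: disj_sym)
  then have "rmul A b (rmul A a c) = rmul A (rmul A b a) c" using assms by (subst ring_assoc) auto
  also have "\<dots> = rmul A (rmul A a b) c" using assms by (subst ring_comm[of A b a]) (auto simp: disj_sym)
  also have "\<dots> = rmul A a (rmul A b c)" using assms by (subst ring_assoc) auto
  finally show ?thesis .
qed

lemmas ring_ac = ring_assoc ring_comm ring_lcomm

text \<open>One generic triple suffices, and the right unit law follows from the left one by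
  commutativity. The triple is a parameter so that it may consist of images under a split
  epimorphism.\<close>

lemma is_ringI:
  assumes [simp]: "Car A \<in> Obj K" "arr (Mul A)" "Dom K (Mul A) = Car A \<boxtimes> Car A" "Cod K (Mul A) = Car A"
    "arr (One A)" "Dom K (One A) = Unity K" "Cod K (One A) = Car A"
  assumes ge: "gen a" "gen b" "gen c" "ob a = Car A" "ob b = Car A" "ob c = Car A" "disj a b" "disj a c" "disj b c"
    and as: "rmul A (rmul A a b) c = rmul A a (rmul A b c)" and cm: "rmul A a b = rmul A b a"
    and un: "rmul A (rone A) a = a"
  shows "is_ring K A"
proof -
  note [simp] = ge
  have [simp]: "disj b a" using ge by (simp add: disj_sym)
  have 1: "Mul A \<cdot> (Mul A \<boxdot> Ide K (Car A)) = Mul A \<cdot> (Ide K (Car A) \<boxdot> Mul A) \<cdot> Assoc K (Car A) (Car A) (Car A)"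
    by (rule ext[of _ "(a \<star> b) \<star> c"]) (auto simp: as)
  have 2: "Mul A \<cdot> (One A \<boxdot> Ide K (Car A)) = Lunit K (Car A)"
    by (rule ext[of _ "pt \<star> a"]) (auto simp: un)
  have 3: "Mul A \<cdot> Swap K (Car A) (Car A) = Mul A"
    by (rule ext[of _ "a \<star> b"]) (auto simp: cm)
  have "app (Mul A) (a \<star> rone A) = app (Mul A \<cdot> Swap K (Car A) (Car A)) (a \<star> rone A)" by (simp only: 3)
  then have 4: "Mul A \<cdot> (Ide K (Car A) \<boxdot> One A) = Runit K (Car A)"
    by (intro ext[of _ "a \<star> pt"]) (auto simp: un)
  show ?thesis using 1 2 3 4 by (auto simp: is_ring_def Let_def in_Hom)
qed

lemma ring_mor_typ:
  assumes "ring_mor K A B f"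
  shows "is_ring K A" "is_ring K B" "arr f" "Dom K f = Car A" "Cod K f = Car B" "f \<cdot> One A = One B"
  using assms by (auto simp: ring_mor_def in_Hom)

lemma ring_mor_app:
  assumes "ring_mor K A B f"
  shows "app f (rone A) = rone B"
    "\<lbrakk>el a; el b; ob a = Car A; ob b = Car A; disj a b\<rbrakk> \<Longrightarrow> app f (rmul A a b) = rmul B (app f a) (app f b)"
proof -
  note [simp] = ring_mor_typ[OF assms]
  show "app f (rone A) = rone B" using app_comp[of pt "One A" f] by simp
  assume *: "el a" "el b" "ob a = Car A" "ob b = Car A" "disj a b"
  have "app (f \<cdot> Mul A) (a \<star> b) = app (Mul B \<cdot> (f \<boxdot> f)) (a \<star> b)"
    using assms by (auto simp: ring_mor_def)
  then show "app f (rmul A a b) = rmul B (app f a) (app f b)" using * by simp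
qed

lemma ring_morI:
  assumes "is_ring K A" "is_ring K B" "arr f" "Dom K f = Car A" "Cod K f = Car B"
    and ge: "gen a" "gen b" "ob a = Car A" "ob b = Car A" "disj a b"
    and "app f (rone A) = rone B" and m: "app f (rmul A a b) = rmul B (app f a) (app f b)"
  shows "ring_mor K A B f"
proof -
  note [simp] = assms
  have 1: "f \<cdot> Mul A = Mul B \<cdot> (f \<boxdot> f)"
    by (rule ext[of _ "a \<star> b"]) auto
  have 2: "f \<cdot> One A = One B"
    by (rule ext[of _ "pt"]) auto
  show ?thesis using 1 2 by (auto simp: ring_mor_def in_Hom)
qed

lemma ring_mor_ide: "is_ring K A \<Longrightarrow> ring_mor K A A (Ide K (Car A))"
  by (rule ring_morI[where a = "var 0 (Car A)" and b = "var 1 (Car A)"]) auto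

lemma ring_mor_comp:
  assumes "ring_mor K A B f" "ring_mor K B C g" shows "ring_mor K A C (g \<cdot> f)"
proof -
  note [simp] = ring_mor_typ[OF assms(1)] ring_mor_typ[OF assms(2)] ring_mor_app[OF assms(1)] ring_mor_app[OF assms(2)]
  show ?thesis
    by (rule ring_morI[where a = "var 0 (Car A)" and b = "var 1 (Car A)"]) auto
qed

lemma ring_mor_inv:
  assumes "ring_mor K A B f" "iso f" shows "ring_mor K B A (inv_arr K f)"
proof -
  note [simp] = ring_mor_typ[OF assms(1)] ring_mor_app[OF assms(1)] assms(2)
  \<comment> \<open>Elements of the form \<open>f x\<close> are generic since \<open>f\<close> has a
    section; on them the inverse simply cancels.\<close>
  let ?a = "app f (var 0 (Car A))" and ?b = "app f (var 1 (Car A))"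
  show ?thesis
  proof (rule ring_morI[where a = ?a and b = ?b])
    show "gen ?a" "gen ?b" by (rule gen_app[where s = "inv_arr K f"]; simp)+
    have "app (inv_arr K f) (rmul B ?a ?b) = app (inv_arr K f) (app f (rmul A (var 0 (Car A)) (var 1 (Car A))))"
      by (simp del: app_inv)
    then show "app (inv_arr K f) (rmul B ?a ?b) = rmul A (app (inv_arr K f) ?a) (app (inv_arr K f) ?b)" by (simp del: ring_mor_app[OF assms(1)])
    have "app (inv_arr K f) (rone B) = app (inv_arr K f) (app f (rone A))"
      by (simp del: app_inv)
    then show "app (inv_arr K f) (rone B) = rone A" by (simp del: ring_mor_app[OF assms(1)])
  qed auto
qed

definition inl where "inl A B = (Ide K (Car A) \<boxdot> One B) \<cdot> inv_arr K (Runit K (Car A))"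
definition inr where "inr A B = (One A \<boxdot> Ide K (Car B)) \<cdot> inv_arr K (Lunit K (Car B))"
definition copair where "copair R f g = Mul R \<cdot> (f \<boxdot> g)"

lemma tens_ring_sel [simp]:
  "Car (tens_ring K A B) = Car A \<boxtimes> Car B"
  "Mul (tens_ring K A B) = (Mul A \<boxdot> Mul B) \<cdot> mid_swap K (Car A) (Car B) (Car A) (Car B)"
  "One (tens_ring K A B) = (One A \<boxdot> One B) \<cdot> inv_arr K (Lunit K (Unity K))"
  by (simp_all add: tens_ring_def)

lemma is_ring_tens [simp]:
  assumes [simp]: "is_ring K A" "is_ring K B" shows "is_ring K (tens_ring K A B)"
  by (rule is_ringI[where a = "var 0 (Car A) \<star> var 1 (Car B)" and b = "var 2 (Car A) \<star> var 3 (Car B)"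
        and c = "var 4 (Car A) \<star> var 5 (Car B)"]) (auto simp: ring_ac)

lemma inl_typ [simp]:
  assumes [simp]: "is_ring K A" "is_ring K B"
  shows "arr (inl A B)" "Dom K (inl A B) = Car A" "Cod K (inl A B) = Car A \<boxtimes> Car B"
    "\<lbrakk>el a; ob a = Car A\<rbrakk> \<Longrightarrow> app (inl A B) a = a \<star> rone B"
  by (auto simp: inl_def)

lemma inr_typ [simp]:
  assumes [simp]: "is_ring K A" "is_ring K B"
  shows "arr (inr A B)" "Dom K (inr A B) = Car B" "Cod K (inr A B) = Car A \<boxtimes> Car B"
    "\<lbrakk>el a; ob a = Car B\<rbrakk> \<Longrightarrow> app (inr A B) a = rone A \<star> a"
  by (auto simp: inr_def)

lemma inl_mor: assumes [simp]: "is_ring K A" "is_ring K B" shows "ring_mor K A (tens_ring K A B) (inl A B)"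
  by (rule ring_morI[where a = "var 0 (Car A)" and b = "var 1 (Car A)"]) auto

lemma inr_mor: assumes [simp]: "is_ring K A" "is_ring K B" shows "ring_mor K B (tens_ring K A B) (inr A B)"
  by (rule ring_morI[where a = "var 0 (Car B)" and b = "var 1 (Car B)"]) auto

lemma copair_typ:
  assumes f: "ring_mor K A R f" and g: "ring_mor K B R g"
  shows "arr (copair R f g)" "Dom K (copair R f g) = Car A \<boxtimes> Car B" "Cod K (copair R f g) = Car R"
    "\<lbrakk>el a; el b; ob a = Car A; ob b = Car B; disj a b\<rbrakk> \<Longrightarrow> app (copair R f g) (a \<star> b) = rmul R (app f a) (app g b)"
  using ring_mor_typ[OF f] ring_mor_typ[OF g] by (auto simp: copair_def)

lemma copair_mor:
  assumes f: "ring_mor K A R f" and g: "ring_mor K B R g"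
  shows "ring_mor K (tens_ring K A B) R (copair R f g)"
proof -
  note [simp] = ring_mor_typ[OF f] ring_mor_typ[OF g] copair_typ[OF f g] ring_mor_app[OF f] ring_mor_app[OF g]
  show ?thesis
    by (rule ring_morI[where a = "var 0 (Car A) \<star> var 1 (Car B)" and b = "var 2 (Car A) \<star> var 3 (Car B)"])
      (auto simp: ring_ac)
qed

lemma copair_in:
  assumes f: "ring_mor K A R f" and g: "ring_mor K B R g"
  shows "copair R f g \<cdot> inl A B = f" "copair R f g \<cdot> inr A B = g"
proof -
  note [simp] = ring_mor_typ[OF f] ring_mor_typ[OF g] copair_typ[OF f g] ring_mor_app[OF f] ring_mor_app[OF g]
  show "copair R f g \<cdot> inl A B = f" by (rule ext[of _ "var 0 (Car A)"]) auto
  show "copair R f g \<cdot> inr A B = g" by (rule ext[of _ "var 0 (Car B)"]) auto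
qed

text \<open>A simple tensor is a product, a \<otimes> b = (a \<otimes> 1)(1 \<otimes> b), so a ring
  morphism is determined by its restrictions to the two factors. Together with
  \<open>copair_in\<close> this makes the tensor product the coproduct of commutative rings.\<close>

lemma copair_eq:
  assumes A: "is_ring K A" and B: "is_ring K B" and u: "ring_mor K (tens_ring K A B) R u"
  shows "u = copair R (u \<cdot> inl A B) (u \<cdot> inr A B)"
proof -
  note f = ring_mor_comp[OF inl_mor[OF A B] u] and g = ring_mor_comp[OF inr_mor[OF A B] u]
  note [simp] = A B ring_mor_typ(3,5)[OF u] ring_mor_typ(4)[OF u, simplified] copair_typ[OF f g]
  let ?a = "var 0 (Car A)" and ?b = "var 1 (Car B)"
  have "app u (rmul (tens_ring K A B) (?a \<star> rone B) (rone A \<star> ?b)) = rmul R (app u (?a \<star> rone B)) (app u (rone A \<star> ?b))"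
    by (rule ring_mor_app[OF u]) auto
  then show ?thesis
    by (intro ext[of _ "?a \<star> ?b"]) auto
qed

lemma copair_unique:
  assumes "is_ring K A" "is_ring K B" "ring_mor K (tens_ring K A B) R u" "ring_mor K (tens_ring K A B) R v"
    "u \<cdot> inl A B = v \<cdot> inl A B" "u \<cdot> inr A B = v \<cdot> inr A B"
  shows "u = v"
  using copair_eq[OF assms(1-3)] copair_eq[OF assms(1,2,4)] assms(5,6) by simp

end

section \<open>Zero arrows and finite sums of arrows\<close>

context additive_category
begin

abbreviation Z where "Z x y \<equiv> Zero K x y"

lemma hom_group_sel [simp]: "carrier (hom_group K x y) = Hom K x y" "mult (hom_group K x y) = Plus K"
  "one (hom_group K x y) = Zero K x y"
  by (simp_all add: hom_group_def)

lemma zero_typ [simp]: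
  assumes "x \<in> Obj K" "y \<in> Obj K" shows "arr (Z x y)" "Dom K (Z x y) = x" "Cod K (Z x y) = y"
proof -
  interpret comm_group "hom_group K x y" using hom_comm_group assms .
  show "arr (Z x y)" "Dom K (Z x y) = x" "Cod K (Z x y) = y" using one_closed by (auto simp: in_Hom)
qed

lemma plus_typ [simp]:
  assumes "arr f" "arr g" "Dom K f = Dom K g" "Cod K f = Cod K g"
  shows "arr (f \<boxplus> g)" "Dom K (f \<boxplus> g) = Dom K g" "Cod K (f \<boxplus> g) = Cod K g"
proof -
  interpret comm_group "hom_group K (Dom K g) (Cod K g)" using hom_comm_group assms by simp
  have "f \<boxplus> g \<in> Hom K (Dom K g) (Cod K g)" using m_closed[of f g] assms by (simp add: in_Hom)
  then show "arr (f \<boxplus> g)" "Dom K (f \<boxplus> g) = Dom K g" "Cod K (f \<boxplus> g) = Cod K g"  by (auto simp: in_Hom)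
qed

lemma comp_plus [simp]:
  "\<lbrakk>arr f; arr g; arr h; Cod K f = Dom K g; Dom K g = Dom K h; Cod K g = Cod K h\<rbrakk> \<Longrightarrow> (g \<boxplus> h) \<cdot> f = (g \<cdot> f) \<boxplus> (h \<cdot> f)"
  "\<lbrakk>arr f; arr g; arr h; Dom K f = Dom K g; Cod K f = Cod K g; Cod K g = Dom K h\<rbrakk> \<Longrightarrow> h \<cdot> (f \<boxplus> g) = (h \<cdot> f) \<boxplus> (h \<cdot> g)"
  using comp_plus_left[of f "Dom K f" "Cod K f" g "Cod K g" h]
    comp_plus_right[of f "Dom K f" "Cod K f" g h "Cod K h"] by (auto simp: in_Hom)

lemma plus_zero [simp]:
  assumes "arr f" "Dom K f = x" "Cod K f = y"
  shows "Z x y \<boxplus> f = f" "f \<boxplus> Z x y = f"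
proof -
  interpret comm_group "hom_group K x y" using hom_comm_group assms by auto
  show "Z x y \<boxplus> f = f" "f \<boxplus> Z x y = f" using l_one[of f] r_one[of f] assms by (auto simp: in_Hom)
qed

text \<open>Cancellation in the group of arrows. The axioms state additivity of composition and
  tensor but not that they preserve zero; this is deduced from 0 + 0 = 0 with the present
  lemma.\<close>

lemma plus_idem_zero:
  assumes "arr f" "f \<boxplus> f = f" shows "f = Z (Dom K f) (Cod K f)"
proof -
  interpret comm_group "hom_group K (Dom K f) (Cod K f)" using hom_comm_group assms by auto
  show ?thesis using assms l_cancel_one[of f f] by (auto simp: in_Hom)
qed

lemma comp_zero [simp]:
  "\<lbrakk>arr f; Cod K f = x; y \<in> Obj K\<rbrakk> \<Longrightarrow> Z x y \<cdot> f = Z (Dom K f) y"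
  "\<lbrakk>arr f; Dom K f = y; x \<in> Obj K\<rbrakk> \<Longrightarrow> f \<cdot> Z x y = Z x (Cod K f)"
proof -
  assume *: "arr f" "Cod K f = x" "y \<in> Obj K"
  have "Z x y \<boxplus> Z x y = Z x y" using * by auto
  then have "(Z x y \<boxplus> Z x y) \<cdot> f = Z x y \<cdot> f" by simp
  then have "(Z x y \<cdot> f) \<boxplus> (Z x y \<cdot> f) = Z x y \<cdot> f" using * comp_plus(1)[of f "Z x y" "Z x y"] by auto
  then show "Z x y \<cdot> f = Z (Dom K f) y" using plus_idem_zero[of "Z x y \<cdot> f"] * by auto
next
  assume *: "arr f" "Dom K f = y" "x \<in> Obj K"
  have "Z x y \<boxplus> Z x y = Z x y" using * by auto
  then have "f \<cdot> (Z x y \<boxplus> Z x y) = f \<cdot> Z x y" by simp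
  then have "(f \<cdot> Z x y) \<boxplus> (f \<cdot> Z x y) = f \<cdot> Z x y" using * comp_plus(2)[of "Z x y" "Z x y" f] by auto
  then show "f \<cdot> Z x y = Z x (Cod K f)" using plus_idem_zero[of "f \<cdot> Z x y"] * by auto
qed

lemma zero_object_iff: "zero_object K x \<longleftrightarrow> x \<in> Obj K \<and> Ide K x = Z x x"
proof
  assume "zero_object K x"
  then have "x \<in> Obj K" "\<exists>!f. f \<in> Hom K x x" by (auto simp: zero_object_def)
  then show "x \<in> Obj K \<and> Ide K x = Z x x" by (auto simp: in_Hom)
next
  assume *: "x \<in> Obj K \<and> Ide K x = Z x x"
  show "zero_object K x" unfolding zero_object_def
  proof (intro conjI ballI)
    fix y assume y: "y \<in> Obj K"
    have "f = Z y x" if "f \<in> Hom K y x" for f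
    proof -
      have "f = Ide K x \<cdot> f" using that by (simp add: in_Hom)
      also have "\<dots> = Z x x \<cdot> f" using * by simp
      finally show ?thesis using that * comp_zero(1)[of f x x] by (simp add: in_Hom)
    qed
    then show "\<exists>!f. f \<in> Hom K y x" using y * by (auto intro!: ex1I[of _ "Z y x"] simp: in_Hom)
    have "f = Z x y" if "f \<in> Hom K x y" for f
    proof -
      have "f = f \<cdot> Ide K x" using that by (simp add: in_Hom)
      also have "\<dots> = f \<cdot> Z x x" using * by simp
      finally show ?thesis using that * comp_zero(2)[of f x x] by (simp add: in_Hom)
    qed
    then show "\<exists>!f. f \<in> Hom K x y" using y * by (auto intro!: ex1I[of _ "Z x y"] simp: in_Hom)
  qed (use * in auto)
qed

text \<open>Sums of arrows are \<open>finprod\<close> in hom groups written multiplicatively. The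
  additive maps \<phi> that occur are composition with fixed arrows and the passage from an element
  to multiplication by it.\<close>

lemma finprod_hom_map:
  assumes "finite I" "\<And>i. i \<in> I \<Longrightarrow> f i \<in> Hom K x y" "x \<in> Obj K" "y \<in> Obj K" "x' \<in> Obj K" "y' \<in> Obj K"
    and \<phi>: "\<And>g. g \<in> Hom K x y \<Longrightarrow> \<phi> g \<in> Hom K x' y'" "\<phi> (Z x y) = Z x' y'"
      "\<And>g h. \<lbrakk>g \<in> Hom K x y; h \<in> Hom K x y\<rbrakk> \<Longrightarrow> \<phi> (g \<boxplus> h) = \<phi> g \<boxplus> \<phi> h"
  shows "\<phi> (finprod (hom_group K x y) f I) = finprod (hom_group K x' y') (\<lambda>i. \<phi> (f i)) I"
proof -
  interpret A: comm_group "hom_group K x y" using hom_comm_group assms by auto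
  interpret B: comm_group "hom_group K x' y'" using hom_comm_group assms by auto
  have "(\<forall>i\<in>I. f i \<in> Hom K x y) \<longrightarrow> ?thesis" using assms(1)
  proof (induction I rule: finite_induct)
    case (insert i I)
    show ?case
    proof
      assume *: "\<forall>i\<in>insert i I. f i \<in> Hom K x y"
      then have f: "f \<in> I \<rightarrow> carrier (hom_group K x y)" "(\<lambda>i. \<phi> (f i)) \<in> I \<rightarrow> carrier (hom_group K x' y')"
        using \<phi> by auto
      show "\<phi> (finprod (hom_group K x y) f (insert i I)) = finprod (hom_group K x' y') (\<lambda>i. \<phi> (f i)) (insert i I)"
        using insert * f A.finprod_closed[OF f(1)] \<phi> by (simp add: A.finprod_insert B.finprod_insert)
    qed
  qed (use \<phi> in auto)
  with assms(2) show ?thesis by blast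
qed

end

context idempotent_complete_smc
begin

lemma tens_plus [simp]:
  "\<lbrakk>arr f; arr g; arr h; Dom K f = Dom K g; Cod K f = Cod K g\<rbrakk> \<Longrightarrow> (f \<boxplus> g) \<boxdot> h = (f \<boxdot> h) \<boxplus> (g \<boxdot> h)"
  "\<lbrakk>arr f; arr g; arr h; Dom K h = Dom K g; Cod K h = Cod K g\<rbrakk> \<Longrightarrow> f \<boxdot> (g \<boxplus> h) = (f \<boxdot> g) \<boxplus> (f \<boxdot> h)"
  using tens_plus_left[of f "Dom K f" "Cod K f" g h "Dom K h" "Cod K h"]
   tens_plus_right[of f "Dom K f" "Cod K f" g "Dom K g" "Cod K g" h] by (auto simp: in_Hom)

section \<open>Idempotents and factors\<close>

text \<open>\<open>Gam R\<close> is the ring of arrows $1 \to R$, with units and products induced by $R$, and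
  \<open>scal R e\<close> is multiplication by $e$ on $R$.\<close>

definition gmul where "gmul R e f = Mul R \<cdot> (e \<boxdot> f) \<cdot> inv_arr K (Lunit K (Unity K))"

definition Gam where
  "Gam R = \<lparr>carrier = Hom K (Unity K) (Car R), mult = gmul R, one = One R, zero = Z (Unity K) (Car R), add = Plus K\<rparr>"

definition scal where "scal R e = Mul R \<cdot> (e \<boxdot> Ide K (Car R)) \<cdot> inv_arr K (Lunit K (Car R))"

abbreviation glob where "glob R e \<equiv> arr e \<and> Dom K e = Unity K \<and> Cod K e = Car R"

lemma Gam_sel [simp]: "carrier (Gam R) = Hom K (Unity K) (Car R)" "mult (Gam R) = gmul R" "one (Gam R) = One R"
  "zero (Gam R) = Z (Unity K) (Car R)" "add (Gam R) = Plus K"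
  by (simp_all add: Gam_def)

lemma gmul_typ [simp]:
  assumes "is_ring K R" "glob R e" "glob R f"
  shows "arr (gmul R e f)" "Dom K (gmul R e f) = Unity K" "Cod K (gmul R e f) = Car R"
    "app (gmul R e f) pt = rmul R (app e pt) (app f pt)"
  using assms by (auto simp: gmul_def)

lemma glob_eqI: "\<lbrakk>app e pt = app f pt; glob R e; glob R f\<rbrakk> \<Longrightarrow> e = f"
  by (rule ext[of _ pt]) auto

lemma scal_typ [simp]:
  assumes "is_ring K R" "glob R e"
  shows "arr (scal R e)" "Dom K (scal R e) = Car R" "Cod K (scal R e) = Car R"
    "\<lbrakk>el a; ob a = Car R\<rbrakk> \<Longrightarrow> app (scal R e) a = rmul R (app e pt) a"
  using assms by (auto simp: scal_def)

text \<open>It makes the algebra of idempotents available: complements and finite sums of orthogonal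
  idempotents are computed in an honest commutative ring.\<close>

lemma cring_Gam: assumes R [simp]: "is_ring K R" shows "cring (Gam R)"
proof (rule cringI)
  have "add_monoid (Gam R) = hom_group K (Unity K) (Car R)" by (simp add: hom_group_def)
  then show "abelian_group (Gam R)"
    using hom_comm_group[of "Unity K" "Car R"]
    by (metis R comm_group.axioms(1) comm_group_abelian_groupI is_ring_typ(1) unity_obj')
  show "Group.comm_monoid (Gam R)"
  proof
    fix e f g assume "e \<in> carrier (Gam R)" "f \<in> carrier (Gam R)" "g \<in> carrier (Gam R)"
    then have [simp]: "glob R e" "glob R f" "glob R g" by (auto simp: in_Hom)
    show "e \<otimes>\<^bsub>Gam R\<^esub> f \<in> carrier (Gam R)" by (auto simp: in_Hom)
    show "e \<otimes>\<^bsub>Gam R\<^esub> f \<otimes>\<^bsub>Gam R\<^esub> g = e \<otimes>\<^bsub>Gam R\<^esub> (f \<otimes>\<^bsub>Gam R\<^esub> g)"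
      by (rule glob_eqI) (auto simp: ring_ac)
    show "e \<otimes>\<^bsub>Gam R\<^esub> f = f \<otimes>\<^bsub>Gam R\<^esub> e"
      by (rule glob_eqI) (auto simp: ring_ac)
    show "\<one>\<^bsub>Gam R\<^esub> \<otimes>\<^bsub>Gam R\<^esub> e = e" "e \<otimes>\<^bsub>Gam R\<^esub> \<one>\<^bsub>Gam R\<^esub> = e"
      by (rule glob_eqI; auto)+
  qed (auto simp: in_Hom)
  fix e f g assume "e \<in> carrier (Gam R)" "f \<in> carrier (Gam R)" "g \<in> carrier (Gam R)"
  then show "(e \<oplus>\<^bsub>Gam R\<^esub> f) \<otimes>\<^bsub>Gam R\<^esub> g = e \<otimes>\<^bsub>Gam R\<^esub> g \<oplus>\<^bsub>Gam R\<^esub> f \<otimes>\<^bsub>Gam R\<^esub> g"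
    by (simp add: gmul_def in_Hom)
qed

lemma Gam_finsum: "finsum (Gam R) f I = finprod (hom_group K (Unity K) (Car R)) f I"
  by (simp add: finsum_def hom_group_def)

lemma Gam_hom:
  assumes u: "ring_mor K R S u" shows "ring_hom_cring (Gam R) (Gam S) (\<lambda>e. u \<cdot> e)"
proof -
  note [simp] = ring_mor_typ[OF u] ring_mor_app[OF u]
  interpret R: cring "Gam R" by (rule cring_Gam) simp
  interpret S: cring "Gam S" by (rule cring_Gam) simp
  show ?thesis
  proof
    show "(\<lambda>e. u \<cdot> e) \<in> ring_hom (Gam R) (Gam S)"
    proof (rule ring_hom_memI)
      fix e f assume "e \<in> carrier (Gam R)" "f \<in> carrier (Gam R)"
      then have [simp]: "glob R e" "glob R f" by (auto simp: in_Hom)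
      show "u \<cdot> e \<in> carrier (Gam S)" by (auto simp: in_Hom)
      show "u \<cdot> (e \<otimes>\<^bsub>Gam R\<^esub> f) = u \<cdot> e \<otimes>\<^bsub>Gam S\<^esub> (u \<cdot> f)"
        by (rule glob_eqI[of _ _ S]) auto
      show "u \<cdot> (e \<oplus>\<^bsub>Gam R\<^esub> f) = u \<cdot> e \<oplus>\<^bsub>Gam S\<^esub> (u \<cdot> f)" by simp
    qed auto
  qed
qed

lemma scal_add:
  assumes "is_ring K R" "glob R e" "glob R f" shows "scal R (e \<boxplus> f) = scal R e \<boxplus> scal R f"
  using assms by (simp add: scal_def)

lemma scal_zero:
  assumes [simp]: "is_ring K R" shows "scal R (Z (Unity K) (Car R)) = Z (Car R) (Car R)"
proof -
  have "scal R (Z (Unity K) (Car R)) \<boxplus> scal R (Z (Unity K) (Car R)) = scal R (Z (Unity K) (Car R))"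
    by (subst scal_add[symmetric]) auto
  then show ?thesis by (subst plus_idem_zero[of "scal R (Z (Unity K) (Car R))"]) auto
qed

lemma scal_one:
  assumes [simp]: "is_ring K R" shows "scal R (One R) = Ide K (Car R)"
  by (rule ext[of _ "var 0 (Car R)"]) auto

lemma scal_gmul:
  assumes [simp]: "is_ring K R" "glob R e" "glob R f" shows "scal R e \<cdot> scal R f = scal R (gmul R e f)"
  by (rule ext[of _ "var 0 (Car R)"]) (auto simp: ring_ac)

lemma scal_comp:
  assumes [simp]: "is_ring K R" "glob R e" "glob R f" shows "scal R e \<cdot> f = gmul R e f"
  by (rule ext[of _ "pt"]) (auto simp: ring_ac)

lemma scal_comp_one:
  assumes [simp]: "is_ring K R" "glob R e" shows "scal R e \<cdot> One R = e"
  by (rule ext[of _ "pt"]) (auto simp: ring_ac)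

lemma ring_mor_scal:
  assumes u: "ring_mor K R S u" and [simp]: "glob R e" shows "u \<cdot> scal R e = scal S (u \<cdot> e) \<cdot> u"
proof -
  note [simp] = ring_mor_typ[OF u] ring_mor_app[OF u]
  show ?thesis by (rule ext[of _ "var 0 (Car R)"]) auto
qed

text \<open>The condition 1 = 0 is preferred to vanishing of the carrier because ring morphisms
  visibly preserve it.\<close>

definition zero_ring where "zero_ring R \<longleftrightarrow> One R = Z (Unity K) (Car R)"

lemma zero_ring_iff:
  assumes [simp]: "is_ring K R" shows "zero_ring R \<longleftrightarrow> \<not> nonzero K R"
proof
  assume "zero_ring R"
  then have "Ide K (Car R) = Z (Car R) (Car R)"
    using scal_one[of R] scal_zero[of R] by (simp add: zero_ring_def)
  then show "\<not> nonzero K R" by (simp add: nonzero_def zero_object_iff)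
next
  assume "\<not> nonzero K R"
  then have "Ide K (Car R) = Z (Car R) (Car R)" by (simp add: nonzero_def zero_object_iff)
  then have "Ide K (Car R) \<cdot> One R = Z (Car R) (Car R) \<cdot> One R" by simp
  then show "zero_ring R" by (simp add: zero_ring_def)
qed

lemma zero_ring_mor:
  assumes u: "ring_mor K R S u" and "zero_ring R" shows "zero_ring S"
proof -
  note [simp] = ring_mor_typ[OF u]
  have "u \<cdot> One R = u \<cdot> Z (Unity K) (Car R)" using assms(2) by (simp add: zero_ring_def)
  then show ?thesis by (simp add: zero_ring_def)
qed

text \<open>\<open>S\<close> is the factor $eR$ of \<open>R\<close> and \<open>p\<close> the projection onto it.\<close>

definition is_factor where
  "is_factor R e S p \<longleftrightarrow> ring_mor K R S p \<and> glob R e \<and>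
     (\<exists>\<iota>. arr \<iota> \<and> Dom K \<iota> = Car S \<and> Cod K \<iota> = Car R \<and> p \<cdot> \<iota> = Ide K (Car S) \<and> \<iota> \<cdot> p = scal R e)"

lemma is_factorD:
  assumes "is_factor R e S p"
  shows "ring_mor K R S p" "glob R e" "p \<cdot> e = One S" "gmul R e e = e"
    "\<lbrakk>arr f; arr g; Dom K f = Car S; Dom K g = Car S; f \<cdot> p = g \<cdot> p\<rbrakk> \<Longrightarrow> f = g"
proof -
  from assms obtain \<iota> where i: "arr \<iota>" "Dom K \<iota> = Car S" "Cod K \<iota> = Car R" "p \<cdot> \<iota> = Ide K (Car S)" "\<iota> \<cdot> p = scal R e"
    and p: "ring_mor K R S p" and e: "glob R e" by (auto simp: is_factor_def)
  note [simp] = i(1-4) ring_mor_typ[OF p] e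
  show "ring_mor K R S p" "glob R e" using p e by auto
  have pe: "p \<cdot> scal R e = p" unfolding i(5)[symmetric] using comp_assoc'[of p \<iota> p] by simp
  have "p \<cdot> e = p \<cdot> (scal R e \<cdot> One R)" by (simp add: scal_comp_one)
  also have "\<dots> = (p \<cdot> scal R e) \<cdot> One R" by simp
  finally show "p \<cdot> e = One S" using pe by simp
  have "scal R e \<cdot> scal R e = \<iota> \<cdot> (p \<cdot> \<iota>) \<cdot> p" unfolding i(5)[symmetric] by (simp del: i(4))
  then have "scal R e \<cdot> scal R e = scal R e" using i(5) by simp
  then have "scal R (gmul R e e) \<cdot> One R = scal R e \<cdot> One R" by (simp add: scal_gmul)
  then show "gmul R e e = e" by (simp add: scal_comp_one)
  assume *: "arr f" "arr g" "Dom K f = Car S" "Dom K g = Car S" "f \<cdot> p = g \<cdot> p"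
  have "f = (f \<cdot> p) \<cdot> \<iota>" using *(1-4) by simp
  also have "\<dots> = (g \<cdot> p) \<cdot> \<iota>" by (simp only: *(5))
  also have "\<dots> = g" using *(1-4) by simp
  finally show "f = g" .
qed

lemma factor_gen:
  assumes "is_factor R e S p" "gen a" "ob a = Car R" shows "gen (app p a)"
proof -
  from assms(1) obtain \<iota> where i: "arr \<iota>" "Dom K \<iota> = Car S" "Cod K \<iota> = Car R" "p \<cdot> \<iota> = Ide K (Car S)" "\<iota> \<cdot> p = scal R e"
    and p: "ring_mor K R S p" and e: "glob R e" by (auto simp: is_factor_def)
  then show ?thesis using assms ring_mor_typ[OF p] by (intro gen_app[where s = \<iota>]) auto
qed

text \<open>Idempotent completeness splits multiplication by \<open>e\<close> into
  \<open>i \<cdot> p\<close>, and the product on the image is transported along the splitting. The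
  projection is multiplicative because (ea)(eb) and ab have the same image: \<open>p\<close> absorbs
  \<open>e\<close>.\<close>

lemma ex_factor:
  assumes [simp]: "is_ring K R" and e [simp]: "glob R e" and ee: "gmul R e e = e"
  shows "\<exists>S p. is_factor R e S p"
proof -
  have "scal R e \<in> Hom K (Car R) (Car R)" by (simp add: in_Hom)
  moreover have "scal R e \<cdot> scal R e = scal R e" by (simp add: scal_gmul ee)
  ultimately obtain x1 x2 i i2 p p2 where b: "biproduct K x1 x2 (Car R) i i2 p p2" and ip: "scal R e = i \<cdot> p"
    using idempotent_split by blast
  from b have [simp]: "x1 \<in> Obj K" "arr i" "Dom K i = x1" "Cod K i = Car R" "arr p" "Dom K p = Car R" "Cod K p = x1"
    and pi [simp]: "p \<cdot> i = Ide K x1" by (auto simp: biproduct_def in_Hom)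
  define S where "S = \<lparr>Car = x1, Mul = p \<cdot> Mul R \<cdot> (i \<boxdot> i), One = p \<cdot> One R\<rparr>"
  have MS: "Mul S = p \<cdot> Mul R \<cdot> (i \<boxdot> i)" and OS: "One S = p \<cdot> One R" and [simp]: "Car S = x1" by (auto simp: S_def)
  have [simp]: "arr (Mul S)" "Dom K (Mul S) = x1 \<boxtimes> x1" "Cod K (Mul S) = x1" "arr (One S)" "Dom K (One S) = Unity K" "Cod K (One S) = x1"
    by (simp_all add: MS OS)
  have gp: "gen (app p a)" if "gen a" "ob a = Car R" for a
    using that by (intro gen_app[where s = i]) auto
  have ipa: "app i (app p a) = rmul R (app e pt) a" if "el a" "ob a = Car R" for a
  proof -
    have "app i (app p a) = app (i \<cdot> p) a" using that by simp
    then show ?thesis using that unfolding ip[symmetric] by simp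
  qed
  have pea: "app p (rmul R (app e pt) a) = app p a" if "el a" "ob a = Car R" for a
  proof -
    have "app p (rmul R (app e pt) a) = app (p \<cdot> (i \<cdot> p)) a" using that by (simp add: ipa)
    then show ?thesis using that by (simp add: comp_eq[OF pi])
  qed
  have pea2: "app p (rmul R a (rmul R (app e pt) b)) = app p (rmul R a b)"
    if "el a" "ob a = Car R" "el b" "ob b = Car R" "disj a b" for a b
  proof -
    have "rmul R a (rmul R (app e pt) b) = rmul R (app e pt) (rmul R a b)"
      using that by (subst ring_lcomm) auto
    then show ?thesis using that by (simp add: pea)
  qed
  have m: "app p (rmul R a b) = rmul S (app p a) (app p b)"
    if "el a" "ob a = Car R" "el b" "ob b = Car R" "disj a b" for a b
  proof -
    have "rmul S (app p a) (app p b) = app p (rmul R (rmul R (app e pt) a) (rmul R (app e pt) b))"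
      using that by (simp add: ipa MS)
    also have "\<dots> = app p (rmul R (rmul R (app e pt) a) b)"
      using that by (intro pea2) auto
    also have "\<dots> = app p (rmul R (app e pt) (rmul R a b))"
      using that by (subst ring_assoc) auto
    also have "\<dots> = app p (rmul R a b)" using that by (intro pea) auto
    finally show ?thesis by simp
  qed
  let ?a = "var 0 (Car R)" and ?b = "var 1 (Car R)" and ?c = "var 2 (Car R)"
  have S: "is_ring K S"
  proof (rule is_ringI[where a = "app p ?a" and b = "app p ?b" and c = "app p ?c"])
    show "rmul S (rmul S (app p ?a) (app p ?b)) (app p ?c) = rmul S (app p ?a) (rmul S (app p ?b) (app p ?c))"
      by (simp add: m[symmetric]) (simp add: ring_ac)
    show "rmul S (app p ?a) (app p ?b) = rmul S (app p ?b) (app p ?a)"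
      by (simp add: m[symmetric]) (simp add: ring_ac)
    have "rone S = app p (rone R)" by (simp add: OS)
    then show "rmul S (rone S) (app p ?a) = app p ?a"
      using m[of "rone R" ?a, symmetric] by simp
  qed (auto intro: gp)
  have "ring_mor K R S p"
    by (rule ring_morI[where a = ?a and b = ?b]) (use S m[of ?a ?b] in \<open>auto simp: OS\<close>)
  then show ?thesis using ip by (intro exI[of _ S] exI[of _ p]) (auto simp: is_factor_def intro!: exI[of _ i])
qed

text \<open>The factor is the localisation at \<open>e\<close>. With \<iota> the inclusion, u
  \<iota> p is u followed by multiplication by u(e) = 1, so \<open>u \<cdot> \<iota>\<close> is the
  required morphism, although \<iota> itself preserves the unit only when e = 1.\<close>

lemma factor_lift:
  assumes p: "is_factor R e S p" and u: "ring_mor K R X u" and ue: "u \<cdot> e = One X"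
  shows "\<exists>v. ring_mor K S X v \<and> v \<cdot> p = u"
proof -
  from p obtain \<iota> where i: "arr \<iota>" "Dom K \<iota> = Car S" "Cod K \<iota> = Car R" "p \<cdot> \<iota> = Ide K (Car S)" "\<iota> \<cdot> p = scal R e"
    and pm: "ring_mor K R S p" and e: "glob R e" by (auto simp: is_factor_def)
  note [simp] = i(1-4) ring_mor_typ[OF pm] ring_mor_typ[OF u] ring_mor_app[OF pm] ring_mor_app[OF u]
  have 1: "(u \<cdot> \<iota>) \<cdot> p = u"
    using ring_mor_scal[OF u e] ue by (simp add: i(5) scal_one)
  have 2: "app (u \<cdot> \<iota>) (app p a) = app u a" if "el a" "ob a = Car R" for a
    using app_comp[of a p "u \<cdot> \<iota>"] 1 that by (simp del: app_comp comp_assoc')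
  let ?a = "var 0 (Car R)" and ?b = "var 1 (Car R)"
  have "ring_mor K S X (u \<cdot> \<iota>)"
  proof (rule ring_morI[where a = "app p ?a" and b = "app p ?b"])
    have "rone S = app p (rone R)" by simp
    then show "app (u \<cdot> \<iota>) (rone S) = rone X" using 2[of "rone R"] by (simp del: app_comp)
    have "rmul S (app p ?a) (app p ?b) = app p (rmul R ?a ?b)" by simp
    then show "app (u \<cdot> \<iota>) (rmul S (app p ?a) (app p ?b)) = rmul X (app (u \<cdot> \<iota>) (app p ?a)) (app (u \<cdot> \<iota>) (app p ?b))"
      using 2[of ?a] 2[of ?b] 2[of "rmul R ?a ?b"] by (simp del: app_comp)
  qed (auto intro: factor_gen[OF p])
  with 1 show ?thesis by blast
qed

lemma factor_zero_iff:
  assumes p: "is_factor R e S p" shows "zero_ring S \<longleftrightarrow> e = Z (Unity K) (Car R)"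
proof -
  from p obtain \<iota> where i: "arr \<iota>" "Dom K \<iota> = Car S" "Cod K \<iota> = Car R" "p \<cdot> \<iota> = Ide K (Car S)" "\<iota> \<cdot> p = scal R e"
    and pm: "ring_mor K R S p" and e: "glob R e" by (auto simp: is_factor_def)
  note [simp] = i(1-3) ring_mor_typ[OF pm] e
  have pe: "p \<cdot> e = One S" using is_factorD[OF p] by auto
  have "\<iota> \<cdot> One S = scal R e \<cdot> One R"
    unfolding i(5)[symmetric] by simp
  then have "\<iota> \<cdot> One S = e" by (simp add: scal_comp_one)
  then show ?thesis using pe by (auto simp: zero_ring_def)
qed

text \<open>A section \<open>s\<close> of \<open>p\<close> need not land in eR. Multiplying it by
  \<open>e\<close> corrects this without destroying the section property, because p(e) = 1.\<close>

lemma factorI: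
  assumes p: "ring_mor K R S p" and e: "glob R e"
    and s: "arr s" "Dom K s = Car S" "Cod K s = Car R" "p \<cdot> s = Ide K (Car S)"
    and pe: "p \<cdot> e = One S" and m: "scal R e \<cdot> s \<cdot> p = scal R e"
  shows "is_factor R e S p"
proof -
  note [simp] = ring_mor_typ[OF p] e s(1-3)
  have "(p \<cdot> scal R e) \<cdot> s = Ide K (Car S)"
    using ring_mor_scal[OF p e] s(4) by (simp add: pe scal_one)
  then show ?thesis using p m by (auto simp: is_factor_def intro!: exI[of _ "scal R e \<cdot> s"])
qed

lemma factor_iso:
  assumes p: "is_factor R e S p" and f: "ring_mor K S X f" and i: "iso f"
  shows "is_factor R e X (f \<cdot> p)"
proof -
  from p obtain \<iota> where \<iota>: "arr \<iota>" "Dom K \<iota> = Car S" "Cod K \<iota> = Car R" "p \<cdot> \<iota> = Ide K (Car S)" "\<iota> \<cdot> p = scal R e"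
    and pm: "ring_mor K R S p" and e: "glob R e" by (auto simp: is_factor_def)
  note [simp] = \<iota> ring_mor_typ[OF pm] ring_mor_typ[OF f] i e
  have "(f \<cdot> p) \<cdot> (\<iota> \<cdot> inv_arr K f) = Ide K (Car X)" by (simp add: comp_eq[OF \<iota>(4)])
  moreover have "(\<iota> \<cdot> inv_arr K f) \<cdot> (f \<cdot> p) = scal R e" by simp
  ultimately show ?thesis using ring_mor_comp[OF pm f]
    by (auto simp: is_factor_def simp del: comp_assoc' intro!: exI[of _ "\<iota> \<cdot> inv_arr K f"])
qed

definition compl where "compl R e = One R \<ominus>\<^bsub>Gam R\<^esub> e"

lemma compl_props:
  assumes [simp]: "is_ring K R" and e: "glob R e"
  shows "glob R (compl R e)" "e \<boxplus> compl R e = One R" "gmul R e e = e \<Longrightarrow> gmul R e (compl R e) = Z (Unity K) (Car R)"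
    "gmul R e e = e \<Longrightarrow> gmul R (compl R e) (compl R e) = compl R e"
    "ring_mor K R S u \<Longrightarrow> u \<cdot> compl R e = compl S (u \<cdot> e)"
    "compl R e = Z (Unity K) (Car R) \<longleftrightarrow> e = One R" "compl R e = One R \<longleftrightarrow> e = Z (Unity K) (Car R)"
proof -
  interpret cring "Gam R" by (rule cring_Gam) simp
  have c: "e \<in> carrier (Gam R)" "One R \<in> carrier (Gam R)" using e by (auto simp: in_Hom)
  then have "compl R e \<in> carrier (Gam R)" unfolding compl_def by (rule minus_closed[rotated])
  then show g: "glob R (compl R e)" by (simp add: in_Hom)
  have "e \<oplus>\<^bsub>Gam R\<^esub> (One R \<ominus>\<^bsub>Gam R\<^esub> e) = One R" using c
    by (metis a_minus_def add.inv_closed add.m_lcomm r_neg r_zero)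
  then show s: "e \<boxplus> compl R e = One R" by (simp add: compl_def)
  show "compl R e = Z (Unity K) (Car R) \<longleftrightarrow> e = One R"
  proof
    assume "e = One R"
    then show "compl R e = Z (Unity K) (Car R)" using c r_neg[of "One R"] by (simp add: compl_def a_minus_def)
  qed (use s e in simp)
  show "compl R e = One R \<longleftrightarrow> e = Z (Unity K) (Car R)"
  proof
    assume *: "compl R e = One R"
    then have "e \<oplus>\<^bsub>Gam R\<^esub> One R = One R" using s by simp
    then show "e = Z (Unity K) (Car R)" using c add.r_cancel_one'[of "One R" e] by simp
  qed (use s g in simp)
  show "ring_mor K R S u \<Longrightarrow> u \<cdot> compl R e = compl S (u \<cdot> e)"
  proof -
    assume u: "ring_mor K R S u"
    have neg: "\<ominus>\<^bsub>Gam R\<^esub> e \<in> carrier (Gam R)" using c(1) by (rule a_inv_closed)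
    interpret ring_hom_cring "Gam R" "Gam S" "\<lambda>e. u \<cdot> e" by (rule Gam_hom[OF u])
    show ?thesis unfolding compl_def a_minus_def
      using c hom_add[of "One R" "\<ominus>\<^bsub>Gam R\<^esub> e"] hom_a_inv[of e] hom_one neg by simp
  qed
  assume i: "gmul R e e = e"
  have "e \<otimes>\<^bsub>Gam R\<^esub> (One R \<ominus>\<^bsub>Gam R\<^esub> e)
      = e \<otimes>\<^bsub>Gam R\<^esub> \<one>\<^bsub>Gam R\<^esub> \<oplus>\<^bsub>Gam R\<^esub> (\<ominus>\<^bsub>Gam R\<^esub> (e \<otimes>\<^bsub>Gam R\<^esub> e))"
    unfolding a_minus_def using r_distr[OF c(2) a_inv_closed[OF c(1)] c(1)] r_minus[OF c(1) c(1)]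
    by simp
  also have "\<dots> = \<zero>\<^bsub>Gam R\<^esub>" using r_one[OF c(1)] r_neg[OF c(1)] i by simp
  finally have "e \<otimes>\<^bsub>Gam R\<^esub> (One R \<ominus>\<^bsub>Gam R\<^esub> e) = \<zero>\<^bsub>Gam R\<^esub>" .
  then show 1: "gmul R e (compl R e) = Z (Unity K) (Car R)" by (simp add: compl_def)
  have "compl R e = One R \<otimes>\<^bsub>Gam R\<^esub> compl R e" using \<open>compl R e \<in> carrier (Gam R)\<close> l_one by simp
  also have "\<dots> = (e \<oplus>\<^bsub>Gam R\<^esub> compl R e) \<otimes>\<^bsub>Gam R\<^esub> compl R e" using s by simp
  also have "\<dots> = gmul R (compl R e) (compl R e)" using c \<open>compl R e \<in> carrier (Gam R)\<close> 1
    by (subst l_distr) (auto simp: in_Hom)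
  finally show "gmul R (compl R e) (compl R e) = compl R e" by simp
qed

section \<open>Separability\<close>

abbreviation tr where "tr A \<equiv> tens_ring K A A"

lemma Mul_copair: "is_ring K A \<Longrightarrow> Mul A = copair A (Ide K (Car A)) (Ide K (Car A))"
  by (simp add: copair_def)

lemma Mul_mor:
  assumes A [simp]: "is_ring K A"
  shows "ring_mor K (tr A) A (Mul A)" "Mul A \<cdot> inl A A = Ide K (Car A)" "Mul A \<cdot> inr A A = Ide K (Car A)"
  using copair_mor[OF ring_mor_ide[OF A] ring_mor_ide[OF A]] copair_in[OF ring_mor_ide[OF A] ring_mor_ide[OF A]]
    Mul_copair[OF A] by metis+

text \<open>The multiplication is the codiagonal of the coproduct A \<otimes> A, so a morphism whose
  two restrictions agree factors through it.\<close>

lemma collapse: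
  assumes A [simp]: "is_ring K A" and u: "ring_mor K (tr A) S u" and e: "u \<cdot> inl A A = u \<cdot> inr A A"
  shows "u = (u \<cdot> inl A A) \<cdot> Mul A"
proof (rule copair_unique[OF A A u])
  show "ring_mor K (tr A) S ((u \<cdot> inl A A) \<cdot> Mul A)"
    by (intro ring_mor_comp[OF Mul_mor(1)] ring_mor_comp[OF inl_mor u]) auto
  note [simp] = ring_mor_typ(3,5)[OF u] ring_mor_typ(4)[OF u, simplified]
  have "((u \<cdot> inl A A) \<cdot> Mul A) \<cdot> inl A A = (u \<cdot> inl A A) \<cdot> (Mul A \<cdot> inl A A)"
    by (rule comp_assoc') auto
  then show "u \<cdot> inl A A = ((u \<cdot> inl A A) \<cdot> Mul A) \<cdot> inl A A" by (simp add: Mul_mor)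
  have "((u \<cdot> inl A A) \<cdot> Mul A) \<cdot> inr A A = (u \<cdot> inl A A) \<cdot> (Mul A \<cdot> inr A A)"
    by (rule comp_assoc') auto
  then show "u \<cdot> inr A A = ((u \<cdot> inl A A) \<cdot> Mul A) \<cdot> inr A A" by (simp add: Mul_mor e)
qed

text \<open>The idempotent of $A \otimes A$ that cuts out the diagonal.\<close>

definition sep_elem where
  "sep_elem A \<epsilon> \<longleftrightarrow> glob (tr A) \<epsilon> \<and> Mul A \<cdot> \<epsilon> = One A \<and>
     scal (tr A) \<epsilon> \<cdot> inl A A = scal (tr A) \<epsilon> \<cdot> inr A A"

text \<open>The left side occurs in the bilinearity condition on a section \<sigma>. Written as
  multiplication by 1 \<otimes> x in the ring A \<otimes> A, it allows \<sigma> to be replaced by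
  the single element \<sigma>(1).\<close>

lemma app_mul_inr:
  assumes A [simp]: "is_ring K A" and "el z" "ob z = Car A \<boxtimes> Car A" "el x" "ob x = Car A" "disj z x"
  shows "app (Ide K (Car A) \<boxdot> Mul A) (app (Assoc K (Car A) (Car A) (Car A)) (z \<star> x)) = rmul (tr A) z (app (inr A A) x)"
proof -
  have "(Ide K (Car A) \<boxdot> Mul A) \<cdot> Assoc K (Car A) (Car A) (Car A) = Mul (tr A) \<cdot> (Ide K (Car A \<boxtimes> Car A) \<boxdot> inr A A)"
    by (rule ext[of _ "(var 0 (Car A) \<star> var 1 (Car A)) \<star> var 2 (Car A)"]) auto
  then have "app ((Ide K (Car A) \<boxdot> Mul A) \<cdot> Assoc K (Car A) (Car A) (Car A)) (z \<star> x)
     = app (Mul (tr A) \<cdot> (Ide K (Car A \<boxtimes> Car A) \<boxdot> inr A A)) (z \<star> x)" by simp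
  then show ?thesis using assms by simp
qed

lemma app_mul_inl:
  assumes A [simp]: "is_ring K A" and "el z" "ob z = Car A \<boxtimes> Car A" "el x" "ob x = Car A" "disj x z"
  shows "app (Mul A \<boxdot> Ide K (Car A)) (app (inv_arr K (Assoc K (Car A) (Car A) (Car A))) (x \<star> z)) = rmul (tr A) (app (inl A A) x) z"
proof -
  have "(Mul A \<boxdot> Ide K (Car A)) \<cdot> inv_arr K (Assoc K (Car A) (Car A) (Car A)) = Mul (tr A) \<cdot> (inl A A \<boxdot> Ide K (Car A \<boxtimes> Car A))"
    by (rule ext[of _ "var 0 (Car A) \<star> (var 1 (Car A) \<star> var 2 (Car A))"]) auto
  then have "app ((Mul A \<boxdot> Ide K (Car A)) \<cdot> inv_arr K (Assoc K (Car A) (Car A) (Car A))) (x \<star> z)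
     = app (Mul (tr A) \<cdot> (inl A A \<boxdot> Ide K (Car A \<boxtimes> Car A))) (x \<star> z)" by simp
  then show ?thesis using assms by simp
qed

text \<open>The element is \<sigma>(1): by bilinearity both \<sigma>(1)(x \<otimes> 1) and
  \<sigma>(1)(1 \<otimes> x) are \<sigma>(x).\<close>

lemma separable_sep_elem:
  assumes "separable_ring K A"
  shows "is_ring K A" "\<exists>\<epsilon>. sep_elem A \<epsilon>"
proof -
  let ?a = "Car A"
  from assms show [simp]: "is_ring K A" by (simp add: separable_ring_def)
  from assms obtain \<sigma> where s: "\<sigma> \<in> Hom K ?a (?a \<boxtimes> ?a)" "Mul A \<cdot> \<sigma> = Ide K ?a"
     and l: "(Ide K ?a \<boxdot> Mul A) \<cdot> Assoc K ?a ?a ?a \<cdot> (\<sigma> \<boxdot> Ide K ?a) = \<sigma> \<cdot> Mul A"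
     and r: "\<sigma> \<cdot> Mul A = (Mul A \<boxdot> Ide K ?a) \<cdot> inv_arr K (Assoc K ?a ?a ?a) \<cdot> (Ide K ?a \<boxdot> \<sigma>)"
    by (auto simp: separable_ring_def Let_def)
  from s have [simp]: "arr \<sigma>" "Dom K \<sigma> = ?a" "Cod K \<sigma> = ?a \<boxtimes> ?a" by (auto simp: in_Hom)
  have "Mul A \<cdot> (\<sigma> \<cdot> One A) = (Mul A \<cdot> \<sigma>) \<cdot> One A" by (rule comp_assoc'[symmetric]) auto
  then have 1: "Mul A \<cdot> (\<sigma> \<cdot> One A) = One A" by (simp add: s)
  let ?v = "var 0 ?a"
  have "app ((Ide K ?a \<boxdot> Mul A) \<cdot> Assoc K ?a ?a ?a \<cdot> (\<sigma> \<boxdot> Ide K ?a)) (rone A \<star> ?v) = app (\<sigma> \<cdot> Mul A) (rone A \<star> ?v)"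
    by (simp only: l)
  then have 2: "rmul (tr A) (app \<sigma> (rone A)) (app (inr A A) ?v) = app \<sigma> ?v"
    by (simp add: app_mul_inr del: tens_ring_sel inr_typ(4))
  have "app ((Mul A \<boxdot> Ide K ?a) \<cdot> inv_arr K (Assoc K ?a ?a ?a) \<cdot> (Ide K ?a \<boxdot> \<sigma>)) (?v \<star> rone A) = app (\<sigma> \<cdot> Mul A) (?v \<star> rone A)"
    by (simp only: r)
  then have "rmul (tr A) (app (inl A A) ?v) (app \<sigma> (rone A)) = app \<sigma> ?v"
    by (simp add: app_mul_inl del: tens_ring_sel inl_typ(4))
  moreover have "rmul (tr A) (app (inl A A) ?v) (app \<sigma> (rone A)) = rmul (tr A) (app \<sigma> (rone A)) (app (inl A A) ?v)"
    by (rule ring_comm) auto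
  ultimately have 3: "rmul (tr A) (app \<sigma> (rone A)) (app (inl A A) ?v) = app \<sigma> ?v" by simp
  have "scal (tr A) (\<sigma> \<cdot> One A) \<cdot> inl A A = scal (tr A) (\<sigma> \<cdot> One A) \<cdot> inr A A"
    by (rule ext[of _ ?v]) (use 2 3 in \<open>auto simp del: tens_ring_sel(2)\<close>)
  then have "sep_elem A (\<sigma> \<cdot> One A)" using 1 by (simp add: sep_elem_def)
  then show "\<exists>\<epsilon>. sep_elem A \<epsilon>" by blast
qed

lemma sep_elem_app:
  assumes A [simp]: "is_ring K A" and e: "sep_elem A \<epsilon>" and x: "el x" "ob x = Car A"
  shows "rmul (tr A) (app \<epsilon> pt) (app (inl A A) x) = rmul (tr A) (app \<epsilon> pt) (app (inr A A) x)"
proof -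
  have [simp]: "arr \<epsilon>" "Dom K \<epsilon> = Unity K" "Cod K \<epsilon> = Car A \<boxtimes> Car A" using e by (auto simp: sep_elem_def)
  have "app (scal (tr A) \<epsilon> \<cdot> inl A A) x = app (scal (tr A) \<epsilon> \<cdot> inr A A) x"
    using e by (simp add: sep_elem_def)
  then show ?thesis using x by (simp del: tens_ring_sel(2) inl_typ(4) inr_typ(4))
qed

text \<open>The section is \<sigma>(x) = \<epsilon>(x \<otimes> 1). As this equals \<epsilon>(1
  \<otimes> x), it is linear on both sides.\<close>

lemma sep_elem_separable:
  assumes A [simp]: "is_ring K A" and e: "sep_elem A \<epsilon>"
  shows "separable_ring K A"
proof -
  let ?a = "Car A"
  have [simp]: "arr \<epsilon>" "Dom K \<epsilon> = Unity K" "Cod K \<epsilon> = Car A \<boxtimes> Car A" and me: "Mul A \<cdot> \<epsilon> = One A"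
    using e by (auto simp: sep_elem_def)
  note [simp del] = tens_ring_sel(2)
  define \<sigma> where "\<sigma> = scal (tr A) \<epsilon> \<cdot> inl A A"
  have [simp]: "arr \<sigma>" "Dom K \<sigma> = ?a" "Cod K \<sigma> = ?a \<boxtimes> ?a" by (auto simp: \<sigma>_def)
  have s: "app \<sigma> x = rmul (tr A) (app \<epsilon> pt) (app (inl A A) x)" if "el x" "ob x = ?a" for x
    unfolding \<sigma>_def using that by (simp del: inl_typ(4))
  have mme: "app (Mul A) (app \<epsilon> pt) = rone A"
    using app_comp[of pt \<epsilon> "Mul A"] me by simp
  note mul_m = ring_mor_app(2)[OF Mul_mor(1)[OF A]]
  have ml: "app (Mul A) (app (inl A A) x) = x" "app (Mul A) (app (inr A A) x) = x" if "el x" "ob x = ?a" for x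
    using that app_comp[of x "inl A A" "Mul A"] app_comp[of x "inr A A" "Mul A"]
    by (simp_all add: Mul_mor del: inl_typ(4) inr_typ(4))
  have 1: "Mul A \<cdot> \<sigma> = Ide K ?a"
    by (rule ext[of _ "var 0 ?a"]) (auto simp: s mul_m mme ml simp del: inl_typ(4))
  have 2: "(Ide K ?a \<boxdot> Mul A) \<cdot> Assoc K ?a ?a ?a \<cdot> (\<sigma> \<boxdot> Ide K ?a) = \<sigma> \<cdot> Mul A"
  proof (rule ext[of _ "var 0 ?a \<star> var 1 ?a"])
    let ?x = "var 0 ?a" and ?y = "var 1 ?a"
    let ?E = "app \<epsilon> pt"
    have "rmul (tr A) (rmul (tr A) ?E (app (inl A A) ?x)) (app (inr A A) ?y)
       = rmul (tr A) (app (inl A A) ?x) (rmul (tr A) ?E (app (inr A A) ?y))"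
      by (simp add: ring_ac del: inl_typ(4) inr_typ(4))
    also have "\<dots> = rmul (tr A) (app (inl A A) ?x) (rmul (tr A) ?E (app (inl A A) ?y))"
      by (subst sep_elem_app[OF A e]) auto
    also have "\<dots> = rmul (tr A) ?E (rmul (tr A) (app (inl A A) ?x) (app (inl A A) ?y))"
      by (simp add: ring_ac del: inl_typ(4) inr_typ(4))
    also have "\<dots> = rmul (tr A) ?E (app (inl A A) (rmul A ?x ?y))"
      by (subst ring_mor_app(2)[OF inl_mor[OF A A]]) auto
    finally show "app ((Ide K ?a \<boxdot> Mul A) \<cdot> Assoc K ?a ?a ?a \<cdot> (\<sigma> \<boxdot> Ide K ?a)) (?x \<star> ?y) = app (\<sigma> \<cdot> Mul A) (?x \<star> ?y)"
      by (simp add: s app_mul_inr del: inl_typ(4) inr_typ(4))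
  qed auto
  have 3: "\<sigma> \<cdot> Mul A = (Mul A \<boxdot> Ide K ?a) \<cdot> inv_arr K (Assoc K ?a ?a ?a) \<cdot> (Ide K ?a \<boxdot> \<sigma>)"
  proof (rule ext[of _ "var 0 ?a \<star> var 1 ?a"])
    let ?x = "var 0 ?a" and ?y = "var 1 ?a"
    let ?E = "app \<epsilon> pt"
    have "rmul (tr A) (app (inl A A) ?x) (rmul (tr A) ?E (app (inl A A) ?y))
       = rmul (tr A) ?E (rmul (tr A) (app (inl A A) ?x) (app (inl A A) ?y))"
      by (simp add: ring_ac del: inl_typ(4) inr_typ(4))
    also have "\<dots> = rmul (tr A) ?E (app (inl A A) (rmul A ?x ?y))"
      by (subst ring_mor_app(2)[OF inl_mor[OF A A]]) auto
    finally show "app (\<sigma> \<cdot> Mul A) (?x \<star> ?y) = app ((Mul A \<boxdot> Ide K ?a) \<cdot> inv_arr K (Assoc K ?a ?a ?a) \<cdot> (Ide K ?a \<boxdot> \<sigma>)) (?x \<star> ?y)"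
      by (simp add: s app_mul_inl del: inl_typ(4) inr_typ(4))
  qed auto
  show ?thesis using 1 2 3 by (auto simp: separable_ring_def Let_def in_Hom intro!: bexI[of _ \<sigma>])
qed

text \<open>Geometrically \<open>e\<close> cuts out an open and closed locus on which
  \<open>g\<close> and \<open>h\<close> agree. It is characterised through morphisms out of
  \<open>R\<close>, so that closure properties of separability become statements about
  morphisms.\<close>

definition equalizes where
  "equalizes R e g h \<longleftrightarrow> glob R e \<and> gmul R e e = e \<and>
     (\<forall>S u. ring_mor K R S u \<longrightarrow> (u \<cdot> g = u \<cdot> h \<longleftrightarrow> u \<cdot> e = One S))"

lemma equalizesD:
  assumes "equalizes R e g h" shows "glob R e" "gmul R e e = e"
    "ring_mor K R S u \<Longrightarrow> u \<cdot> g = u \<cdot> h \<longleftrightarrow> u \<cdot> e = One S"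
  using assms by (auto simp: equalizes_def)

text \<open>For every z one has \<epsilon> z = \<epsilon>(\<mu>(z) \<otimes> 1); for z = \<epsilon>
  the right side is \<epsilon>, since \<mu>(\<epsilon>) = 1.\<close>

lemma sep_elem_idem:
  assumes A [simp]: "is_ring K A" and e: "sep_elem A \<epsilon>"
  shows "gmul (tr A) \<epsilon> \<epsilon> = \<epsilon>"
proof -
  let ?a = "Car A" and ?E = "app \<epsilon> pt" and ?x = "var 0 (Car A)" and ?y = "var 1 (Car A)"
  have [simp]: "arr \<epsilon>" "Dom K \<epsilon> = Unity K" "Cod K \<epsilon> = Car A \<boxtimes> Car A" and me: "Mul A \<cdot> \<epsilon> = One A"
    using e by (auto simp: sep_elem_def)
  have xy: "?x \<star> ?y = rmul (tr A) (app (inl A A) ?x) (app (inr A A) ?y)"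
    by simp
  note [simp del] = tens_ring_sel(2)
  have "rmul (tr A) ?E (?x \<star> ?y) = rmul (tr A) (app (inl A A) ?x) (rmul (tr A) ?E (app (inr A A) ?y))"
    unfolding xy by (simp add: ring_ac del: inl_typ(4) inr_typ(4))
  also have "\<dots> = rmul (tr A) (app (inl A A) ?x) (rmul (tr A) ?E (app (inl A A) ?y))"
    by (subst sep_elem_app[OF A e]) auto
  also have "\<dots> = rmul (tr A) ?E (rmul (tr A) (app (inl A A) ?x) (app (inl A A) ?y))"
    by (simp add: ring_ac del: inl_typ(4) inr_typ(4))
  also have "\<dots> = rmul (tr A) ?E (app (inl A A) (rmul A ?x ?y))"
    by (subst ring_mor_app(2)[OF inl_mor[OF A A]]) auto
  finally have 1: "scal (tr A) \<epsilon> = scal (tr A) \<epsilon> \<cdot> inl A A \<cdot> Mul A"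
    by (intro ext[of _ "?x \<star> ?y"]) (auto simp del: inl_typ(4))
  have "gmul (tr A) \<epsilon> \<epsilon> = scal (tr A) \<epsilon> \<cdot> \<epsilon>" by (rule scal_comp[symmetric]) auto
  also have "\<dots> = (scal (tr A) \<epsilon> \<cdot> inl A A \<cdot> Mul A) \<cdot> \<epsilon>" by (subst 1) simp
  also have "\<dots> = scal (tr A) \<epsilon> \<cdot> (inl A A \<cdot> (Mul A \<cdot> \<epsilon>))" by simp
  also have "inl A A \<cdot> (Mul A \<cdot> \<epsilon>) = One (tr A)" using ring_mor_typ(6)[OF inl_mor[OF A A]] by (simp add: me)
  also have "scal (tr A) \<epsilon> \<cdot> One (tr A) = \<epsilon>" by (rule scal_comp_one) auto
  finally show ?thesis .
qed

text \<open>The idempotent is the image of \<epsilon> under the morphism A \<otimes> A \<rightarrow>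
  R with components \<open>g\<close> and \<open>h\<close>, the pullback of the diagonal. After
  composition with \<open>u\<close> the components agree iff the composite factors through \<mu>,
  and this happens iff \<epsilon> goes to 1.\<close>

lemma separable_equalizes:
  assumes sep: "separable_ring K A" and g: "ring_mor K A R g" and h: "ring_mor K A R h"
  shows "\<exists>e. equalizes R e g h"
proof -
  from separable_sep_elem[OF sep] obtain \<epsilon> where A [simp]: "is_ring K A" and e: "sep_elem A \<epsilon>" by auto
  have [simp]: "arr \<epsilon>" "Dom K \<epsilon> = Unity K" "Cod K \<epsilon> = Car A \<boxtimes> Car A" and me: "Mul A \<cdot> \<epsilon> = One A"
    using e by (auto simp: sep_elem_def)
  note [simp] = ring_mor_typ[OF g] ring_mor_typ[OF h]
  let ?c = "copair R g h"
  have c: "ring_mor K (tr A) R ?c" by (rule copair_mor[OF g h])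
  note [simp] = ring_mor_typ(3,5)[OF c] ring_mor_typ(4)[OF c, simplified]
  note [simp del] = tens_ring_sel(2)
  interpret T: cring "Gam (tr A)" by (rule cring_Gam) simp
  interpret h: ring_hom_cring "Gam (tr A)" "Gam R" "\<lambda>e. ?c \<cdot> e" by (rule Gam_hom[OF c])
  have "\<epsilon> \<in> carrier (Gam (tr A))" by (simp add: in_Hom)
  from h.hom_mult[OF this this] have "gmul R (?c \<cdot> \<epsilon>) (?c \<cdot> \<epsilon>) = ?c \<cdot> \<epsilon>"
    by (simp add: sep_elem_idem[OF A e])
  moreover have "u \<cdot> g = u \<cdot> h \<longleftrightarrow> u \<cdot> (?c \<cdot> \<epsilon>) = One S" if u: "ring_mor K R S u" for S u
  proof
    note [simp] = ring_mor_typ[OF u]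
    have w: "ring_mor K (tr A) S (u \<cdot> ?c)" by (rule ring_mor_comp[OF c u])
    have wi: "(u \<cdot> ?c) \<cdot> inl A A = u \<cdot> g" "(u \<cdot> ?c) \<cdot> inr A A = u \<cdot> h"
      using copair_in[OF g h] by simp_all
    { assume "u \<cdot> g = u \<cdot> h"
      with wi have "(u \<cdot> ?c) \<cdot> inl A A = (u \<cdot> ?c) \<cdot> inr A A" by simp
      from collapse[OF A w this] have "u \<cdot> ?c = (u \<cdot> g) \<cdot> Mul A" unfolding wi .
      then have "(u \<cdot> ?c) \<cdot> \<epsilon> = ((u \<cdot> g) \<cdot> Mul A) \<cdot> \<epsilon>" by simp
      then show "u \<cdot> (?c \<cdot> \<epsilon>) = One S" by (simp add: me) }
    { assume e1: "u \<cdot> (?c \<cdot> \<epsilon>) = One S"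
      have "(u \<cdot> ?c) \<cdot> (scal (tr A) \<epsilon> \<cdot> inl A A) = ((u \<cdot> ?c) \<cdot> scal (tr A) \<epsilon>) \<cdot> inl A A" by simp
      also have "(u \<cdot> ?c) \<cdot> scal (tr A) \<epsilon> = u \<cdot> ?c"
        using ring_mor_scal[OF w, of \<epsilon>] e1 by (simp add: scal_one)
      finally have l: "(u \<cdot> ?c) \<cdot> (scal (tr A) \<epsilon> \<cdot> inl A A) = u \<cdot> g" using wi by simp
      have "(u \<cdot> ?c) \<cdot> (scal (tr A) \<epsilon> \<cdot> inr A A) = ((u \<cdot> ?c) \<cdot> scal (tr A) \<epsilon>) \<cdot> inr A A" by simp
      also have "(u \<cdot> ?c) \<cdot> scal (tr A) \<epsilon> = u \<cdot> ?c"
        using ring_mor_scal[OF w, of \<epsilon>] e1 by (simp add: scal_one)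
      finally have r: "(u \<cdot> ?c) \<cdot> (scal (tr A) \<epsilon> \<cdot> inr A A) = u \<cdot> h" using wi by simp
      show "u \<cdot> g = u \<cdot> h" using l r e by (simp add: sep_elem_def) }
  qed
  ultimately have "equalizes R (?c \<cdot> \<epsilon>) g h" by (simp add: equalizes_def)
  then show ?thesis by blast
qed

text \<open>For the universal pair \<open>inl\<close>, \<open>inr\<close> the equalising idempotent
  is itself a separability element: over its factor the two inclusions agree, and the multiplication
  sends it to 1.\<close>

lemma separableI:
  assumes A [simp]: "is_ring K A" and e: "equalizes (tr A) e (inl A A) (inr A A)"
  shows "separable_ring K A"
proof (rule sep_elem_separable[OF A])
  have g: "glob (tr A) e" and ee: "gmul (tr A) e e = e" using equalizesD[OF e] by auto
  obtain S p where p: "is_factor (tr A) e S p" using ex_factor[OF _ g ee] by auto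
  then obtain \<iota> where i: "arr \<iota>" "Dom K \<iota> = Car S" "Cod K \<iota> = Car (tr A)" "p \<cdot> \<iota> = Ide K (Car S)" "\<iota> \<cdot> p = scal (tr A) e"
    and pm: "ring_mor K (tr A) S p" by (auto simp: is_factor_def)
  note [simp] = i(1-3) ring_mor_typ(3,5)[OF pm] ring_mor_typ(4)[OF pm, simplified]
  have "p \<cdot> inl A A = p \<cdot> inr A A" using equalizesD(3)[OF e pm] is_factorD(3)[OF p] by simp
  then have "\<iota> \<cdot> (p \<cdot> inl A A) = \<iota> \<cdot> (p \<cdot> inr A A)" by simp
  then have "scal (tr A) e \<cdot> inl A A = scal (tr A) e \<cdot> inr A A"
    unfolding i(5)[symmetric] by (simp del: i(3) add: i(3)[simplified])
  moreover have "Mul A \<cdot> e = One A" using equalizesD(3)[OF e Mul_mor(1)[OF A]] Mul_mor(2,3)[OF A] by simp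
  ultimately show "sep_elem A e" using g by (simp add: sep_elem_def)
qed

text \<open>Since \<open>p\<close> is an epimorphism, two morphisms out of \<open>S\<close> agree
  iff they agree after precomposition with \<open>p\<close>; the idempotent belonging to the
  precomposed pair therefore serves for \<open>S\<close>.\<close>

lemma separable_factor:
  assumes sep: "separable_ring K R" and p: "is_factor R e S p"
  shows "separable_ring K S"
proof -
  note pm = is_factorD(1)[OF p]
  note [simp] = ring_mor_typ[OF pm]
  have "\<exists>e. equalizes (tr S) e (inl S S \<cdot> p) (inr S S \<cdot> p)"
    by (intro separable_equalizes[OF sep] ring_mor_comp[OF pm] inl_mor inr_mor) auto
  then obtain e' where e': "equalizes (tr S) e' (inl S S \<cdot> p) (inr S S \<cdot> p)" by blast
  have "u \<cdot> inl S S = u \<cdot> inr S S \<longleftrightarrow> u \<cdot> e' = One X" if u: "ring_mor K (tr S) X u" for X u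
  proof -
    note [simp] = ring_mor_typ(3,5)[OF u] ring_mor_typ(4)[OF u, simplified]
    have "u \<cdot> inl S S = u \<cdot> inr S S \<longleftrightarrow> (u \<cdot> inl S S) \<cdot> p = (u \<cdot> inr S S) \<cdot> p"
      by (auto intro!: is_factorD(5)[OF p, of "u \<cdot> inl S S" "u \<cdot> inr S S"] simp del: comp_assoc')
    then show ?thesis using equalizesD(3)[OF e' u] by simp
  qed
  then have "equalizes (tr S) e' (inl S S) (inr S S)"
    using equalizesD[OF e'] by (simp add: equalizes_def)
  then show ?thesis by (intro separableI) auto
qed

lemma gmul_one_iff:
  assumes [simp]: "is_ring K R" "glob R e" "glob R f" and i: "gmul R e e = e" "gmul R f f = f"
  shows "gmul R (gmul R e f) (gmul R e f) = gmul R e f" "gmul R e f = One R \<longleftrightarrow> e = One R \<and> f = One R"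
proof -
  interpret cring "Gam R" by (rule cring_Gam) simp
  have c: "e \<in> carrier (Gam R)" "f \<in> carrier (Gam R)" by (auto simp: in_Hom)
  show "gmul R (gmul R e f) (gmul R e f) = gmul R e f" using m_ac c i
    by (metis Gam_sel(2) m_closed)
  show "gmul R e f = One R \<longleftrightarrow> e = One R \<and> f = One R"
  proof
    assume *: "gmul R e f = One R"
    have "e = gmul R e (gmul R e f)" using * r_one[OF c(1)] by simp
    also have "\<dots> = gmul R e f" using m_assoc[of e e f] c i by simp
    finally have "e = One R" using * by simp
    then show "e = One R \<and> f = One R" using * l_one[OF c(2)] by simp
  qed (use l_one c in simp)
qed

lemma ring_mor_gmul:
  assumes u: "ring_mor K R S u" and "glob R e" "glob R f"
  shows "u \<cdot> gmul R e f = gmul S (u \<cdot> e) (u \<cdot> f)"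
proof -
  interpret ring_hom_cring "Gam R" "Gam S" "\<lambda>e. u \<cdot> e" by (rule Gam_hom[OF u])
  show ?thesis using hom_mult[of e f] assms by (simp add: in_Hom)
qed

text \<open>Morphisms out of a coproduct agree iff both restrictions do, and a product of two
  idempotents is 1 iff both are 1.\<close>

lemma separable_tens:
  assumes A: "separable_ring K A" and B: "separable_ring K B"
  shows "separable_ring K (tens_ring K A B)"
proof -
  have [simp]: "is_ring K A" "is_ring K B" using A B by (auto simp: separable_ring_def)
  let ?D = "tens_ring K A B"
  have D [simp]: "is_ring K ?D" by simp
  note m = inl_mor[OF D D] inr_mor[OF D D] inl_mor[of A B] inr_mor[of A B]
  have "\<exists>e. equalizes (tr ?D) e (inl ?D ?D \<cdot> inl A B) (inr ?D ?D \<cdot> inl A B)"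
    by (intro separable_equalizes[OF A] ring_mor_comp[OF m(3)] m) auto
  then obtain e where e: "equalizes (tr ?D) e (inl ?D ?D \<cdot> inl A B) (inr ?D ?D \<cdot> inl A B)" by blast
  have "\<exists>e. equalizes (tr ?D) e (inl ?D ?D \<cdot> inr A B) (inr ?D ?D \<cdot> inr A B)"
    by (intro separable_equalizes[OF B] ring_mor_comp[OF m(4)] m) auto
  then obtain f where f: "equalizes (tr ?D) f (inl ?D ?D \<cdot> inr A B) (inr ?D ?D \<cdot> inr A B)" by blast
  have ge: "glob (tr ?D) e" "gmul (tr ?D) e e = e" and gf: "glob (tr ?D) f" "gmul (tr ?D) f f = f"
    using equalizesD[OF e] equalizesD[OF f] by auto
  have "u \<cdot> inl ?D ?D = u \<cdot> inr ?D ?D \<longleftrightarrow> u \<cdot> gmul (tr ?D) e f = One X" if u: "ring_mor K (tr ?D) X u" for X u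
  proof -
    note [simp] = ring_mor_typ(3,5)[OF u] ring_mor_typ(4)[OF u, simplified]
    have X [simp]: "is_ring K X" using ring_mor_typ[OF u] by simp
    have ul: "ring_mor K ?D X (u \<cdot> inl ?D ?D)" "ring_mor K ?D X (u \<cdot> inr ?D ?D)"
      by (intro ring_mor_comp[OF m(1) u] ring_mor_comp[OF m(2) u])+
    have "u \<cdot> inl ?D ?D = u \<cdot> inr ?D ?D \<longleftrightarrow> (u \<cdot> inl ?D ?D) \<cdot> inl A B = (u \<cdot> inr ?D ?D) \<cdot> inl A B \<and> (u \<cdot> inl ?D ?D) \<cdot> inr A B = (u \<cdot> inr ?D ?D) \<cdot> inr A B"
      using copair_unique[OF _ _ ul] by (auto simp del: comp_assoc')
    also have "\<dots> \<longleftrightarrow> u \<cdot> e = One X \<and> u \<cdot> f = One X"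
      using equalizesD(3)[OF e u] equalizesD(3)[OF f u] by simp
    also have "\<dots> \<longleftrightarrow> gmul X (u \<cdot> e) (u \<cdot> f) = One X"
      using ge gf ring_mor_gmul[OF u] by (intro gmul_one_iff(2)[symmetric]) (auto simp flip: ring_mor_gmul[OF u])
    finally show ?thesis using ring_mor_gmul[OF u] ge gf by simp
  qed
  moreover have "glob (tr ?D) (gmul (tr ?D) e f)" using ge gf by (simp del: tens_ring_sel)
  moreover have "gmul (tr ?D) (gmul (tr ?D) e f) (gmul (tr ?D) e f) = gmul (tr ?D) e f"
    using ge gf by (intro gmul_one_iff(1)) auto
  ultimately have "equalizes (tr ?D) (gmul (tr ?D) e f) (inl ?D ?D) (inr ?D ?D)"
    by (simp only: equalizes_def) blast
  then show ?thesis by (intro separableI) auto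
qed

section \<open>Disjoint morphisms and decompositions\<close>

text \<open>In geometric terms, \<open>g\<close> and \<open>h\<close> agree at no point of the spectrum of \<open>R\<close>.\<close>

definition disjoint where
  "disjoint R g h \<longleftrightarrow> (\<forall>S u. ring_mor K R S u \<and> u \<cdot> g = u \<cdot> h \<longrightarrow> zero_ring S)"

lemma disjointD: "\<lbrakk>disjoint R g h; ring_mor K R S u; u \<cdot> g = u \<cdot> h\<rbrakk> \<Longrightarrow> zero_ring S"
  by (auto simp: disjoint_def)

lemma disjoint_sym: "disjoint R g h \<Longrightarrow> disjoint R h g"
  unfolding disjoint_def by metis

lemma disjoint_comp:
  assumes "disjoint R g h" "ring_mor K R S u" "ring_mor K A R g" "ring_mor K A R h"
  shows "disjoint S (u \<cdot> g) (u \<cdot> h)"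
proof -
  note [simp] = ring_mor_typ[OF assms(2)] ring_mor_typ[OF assms(3)] ring_mor_typ[OF assms(4)]
  show ?thesis unfolding disjoint_def
  proof (intro allI impI, elim conjE)
    fix X v assume v: "ring_mor K S X v" "v \<cdot> (u \<cdot> g) = v \<cdot> (u \<cdot> h)"
    note [simp] = ring_mor_typ[OF v(1)]
    have "(v \<cdot> u) \<cdot> g = (v \<cdot> u) \<cdot> h" using v by simp
    then show "zero_ring X" using disjointD[OF assms(1) ring_mor_comp[OF assms(2) v(1)]] by simp
  qed
qed

text \<open>Disjointness can be tested on the single factor eR, through which every morphism that
  makes \<open>g\<close> and \<open>h\<close> agree must factor; that ring is zero iff e =
  0.\<close>

lemma disjoint_iff_equalizes:
  assumes e: "equalizes R e g h" and [simp]: "is_ring K R"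
  shows "disjoint R g h \<longleftrightarrow> e = Z (Unity K) (Car R)"
proof
  assume d: "disjoint R g h"
  obtain S p where p: "is_factor R e S p" using ex_factor equalizesD[OF e] by force
  then have "p \<cdot> g = p \<cdot> h" using equalizesD(3)[OF e is_factorD(1)[OF p]] is_factorD(3)[OF p] by simp
  then have "zero_ring S" using disjointD[OF d is_factorD(1)[OF p]] by simp
  then show "e = Z (Unity K) (Car R)" using factor_zero_iff[OF p] by simp
next
  assume z: "e = Z (Unity K) (Car R)"
  show "disjoint R g h" unfolding disjoint_def
  proof (intro allI impI, elim conjE)
    fix X v assume v: "ring_mor K R X v" "v \<cdot> g = v \<cdot> h"
    then have "v \<cdot> e = One X" using equalizesD(3)[OF e v(1)] by simp
    then show "zero_ring X" using z ring_mor_typ[OF v(1)] by (simp add: zero_ring_def)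
  qed
qed

text \<open>Multiplication by \<open>e\<close> is one of the linear idempotent endomorphisms in the
  definition of indecomposability, and its value at the unit recovers \<open>e\<close>.\<close>

lemma indecomposable_idem:
  assumes "indecomposable K B" "glob B e" "gmul B e e = e"
  shows "e = One B \<or> e = Z (Unity K) (Car B)"
proof -
  have [simp]: "is_ring K B" using assms by (simp add: indecomposable_def)
  note [simp] = assms(2)
  have l: "scal B e \<cdot> Mul B = Mul B \<cdot> (Ide K (Car B) \<boxdot> scal B e)"
    by (rule ext[of _ "var 0 (Car B) \<star> var 1 (Car B)"]) (auto simp: ring_ac)
  have "scal B e \<cdot> scal B e = scal B e" by (simp add: scal_gmul assms(3))
  then have "scal B e = Ide K (Car B) \<or> scal B e = Z (Car B) (Car B)"
    using assms(1) l by (auto simp: indecomposable_def in_Hom)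
  then show ?thesis
  proof
    assume "scal B e = Ide K (Car B)"
    then have "e = Ide K (Car B) \<cdot> One B" using scal_comp_one[of B e] by simp
    then show ?thesis by simp
  next
    assume "scal B e = Z (Car B) (Car B)"
    then have "e = Z (Car B) (Car B) \<cdot> One B" using scal_comp_one[of B e] by simp
    then show ?thesis by simp
  qed
qed

lemma indecomposable_nonzero: "indecomposable K B \<Longrightarrow> \<not> zero_ring B"
  using zero_ring_iff by (auto simp: indecomposable_def)

text \<open>The equalising idempotent lives in an indecomposable ring, so it is 1 or 0: the
  morphisms agree everywhere or nowhere.\<close>

lemma equal_or_disjoint:
  assumes "separable_ring K A" "indecomposable K B" "ring_mor K A B g" "ring_mor K A B h"
  shows "g = h \<or> disjoint B g h"
proof -
  have B [simp]: "is_ring K B" using assms by (simp add: indecomposable_def)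
  note [simp] = ring_mor_typ[OF assms(3)] ring_mor_typ[OF assms(4)]
  obtain e where e: "equalizes B e g h" using separable_equalizes assms by blast
  from indecomposable_idem[OF assms(2)] equalizesD[OF e] have "e = One B \<or> e = Z (Unity K) (Car B)" by blast
  then show ?thesis
  proof
    assume "e = One B"
    then show ?thesis using equalizesD(3)[OF e ring_mor_ide[OF B]] by simp
  next
    assume "e = Z (Unity K) (Car B)"
    then show ?thesis using disjoint_iff_equalizes[OF e] by simp
  qed
qed

text \<open>A finite product seen from inside, by orthogonal idempotents with sum 1. This form can
  be pushed along ring morphisms, which is what locating points on components requires.\<close>

definition decomp where
  "decomp I R e S p \<longleftrightarrow> is_ring K R \<and> finite I \<and> (\<forall>i\<in>I. is_factor R (e i) (S i) (p i)) \<and>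
     (\<forall>i\<in>I. \<forall>j\<in>I. i \<noteq> j \<longrightarrow> gmul R (e i) (e j) = Z (Unity K) (Car R)) \<and> finsum (Gam R) e I = One R"

lemma decomp_product:
  assumes d: "decomp I R e S p" shows "product_ring K I S R p"
proof -
  from d have [simp]: "is_ring K R" and I: "finite I" and f: "\<And>i. i \<in> I \<Longrightarrow> is_factor R (e i) (S i) (p i)"
    and o: "\<And>i j. \<lbrakk>i \<in> I; j \<in> I; i \<noteq> j\<rbrakk> \<Longrightarrow> gmul R (e i) (e j) = Z (Unity K) (Car R)"
    and s: "finsum (Gam R) e I = One R" by (auto simp: decomp_def)
  have "\<forall>i\<in>I. \<exists>\<iota>. arr \<iota> \<and> Dom K \<iota> = Car (S i) \<and> Cod K \<iota> = Car R \<and> p i \<cdot> \<iota> = Ide K (Car (S i)) \<and> \<iota> \<cdot> p i = scal R (e i)"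
    using f by (auto simp: is_factor_def)
  then obtain \<iota> where \<iota>: "\<And>i. i \<in> I \<Longrightarrow> arr (\<iota> i) \<and> Dom K (\<iota> i) = Car (S i) \<and> Cod K (\<iota> i) = Car R \<and> p i \<cdot> \<iota> i = Ide K (Car (S i)) \<and> \<iota> i \<cdot> p i = scal R (e i)"
    by metis
  have pm: "ring_mor K R (S i) (p i)" "glob R (e i)" if "i \<in> I" for i using f[OF that] by (auto simp: is_factor_def)
  have zero: "p j \<cdot> \<iota> i = Z (Car (S i)) (Car (S j))" if "i \<in> I" "j \<in> I" "i \<noteq> j" for i j
  proof -
    note [simp] = \<iota>[OF that(1)] \<iota>[OF that(2)] ring_mor_typ[OF pm(1)[OF that(1)]] ring_mor_typ[OF pm(1)[OF that(2)]] pm(2)[OF that(1)] pm(2)[OF that(2)]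
    have 1: "p j \<cdot> scal R (e j) = p j"
      using comp_eq[of "p j" "\<iota> j" _ "p j"] \<iota>[OF that(2)] by simp
    have 2: "scal R (e i) \<cdot> \<iota> i = \<iota> i"
      using comp_assoc'[of "\<iota> i" "p i" "\<iota> i"] \<iota>[OF that(1)] by simp
    have "p j \<cdot> \<iota> i = (p j \<cdot> scal R (e j)) \<cdot> (scal R (e i) \<cdot> \<iota> i)" by (simp only: 1 2)
    also have "\<dots> = p j \<cdot> (scal R (e j) \<cdot> scal R (e i)) \<cdot> \<iota> i" by simp
    also have "scal R (e j) \<cdot> scal R (e i) = Z (Car R) (Car R)"
      using o[OF that(2,1)] that by (simp add: scal_gmul scal_zero)
    finally show ?thesis by simp
  qed
  have "finprod (hom_group K (Car R) (Car R)) (\<lambda>i. scal R (e i)) I = scal R (finprod (hom_group K (Unity K) (Car R)) e I)"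
    by (rule finprod_hom_map[symmetric]) (use I pm in \<open>auto simp: in_Hom scal_zero scal_add\<close>)
  also have "\<dots> = Ide K (Car R)" using s by (simp add: Gam_finsum scal_one)
  finally have sum: "finprod (hom_group K (Car R) (Car R)) (\<lambda>i. scal R (e i)) I = Ide K (Car R)" .
  interpret G: Group.comm_group "hom_group K (Car R) (Car R)" by (rule hom_comm_group) auto
  have sum': "finprod (hom_group K (Car R) (Car R)) (\<lambda>i. \<iota> i \<cdot> p i) I = Ide K (Car R)"
    using \<iota> pm unfolding sum[symmetric] by (intro G.finprod_cong') (auto simp: in_Hom)
  have "direct_sum K I (\<lambda>i. Car (S i)) (Car R) p"
    unfolding direct_sum_def
  proof (intro conjI ballI exI[of _ \<iota>])
    fix i j assume ij: "i \<in> I" "j \<in> I"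
    show "p j \<cdot> \<iota> i = (if i = j then Ide K (Car (S i)) else Z (Car (S i)) (Car (S j)))"
      using zero[OF ij] \<iota>[OF ij(1)] by auto
  next
    fix i assume i: "i \<in> I"
    show "Car (S i) \<in> Obj K" "p i \<in> Hom K (Car R) (Car (S i))" "\<iota> i \<in> Hom K (Car (S i)) (Car R)"
      using ring_mor_typ[OF pm(1)[OF i]] \<iota>[OF i] by (auto simp: in_Hom)
  qed (use I sum' in auto)
  then show ?thesis using pm by (auto simp: product_ring_def)
qed

text \<open>Only the projections of a product are assumed to be ring morphisms; the injections are
  mere arrows. As the projections are jointly monic, comparing components identifies \<iota>_i p_i
  with multiplication by the element \<iota>_i(1).\<close>

lemma product_decomp_inj:
  assumes pr: "product_ring K I S R p"
    and \<iota>': "\<forall>i\<in>I. \<iota> i \<in> Hom K (Car (S i)) (Car R)"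
    and d': "\<forall>i\<in>I. \<forall>j\<in>I. p j \<cdot> \<iota> i = (if i = j then Ide K (Car (S i)) else Z (Car (S i)) (Car (S j)))"
    and s: "finprod (hom_group K (Car R) (Car R)) (\<lambda>i. \<iota> i \<cdot> p i) I = Ide K (Car R)"
  shows "decomp I R (\<lambda>i. \<iota> i \<cdot> One (S i)) S p" "i \<in> I \<Longrightarrow> \<iota> i \<cdot> p i = scal R (\<iota> i \<cdot> One (S i))"
proof -
  from pr have [simp]: "is_ring K R" and I: "finite I" and pm: "\<And>i. i \<in> I \<Longrightarrow> ring_mor K R (S i) (p i)"
    by (auto simp: product_ring_def direct_sum_def)
  have \<iota>: "arr (\<iota> i) \<and> Dom K (\<iota> i) = Car (S i) \<and> Cod K (\<iota> i) = Car R" if "i \<in> I" for i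
    using \<iota>' that by (auto simp: in_Hom)
  have d: "p j \<cdot> \<iota> i = (if i = j then Ide K (Car (S i)) else Z (Car (S i)) (Car (S j)))" if "i \<in> I" "j \<in> I" for i j
    using d' that by blast
  note t = ring_mor_typ[OF pm] \<iota>
  have S: "Car (S i) \<in> Obj K" if "i \<in> I" for i using is_ring_typ(1)[OF ring_mor_typ(2)[OF pm[OF that]]] .
  have pc: "p i \<cdot> (\<iota> j \<cdot> f) = (if i = j then f else Z (Dom K f) (Car (S i)))"
    if "i \<in> I" "j \<in> I" "arr f" "Cod K f = Car (S j)" for i j f
    using comp_eq[OF d[OF that(2,1)], of f] that t S by auto
  have sum_map: "f = finprod (hom_group K (Dom K f) (Car R)) (\<lambda>i. (\<iota> i \<cdot> p i) \<cdot> f) I"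
    if "arr f" "Cod K f = Car R" for f
  proof -
    have "f = finprod (hom_group K (Car R) (Car R)) (\<lambda>i. \<iota> i \<cdot> p i) I \<cdot> f" using s that by simp
    also have "\<dots> = finprod (hom_group K (Dom K f) (Car R)) (\<lambda>i. (\<iota> i \<cdot> p i) \<cdot> f) I"
      by (rule finprod_hom_map[where \<phi> = "\<lambda>g. g \<cdot> f"]) (use I that t in \<open>auto simp: in_Hom\<close>)
    finally show ?thesis .
  qed
  have joint: "f = g" if "arr f" "arr g" "Dom K f = Dom K g" "Cod K f = Car R" "Cod K g = Car R" "\<And>i. i \<in> I \<Longrightarrow> p i \<cdot> f = p i \<cdot> g" for f g
  proof -
    interpret G: Group.comm_group "hom_group K (Dom K g) (Car R)" by (rule hom_comm_group) (use that in auto)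
    have "finprod (hom_group K (Dom K g) (Car R)) (\<lambda>i. (\<iota> i \<cdot> p i) \<cdot> f) I = finprod (hom_group K (Dom K g) (Car R)) (\<lambda>i. (\<iota> i \<cdot> p i) \<cdot> g) I"
      by (rule G.finprod_cong') (use that t in \<open>auto simp: in_Hom\<close>)
    then show ?thesis using sum_map[of f] sum_map[of g] that by simp
  qed
  define e where "e = (\<lambda>i. \<iota> i \<cdot> One (S i))"
  have ge: "glob R (e i)" if "i \<in> I" for i using t[OF that] by (auto simp: e_def)
  have pe: "p j \<cdot> e i = (if i = j then One (S i) else Z (Unity K) (Car (S j)))" if "i \<in> I" "j \<in> I" for i j
    using pc[of j i "One (S i)"] t[OF that(1)] that by (auto simp: e_def)
  have ip: "\<iota> i \<cdot> p i = scal R (e i)" if i: "i \<in> I" for i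
  proof (rule joint)
    fix j assume j: "j \<in> I"
    show "p j \<cdot> (\<iota> i \<cdot> p i) = p j \<cdot> scal R (e i)"
      using ring_mor_scal[OF pm[OF j] ge[OF i]] pe[OF i j] pc[OF j i, of "p i"] t[OF i] t[OF j] S[OF i] S[OF j]
      by (auto simp: scal_one scal_zero)
  qed (use t[OF i] ge[OF i] in auto)
  then show "i \<in> I \<Longrightarrow> \<iota> i \<cdot> p i = scal R (\<iota> i \<cdot> One (S i))" by (simp add: e_def)
  have "decomp I R e S p" unfolding decomp_def
  proof (intro conjI ballI impI)
    fix i assume i: "i \<in> I"
    show "is_factor R (e i) (S i) (p i)"
      using pm[OF i] ge[OF i] t[OF i] d[OF i i] ip[OF i] by (auto simp: is_factor_def intro!: exI[of _ "\<iota> i"])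
  next
    fix i j assume ij: "i \<in> I" "j \<in> I" "i \<noteq> j"
    have "gmul R (e i) (e j) = scal R (e i) \<cdot> e j" using ge ij by (simp add: scal_comp)
    also have "\<dots> = \<iota> i \<cdot> (p i \<cdot> e j)" unfolding ip[OF ij(1), symmetric] using t[OF ij(1)] ge[OF ij(2)] by simp
    also have "\<dots> = Z (Unity K) (Car R)" using pe[OF ij(2,1)] ij t[OF ij(1)] by simp
    finally show "gmul R (e i) (e j) = Z (Unity K) (Car R)" .
  next
    interpret G: Group.comm_group "hom_group K (Unity K) (Car R)" by (rule hom_comm_group) auto
    have "finsum (Gam R) e I = finprod (hom_group K (Unity K) (Car R)) (\<lambda>i. (\<iota> i \<cdot> p i) \<cdot> One R) I"
      unfolding Gam_finsum using t by (intro G.finprod_cong') (auto simp: in_Hom e_def)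
    then show "finsum (Gam R) e I = One R" using sum_map[of "One R"] by simp
  qed (use I in auto)
  then show "decomp I R (\<lambda>i. \<iota> i \<cdot> One (S i)) S p" by (simp add: e_def)
qed

lemma product_decomp:
  assumes pr: "product_ring K I S R p"
  shows "\<exists>e. decomp I R e S p"
proof -
  from pr obtain \<iota> where "\<forall>i\<in>I. \<iota> i \<in> Hom K (Car (S i)) (Car R)"
    "\<forall>i\<in>I. \<forall>j\<in>I. p j \<cdot> \<iota> i = (if i = j then Ide K (Car (S i)) else Z (Car (S i)) (Car (S j)))"
    "finprod (hom_group K (Car R) (Car R)) (\<lambda>i. \<iota> i \<cdot> p i) I = Ide K (Car R)"
    unfolding product_ring_def direct_sum_def by blast
  from product_decomp_inj(1)[OF pr this] show ?thesis by blast
qed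

lemma decompD:
  assumes "decomp I R e S p"
  shows "is_ring K R" "finite I" "i \<in> I \<Longrightarrow> is_factor R (e i) (S i) (p i)"
    "\<lbrakk>i \<in> I; j \<in> I; i \<noteq> j\<rbrakk> \<Longrightarrow> gmul R (e i) (e j) = Z (Unity K) (Car R)" "finsum (Gam R) e I = One R"
    "\<lbrakk>i \<in> I; j \<in> I; i \<noteq> j\<rbrakk> \<Longrightarrow> p j \<cdot> e i = Z (Unity K) (Car (S j))"
proof -
  show 1: "is_ring K R" "finite I" "i \<in> I \<Longrightarrow> is_factor R (e i) (S i) (p i)" for i
    using assms by (auto simp: decomp_def)
  show 2: "\<lbrakk>i \<in> I; j \<in> I; i \<noteq> j\<rbrakk> \<Longrightarrow> gmul R (e i) (e j) = Z (Unity K) (Car R)" "finsum (Gam R) e I = One R" for i j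
    using assms by (auto simp: decomp_def)
  assume ij: "i \<in> I" "j \<in> I" "i \<noteq> j"
  note i = is_factorD[OF 1(3)[OF ij(1)]] and j = is_factorD[OF 1(3)[OF ij(2)]]
  note [simp] = ring_mor_typ[OF j(1)]
  have "p j \<cdot> gmul R (e i) (e j) = gmul (S j) (p j \<cdot> e i) (One (S j))"
    using ring_mor_gmul[OF j(1) i(2) j(2)] j(3) by simp
  also have "\<dots> = p j \<cdot> e i"
  proof -
    interpret cring "Gam (S j)" by (rule cring_Gam) simp
    have "p j \<cdot> e i \<in> carrier (Gam (S j))" using i by (simp add: in_Hom)
    then show ?thesis using r_one by simp
  qed
  finally show "p j \<cdot> e i = Z (Unity K) (Car (S j))" using 2(1)[OF ij] by simp
qed

lemma decomp_sum_nonzero: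
  assumes d: "decomp I R e S p" and u: "ring_mor K R X u" and nz: "\<not> zero_ring X"
  shows "\<exists>i\<in>I. u \<cdot> e i \<noteq> Z (Unity K) (Car X)"
proof (rule ccontr)
  assume *: "\<not> ?thesis"
  interpret h: ring_hom_cring "Gam R" "Gam X" "\<lambda>e. u \<cdot> e" by (rule Gam_hom[OF u])
  have e: "e \<in> I \<rightarrow> carrier (Gam R)" using is_factorD(2)[OF decompD(3)[OF d]] by (auto simp: in_Hom)
  have "u \<cdot> One R = u \<cdot> finsum (Gam R) e I" using decompD[OF d] by simp
  also have "\<dots> = finsum (Gam X) (\<lambda>i. u \<cdot> e i) I" using h.hom_finsum[OF e] by (simp add: comp_def)
  also have "\<dots> = finsum (Gam X) (\<lambda>i. \<zero>\<^bsub>Gam X\<^esub>) I"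
    by (rule h.S.finsum_cong') (use * in \<open>auto simp: Pi_def intro: h.S.zero_closed[simplified]\<close>)
  also have "\<dots> = \<zero>\<^bsub>Gam X\<^esub>" by (rule h.S.finsum_zero)
  finally show False using nz ring_mor_typ[OF u] by (simp add: zero_ring_def)
qed

text \<open>The images of the idempotents sum to 1, so one of them is nonzero in \<open>X\<close>;
  over its factor \<open>X'\<close> it becomes 1 and the morphism factors through
  \<open>S i\<close>. Shrinking is unavoidable, since different parts of \<open>X\<close> may lie
  over different components.\<close>

lemma decomp_point:
  assumes d: "decomp I R e S p" and u: "ring_mor K R X u" and nz: "\<not> zero_ring X"
  shows "\<exists>i\<in>I. \<exists>X' v w. ring_mor K X X' v \<and> \<not> zero_ring X' \<and> ring_mor K (S i) X' w \<and> w \<cdot> p i = v \<cdot> u"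
proof -
  from decomp_sum_nonzero[OF assms] obtain i where i: "i \<in> I" and n: "u \<cdot> e i \<noteq> Z (Unity K) (Car X)" by blast
  note f = is_factorD[OF decompD(3)[OF d i]]
  note [simp] = ring_mor_typ[OF u] f(2)
  have "gmul X (u \<cdot> e i) (u \<cdot> e i) = u \<cdot> e i" using ring_mor_gmul[OF u f(2) f(2)] f(4) by simp
  then obtain X' v where v: "is_factor X (u \<cdot> e i) X' v" using ex_factor[of X "u \<cdot> e i"] by auto
  note [simp] = ring_mor_typ[OF is_factorD(1)[OF v]]
  have vu: "ring_mor K R X' (v \<cdot> u)" using ring_mor_comp[OF u is_factorD(1)[OF v]] .
  have "(v \<cdot> u) \<cdot> e i = One X'" using is_factorD(3)[OF v] by simp
  from factor_lift[OF decompD(3)[OF d i] vu this] obtain w where "ring_mor K (S i) X' w" "w \<cdot> p i = v \<cdot> u" by blast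
  moreover have "\<not> zero_ring X'" using factor_zero_iff[OF v] n by simp
  ultimately show ?thesis using i is_factorD(1)[OF v] by blast
qed

text \<open>Here the nonzero idempotent is already 1, so the morphism itself factors and no
  shrinking takes place.\<close>

lemma decomp_point_indecomposable:
  assumes d: "decomp I R e S p" and u: "ring_mor K R X u" and X: "indecomposable K X"
  shows "\<exists>i\<in>I. u \<cdot> e i = One X \<and> (\<exists>w. ring_mor K (S i) X w \<and> w \<cdot> p i = u)"
proof -
  from decomp_sum_nonzero[OF d u indecomposable_nonzero[OF X]]
  obtain i where i: "i \<in> I" and n: "u \<cdot> e i \<noteq> Z (Unity K) (Car X)" by blast
  note f = is_factorD[OF decompD(3)[OF d i]]
  note [simp] = ring_mor_typ[OF u] f(2)
  have "gmul X (u \<cdot> e i) (u \<cdot> e i) = u \<cdot> e i" using ring_mor_gmul[OF u f(2) f(2)] f(4) by simp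
  then have "u \<cdot> e i = One X" using indecomposable_idem[OF X, of "u \<cdot> e i"] n by auto
  then show ?thesis using i factor_lift[OF decompD(3)[OF d i] u] by blast
qed

text \<open>Over the factor cut out by \<open>e\<close> both inclusions agree, so by
  \<open>collapse\<close> its projection factors through the multiplication, of which
  \<open>inl\<close> is a section.\<close>

lemma factor_codiag:
  assumes A [simp]: "is_ring K A" and e: "equalizes (tr A) e (inl A A) (inr A A)"
  shows "is_factor (tr A) e A (Mul A)"
proof (rule factorI[where s = "inl A A"])
  show g: "glob (tr A) e" using equalizesD[OF e] by auto
  show "Mul A \<cdot> e = One A" using equalizesD(3)[OF e Mul_mor(1)[OF A]] Mul_mor(2,3)[OF A] by simp
  obtain S p where p: "is_factor (tr A) e S p" using ex_factor[OF _ g] equalizesD[OF e] by auto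
  then obtain \<iota> where i: "arr \<iota>" "Dom K \<iota> = Car S" "Cod K \<iota> = Car (tr A)" "p \<cdot> \<iota> = Ide K (Car S)" "\<iota> \<cdot> p = scal (tr A) e"
    and pm: "ring_mor K (tr A) S p" by (auto simp: is_factor_def)
  note [simp] = i(1,2) i(3)[simplified] ring_mor_typ(3,5)[OF pm] ring_mor_typ(4)[OF pm, simplified]
  have "p \<cdot> inl A A = p \<cdot> inr A A" using equalizesD(3)[OF e pm] is_factorD(3)[OF p] by simp
  from collapse[OF A pm this] have "p = p \<cdot> (inl A A \<cdot> Mul A)" by simp
  then have "\<iota> \<cdot> p = \<iota> \<cdot> (p \<cdot> (inl A A \<cdot> Mul A))" by simp
  also have "\<dots> = (\<iota> \<cdot> p) \<cdot> inl A A \<cdot> Mul A" by simp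
  finally show "scal (tr A) e \<cdot> inl A A \<cdot> Mul A = scal (tr A) e" unfolding i(5) by simp
qed (auto simp: Mul_mor)

section \<open>Binary products and the derived ring A'\<close>

lemma factors_binary_product:
  assumes p: "is_factor R e S p" and q: "is_factor R (compl R e) T q"
  shows "binary_product_ring K S T R p q"
proof -
  from p obtain \<iota> where i: "arr \<iota>" "Dom K \<iota> = Car S" "Cod K \<iota> = Car R" "p \<cdot> \<iota> = Ide K (Car S)" "\<iota> \<cdot> p = scal R e"
    and pm: "ring_mor K R S p" and e: "glob R e" by (auto simp: is_factor_def)
  from q obtain \<kappa> where k: "arr \<kappa>" "Dom K \<kappa> = Car T" "Cod K \<kappa> = Car R" "q \<cdot> \<kappa> = Ide K (Car T)" "\<kappa> \<cdot> q = scal R (compl R e)"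
    and qm: "ring_mor K R T q" by (auto simp: is_factor_def)
  note [simp] = i(1-4) k(1-4) e ring_mor_typ[OF pm] ring_mor_typ[OF qm]
  have R [simp]: "is_ring K R" by simp
  note c = compl_props[OF R e]
  have ee: "gmul R e e = e" using is_factorD[OF p] by simp
  have z1: "scal R (compl R e) \<cdot> scal R e = Z (Car R) (Car R)"
  proof -
    interpret cring "Gam R" by (rule cring_Gam) simp
    have "gmul R (compl R e) e = gmul R e (compl R e)" using c(1) m_comm[of e "compl R e"] by (simp add: in_Hom)
    then show ?thesis using c ee by (simp add: scal_gmul scal_zero)
  qed
  have z2: "scal R e \<cdot> scal R (compl R e) = Z (Car R) (Car R)"
    using c ee by (simp add: scal_gmul scal_zero)
  have qi: "q \<cdot> \<iota> = Z (Car S) (Car T)"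
  proof -
    have "q \<cdot> \<iota> = (q \<cdot> \<kappa>) \<cdot> (q \<cdot> \<iota>) \<cdot> (p \<cdot> \<iota>)" by simp
    also have "\<dots> = q \<cdot> ((\<kappa> \<cdot> q) \<cdot> (\<iota> \<cdot> p)) \<cdot> \<iota>" by (simp del: i(4) k(4))
    finally show ?thesis by (simp add: i(5) k(5) z1)
  qed
  have pk: "p \<cdot> \<kappa> = Z (Car T) (Car S)"
  proof -
    have "p \<cdot> \<kappa> = (p \<cdot> \<iota>) \<cdot> (p \<cdot> \<kappa>) \<cdot> (q \<cdot> \<kappa>)" by simp
    also have "\<dots> = p \<cdot> ((\<iota> \<cdot> p) \<cdot> (\<kappa> \<cdot> q)) \<cdot> \<kappa>" by (simp del: i(4) k(4))
    finally show ?thesis by (simp add: i(5) k(5) z2)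
  qed
  have "(\<iota> \<cdot> p) \<boxplus> (\<kappa> \<cdot> q) = Ide K (Car R)"
    using c scal_add[OF R e c(1)] by (simp add: i(5) k(5) scal_one)
  then have "biproduct K (Car S) (Car T) (Car R) \<iota> \<kappa> p q"
    using qi pk by (simp add: biproduct_def in_Hom)
  then show ?thesis using pm qm by (auto simp: binary_product_ring_def)
qed

lemma binary_product_factors:
  assumes "binary_product_ring K S T R p q"
  shows "\<exists>e. is_factor R e S p \<and> is_factor R (compl R e) T q"
proof -
  from assms obtain \<iota> \<kappa> where b: "biproduct K (Car S) (Car T) (Car R) \<iota> \<kappa> p q"
    and pm: "ring_mor K R S p" and qm: "ring_mor K R T q" by (auto simp: binary_product_ring_def)
  from b have [simp]: "arr \<iota>" "Dom K \<iota> = Car S" "Cod K \<iota> = Car R" "p \<cdot> \<iota> = Ide K (Car S)"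
    "arr \<kappa>" "Dom K \<kappa> = Car T" "Cod K \<kappa> = Car R" "q \<cdot> \<kappa> = Ide K (Car T)"
    "q \<cdot> \<iota> = Z (Car S) (Car T)" "p \<cdot> \<kappa> = Z (Car T) (Car S)" and s: "(\<iota> \<cdot> p) \<boxplus> (\<kappa> \<cdot> q) = Ide K (Car R)"
    by (auto simp: biproduct_def in_Hom)
  note [simp] = ring_mor_typ[OF pm] ring_mor_typ[OF qm]
  have R [simp]: "is_ring K R" by simp
  have joint: "f = g" if "arr f" "arr g" "Dom K f = Dom K g" "Cod K f = Car R" "Cod K g = Car R" "p \<cdot> f = p \<cdot> g" "q \<cdot> f = q \<cdot> g" for f g
  proof -
    have "((\<iota> \<cdot> p) \<boxplus> (\<kappa> \<cdot> q)) \<cdot> f = ((\<iota> \<cdot> p) \<boxplus> (\<kappa> \<cdot> q)) \<cdot> g" using that by simp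
    then show ?thesis unfolding s using that by simp
  qed
  define e where "e = \<iota> \<cdot> One S"
  have e: "glob R e" by (simp add: e_def)
  note c = compl_props[OF R e]
  have pe: "p \<cdot> e = One S" "q \<cdot> e = Z (Unity K) (Car T)"
    unfolding e_def using comp_eq[of p \<iota> "Ide K (Car S)" "One S"] comp_eq[of q \<iota> "Z (Car S) (Car T)" "One S"] by simp_all
  have "compl S (One S) = Z (Unity K) (Car S)"
    by (subst compl_props(6)) auto
  then have pc1: "p \<cdot> compl R e = Z (Unity K) (Car S)"
    using c(5)[OF pm] pe by simp
  have "compl T (Z (Unity K) (Car T)) = One T"
    by (subst compl_props(7)) auto
  then have pc2: "q \<cdot> compl R e = One T"
    using c(5)[OF qm] pe by simp
  have i1: "p \<cdot> (\<iota> \<cdot> p) = p"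
    using comp_assoc'[of p \<iota> p] by simp
  have i2: "q \<cdot> (\<iota> \<cdot> p) = Z (Car R) (Car T)"
    by (subst comp_eq[of q \<iota> "Z (Car S) (Car T)"]) (simp_all del: comp_assoc')
  have i3: "q \<cdot> (\<kappa> \<cdot> q) = q"
    using comp_assoc'[of q \<kappa> q] by simp
  have i4: "p \<cdot> (\<kappa> \<cdot> q) = Z (Car R) (Car S)"
    by (subst comp_eq[of p \<kappa> "Z (Car T) (Car S)"]) (simp_all del: comp_assoc')
  note i = i1 i2 i3 i4
  have "\<iota> \<cdot> p = scal R e"
    by (rule joint) (simp_all add: e ring_mor_scal[OF pm e] ring_mor_scal[OF qm e] pe scal_one scal_zero i)
  then have 1: "is_factor R e S p"
    using pm e unfolding is_factor_def by (intro conjI exI[of _ \<iota>]) simp_all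
  have "\<kappa> \<cdot> q = scal R (compl R e)"
    by (rule joint) (simp_all add: c(1) ring_mor_scal[OF pm c(1)] ring_mor_scal[OF qm c(1)] pc1 pc2 scal_one scal_zero i)
  then have 2: "is_factor R (compl R e) T q"
    using qm c(1) unfolding is_factor_def by (intro conjI exI[of _ \<kappa>]) simp_all
  from 1 2 show ?thesis by blast
qed

text \<open>A' is the factor complementary to the diagonal of A \<otimes> A, so the product
  decomposition can be taken on A \<otimes> A itself with the identity as \<open>h\<close>. Its
  structure map is the projection after \<open>inl\<close>.\<close>

lemma ex_derived_ring:
  assumes "separable_ring K A" shows "\<exists>C k. derived_ring K A C k"
proof -
  have A [simp]: "is_ring K A" using assms by (simp add: separable_ring_def)
  obtain e where e: "equalizes (tr A) e (inl A A) (inr A A)"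
    using separable_equalizes[OF assms inl_mor inr_mor] by auto
  have g: "glob (tr A) e" using equalizesD[OF e] by simp
  have T [simp]: "is_ring K (tr A)" by simp
  note c = compl_props[OF T g]
  obtain C q where q: "is_factor (tr A) (compl (tr A) e) C q"
    using ex_factor[OF T c(1)] c(4) equalizesD[OF e] by auto
  have b: "binary_product_ring K A C (tr A) (Mul A) q"
    by (rule factors_binary_product[OF factor_codiag[OF A e] q])
  have C: "separable_ring K C" by (rule separable_factor[OF separable_tens[OF assms assms] q])
  have qm: "ring_mor K (tr A) C q" by (rule is_factorD(1)[OF q])
  note [simp] = ring_mor_typ(3,5)[OF qm] ring_mor_typ(4)[OF qm, simplified]
  have k: "ring_mor K A C (q \<cdot> inl A A)" by (rule ring_mor_comp[OF inl_mor qm]) auto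
  have i: "ring_isom K (tr A) (tr A) (Ide K (Car (tr A)))"
    unfolding ring_isom_def using ring_mor_ide[OF T] by simp
  have "\<exists>P p1 p2 h. binary_product_ring K A C P p1 p2 \<and> ring_isom K (tr A) P h \<and> p1 \<cdot> h = Mul A \<and>
      q \<cdot> inl A A = p2 \<cdot> h \<cdot> (Ide K (Car A) \<boxdot> One A) \<cdot> inv_arr K (Runit K (Car A))"
    by (rule exI[of _ "tr A"], rule exI[of _ "Mul A"], rule exI[of _ q], rule exI[of _ "Ide K (Car (tr A))"])
      (use b i in \<open>simp add: inl_def\<close>)
  then have "derived_ring K A C (q \<cdot> inl A A)" using C k by (simp add: derived_ring_def)
  then show ?thesis by blast
qed

text \<open>Removing the diagonal from A \<otimes> A leaves the pairs that agree nowhere. The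
  structure map \<open>k\<close> is the restriction of \<open>inl\<close>; the second universal
  morphism \<open>k2\<close> is that of \<open>inr\<close> and is not recorded in the
  definition.\<close>

lemma derived_ring_represents:
  assumes d: "derived_ring K A C k"
  shows "\<exists>k2. ring_mor K A C k2 \<and> disjoint C k k2 \<and>
    (\<forall>R g1 g2. ring_mor K A R g1 \<and> ring_mor K A R g2 \<and> disjoint R g1 g2 \<longrightarrow>
      (\<exists>!u. ring_mor K C R u \<and> u \<cdot> k = g1 \<and> u \<cdot> k2 = g2))"
proof -
  from d obtain P p1 p2 h where b: "binary_product_ring K A C P p1 p2" and h: "ring_isom K (tr A) P h"
    and m: "p1 \<cdot> h = Mul A" and k: "k = p2 \<cdot> h \<cdot> (Ide K (Car A) \<boxdot> One A) \<cdot> inv_arr K (Runit K (Car A))"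
    by (auto simp: derived_ring_def)
  from binary_product_factors[OF b] obtain e where e1: "is_factor P e A p1" and e2: "is_factor P (compl P e) C p2" by blast
  note p1m = is_factorD(1)[OF e1] and p2m = is_factorD(1)[OF e2] and ge = is_factorD(2)[OF e1]
  have hm: "ring_mor K (tr A) P h" and hi: "iso h" using h by (auto simp: ring_isom_def)
  have A [simp]: "is_ring K A" using d by (auto simp: derived_ring_def ring_mor_def)
  note [simp] = ring_mor_typ[OF p1m] ring_mor_typ[OF p2m] ring_mor_typ(3,5)[OF hm] ring_mor_typ(4)[OF hm, simplified]
     hi ge
  have P [simp]: "is_ring K P" by simp
  note c = compl_props[OF P ge]
  define q where "q = p2 \<cdot> h"
  have qm: "ring_mor K (tr A) C q" unfolding q_def by (rule ring_mor_comp[OF hm p2m])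
  note [simp] = ring_mor_typ(3,5)[OF qm] ring_mor_typ(4)[OF qm, simplified]
  have kq: "k = q \<cdot> inl A A" by (simp add: k q_def inl_def)
  have epi: "f = g" if "arr f" "arr g" "Dom K f = Car C" "Dom K g = Car C" "f \<cdot> q = g \<cdot> q" for f g
  proof (rule is_factorD(5)[OF e2])
    show "f \<cdot> p2 = g \<cdot> p2" using that unfolding q_def by (intro iso_epi[of h "f \<cdot> p2" "g \<cdot> p2"]) auto
  qed (use that in auto)
  have dis: "disjoint C (q \<cdot> inl A A) (q \<cdot> inr A A)" unfolding disjoint_def
  proof (intro allI impI, elim conjE)
    fix S u assume u: "ring_mor K C S u" and eq: "u \<cdot> (q \<cdot> inl A A) = u \<cdot> (q \<cdot> inr A A)"
    note [simp] = ring_mor_typ[OF u]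
    have uq: "ring_mor K (tr A) S (u \<cdot> q)" by (rule ring_mor_comp[OF qm u])
    have "(u \<cdot> q) \<cdot> inl A A = (u \<cdot> q) \<cdot> inr A A" using eq by simp
    note co = collapse[OF A uq this]
    define v where "v = (u \<cdot> q) \<cdot> inl A A"
    have v: "ring_mor K A S v"
      unfolding v_def using ring_mor_comp[OF inl_mor[OF A A] uq] .
    note [simp] = ring_mor_typ[OF v]
    have "(u \<cdot> p2) \<cdot> h = u \<cdot> q" by (simp add: q_def)
    also have "\<dots> = v \<cdot> Mul A" using co by (simp only: v_def)
    also have "\<dots> = (v \<cdot> p1) \<cdot> h" by (simp add: m)
    finally have *: "u \<cdot> p2 = v \<cdot> p1" by (rule iso_epi[OF hi, rotated -1]) auto
    have "(u \<cdot> p2) \<cdot> e = v \<cdot> (p1 \<cdot> e)" unfolding * by simp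
    then have 1: "u \<cdot> (p2 \<cdot> e) = One S" using is_factorD(3)[OF e1] ring_mor_typ(6)[OF v] by simp
    have "compl C (p2 \<cdot> e) = One C" using c(5)[OF p2m] is_factorD(3)[OF e2] by simp
    then have "p2 \<cdot> e = Z (Unity K) (Car C)" using compl_props(7)[of C "p2 \<cdot> e"] by simp
    then show "zero_ring S" using 1 by (simp add: zero_ring_def)
  qed
  have k2: "ring_mor K A C (q \<cdot> inr A A)" by (rule ring_mor_comp[OF inr_mor qm]) auto
  have "\<exists>!u. ring_mor K C R u \<and> u \<cdot> k = g1 \<and> u \<cdot> (q \<cdot> inr A A) = g2"
    if g1: "ring_mor K A R g1" and g2: "ring_mor K A R g2" and dj: "disjoint R g1 g2" for R g1 g2
  proof (rule ex_ex1I)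
    let ?w = "copair R g1 g2 \<cdot> inv_arr K h"
    have cm: "ring_mor K (tr A) R (copair R g1 g2)" by (rule copair_mor[OF g1 g2])
    have w: "ring_mor K P R ?w" by (rule ring_mor_comp[OF ring_mor_inv[OF hm hi] cm])
    note [simp] = ring_mor_typ[OF g1] ring_mor_typ[OF g2]  ring_mor_typ(3,5)[OF cm] ring_mor_typ(4)[OF cm, simplified]
    \<comment> \<open>Over the factor \<open>X\<close> of \<open>R\<close> cut out by the image of
      the diagonal idempotent, \<open>g1\<close> and \<open>g2\<close> agree. Disjointness makes
      \<open>X\<close> zero; so that image is 0, its complement is sent to 1, and the morphism
      factors through \<open>C\<close>.\<close>
    have "gmul R (?w \<cdot> e) (?w \<cdot> e) = ?w \<cdot> e"
      using ring_mor_gmul[OF w ge ge] is_factorD(4)[OF e1] by simp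
    then obtain X p where p: "is_factor R (?w \<cdot> e) X p" using ex_factor[of R "?w \<cdot> e"] by auto
    note pm = is_factorD(1)[OF p]
    note [simp] = ring_mor_typ[OF pm]
    have pw: "ring_mor K P X (p \<cdot> ?w)" by (rule ring_mor_comp[OF w pm])
    have "(p \<cdot> ?w) \<cdot> e = One X" using is_factorD(3)[OF p] by simp
    from factor_lift[OF e1 pw this] obtain v where v: "ring_mor K A X v" and vp: "v \<cdot> p1 = p \<cdot> ?w" by blast
    note [simp] = ring_mor_typ[OF v]
    have "v \<cdot> Mul A = (v \<cdot> p1) \<cdot> h" by (simp add: m)
    also have "\<dots> = p \<cdot> copair R g1 g2" unfolding vp by simp
    finally have vm: "v \<cdot> Mul A = p \<cdot> copair R g1 g2" .
    have "p \<cdot> g1 = (p \<cdot> copair R g1 g2) \<cdot> inl A A" using copair_in[OF g1 g2] by simp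
    also have "\<dots> = v" unfolding vm[symmetric] by (simp add: Mul_mor)
    finally have 1: "p \<cdot> g1 = v" .
    have "p \<cdot> g2 = (p \<cdot> copair R g1 g2) \<cdot> inr A A" using copair_in[OF g1 g2] by simp
    also have "\<dots> = v" unfolding vm[symmetric] by (simp add: Mul_mor)
    finally have "zero_ring X" using disjointD[OF dj pm] 1 by simp
    then have "?w \<cdot> e = Z (Unity K) (Car R)" using factor_zero_iff[OF p] by simp
    then have "?w \<cdot> compl P e = One R" using c(5)[OF w] compl_props(7)[of R "?w \<cdot> e"] by simp
    from factor_lift[OF e2 w this] obtain u where u: "ring_mor K C R u" and up: "u \<cdot> p2 = ?w" by blast
    note [simp] = ring_mor_typ[OF u]
    have "u \<cdot> q = (u \<cdot> p2) \<cdot> h" by (simp add: q_def)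
    also have "\<dots> = copair R g1 g2" unfolding up by simp
    finally have uq: "u \<cdot> q = copair R g1 g2" .
    have "(u \<cdot> q) \<cdot> inl A A = g1" "(u \<cdot> q) \<cdot> inr A A = g2" unfolding uq using copair_in[OF g1 g2] by auto
    then show "\<exists>u. ring_mor K C R u \<and> u \<cdot> k = g1 \<and> u \<cdot> (q \<cdot> inr A A) = g2"
      using u kq by (intro exI[of _ u]) simp
  next
    fix u u' assume "ring_mor K C R u \<and> u \<cdot> k = g1 \<and> u \<cdot> (q \<cdot> inr A A) = g2"
       "ring_mor K C R u' \<and> u' \<cdot> k = g1 \<and> u' \<cdot> (q \<cdot> inr A A) = g2"
    then have u: "ring_mor K C R u" "u \<cdot> k = g1" "u \<cdot> (q \<cdot> inr A A) = g2" and
      u': "ring_mor K C R u'" "u' \<cdot> k = g1" "u' \<cdot> (q \<cdot> inr A A) = g2" by auto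
    note [simp] = ring_mor_typ[OF u(1)] ring_mor_typ[OF u'(1)]
    have "u \<cdot> q = u' \<cdot> q"
      by (rule copair_unique[OF A A ring_mor_comp[OF qm u(1)] ring_mor_comp[OF qm u'(1)]])
        (use u u' kq in auto)
    then show "u = u'" by (rule epi[rotated -1]) auto
  qed
  then show ?thesis using k2 dis kq by (intro exI[of _ "q \<cdot> inr A A"]) blast
qed

lemma tens_zero [simp]:
  assumes "arr f" "x \<in> Obj K" "y \<in> Obj K"
  shows "f \<boxdot> Z x y = Z (Dom K f \<boxtimes> x) (Cod K f \<boxtimes> y)" "Z x y \<boxdot> f = Z (x \<boxtimes> Dom K f) (y \<boxtimes> Cod K f)"
proof -
  have "Z x y \<boxplus> Z x y = Z x y" using assms by auto
  then have "f \<boxdot> (Z x y \<boxplus> Z x y) = f \<boxdot> Z x y" "(Z x y \<boxplus> Z x y) \<boxdot> f = Z x y \<boxdot> f" by auto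
  then have "(f \<boxdot> Z x y) \<boxplus> (f \<boxdot> Z x y) = f \<boxdot> Z x y" "(Z x y \<boxdot> f) \<boxplus> (Z x y \<boxdot> f) = Z x y \<boxdot> f"
    using assms tens_plus(1)[of "Z x y" "Z x y" f] tens_plus(2)[of f "Z x y" "Z x y"] by simp_all
  then show "f \<boxdot> Z x y = Z (Dom K f \<boxtimes> x) (Cod K f \<boxtimes> y)" "Z x y \<boxdot> f = Z (x \<boxtimes> Dom K f) (y \<boxtimes> Cod K f)"
    using assms plus_idem_zero[of "f \<boxdot> Z x y"] plus_idem_zero[of "Z x y \<boxdot> f"] by auto
qed

section \<open>Tensor products of modules\<close>

abbreviation act where "act X u m \<equiv> app (snd X) (u \<star> m)"

lemma module_typ:
  assumes "is_module K A X"
  shows "fst X \<in> Obj K" "arr (snd X)" "Dom K (snd X) = Car A \<boxtimes> fst X" "Cod K (snd X) = fst X"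
  using assms by (auto simp: is_module_def Let_def in_Hom)

lemma module_app:
  assumes X: "is_module K A X" and A: "is_ring K A"
  shows "\<lbrakk>el u; el v; el m; ob u = Car A; ob v = Car A; ob m = fst X; disj u v; disj u m; disj v m\<rbrakk>
      \<Longrightarrow> act X (rmul A u v) m = act X u (act X v m)"
    "\<lbrakk>el m; ob m = fst X\<rbrakk> \<Longrightarrow> act X (rone A) m = m"
proof -
  note [simp] = module_typ[OF X] A
  { assume *: "el u" "el v" "el m" "ob u = Car A" "ob v = Car A" "ob m = fst X" "disj u v" "disj u m" "disj v m"
    have "app (snd X \<cdot> (Mul A \<boxdot> Ide K (fst X))) ((u \<star> v) \<star> m)
        = app (snd X \<cdot> (Ide K (Car A) \<boxdot> snd X) \<cdot> Assoc K (Car A) (Car A) (fst X)) ((u \<star> v) \<star> m)"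
      using X by (simp only: is_module_def Let_def)
    then show "act X (rmul A u v) m = act X u (act X v m)" using * by simp }
  { assume *: "el m" "ob m = fst X"
    have "app (snd X \<cdot> (One A \<boxdot> Ide K (fst X))) (pt \<star> m) = app (Lunit K (fst X)) (pt \<star> m)"
      using X by (simp only: is_module_def Let_def)
    then show "act X (rone A) m = m" using * by simp }
qed

lemma is_moduleI:
  assumes A: "is_ring K A" and t: "fst X \<in> Obj K" "arr (snd X)" "Dom K (snd X) = Car A \<boxtimes> fst X" "Cod K (snd X) = fst X"
    and g: "gen u" "gen v" "gen m" "ob u = Car A" "ob v = Car A" "ob m = fst X" "disj u v" "disj u m" "disj v m"
    and "act X (rmul A u v) m = act X u (act X v m)" "act X (rone A) m = m"
  shows "is_module K A X"
proof -
  note [simp] = assms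
  have "snd X \<cdot> (Mul A \<boxdot> Ide K (fst X)) = snd X \<cdot> (Ide K (Car A) \<boxdot> snd X) \<cdot> Assoc K (Car A) (Car A) (fst X)"
    by (rule ext[of _ "(u \<star> v) \<star> m"]) auto
  moreover have "snd X \<cdot> (One A \<boxdot> Ide K (fst X)) = Lunit K (fst X)"
    by (rule ext[of _ "pt \<star> m"]) auto
  ultimately show ?thesis by (auto simp: is_module_def Let_def in_Hom)
qed

lemma linear_typ:
  assumes "linear K A X Y f" shows "arr f" "Dom K f = fst X" "Cod K f = fst Y"
  using assms by (auto simp: linear_def in_Hom)

lemma linear_app:
  assumes "linear K A X Y f" "is_module K A X" "is_module K A Y" "is_ring K A"
    "el u" "el m" "ob u = Car A" "ob m = fst X" "disj u m"
  shows "app f (act X u m) = act Y u (app f m)"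
proof -
  note [simp] = linear_typ[OF assms(1)] module_typ[OF assms(2)] module_typ[OF assms(3)] assms(4-)
  have "app (f \<cdot> snd X) (u \<star> m) = app (snd Y \<cdot> (Ide K (Car A) \<boxdot> f)) (u \<star> m)"
    using assms(1) by (simp only: linear_def)
  then show ?thesis by simp
qed

lemma linearI:
  assumes "is_module K A X" "is_module K A Y" and A: "is_ring K A" and t: "arr f" "Dom K f = fst X" "Cod K f = fst Y"
    and g: "gen u" "gen m" "ob u = Car A" "ob m = fst X" "disj u m"
    and e: "app f (act X u m) = act Y u (app f m)"
  shows "linear K A X Y f"
proof -
  note [simp] = A t g module_typ[OF assms(1)] module_typ[OF assms(2)]
  have "f \<cdot> snd X = snd Y \<cdot> (Ide K (Car A) \<boxdot> f)"
    by (rule ext[of _ "u \<star> m"]) (auto simp: e)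
  then show ?thesis by (simp add: linear_def in_Hom)
qed

end

locale sep_ring = idempotent_complete_smc K for K :: "('o, 'm) smc" (structure) +
  fixes A :: "('o, 'm) ring_data"
  assumes sep: "separable_ring K A"
begin

lemma A_ring [simp]: "is_ring K A"
  using sep by (simp add: separable_ring_def)

abbreviation md where "md \<equiv> is_module K A"
abbreviation lin where "lin \<equiv> linear K A"
abbreviation qt where "qt \<equiv> tens_quot K A"
abbreviation mt where "mt \<equiv> mod_tens K A"
abbreviation tn where "tn X Y m n \<equiv> app (qt X Y) (m \<star> n)"

lemmas [simp] = module_typ[of A]

lemma act_simps [simp]:
  "\<lbrakk>md X; el u; el v; el m; ob u = Car A; ob v = Car A; ob m = fst X; disj u v; disj u m; disj v m\<rbrakk>
      \<Longrightarrow> act X (rmul A u v) m = act X u (act X v m)"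
  "\<lbrakk>md X; el m; ob m = fst X\<rbrakk> \<Longrightarrow> act X (rone A) m = m"
  by (rule module_app; simp)+

lemma act_comm:
  assumes "md X" "el u" "el v" "el m" "ob u = Car A" "ob v = Car A" "ob m = fst X" "disj u v" "disj u m" "disj v m"
  shows "act X u (act X v m) = act X v (act X u m)"
proof -
  have "disj v u" using assms by (simp add: disj_sym)
  have "act X (rmul A u v) m = act X (rmul A v u) m" using assms by (subst ring_comm) auto
  then show ?thesis using assms \<open>disj v u\<close> by simp
qed

definition eps where "eps = (SOME \<epsilon>. sep_elem A \<epsilon>)"

lemma eps: "sep_elem A eps"
  unfolding eps_def using separable_sep_elem[OF sep] by (rule_tac someI_ex)

lemma eps_typ [simp]: "arr eps" "Dom K eps = Unity K" "Cod K eps = Car A \<boxtimes> Car A" "app (Mul A) (app eps pt) = rone A"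
proof -
  show *: "arr eps" "Dom K eps = Unity K" "Cod K eps = Car A \<boxtimes> Car A" using eps by (auto simp: sep_elem_def)
  have "Mul A \<cdot> eps = One A" using eps by (simp add: sep_elem_def)
  then show "app (Mul A) (app eps pt) = rone A" using app_comp[of pt eps "Mul A"] * by simp
qed

text \<open>The ring \<open>A \<otimes> A\<close> acts on \<open>X \<otimes> Y\<close>; the separability idempotent projects onto a copy of the
  tensor product over \<open>A\<close>.\<close>

definition act2 where
  "act2 X Y = (snd X \<boxdot> snd Y) \<cdot> mid_swap K (Car A) (Car A) (fst X) (fst Y)"

lemma act2_typ [simp]:
  assumes "md X" "md Y"
  shows "arr (act2 X Y)" "Dom K (act2 X Y) = (Car A \<boxtimes> Car A) \<boxtimes> (fst X \<boxtimes> fst Y)" "Cod K (act2 X Y) = fst X \<boxtimes> fst Y"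
    "\<lbrakk>el u; el v; el m; el n; ob u = Car A; ob v = Car A; ob m = fst X; ob n = fst Y;
      disj u v; disj u m; disj u n; disj v m; disj v n; disj m n\<rbrakk>
     \<Longrightarrow> app (act2 X Y) ((u \<star> v) \<star> (m \<star> n)) = act X u m \<star> act Y v n"
proof -
  assume *: "el u" "el v" "el m" "el n" "ob u = Car A" "ob v = Car A" "ob m = fst X" "ob n = fst Y"
      "disj u v" "disj u m" "disj u n" "disj v m" "disj v n" "disj m n"
  then have "disj m v" by (simp add: disj_sym)
  with * show "app (act2 X Y) ((u \<star> v) \<star> (m \<star> n)) = act X u m \<star> act Y v n"
    using assms by (simp add: act2_def)
qed (use assms in \<open>auto simp: act2_def\<close>)

lemma act2_module:
  assumes [simp]: "md X" "md Y" shows "is_module K (tr A) (fst X \<boxtimes> fst Y, act2 X Y)"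
proof -
  let ?u = "var 0 (Car A) \<star> var 1 (Car A)" and ?v = "var 2 (Car A) \<star> var 3 (Car A)" and ?m = "var 4 (fst X) \<star> var 5 (fst Y)"
  show ?thesis by (rule is_moduleI[where u = ?u and v = ?v and m = ?m]) auto
qed

lemma act2_app:
  assumes X: "md X" and Y: "md Y"
    and "el s" "el t" "el z" "ob s = Car A \<boxtimes> Car A" "ob t = Car A \<boxtimes> Car A" "ob z = fst X \<boxtimes> fst Y" "disj s t" "disj s z" "disj t z"
  shows "app (act2 X Y) (s \<star> app (act2 X Y) (t \<star> z)) = app (act2 X Y) (rmul (tr A) s t \<star> z)"
  using module_app(1)[OF act2_module[OF X Y], of s t z] assms by (simp del: tens_ring_sel(2))

definition bal where
  "bal X Y = act2 X Y \<cdot> (eps \<boxdot> Ide K (fst X \<boxtimes> fst Y)) \<cdot> inv_arr K (Lunit K (fst X \<boxtimes> fst Y))"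

lemma bal_typ [simp]:
  assumes "md X" "md Y"
  shows "arr (bal X Y)" "Dom K (bal X Y) = fst X \<boxtimes> fst Y" "Cod K (bal X Y) = fst X \<boxtimes> fst Y"
    "\<lbrakk>el z; ob z = fst X \<boxtimes> fst Y\<rbrakk> \<Longrightarrow> app (bal X Y) z = app (act2 X Y) (app eps pt \<star> z)"
  using assms by (auto simp: bal_def)

text \<open>Moving the scalar across the tensor sign replaces u \<otimes> 1 by 1 \<otimes> u, which
  multiplication by \<epsilon> does not distinguish.\<close>

lemma bal_balanced:
  assumes [simp]: "md X" "md Y" and e: "el u" "el m" "el n" "ob u = Car A" "ob m = fst X" "ob n = fst Y" "disj u m" "disj u n" "disj m n"
  shows "app (bal X Y) (act X u m \<star> n) = app (bal X Y) (m \<star> act Y u n)"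
proof -
  note [simp] = e
  have 1: "act X u m \<star> n = app (act2 X Y) (app (inl A A) u \<star> (m \<star> n))" by simp
  have 2: "m \<star> act Y u n = app (act2 X Y) (app (inr A A) u \<star> (m \<star> n))" using disj_sym[of u m] by simp
  have "app (bal X Y) (act X u m \<star> n) = app (act2 X Y) (app eps pt \<star> (app (act2 X Y) (app (inl A A) u \<star> (m \<star> n))))"
    unfolding 1 by (simp del: act2_typ(4) inl_typ(4))
  also have "\<dots> = app (act2 X Y) (app eps pt \<star> (app (act2 X Y) (app (inr A A) u \<star> (m \<star> n))))"
    using sep_elem_app[OF A_ring eps, of u]
    by (simp add: act2_app del: act2_typ(4) inl_typ(4) inr_typ(4) tens_ring_sel(2))
  also have "\<dots> = app (bal X Y) (m \<star> act Y u n)"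
    unfolding 2 by (simp del: act2_typ(4) inr_typ(4))
  finally show ?thesis .
qed

lemma bal_idem:
  assumes [simp]: "md X" "md Y" shows "bal X Y \<cdot> bal X Y = bal X Y"
proof (rule ext[of _ "var 0 (fst X) \<star> var 1 (fst Y)"])
  let ?z = "var 0 (fst X) \<star> var 1 (fst Y)"
  have "app (gmul (tr A) eps eps) pt = app eps pt"
    using sep_elem_idem[OF A_ring eps] by simp
  then have "rmul (tr A) (app eps pt) (app eps pt) = app eps pt" by (simp del: tens_ring_sel(2))
  then show "app (bal X Y \<cdot> bal X Y) ?z = app (bal X Y) ?z"
    by (simp add: act2_app del: tens_ring_sel(2))
qed auto

text \<open>For a balanced arrow the action of u \<otimes> v on m \<otimes> n may be replaced by the
  action of uv on n alone, and \<epsilon> multiplies out to 1. The passive factor \<open>w\<close>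
  is there for the associator, which descends through one quotient while a third module stands
  by.\<close>

lemma balanced_bal_tens:
  assumes [simp]: "md X" "md Y" and k: "arr k" "Dom K k = (fst X \<boxtimes> fst Y) \<boxtimes> w" "w \<in> Obj K"
    and e: "gen u" "gen m" "gen n" "gen p" "ob u = Car A" "ob m = fst X" "ob n = fst Y" "ob p = w"
      "disj u m" "disj u n" "disj m n" "disj u p" "disj m p" "disj n p"
    and b: "app k ((act X u m \<star> n) \<star> p) = app k ((m \<star> act Y u n) \<star> p)"
  shows "k \<cdot> (bal X Y \<boxdot> Ide K w) = k"
proof -
  note [simp] = k e
  have [simp]: "disj m u" "disj n u" "disj n m" using e by (simp_all add: disj_sym)
  let ?s = "(Ide K (fst X) \<boxdot> snd Y) \<cdot> Assoc K (fst X) (Car A) (fst Y) \<cdot> (Swap K (Car A) (fst X) \<boxdot> Ide K (fst Y))"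
  \<comment> \<open>The hypothesis speaks of one generic choice. As an equation of arrows it holds
    for all elements, in particular for those already multiplied by another scalar.\<close>
  have kb: "k \<cdot> ((snd X \<boxdot> Ide K (fst Y)) \<boxdot> Ide K w) = k \<cdot> (?s \<boxdot> Ide K w)"
    by (rule ext[of _ "((u \<star> m) \<star> n) \<star> p"]) (auto simp: b)
  have b': "app k ((act X u m \<star> n) \<star> p) = app k ((m \<star> act Y u n) \<star> p)"
    if [simp]: "el u" "el m" "el n" "el p" "ob u = Car A" "ob m = fst X" "ob n = fst Y" "ob p = w" "disj u m" "disj u n" "disj m n"
       "disj u p" "disj m p" "disj n p" for u m n p
  proof -
    have "app (k \<cdot> ((snd X \<boxdot> Ide K (fst Y)) \<boxdot> Ide K w)) (((u \<star> m) \<star> n) \<star> p) = app (k \<cdot> (?s \<boxdot> Ide K w)) (((u \<star> m) \<star> n) \<star> p)"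
      by (simp only: kb)
    moreover have "disj m u" "disj n u" "disj n m" using that by (simp_all add: disj_sym)
    ultimately show ?thesis by simp
  qed
  let ?m = "var 0 (fst X)" and ?n = "var 1 (fst Y)" and ?u = "var 2 (Car A)" and ?v = "var 3 (Car A)" and ?p = "var 4 w"
  let ?l = "k \<cdot> (act2 X Y \<boxdot> Ide K w)"
  let ?r = "k \<cdot> (((Ide K (fst X) \<boxdot> (snd Y \<cdot> (Mul A \<boxdot> Ide K (fst Y)))) \<cdot> Assoc K (fst X) (Car A \<boxtimes> Car A) (fst Y) \<cdot> (Swap K (Car A \<boxtimes> Car A) (fst X) \<boxdot> Ide K (fst Y)) \<cdot> inv_arr K (Assoc K (Car A \<boxtimes> Car A) (fst X) (fst Y))) \<boxdot> Ide K w)"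
  have "?l = ?r"
    by (rule ext[of _ "((?u \<star> ?v) \<star> (?m \<star> ?n)) \<star> ?p"]) (auto simp: b')
  then have "app ?l ((app eps pt \<star> (?m \<star> ?n)) \<star> ?p) = app ?r ((app eps pt \<star> (?m \<star> ?n)) \<star> ?p)" by simp
  then show ?thesis by (intro ext[of _ "(?m \<star> ?n) \<star> ?p"]) auto
qed

lemma balanced_bal:
  assumes [simp]: "md X" "md Y" and k: "arr k" "Dom K k = fst X \<boxtimes> fst Y"
    and e: "gen u" "gen m" "gen n" "ob u = Car A" "ob m = fst X" "ob n = fst Y" "disj u m" "disj u n" "disj m n"
    and b: "app k (act X u m \<star> n) = app k (m \<star> act Y u n)"
  shows "k \<cdot> bal X Y = k"
proof -
  note [simp] = k e
  have [simp]: "disj m u" "disj n u" "disj n m" using e by (simp_all add: disj_sym)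
  let ?r = "Runit K (fst X \<boxtimes> fst Y)"
  have "(k \<cdot> ?r) \<cdot> (bal X Y \<boxdot> Ide K (Unity K)) = k \<cdot> ?r"
    by (rule balanced_bal_tens[where u = u and m = m and n = n and p = pt]) (use b in auto)
  then have "(k \<cdot> bal X Y) \<cdot> ?r = k \<cdot> ?r" using runit_nat[of "bal X Y"] by simp
  then show ?thesis by (rule iso_epi[rotated -1]) auto
qed

lemma act_lr_typ [simp]:
  assumes "md X" "md Y"
  shows "arr (act_left K A X Y)" "Dom K (act_left K A X Y) = (fst X \<boxtimes> Car A) \<boxtimes> fst Y" "Cod K (act_left K A X Y) = fst X \<boxtimes> fst Y"
    "arr (act_right K A X Y)" "Dom K (act_right K A X Y) = (fst X \<boxtimes> Car A) \<boxtimes> fst Y" "Cod K (act_right K A X Y) = fst X \<boxtimes> fst Y"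
  using assms by (simp_all add: act_left_def act_right_def)

lemma act_left_right:
  assumes [simp]: "md X" "md Y" and k: "arr k" "Dom K k = fst X \<boxtimes> fst Y"
    and e: "gen u" "gen m" "gen n" "ob u = Car A" "ob m = fst X" "ob n = fst Y" "disj u m" "disj u n" "disj m n"
  shows "k \<cdot> act_left K A X Y = k \<cdot> act_right K A X Y \<longleftrightarrow> app k (act X u m \<star> n) = app k (m \<star> act Y u n)"
proof -
  note [simp] = k e
  have [simp]: "disj m u" using e by (simp add: disj_sym)
  have "app (k \<cdot> act_left K A X Y) ((m \<star> u) \<star> n) = app k (act X u m \<star> n)"
    "app (k \<cdot> act_right K A X Y) ((m \<star> u) \<star> n) = app k (m \<star> act Y u n)"
    by (simp_all add: act_left_def act_right_def)
  moreover have "k \<cdot> act_left K A X Y = k \<cdot> act_right K A X Y \<longleftrightarrow>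
     app (k \<cdot> act_left K A X Y) ((m \<star> u) \<star> n) = app (k \<cdot> act_right K A X Y) ((m \<star> u) \<star> n)"
  proof
    assume "app (k \<cdot> act_left K A X Y) ((m \<star> u) \<star> n) = app (k \<cdot> act_right K A X Y) ((m \<star> u) \<star> n)"
    then show "k \<cdot> act_left K A X Y = k \<cdot> act_right K A X Y"
      by (rule ext) auto
  qed simp
  ultimately show ?thesis by (simp only:)
qed

text \<open>The splitting of the idempotent \<open>bal X Y\<close> is the coequaliser: its
  projection is balanced, and any balanced arrow is fixed by \<open>bal X Y\<close>, hence factors
  through the image.\<close>

lemma ex_coequalizer:
  assumes X [simp]: "md X" and Y [simp]: "md Y"
  shows "\<exists>t q. coequalizer K (act_left K A X Y) (act_right K A X Y) t q"
proof -
  let ?u = "var 0 (Car A)" and ?m = "var 1 (fst X)" and ?n = "var 2 (fst Y)"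
  have "bal X Y \<in> Hom K (fst X \<boxtimes> fst Y) (fst X \<boxtimes> fst Y)" by (simp add: in_Hom)
  from idempotent_split[OF this bal_idem[OF X Y]]
  obtain x1 x2 i i2 p p2 where b: "biproduct K x1 x2 (fst X \<boxtimes> fst Y) i i2 p p2" and ip: "bal X Y = i \<cdot> p" by blast
  from b have [simp]: "x1 \<in> Obj K" "arr i" "Dom K i = x1" "Cod K i = fst X \<boxtimes> fst Y" "arr p" "Dom K p = fst X \<boxtimes> fst Y" "Cod K p = x1"
    and pi [simp]: "p \<cdot> i = Ide K x1" by (auto simp: biproduct_def in_Hom)
  have pb: "p \<cdot> bal X Y = p" by (simp add: ip comp_eq[OF pi])
  have "app p (act X ?u ?m \<star> ?n) = app (p \<cdot> bal X Y) (act X ?u ?m \<star> ?n)" by (simp only: pb)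
  also have "\<dots> = app p (app (bal X Y) (?m \<star> act Y ?u ?n))" by (simp add: bal_balanced del: bal_typ(4))
  also have "\<dots> = app (p \<cdot> bal X Y) (?m \<star> act Y ?u ?n)" by (simp del: bal_typ(4))
  also have "\<dots> = app p (?m \<star> act Y ?u ?n)" by (simp only: pb)
  finally have 1: "p \<cdot> act_left K A X Y = p \<cdot> act_right K A X Y"
    by (subst act_left_right[of X Y p ?u ?m ?n]) auto
  have "\<exists>!u. u \<in> Hom K x1 z \<and> u \<cdot> p = k" if k: "k \<in> Hom K (fst X \<boxtimes> fst Y) z" "k \<cdot> act_left K A X Y = k \<cdot> act_right K A X Y" for k z
  proof
    have [simp]: "arr k" "Dom K k = fst X \<boxtimes> fst Y" "Cod K k = z" using k by (auto simp: in_Hom)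
    have "app k (act X ?u ?m \<star> ?n) = app k (?m \<star> act Y ?u ?n)"
      using k(2) by (subst (asm) act_left_right[of X Y k ?u ?m ?n]) auto
    then have "k \<cdot> bal X Y = k" by (intro balanced_bal[of X Y k ?u ?m ?n]) auto
    then show "k \<cdot> i \<in> Hom K x1 z \<and> (k \<cdot> i) \<cdot> p = k" by (simp add: in_Hom ip)
    fix u assume u: "u \<in> Hom K x1 z \<and> u \<cdot> p = k"
    then have [simp]: "arr u" "Dom K u = x1" by (auto simp: in_Hom)
    have "k \<cdot> i = (u \<cdot> p) \<cdot> i" using u by simp
    then show "u = k \<cdot> i" by simp
  qed
  then have "coequalizer K (act_left K A X Y) (act_right K A X Y) x1 p"
    unfolding coequalizer_def using 1 by (intro conjI ballI impI) (simp_all add: in_Hom)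
  then show ?thesis by blast
qed

lemma tens_coeq:
  assumes X: "md X" and Y: "md Y"
  shows "coequalizer K (act_left K A X Y) (act_right K A X Y) (fst (mt X Y)) (qt X Y)"
proof -
  have "\<exists>tq. coequalizer K (act_left K A X Y) (act_right K A X Y) (fst tq) (snd tq)"
    using ex_coequalizer[OF X Y] by auto
  from someI_ex[OF this] show ?thesis by (simp add: tens_quot_def mod_tens_def tens_coeq_def Let_def)
qed

lemma qt_typ [simp]:
  assumes "md X" "md Y"
  shows "arr (qt X Y)" "Dom K (qt X Y) = fst X \<boxtimes> fst Y" "Cod K (qt X Y) = fst (mt X Y)" "fst (mt X Y) \<in> Obj K"
  using tens_coeq[OF assms] assms by (auto simp: coequalizer_def in_Hom)

lemma tn_balanced:
  assumes [simp]: "md X" "md Y" and e: "el u" "el m" "el n" "ob u = Car A" "ob m = fst X" "ob n = fst Y" "disj u m" "disj u n" "disj m n"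
  shows "tn X Y (act X u m) n = tn X Y m (act Y u n)"
proof -
  note [simp] = e
  have "qt X Y \<cdot> act_left K A X Y = qt X Y \<cdot> act_right K A X Y"
    using tens_coeq[of X Y] by (auto simp: coequalizer_def)
  then have "app (qt X Y \<cdot> act_left K A X Y) ((m \<star> u) \<star> n) = app (qt X Y \<cdot> act_right K A X Y) ((m \<star> u) \<star> n)" by simp
  moreover have "disj m u" using e by (simp add: disj_sym)
  ultimately show ?thesis by (simp add: act_left_def act_right_def)
qed

lemma qt_bal:
  assumes [simp]: "md X" "md Y" shows "qt X Y \<cdot> bal X Y = qt X Y"
proof (rule balanced_bal[of _ _ _ "var 0 (Car A)" "var 1 (fst X)" "var 2 (fst Y)"])
qed (auto simp: tn_balanced)

text \<open>The chosen coequaliser also splits \<open>bal X Y\<close>. Its quotient map is thus a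
  split epimorphism and carries generic elements to generic ones, which opens the element calculus
  to tensor products over \<open>A\<close>.\<close>

lemma ex_section:
  assumes [simp]: "md X" "md Y"
  shows "\<exists>s. arr s \<and> Dom K s = fst (mt X Y) \<and> Cod K s = fst X \<boxtimes> fst Y \<and> s \<cdot> qt X Y = bal X Y \<and> qt X Y \<cdot> s = Ide K (fst (mt X Y))"
proof -
  note c = tens_coeq[OF assms]
  have "bal X Y \<cdot> act_left K A X Y = bal X Y \<cdot> act_right K A X Y"
    by (subst act_left_right[of X Y _ "var 0 (Car A)" "var 1 (fst X)" "var 2 (fst Y)"]) (auto simp: bal_balanced simp del: bal_typ(4))
  moreover have "bal X Y \<in> Hom K (Cod K (act_left K A X Y)) (fst X \<boxtimes> fst Y)" by (simp add: in_Hom)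
  ultimately obtain s where s: "s \<in> Hom K (fst (mt X Y)) (fst X \<boxtimes> fst Y)" "s \<cdot> qt X Y = bal X Y"
    using c unfolding coequalizer_def by (metis assms module_typ(1) tens_obj')
  then have [simp]: "arr s" "Dom K s = fst (mt X Y)" "Cod K s = fst X \<boxtimes> fst Y" by (auto simp: in_Hom)
  have "\<exists>!u. u \<in> Hom K (fst (mt X Y)) (fst (mt X Y)) \<and> u \<cdot> qt X Y = qt X Y"
    using c unfolding coequalizer_def by blast
  moreover have "qt X Y \<cdot> s \<in> Hom K (fst (mt X Y)) (fst (mt X Y)) \<and> (qt X Y \<cdot> s) \<cdot> qt X Y = qt X Y"
    by (simp add: in_Hom s qt_bal)
  moreover have "Ide K (fst (mt X Y)) \<in> Hom K (fst (mt X Y)) (fst (mt X Y)) \<and> Ide K (fst (mt X Y)) \<cdot> qt X Y = qt X Y"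
    by (simp add: in_Hom)
  ultimately have "qt X Y \<cdot> s = Ide K (fst (mt X Y))" by blast
  then show ?thesis using s by (intro exI[of _ s]) simp
qed

lemma gen_tn [simp]:
  assumes "md X" "md Y" "gen m" "gen n" "ob m = fst X" "ob n = fst Y" "disj m n"
  shows "gen (tn X Y m n)"
proof -
  obtain s where "arr s" "Dom K s = fst (mt X Y)" "Cod K s = fst X \<boxtimes> fst Y" "qt X Y \<cdot> s = Ide K (fst (mt X Y))"
    using ex_section assms by blast
  then show ?thesis using assms by (intro gen_app[where s = s]) auto
qed

text \<open>The hypothesis on \<open>f\<close> copies the definite descriptions in the structure of
  \<open>Mod\<close>. Each structure arrow is thereby characterised by its values on m \<otimes> n,
  at the price of one check that the upstairs arrow is balanced.\<close>

lemma descends: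
  assumes X [simp]: "md X" and Y [simp]: "md Y" and k: "arr k" "Dom K k = fst X \<boxtimes> fst Y"
    and e: "gen u" "gen m" "gen n" "ob u = Car A" "ob m = fst X" "ob n = fst Y" "disj u m" "disj u n" "disj m n"
    and b: "app k (act X u m \<star> n) = app k (m \<star> act Y u n)"
    and f: "f = (THE f. f \<in> Hom K (fst (mt X Y)) (Cod K k) \<and> f \<cdot> qt X Y = k)"
  shows "arr f" "Dom K f = fst (mt X Y)" "Cod K f = Cod K k" "f \<cdot> qt X Y = k"
    "\<lbrakk>el m'; el n'; ob m' = fst X; ob n' = fst Y; disj m' n'\<rbrakk> \<Longrightarrow> app f (tn X Y m' n') = app k (m' \<star> n')"
proof -
  have kb: "k \<cdot> bal X Y = k" by (rule balanced_bal[OF X Y k e b])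
  obtain s where s [simp]: "arr s" "Dom K s = fst (mt X Y)" "Cod K s = fst X \<boxtimes> fst Y" "s \<cdot> qt X Y = bal X Y" "qt X Y \<cdot> s = Ide K (fst (mt X Y))"
    using ex_section[OF X Y] by blast
  note [simp] = k
  have 1: "k \<cdot> s \<in> Hom K (fst (mt X Y)) (Cod K k) \<and> (k \<cdot> s) \<cdot> qt X Y = k" by (simp add: in_Hom kb)
  have 2: "u = k \<cdot> s" if "u \<in> Hom K (fst (mt X Y)) (Cod K k) \<and> u \<cdot> qt X Y = k" for u
  proof -
    have [simp]: "arr u" "Dom K u = fst (mt X Y)" using that by (auto simp: in_Hom)
    have "k \<cdot> s = (u \<cdot> qt X Y) \<cdot> s" using that by simp
    then show ?thesis by simp
  qed
  have "f = k \<cdot> s" unfolding f by (rule the_equality) (use 1 2 in auto)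
  then show *: "arr f" "Dom K f = fst (mt X Y)" "Cod K f = Cod K k" "f \<cdot> qt X Y = k" using 1 by (auto simp: in_Hom)
  assume "el m'" "el n'" "ob m' = fst X" "ob n' = fst Y" "disj m' n'"
  then show "app f (tn X Y m' n') = app k (m' \<star> n')"
    using app_comp[of "m' \<star> n'" "qt X Y" f] * by simp
qed

lemma mt_action:
  assumes X [simp]: "md X" and Y [simp]: "md Y"
  shows "arr (snd (mt X Y))" "Dom K (snd (mt X Y)) = Car A \<boxtimes> fst (mt X Y)" "Cod K (snd (mt X Y)) = fst (mt X Y)"
    "\<lbrakk>el u; el m; el n; ob u = Car A; ob m = fst X; ob n = fst Y; disj u m; disj u n; disj m n\<rbrakk> \<Longrightarrow>
      act (mt X Y) u (tn X Y m n) = tn X Y (act X u m) n"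
proof -
  let ?a = "Car A" and ?t = "fst (mt X Y)"
  let ?k = "qt X Y \<cdot> (snd X \<boxdot> Ide K (fst Y)) \<cdot> inv_arr K (Assoc K ?a (fst X) (fst Y))"
  have r: "snd (mt X Y) = (THE r. r \<in> Hom K (?a \<boxtimes> ?t) ?t \<and> r \<cdot> (Ide K ?a \<boxdot> qt X Y) = ?k)"
    by (simp add: mod_tens_def Let_def)
  obtain s where s [simp]: "arr s" "Dom K s = ?t" "Cod K s = fst X \<boxtimes> fst Y" "s \<cdot> qt X Y = bal X Y" "qt X Y \<cdot> s = Ide K ?t"
    using ex_section[OF X Y] by blast
  \<comment> \<open>The actions of u \<otimes> 1 and of \<epsilon> commute because A \<otimes> A is
    commutative; this is why the action of \<open>A\<close> passes to the quotient.\<close>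
  have "?k \<cdot> (Ide K ?a \<boxdot> bal X Y) = ?k"
  proof (rule ext[of _ "var 0 ?a \<star> (var 1 (fst X) \<star> var 2 (fst Y))"])
    let ?u = "var 0 ?a" and ?z = "var 1 (fst X) \<star> var 2 (fst Y)"
    have k: "?k = qt X Y \<cdot> act2 X Y \<cdot> (inl A A \<boxdot> Ide K (fst X \<boxtimes> fst Y))"
      by (rule ext[of _ "?u \<star> ?z"]) auto
    have "app ?k (?u \<star> app (bal X Y) ?z) = app (qt X Y) (app (act2 X Y) (app (inl A A) ?u \<star> app (act2 X Y) (app eps pt \<star> ?z)))"
      unfolding k by (simp del: inl_typ(4))
    also have "\<dots> = app (qt X Y) (app (act2 X Y) (app eps pt \<star> app (act2 X Y) (app (inl A A) ?u \<star> ?z)))"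
      by (simp add: act2_app ring_comm[of "tr A" "app (inl A A) ?u"] del: inl_typ(4) tens_ring_sel(2) act2_typ(4))
    also have "\<dots> = app (qt X Y \<cdot> bal X Y) (app (act2 X Y) (app (inl A A) ?u \<star> ?z))"
      by (simp del: inl_typ(4) act2_typ(4))
    also have "\<dots> = app ?k (?u \<star> ?z)" unfolding qt_bal[OF X Y] by simp
    finally show "app (?k \<cdot> (Ide K ?a \<boxdot> bal X Y)) (?u \<star> ?z) = app ?k (?u \<star> ?z)"
      by (simp del: bal_typ(4))
  qed auto
  then have 1: "?k \<cdot> (Ide K ?a \<boxdot> s) \<in> Hom K (?a \<boxtimes> ?t) ?t \<and> (?k \<cdot> (Ide K ?a \<boxdot> s)) \<cdot> (Ide K ?a \<boxdot> qt X Y) = ?k"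
    by (simp add: in_Hom)
  have 2: "u = ?k \<cdot> (Ide K ?a \<boxdot> s)" if "u \<in> Hom K (?a \<boxtimes> ?t) ?t \<and> u \<cdot> (Ide K ?a \<boxdot> qt X Y) = ?k" for u
  proof -
    have [simp]: "arr u" "Dom K u = ?a \<boxtimes> ?t" using that by (auto simp: in_Hom)
    have "?k \<cdot> (Ide K ?a \<boxdot> s) = (u \<cdot> (Ide K ?a \<boxdot> qt X Y)) \<cdot> (Ide K ?a \<boxdot> s)" using that by simp
    then show ?thesis by simp
  qed
  have "snd (mt X Y) = ?k \<cdot> (Ide K ?a \<boxdot> s)" unfolding r by (rule the_equality) (use 1 2 in auto)
  then have *: "snd (mt X Y) \<in> Hom K (?a \<boxtimes> ?t) ?t" "snd (mt X Y) \<cdot> (Ide K ?a \<boxdot> qt X Y) = ?k" using 1 by auto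
  then show [simp]: "arr (snd (mt X Y))" "Dom K (snd (mt X Y)) = Car A \<boxtimes> fst (mt X Y)" "Cod K (snd (mt X Y)) = fst (mt X Y)"
    by (auto simp: in_Hom)
  assume "el u" "el m" "el n" "ob u = Car A" "ob m = fst X" "ob n = fst Y" "disj u m" "disj u n" "disj m n"
  then show "act (mt X Y) u (tn X Y m n) = tn X Y (act X u m) n"
    using arg_cong[OF *(2), of "\<lambda>f. app f (u \<star> (m \<star> n))"] by simp
qed

lemma md_mt [simp]:
  assumes [simp]: "md X" "md Y" shows "md (mt X Y)"
  by (rule is_moduleI[where u = "var 0 (Car A)" and v = "var 1 (Car A)" and m = "tn X Y (var 2 (fst X)) (var 3 (fst Y))"])
    (auto simp: mt_action)

lemma act_tn [simp]:
  "\<lbrakk>md X; md Y; el u; el m; el n; ob u = Car A; ob m = fst X; ob n = fst Y; disj u m; disj u n; disj m n\<rbrakk> \<Longrightarrow>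
      act (mt X Y) u (tn X Y m n) = tn X Y (act X u m) n"
  by (rule mt_action) auto

section \<open>The category of modules\<close>

abbreviation M where "M \<equiv> Mod K A"
abbreviation U where "U \<equiv> (Car A, Mul A)"

lemma md_typ [simp]:
  assumes "md X"
  shows "fst X \<in> Obj K" "arr (snd X)" "Dom K (snd X) = Car A \<boxtimes> fst X" "Cod K (snd X) = fst X"
  using module_typ[OF assms] by auto

lemma md_U [simp]: "md U"
  by (rule is_moduleI[where u = "var 0 (Car A)" and v = "var 1 (Car A)" and m = "var 2 (Car A)"])
    (auto simp: ring_assoc)

lemma lin_app:
  "\<lbrakk>lin X Y f; md X; md Y; el u; el m; ob u = Car A; ob m = fst X; disj u m\<rbrakk> \<Longrightarrow> app f (act X u m) = act Y u (app f m)"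
  by (rule linear_app) auto

lemma lin_comp:
  assumes "lin X Y f" "lin Y V g" "md X" "md Y" "md V" shows "lin X V (g \<cdot> f)"
proof -
  note [simp] = assms(3-5) linear_typ[OF assms(1)] linear_typ[OF assms(2)] lin_app[OF assms(1)] lin_app[OF assms(2)]
  show ?thesis by (rule linearI[where u = "var 0 (Car A)" and m = "var 1 (fst X)"]) auto
qed

lemma lin_ide [simp]: "md X \<Longrightarrow> lin X X (Ide K (fst X))"
  by (rule linearI[where u = "var 0 (Car A)" and m = "var 1 (fst X)"]) auto

lemma lin_zero [simp]:
  assumes [simp]: "md X" "md Y" shows "lin X Y (Zero K (fst X) (fst Y))"
  by (simp add: linear_def in_Hom)

lemma lin_plus:
  assumes "lin X Y f" "lin X Y g" "md X" "md Y" shows "lin X Y (f \<boxplus> g)"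
proof -
  note [simp] = assms(3,4) linear_typ[OF assms(1)] linear_typ[OF assms(2)]
  show ?thesis using assms(1,2) by (simp add: linear_def in_Hom)
qed

lemma lin_inv:
  assumes "lin X Y f" "md X" "md Y" "iso f" shows "lin Y X (inv_arr K f)"
proof -
  note [simp] = assms(2,3,4) linear_typ[OF assms(1)] lin_app[OF assms(1)]
  have g: "gen (app f (var 2 (fst X)))" by (rule gen_app[where s = "inv_arr K f"]) auto
  have "app (inv_arr K f) (app f (act X (var 0 (Car A)) (var 2 (fst X)))) = act X (var 0 (Car A)) (var 2 (fst X))"
    by (rule app_inv) auto
  then show ?thesis
    by (intro linearI[where u = "var 0 (Car A)" and m = "app f (var 2 (fst X))"]) (auto simp: g)
qed

definition tmap where
  "tmap X X' Y Y' f g = (THE u. u \<in> Hom K (fst (mt X Y)) (fst (mt X' Y')) \<and> u \<cdot> qt X Y = qt X' Y' \<cdot> (f \<boxdot> g))"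

lemma tmap:
  assumes f: "lin X X' f" and g: "lin Y Y' g" and [simp]: "md X" "md Y" "md X'" "md Y'"
  shows "arr (tmap X X' Y Y' f g)" "Dom K (tmap X X' Y Y' f g) = fst (mt X Y)" "Cod K (tmap X X' Y Y' f g) = fst (mt X' Y')"
    "\<lbrakk>el m; el n; ob m = fst X; ob n = fst Y; disj m n\<rbrakk> \<Longrightarrow> app (tmap X X' Y Y' f g) (tn X Y m n) = tn X' Y' (app f m) (app g n)"
    "lin (mt X Y) (mt X' Y') (tmap X X' Y Y' f g)"
proof -
  note [simp] = linear_typ[OF f] linear_typ[OF g] lin_app[OF f] lin_app[OF g]
  let ?k = "qt X' Y' \<cdot> (f \<boxdot> g)"
  have b: "app ?k (act X (var 0 (Car A)) (var 1 (fst X)) \<star> (var 2 (fst Y))) = app ?k (var 1 (fst X) \<star> act Y (var 0 (Car A)) (var 2 (fst Y)))"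
    by (simp add: tn_balanced)
  have e: "tmap X X' Y Y' f g = (THE u. u \<in> Hom K (fst (mt X Y)) (Cod K ?k) \<and> u \<cdot> qt X Y = ?k)"
    by (simp add: tmap_def)
  note d = descends[OF _ _ _ _ _ _ _ _ _ _ _ _ _ b e, simplified]
  from d show *: "arr (tmap X X' Y Y' f g)" "Dom K (tmap X X' Y Y' f g) = fst (mt X Y)" "Cod K (tmap X X' Y Y' f g) = fst (mt X' Y')"
    by auto
  show **: "\<lbrakk>el m; el n; ob m = fst X; ob n = fst Y; disj m n\<rbrakk> \<Longrightarrow> app (tmap X X' Y Y' f g) (tn X Y m n) = tn X' Y' (app f m) (app g n)" for m n
    using d(5)[of m n] by simp
  show "lin (mt X Y) (mt X' Y') (tmap X X' Y Y' f g)"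
    by (rule linearI[where u = "var 0 (Car A)" and m = "tn X Y (var 1 (fst X)) (var 2 (fst Y))"]) (auto simp: * **)
qed

definition lmap where
  "lmap X = (THE u. u \<in> Hom K (fst (mt U X)) (fst X) \<and> u \<cdot> qt U X = snd X)"

lemma lmap:
  assumes [simp]: "md X"
  shows "arr (lmap X)" "Dom K (lmap X) = fst (mt U X)" "Cod K (lmap X) = fst X"
    "\<lbrakk>el u; el m; ob u = Car A; ob m = fst X; disj u m\<rbrakk> \<Longrightarrow> app (lmap X) (tn U X u m) = act X u m"
    "lin (mt U X) X (lmap X)" "iso (lmap X)"
proof -
  let ?u = "var 0 (Car A)" and ?v = "var 1 (Car A)" and ?m = "var 2 (fst X)"
  have b: "app (snd X) (act U ?u ?v \<star> ?m) = app (snd X) (?v \<star> act X ?u ?m)"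
    by (simp add: act_comm)
  have e: "lmap X = (THE u. u \<in> Hom K (fst (mt U X)) (Cod K (snd X)) \<and> u \<cdot> qt U X = snd X)"
    by (simp add: lmap_def)
  note d = descends[OF _ _ _ _ _ _ _ _ _ _ _ _ _ b e, simplified]
  from d show [simp]: "arr (lmap X)" "Dom K (lmap X) = fst (mt U X)" "Cod K (lmap X) = fst X"
    by auto
  show **: "\<lbrakk>el u; el m; ob u = Car A; ob m = fst X; disj u m\<rbrakk> \<Longrightarrow> app (lmap X) (tn U X u m) = act X u m" for u m
    using d(5)[of u m] by simp
  show "lin (mt U X) X (lmap X)"
    by (rule linearI[where u = ?u and m = "tn U X ?v ?m"]) (auto simp: **)
  show "iso (lmap X)"
  proof (rule isoI[where g = "qt U X \<cdot> (One A \<boxdot> Ide K (fst X)) \<cdot> inv_arr K (Lunit K (fst X))"])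
    show "lmap X \<cdot> (qt U X \<cdot> (One A \<boxdot> Ide K (fst X)) \<cdot> inv_arr K (Lunit K (fst X))) = Ide K (Cod K (lmap X))"
      by (rule ext[of _ ?m]) (auto simp: **)
    have "tn U X (rone A) (act X ?u ?m) = tn U X ?u ?m"
      using tn_balanced[of U X ?u "rone A" ?m] by simp
    then show "(qt U X \<cdot> (One A \<boxdot> Ide K (fst X)) \<cdot> inv_arr K (Lunit K (fst X))) \<cdot> lmap X = Ide K (Dom K (lmap X))"
      by (intro ext[of _ "tn U X ?u ?m"]) (auto simp: **)
  qed auto
qed

definition smap where
  "smap X Y = (THE u. u \<in> Hom K (fst (mt X Y)) (fst (mt Y X)) \<and> u \<cdot> qt X Y = qt Y X \<cdot> Swap K (fst X) (fst Y))"

lemma smap: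
  assumes [simp]: "md X" "md Y"
  shows "arr (smap X Y)" "Dom K (smap X Y) = fst (mt X Y)" "Cod K (smap X Y) = fst (mt Y X)"
    "\<lbrakk>el m; el n; ob m = fst X; ob n = fst Y; disj m n\<rbrakk> \<Longrightarrow> app (smap X Y) (tn X Y m n) = tn Y X n m"
    "lin (mt X Y) (mt Y X) (smap X Y)"
proof -
  let ?k = "qt Y X \<cdot> Swap K (fst X) (fst Y)"
  let ?u = "var 0 (Car A)" and ?m = "var 1 (fst X)" and ?n = "var 2 (fst Y)"
  have b: "app ?k (act X ?u ?m \<star> ?n) = app ?k (?m \<star> act Y ?u ?n)"
    by (simp add: tn_balanced)
  have e: "smap X Y = (THE u. u \<in> Hom K (fst (mt X Y)) (Cod K ?k) \<and> u \<cdot> qt X Y = ?k)"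
    by (simp add: smap_def)
  note d = descends[OF _ _ _ _ _ _ _ _ _ _ _ _ _ b e, simplified]
  from d show [simp]: "arr (smap X Y)" "Dom K (smap X Y) = fst (mt X Y)" "Cod K (smap X Y) = fst (mt Y X)"
    by auto
  show **: "\<lbrakk>el m; el n; ob m = fst X; ob n = fst Y; disj m n\<rbrakk> \<Longrightarrow> app (smap X Y) (tn X Y m n) = tn Y X n m" for m n
    using d(5)[of m n] by simp
  show "lin (mt X Y) (mt Y X) (smap X Y)"
    by (rule linearI[where u = ?u and m = "tn X Y ?m ?n"]) (auto simp: ** tn_balanced)
qed

definition rmap where
  "rmap X = (THE u. u \<in> Hom K (fst (mt X U)) (fst X) \<and> u \<cdot> qt X U = snd X \<cdot> Swap K (fst X) (Car A))"

lemma rmap: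
  assumes [simp]: "md X"
  shows "arr (rmap X)" "Dom K (rmap X) = fst (mt X U)" "Cod K (rmap X) = fst X"
    "\<lbrakk>el u; el m; ob u = Car A; ob m = fst X; disj m u\<rbrakk> \<Longrightarrow> app (rmap X) (tn X U m u) = act X u m"
    "lin (mt X U) X (rmap X)" "iso (rmap X)"
proof -
  let ?u = "var 0 (Car A)" and ?v = "var 1 (Car A)" and ?m = "var 2 (fst X)"
  let ?k = "snd X \<cdot> Swap K (fst X) (Car A)"
  have b: "app ?k (act X ?u ?m \<star> ?v) = app ?k (?m \<star> act U ?u ?v)"
    by (simp add: act_comm)
  have e: "rmap X = (THE u. u \<in> Hom K (fst (mt X U)) (Cod K ?k) \<and> u \<cdot> qt X U = ?k)"
    by (simp add: rmap_def)
  note d = descends[OF _ _ _ _ _ _ _ _ _ _ _ _ _ b e, simplified]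
  from d show [simp]: "arr (rmap X)" "Dom K (rmap X) = fst (mt X U)" "Cod K (rmap X) = fst X"
    by auto
  show **: "\<lbrakk>el u; el m; ob u = Car A; ob m = fst X; disj m u\<rbrakk> \<Longrightarrow> app (rmap X) (tn X U m u) = act X u m" for u m
    using d(5)[of m u] by simp
  show "lin (mt X U) X (rmap X)"
    by (rule linearI[where u = ?u and m = "tn X U ?m ?v"]) (auto simp: ** act_comm)
  show "iso (rmap X)"
  proof (rule isoI[where g = "qt X U \<cdot> (Ide K (fst X) \<boxdot> One A) \<cdot> inv_arr K (Runit K (fst X))"])
    show "rmap X \<cdot> (qt X U \<cdot> (Ide K (fst X) \<boxdot> One A) \<cdot> inv_arr K (Runit K (fst X))) = Ide K (Cod K (rmap X))"
      by (rule ext[of _ ?m]) (auto simp: **)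
    have "tn X U (act X ?u ?m) (rone A) = tn X U ?m ?u"
      using tn_balanced[of X U ?u ?m "rone A"] by simp
    then show "(qt X U \<cdot> (Ide K (fst X) \<boxdot> One A) \<cdot> inv_arr K (Runit K (fst X))) \<cdot> rmap X = Ide K (Dom K (rmap X))"
      by (intro ext[of _ "tn X U ?m ?u"]) (auto simp: **)
  qed auto
qed

definition amap where
  "amap X Y V = (THE u. u \<in> Hom K (fst (mt (mt X Y) V)) (fst (mt X (mt Y V))) \<and>
      u \<cdot> (qt (mt X Y) V \<cdot> (qt X Y \<boxdot> Ide K (fst V)))
      = qt X (mt Y V) \<cdot> (Ide K (fst X) \<boxdot> qt Y V) \<cdot> Assoc K (fst X) (fst Y) (fst V))"

text \<open>Descent happens in two stages: through the quotient of X \<otimes> Y with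
  \<open>V\<close> as passive factor, by means of the section \<open>s\<close>, and then through the
  quotient of (X \<otimes>_A Y) \<otimes> V. The composite of both quotient maps is epi, so the
  description in the definition picks the same arrow.\<close>

lemma amap:
  assumes [simp]: "md X" "md Y" "md V"
  shows "arr (amap X Y V)" "Dom K (amap X Y V) = fst (mt (mt X Y) V)" "Cod K (amap X Y V) = fst (mt X (mt Y V))"
    "\<lbrakk>el m; el n; el p; ob m = fst X; ob n = fst Y; ob p = fst V; disj m n; disj m p; disj n p\<rbrakk> \<Longrightarrow>
       app (amap X Y V) (tn (mt X Y) V (tn X Y m n) p) = tn X (mt Y V) m (tn Y V n p)"
    "lin (mt (mt X Y) V) (mt X (mt Y V)) (amap X Y V)"
proof -
  let ?k = "qt X (mt Y V) \<cdot> (Ide K (fst X) \<boxdot> qt Y V) \<cdot> Assoc K (fst X) (fst Y) (fst V)"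
  let ?u = "var 0 (Car A)" and ?m = "var 1 (fst X)" and ?n = "var 2 (fst Y)" and ?p = "var 3 (fst V)"
  obtain s where s [simp]: "arr s" "Dom K s = fst (mt X Y)" "Cod K s = fst X \<boxtimes> fst Y" "s \<cdot> qt X Y = bal X Y" "qt X Y \<cdot> s = Ide K (fst (mt X Y))"
    using ex_section[of X Y] by auto
  have kb: "?k \<cdot> (bal X Y \<boxdot> Ide K (fst V)) = ?k"
    by (rule balanced_bal_tens[where u = ?u and m = ?m and n = ?n and p = ?p]) (auto simp: tn_balanced)
  define k' where "k' = ?k \<cdot> (s \<boxdot> Ide K (fst V))"
  have [simp]: "arr k'" "Dom K k' = fst (mt X Y) \<boxtimes> fst V" "Cod K k' = fst (mt X (mt Y V))" by (simp_all add: k'_def)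
  have k'q: "k' \<cdot> (qt X Y \<boxdot> Ide K (fst V)) = ?k" unfolding k'_def using kb by simp
  have k'a: "app k' (tn X Y m n \<star> p) = tn X (mt Y V) m (tn Y V n p)"
    if "el m" "el n" "el p" "ob m = fst X" "ob n = fst Y" "ob p = fst V" "disj m n" "disj m p" "disj n p" for m n p
    using arg_cong[OF k'q, of "\<lambda>f. app f ((m \<star> n) \<star> p)"] that by simp
  have b: "app k' (act (mt X Y) ?u (tn X Y ?m ?n) \<star> ?p) = app k' (tn X Y ?m ?n \<star> act V ?u ?p)"
    by (simp add: k'a tn_balanced)
  define u where "u = (THE u. u \<in> Hom K (fst (mt (mt X Y) V)) (Cod K k') \<and> u \<cdot> qt (mt X Y) V = k')"
  note d = descends[OF _ _ _ _ _ _ _ _ _ _ _ _ _ b u_def, simplified]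
  have ua: "app u (tn (mt X Y) V (tn X Y m n) p) = tn X (mt Y V) m (tn Y V n p)"
    if "el m" "el n" "el p" "ob m = fst X" "ob n = fst Y" "ob p = fst V" "disj m n" "disj m p" "disj n p" for m n p
    using d(5)[of "tn X Y m n" p] k'a[of m n p] that by simp
  have g: "gen (tn (mt X Y) V (tn X Y ?m ?n) ?p)" by simp
  have 1: "u \<cdot> (qt (mt X Y) V \<cdot> (qt X Y \<boxdot> Ide K (fst V))) = ?k"
    by (rule ext[of _ "(?m \<star> ?n) \<star> ?p"]) (auto simp: d(1-3) ua)
  have "amap X Y V = u" unfolding amap_def
  proof (rule the_equality)
    fix v assume v: "v \<in> Hom K (fst (mt (mt X Y) V)) (fst (mt X (mt Y V))) \<and>
      v \<cdot> (qt (mt X Y) V \<cdot> (qt X Y \<boxdot> Ide K (fst V))) = ?k"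
    then have [simp]: "arr v" "Dom K v = fst (mt (mt X Y) V)" by (auto simp: in_Hom)
    have "app (v \<cdot> (qt (mt X Y) V \<cdot> (qt X Y \<boxdot> Ide K (fst V)))) ((?m \<star> ?n) \<star> ?p) = app (u \<cdot> (qt (mt X Y) V \<cdot> (qt X Y \<boxdot> Ide K (fst V)))) ((?m \<star> ?n) \<star> ?p)"
      using v 1 by simp
    then show "v = u" by (intro ext[OF _ g]) (auto simp: d(1-3))
  qed (use 1 d in \<open>auto simp: in_Hom\<close>)
  then show *: "arr (amap X Y V)" "Dom K (amap X Y V) = fst (mt (mt X Y) V)" "Cod K (amap X Y V) = fst (mt X (mt Y V))"
    and **: "\<lbrakk>el m; el n; el p; ob m = fst X; ob n = fst Y; ob p = fst V; disj m n; disj m p; disj n p\<rbrakk> \<Longrightarrow>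
       app (amap X Y V) (tn (mt X Y) V (tn X Y m n) p) = tn X (mt Y V) m (tn Y V n p)" for m n p
    using d ua by auto
  show "lin (mt (mt X Y) V) (mt X (mt Y V)) (amap X Y V)"
    by (rule linearI[OF _ _ _ _ _ _ _ g, where u = ?u]) (auto simp: * **)
qed

lemma smap_smap:
  assumes [simp]: "md X" "md Y" shows "smap Y X \<cdot> smap X Y = Ide K (fst (mt X Y))"
  by (rule ext[of _ "tn X Y (var 0 (fst X)) (var 1 (fst Y))"]) (auto simp: smap)

text \<open>The inverse is again an associator, the one for V, Y, X, placed between symmetries that
  reverse the order of the three factors.\<close>

lemma amap_iso:
  assumes [simp]: "md X" "md Y" "md V" shows "iso (amap X Y V)"
proof -
  let ?m = "var 1 (fst X)" and ?n = "var 2 (fst Y)" and ?p = "var 3 (fst V)"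
  note [simp] = smap tmap[OF smap(5) lin_ide] amap
  show ?thesis
  proof (rule isoI[where g = "tmap (mt Y X) (mt X Y) V V (smap Y X) (Ide K (fst V)) \<cdot> smap V (mt Y X) \<cdot> amap V Y X \<cdot>
        tmap (mt Y V) (mt V Y) X X (smap Y V) (Ide K (fst X)) \<cdot> smap X (mt Y V)"], goal_cases)
    case 5
    show ?case by (rule ext[of _ "tn (mt X Y) V (tn X Y ?m ?n) ?p"]) auto
  next
    case 6
    show ?case by (rule ext[of _ "tn X (mt Y V) ?m (tn Y V ?n ?p)"]) auto
  qed auto
qed

lemma Mod_sel [simp]:
  "Obj M = {X. md X}"
  "(X, Y, f) \<in> Arr M \<longleftrightarrow> md X \<and> md Y \<and> lin X Y f"
  "Dom M (X, Y, f) = X" "Cod M (X, Y, f) = Y" "Comp M (Y', V, g) (X, Y, f) = (X, V, g \<cdot> f)"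
  "Ide M X = (X, X, Ide K (fst X))" "Plus M (X, Y, f) (X', Y', f') = (X, Y, f \<boxplus> f')"
  "Zero M X Y = (X, Y, Zero K (fst X) (fst Y))" "TensO M X Y = mt X Y"
  "TensA M (X, X', f) (Y, Y', g) = (mt X Y, mt X' Y', tmap X X' Y Y' f g)"
  "Unity M = U" "Assoc M X Y V = (mt (mt X Y) V, mt X (mt Y V), amap X Y V)"
  "Lunit M X = (mt U X, X, lmap X)" "Runit M X = (mt X U, X, rmap X)" "Swap M X Y = (mt X Y, mt Y X, smap X Y)"
  by (simp_all add: Mod_def descend_def tmap_def amap_def lmap_def rmap_def smap_def)

lemma Mod_Hom: "F \<in> Hom M X Y \<longleftrightarrow> (\<exists>f. F = (X, Y, f) \<and> md X \<and> md Y \<and> lin X Y f)"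
  by (cases F) (auto simp: Hom_def)

lemma ordinary_Mod: "ordinary_category M"
proof
  fix F assume "F \<in> Arr M"
  then show "Dom M F \<in> Obj M \<and> Cod M F \<in> Obj M" by (cases F) auto
next
  fix F G X Y V assume "F \<in> Hom M X Y" "G \<in> Hom M Y V"
  then show "Comp M G F \<in> Hom M X V" by (auto simp: Mod_Hom intro: lin_comp)
next
  fix F G H W X Y V assume "F \<in> Hom M W X" "G \<in> Hom M X Y" "H \<in> Hom M Y V"
  then show "Comp M (Comp M H G) F = Comp M H (Comp M G F)" by (auto simp: Mod_Hom linear_typ)
qed (auto simp: Mod_Hom linear_typ)

lemma iso_Mod:
  assumes "md X" "md Y" "lin X Y f" "iso f" shows "is_iso M (X, Y, f)" "inv_arr M (X, Y, f) = (Y, X, inv_arr K f)"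
proof -
  interpret M: ordinary_category M by (rule ordinary_Mod)
  note [simp] = assms linear_typ[OF assms(3)] lin_inv[OF assms(3,1,2,4)]
  show "is_iso M (X, Y, f)" by (rule M.isoI[where g = "(Y, X, inv_arr K f)"]) auto
  show "inv_arr M (X, Y, f) = (Y, X, inv_arr K f)" by (rule M.inv_eqI) auto
qed

text \<open>Each axiom compares arrows out of an iterated tensor product over \<open>A\<close> and
  is checked at one generic tensor. The triangle is the axiom that expresses balancedness.\<close>

lemma monoidal_Mod: "symmetric_monoidal_category M"
proof (intro symmetric_monoidal_category.intro ordinary_Mod symmetric_monoidal_category_axioms.intro)
  fix F G X X' Y Y' assume "F \<in> Hom M X X'" "G \<in> Hom M Y Y'"
  then show "TensA M F G \<in> Hom M (TensO M X Y) (TensO M X' Y')" by (auto simp: Mod_Hom tmap)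
next
  fix X Y assume "X \<in> Obj M" "Y \<in> Obj M"
  then have [simp]: "md X" "md Y" by auto
  note [simp] = tmap[OF lin_ide lin_ide]
  have "tmap X X Y Y (Ide K (fst X)) (Ide K (fst Y)) = Ide K (fst (mt X Y))"
    by (rule ext[of _ "tn X Y (var 0 (fst X)) (var 1 (fst Y))"]) auto
  then show "TensA M (Ide M X) (Ide M Y) = Ide M (TensO M X Y)" by simp
next
  fix F F' G G' X X' X'' Y Y' Y''
  assume "F \<in> Hom M X X'" "F' \<in> Hom M X' X''" "G \<in> Hom M Y Y'" "G' \<in> Hom M Y' Y''"
  then obtain f f' g g' where [simp]: "F = (X, X', f)" "F' = (X', X'', f')" "G = (Y, Y', g)" "G' = (Y', Y'', g')"
      "md X" "md X'" "md X''" "md Y" "md Y'" "md Y''"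
    and l: "lin X X' f" "lin X' X'' f'" "lin Y Y' g" "lin Y' Y'' g'" by (auto simp: Mod_Hom)
  have c: "lin X X'' (f' \<cdot> f)" "lin Y Y'' (g' \<cdot> g)" using l by (auto intro: lin_comp)
  note [simp] = tmap[OF c] tmap[OF l(1,3)] tmap[OF l(2,4)] linear_typ[OF l(1)] linear_typ[OF l(2)] linear_typ[OF l(3)] linear_typ[OF l(4)]
  have "tmap X X'' Y Y'' (f' \<cdot> f) (g' \<cdot> g) = tmap X' X'' Y' Y'' f' g' \<cdot> tmap X X' Y Y' f g"
    by (rule ext[of _ "tn X Y (var 0 (fst X)) (var 1 (fst Y))"]) auto
  then show "TensA M (Comp M F' F) (Comp M G' G) = Comp M (TensA M F' G') (TensA M F G)" by simp
next
  fix X Y V assume "X \<in> Obj M" "Y \<in> Obj M" "V \<in> Obj M"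
  then have [simp]: "md X" "md Y" "md V" by auto
  show "Assoc M X Y V \<in> Hom M (TensO M (TensO M X Y) V) (TensO M X (TensO M Y V))" by (simp add: Mod_Hom amap)
  show "is_iso M (Assoc M X Y V)" using iso_Mod(1)[OF _ _ amap(5) amap_iso] by simp
next
  fix F G H X X' Y Y' V V' assume "F \<in> Hom M X X'" "G \<in> Hom M Y Y'" "H \<in> Hom M V V'"
  then obtain f g h where [simp]: "F = (X, X', f)" "G = (Y, Y', g)" "H = (V, V', h)"
      "md X" "md X'" "md Y" "md Y'" "md V" "md V'"
    and l: "lin X X' f" "lin Y Y' g" "lin V V' h" by (auto simp: Mod_Hom)
  note t = tmap[OF l(1,2)] tmap[OF l(2,3)]
  note [simp] = t tmap[OF t(5) l(3)] tmap[OF l(1) t(10)] linear_typ[OF l(1)] linear_typ[OF l(2)] linear_typ[OF l(3)] amap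
  have "amap X' Y' V' \<cdot> tmap (mt X Y) (mt X' Y') V V' (tmap X X' Y Y' f g) h
    = tmap X X' (mt Y V) (mt Y' V') f (tmap Y Y' V V' g h) \<cdot> amap X Y V"
    by (rule ext[of _ "tn (mt X Y) V (tn X Y (var 0 (fst X)) (var 1 (fst Y))) (var 2 (fst V))"]) auto
  then show "Comp M (Assoc M X' Y' V') (TensA M (TensA M F G) H) = Comp M (TensA M F (TensA M G H)) (Assoc M X Y V)" by simp
next
  fix X assume "X \<in> Obj M"
  then have [simp]: "md X" by auto
  show "Lunit M X \<in> Hom M (TensO M (Unity M) X) X" "Runit M X \<in> Hom M (TensO M X (Unity M)) X"
    by (simp_all add: Mod_Hom lmap rmap)
  show "is_iso M (Lunit M X)" "is_iso M (Runit M X)"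
    using iso_Mod(1)[OF _ _ lmap(5,6)] iso_Mod(1)[OF _ _ rmap(5,6)] by simp_all
next
  fix F X Y assume "F \<in> Hom M X Y"
  then obtain f where [simp]: "F = (X, Y, f)" "md X" "md Y" and l: "lin X Y f" by (auto simp: Mod_Hom)
  have u: "lin U U (Ide K (Car A))" using lin_ide[of U] by simp
  note [simp] = tmap[OF u l] tmap[OF l u] lmap rmap linear_typ[OF l] lin_app[OF l]
  have "lmap Y \<cdot> tmap U U X Y (Ide K (Car A)) f = f \<cdot> lmap X"
    by (rule ext[of _ "tn U X (var 0 (Car A)) (var 1 (fst X))"]) auto
  then show "Comp M (Lunit M Y) (TensA M (Ide M (Unity M)) F) = Comp M F (Lunit M X)" by simp
  have "rmap Y \<cdot> tmap X Y U U f (Ide K (Car A)) = f \<cdot> rmap X"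
    by (rule ext[of _ "tn X U (var 0 (fst X)) (var 1 (Car A))"]) auto
  then show "Comp M (Runit M Y) (TensA M F (Ide M (Unity M))) = Comp M F (Runit M X)" by simp
next
  fix X Y assume "X \<in> Obj M" "Y \<in> Obj M"
  then have [simp]: "md X" "md Y" by auto
  show "Swap M X Y \<in> Hom M (TensO M X Y) (TensO M Y X)" by (simp add: Mod_Hom smap)
  show "Comp M (Swap M Y X) (Swap M X Y) = Ide M (TensO M X Y)" by (simp add: smap_smap)
  have u: "lin U U (Ide K (Car A))" using lin_ide[of U] by simp
  note [simp] = lmap rmap amap tmap[OF lin_ide lmap(5)] tmap[OF rmap(5) lin_ide]
  have "tmap X X (mt U Y) Y (Ide K (fst X)) (lmap Y) \<cdot> amap X U Y = tmap (mt X U) X Y Y (rmap X) (Ide K (fst Y))"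
    by (rule ext[of _ "tn (mt X U) Y (tn X U (var 0 (fst X)) (var 1 (Car A))) (var 2 (fst Y))"]) (auto simp: tn_balanced)
  then show "Comp M (TensA M (Ide M X) (Lunit M Y)) (Assoc M X (Unity M) Y) = TensA M (Runit M X) (Ide M Y)" by simp
next
  fix F G X X' Y Y' assume "F \<in> Hom M X X'" "G \<in> Hom M Y Y'"
  then obtain f g where [simp]: "F = (X, X', f)" "G = (Y, Y', g)" "md X" "md X'" "md Y" "md Y'"
    and l: "lin X X' f" "lin Y Y' g" by (auto simp: Mod_Hom)
  note [simp] = tmap[OF l(1,2)] tmap[OF l(2,1)] linear_typ[OF l(1)] linear_typ[OF l(2)] smap
  have "smap X' Y' \<cdot> tmap X X' Y Y' f g = tmap Y Y' X X' g f \<cdot> smap X Y"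
    by (rule ext[of _ "tn X Y (var 0 (fst X)) (var 1 (fst Y))"]) auto
  then show "Comp M (Swap M X' Y') (TensA M F G) = Comp M (TensA M G F) (Swap M X Y)" by simp
next
  fix W X Y V assume "W \<in> Obj M" "X \<in> Obj M" "Y \<in> Obj M" "V \<in> Obj M"
  then have [simp]: "md W" "md X" "md Y" "md V" by auto
  note [simp] = amap tmap[OF lin_ide amap(5)] tmap[OF amap(5) lin_ide]
  have "amap W X (mt Y V) \<cdot> amap (mt W X) Y V = tmap W W (mt (mt X Y) V) (mt X (mt Y V)) (Ide K (fst W)) (amap X Y V) \<cdot>
      amap W (mt X Y) V \<cdot> tmap (mt (mt W X) Y) (mt W (mt X Y)) V V (amap W X Y) (Ide K (fst V))"
    by (rule ext[of _ "tn (mt (mt W X) Y) V (tn (mt W X) Y (tn W X (var 0 (fst W)) (var 1 (fst X))) (var 2 (fst Y))) (var 3 (fst V))"]) auto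
  then show "Comp M (Assoc M W X (TensO M Y V)) (Assoc M (TensO M W X) Y V) =
          Comp M (Comp M (TensA M (Ide M W) (Assoc M X Y V)) (Assoc M W (TensO M X Y) V)) (TensA M (Assoc M W X Y) (Ide M V))" by simp
next
  fix X Y V assume "X \<in> Obj M" "Y \<in> Obj M" "V \<in> Obj M"
  then have [simp]: "md X" "md Y" "md V" by auto
  note [simp] = amap smap tmap[OF lin_ide smap(5)] tmap[OF smap(5) lin_ide]
  have "amap Y V X \<cdot> smap X (mt Y V) \<cdot> amap X Y V = tmap Y Y (mt X V) (mt V X) (Ide K (fst Y)) (smap X V) \<cdot>
     amap Y X V \<cdot> tmap (mt X Y) (mt Y X) V V (smap X Y) (Ide K (fst V))"
    by (rule ext[of _ "tn (mt X Y) V (tn X Y (var 0 (fst X)) (var 1 (fst Y))) (var 2 (fst V))"]) auto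
  then show "Comp M (Comp M (Assoc M Y V X) (Swap M X (TensO M Y V))) (Assoc M X Y V) =
          Comp M (Comp M (TensA M (Ide M Y) (Swap M X V)) (Assoc M Y X V)) (TensA M (Swap M X Y) (Ide M V))" by simp
qed auto

end

section \<open>Additivity and idempotent completeness of module categories\<close>

context idempotent_complete_smc
begin

lemma biproduct_joint:
  assumes b: "biproduct K x y s i j p q"
    and f: "arr f" "arr g" "Dom K f = Dom K g" "Cod K f = s" "Cod K g = s" "p \<cdot> f = p \<cdot> g" "q \<cdot> f = q \<cdot> g"
  shows "f = g"
proof -
  from b have [simp]: "arr i" "Cod K i = s" "Dom K i = x" "arr p" "Dom K p = s" "Cod K p = x"
    "arr j" "Cod K j = s" "Dom K j = y" "arr q" "Dom K q = s" "Cod K q = y" and e: "(i \<cdot> p) \<boxplus> (j \<cdot> q) = Ide K s"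
    by (auto simp: biproduct_def in_Hom)
  have "((i \<cdot> p) \<boxplus> (j \<cdot> q)) \<cdot> f = ((i \<cdot> p) \<boxplus> (j \<cdot> q)) \<cdot> g" using f by simp
  then show ?thesis unfolding e using f by simp
qed

lemma additive_inverse:
  assumes "arr f" shows "\<exists>g. arr g \<and> Dom K g = Dom K f \<and> Cod K g = Cod K f \<and> f \<boxplus> g = Z (Dom K f) (Cod K f)"
proof -
  interpret comm_group "hom_group K (Dom K f) (Cod K f)" using hom_comm_group assms by auto
  have f: "f \<in> carrier (hom_group K (Dom K f) (Cod K f))" using assms by (simp add: in_Hom)
  show ?thesis using inv_closed[OF f] r_inv[OF f] by (auto simp: in_Hom)
qed

lemma plus_cancel:
  assumes "arr f" "arr g" "arr h" "Dom K g = Dom K f" "Cod K g = Cod K f" "Dom K h = Dom K f" "Cod K h = Cod K f" "f \<boxplus> g = f \<boxplus> h"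
  shows "g = h"
proof -
  interpret comm_group "hom_group K (Dom K f) (Cod K f)" using hom_comm_group assms by auto
  show ?thesis using Units_l_cancel[of f g h] Units_eq assms by (auto simp: in_Hom)
qed

lemma plus_commute: "\<lbrakk>arr f; arr g; Dom K f = Dom K g; Cod K f = Cod K g\<rbrakk> \<Longrightarrow> f \<boxplus> g = g \<boxplus> f"
proof -
  assume *: "arr f" "arr g" "Dom K f = Dom K g" "Cod K f = Cod K g"
  interpret comm_group "hom_group K (Dom K g) (Cod K g)" using hom_comm_group * by auto
  show ?thesis using m_comm[of f g] * by (auto simp: in_Hom)
qed

lemma plus_assoc: "\<lbrakk>arr f; arr g; arr h; Dom K f = Dom K g; Cod K f = Cod K g; Dom K g = Dom K h; Cod K g = Cod K h\<rbrakk>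
  \<Longrightarrow> (f \<boxplus> g) \<boxplus> h = f \<boxplus> (g \<boxplus> h)"
proof -
  assume *: "arr f" "arr g" "arr h" "Dom K f = Dom K g" "Cod K f = Cod K g" "Dom K g = Dom K h" "Cod K g = Cod K h"
  interpret comm_group "hom_group K (Dom K h) (Cod K h)" using hom_comm_group * by auto
  show ?thesis using m_assoc[of f g h] * by (auto simp: in_Hom)
qed

end

context sep_ring
begin

text \<open>The additive inverse in \<open>K\<close> is linear by cancellation in the hom group. It
  supplies negatives in \<open>Mod\<close> and the complement of a linear idempotent.\<close>

lemma lin_neg:
  assumes l: "lin X Y f" and [simp]: "md X" "md Y"
  shows "\<exists>g. lin X Y g \<and> f \<boxplus> g = Z (fst X) (fst Y)"
proof -
  note [simp] = linear_typ[OF l]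
  obtain g where [simp]: "arr g" "Dom K g = fst X" "Cod K g = fst Y" and g: "f \<boxplus> g = Z (fst X) (fst Y)"
    using additive_inverse[of f] by auto
  have "(f \<cdot> snd X) \<boxplus> (g \<cdot> snd X) = (f \<boxplus> g) \<cdot> snd X" by simp
  also have "\<dots> = snd Y \<cdot> (Ide K (Car A) \<boxdot> (f \<boxplus> g))" unfolding g by simp
  also have "\<dots> = (snd Y \<cdot> (Ide K (Car A) \<boxdot> f)) \<boxplus> (snd Y \<cdot> (Ide K (Car A) \<boxdot> g))" by simp
  also have "snd Y \<cdot> (Ide K (Car A) \<boxdot> f) = f \<cdot> snd X" using l by (simp add: linear_def)
  finally have "g \<cdot> snd X = snd Y \<cdot> (Ide K (Car A) \<boxdot> g)"
    by (rule plus_cancel[rotated -1]) auto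
  then have "lin X Y g" by (simp add: linear_def in_Hom)
  then show ?thesis using g by blast
qed

text \<open>The identity and the zero endomorphism of \<open>X\<close> are both linear, so they
  coincide when \<open>X\<close> is zero in \<open>Mod\<close>. Conversely, uniqueness of arrows in
  \<open>K\<close> restricts to linear ones.\<close>

lemma Mod_zero_object:
  assumes [simp]: "md X" shows "zero_object M X \<longleftrightarrow> zero_object K (fst X)"
proof
  assume "zero_object M X"
  then have "\<exists>!F. F \<in> Hom M X X" unfolding zero_object_def by blast
  moreover have "(X, X, Ide K (fst X)) \<in> Hom M X X" "(X, X, Z (fst X) (fst X)) \<in> Hom M X X" by (simp_all add: Mod_Hom)
  ultimately have "Ide K (fst X) = Z (fst X) (fst X)" by blast
  then show "zero_object K (fst X)" by (simp add: zero_object_iff)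
next
  assume z: "zero_object K (fst X)"
  have 1: "f = g" if "lin Y X f" "lin Y X g" "md Y" for f g Y
    using z that unfolding zero_object_def linear_def by (metis md_typ(1))
  have 2: "f = g" if "lin X Y f" "lin X Y g" "md Y" for f g Y
    using z that unfolding zero_object_def linear_def by (metis md_typ(1))
  show "zero_object M X" unfolding zero_object_def
  proof (intro conjI ballI)
    fix Y assume "Y \<in> Obj M"
    then have [simp]: "md Y" by simp
    show "\<exists>!F. F \<in> Hom M Y X"
    proof (rule ex1I)
      show "(Y, X, Z (fst Y) (fst X)) \<in> Hom M Y X" by (simp add: Mod_Hom)
      fix F assume "F \<in> Hom M Y X"
      then obtain f where "F = (Y, X, f)" "lin Y X f" unfolding Mod_Hom by blast
      then show "F = (Y, X, Z (fst Y) (fst X))" using 1[of Y f "Z (fst Y) (fst X)"] by simp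
    qed
    show "\<exists>!F. F \<in> Hom M X Y"
    proof (rule ex1I)
      show "(X, Y, Z (fst X) (fst Y)) \<in> Hom M X Y" by (simp add: Mod_Hom)
      fix F assume "F \<in> Hom M X Y"
      then obtain f where "F = (X, Y, f)" "lin X Y f" unfolding Mod_Hom by blast
      then show "F = (X, Y, Z (fst X) (fst Y))" using 2[of Y f "Z (fst X) (fst Y)"] by simp
    qed
  qed simp
qed

lemma additive_Mod: "additive_category M"
proof (intro additive_category.intro ordinary_Mod additive_category_axioms.intro)
  fix X Y assume "X \<in> Obj M" "Y \<in> Obj M"
  then have [simp]: "md X" "md Y" by auto
  have c: "F \<in> carrier (hom_group M X Y) \<longleftrightarrow> (\<exists>f. F = (X, Y, f) \<and> lin X Y f)" for F
    by (simp add: hom_group_def Mod_Hom)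
  have m: "mult (hom_group M X Y) (X, Y, f) (X, Y, g) = (X, Y, f \<boxplus> g)" for f g by (simp add: hom_group_def)
  have o: "one (hom_group M X Y) = (X, Y, Z (fst X) (fst Y))" by (simp add: hom_group_def)
  show "comm_group (hom_group M X Y)"
  proof (rule comm_groupI)
    fix F G assume "F \<in> carrier (hom_group M X Y)" "G \<in> carrier (hom_group M X Y)"
    then obtain f g where f [simp]: "F = (X, Y, f)" "G = (X, Y, g)" and l: "lin X Y f" "lin X Y g" by (auto simp: c)
    note [simp] = linear_typ[OF l(1)] linear_typ[OF l(2)]
    show "F \<otimes>\<^bsub>hom_group M X Y\<^esub> G \<in> carrier (hom_group M X Y)" using lin_plus[OF l] by (simp add: c m)
    show "F \<otimes>\<^bsub>hom_group M X Y\<^esub> G = G \<otimes>\<^bsub>hom_group M X Y\<^esub> F" by (simp add: m plus_commute)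
    fix H assume "H \<in> carrier (hom_group M X Y)"
    then obtain h where [simp]: "H = (X, Y, h)" and l': "lin X Y h" by (auto simp: c)
    note [simp] = linear_typ[OF l']
    show "F \<otimes>\<^bsub>hom_group M X Y\<^esub> G \<otimes>\<^bsub>hom_group M X Y\<^esub> H = F \<otimes>\<^bsub>hom_group M X Y\<^esub> (G \<otimes>\<^bsub>hom_group M X Y\<^esub> H)"
      by (simp add: m plus_assoc)
  next
    show "\<one>\<^bsub>hom_group M X Y\<^esub> \<in> carrier (hom_group M X Y)" by (simp add: c o)
    fix F assume "F \<in> carrier (hom_group M X Y)"
    then obtain f where f [simp]: "F = (X, Y, f)" and l: "lin X Y f" by (auto simp: c)
    note [simp] = linear_typ[OF l]
    show "\<one>\<^bsub>hom_group M X Y\<^esub> \<otimes>\<^bsub>hom_group M X Y\<^esub> F = F" by (simp add: m o)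
    obtain g where g: "lin X Y g" "f \<boxplus> g = Z (fst X) (fst Y)" using lin_neg[OF l] by auto
    then show "\<exists>G\<in>carrier (hom_group M X Y). G \<otimes>\<^bsub>hom_group M X Y\<^esub> F = \<one>\<^bsub>hom_group M X Y\<^esub>"
      using linear_typ[OF g(1)] plus_commute[of f g]
      by (intro bexI[of _ "(X, Y, g)"]) (auto simp: c m o)
  qed
next
  fix F G H X Y V assume "F \<in> Hom M X Y" "G \<in> Hom M Y V" "H \<in> Hom M Y V"
  then show "Comp M (Plus M G H) F = Plus M (Comp M G F) (Comp M H F)" by (auto simp: Mod_Hom linear_typ)
next
  fix F G H X Y V assume "F \<in> Hom M X Y" "G \<in> Hom M X Y" "H \<in> Hom M Y V"
  then show "Comp M H (Plus M F G) = Plus M (Comp M H F) (Comp M H G)" by (auto simp: Mod_Hom linear_typ)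
next
  obtain z where z: "zero_object K z" using ex_zero_object by blast
  then have z' [simp]: "z \<in> Obj K" and iz: "Ide K z = Z z z" by (auto simp: zero_object_iff)
  have u: "f = g" if "arr f" "arr g" "Dom K f = Dom K g" "Cod K f = z" "Cod K g = z" for f g
    using z that unfolding zero_object_def by (metis arr_obj(1) in_Hom)
  have "md (z, Z (Car A \<boxtimes> z) z)"
    by (auto simp: is_module_def Let_def in_Hom intro!: u)
  then have "zero_object M (z, Z (Car A \<boxtimes> z) z)" using Mod_zero_object z by simp
  then show "\<exists>z. zero_object M z" by blast
next
  fix X Y assume "X \<in> Obj M" "Y \<in> Obj M"
  then have [simp]: "md X" "md Y" by auto
  let ?a = "Car A"
  obtain s i j p q where b: "biproduct K (fst X) (fst Y) s i j p q" using ex_biproduct[of "fst X" "fst Y"] by auto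
  then have [simp]: "s \<in> Obj K" "arr i" "Cod K i = s" "Dom K i = fst X" "arr p" "Dom K p = s" "Cod K p = fst X"
    "arr j" "Cod K j = s" "Dom K j = fst Y" "arr q" "Dom K q = s" "Cod K q = fst Y"
    and e: "(i \<cdot> p) \<boxplus> (j \<cdot> q) = Ide K s"
    and d [simp]: "p \<cdot> i = Ide K (fst X)" "q \<cdot> j = Ide K (fst Y)" "q \<cdot> i = Z (fst X) (fst Y)" "p \<cdot> j = Z (fst Y) (fst X)"
    by (auto simp: biproduct_def in_Hom)
  \<comment> \<open>The componentwise action; it is forced by the demand that \<open>p\<close> and
    \<open>q\<close> be linear.\<close>
  define r where "r = (i \<cdot> snd X \<cdot> (Ide K ?a \<boxdot> p)) \<boxplus> (j \<cdot> snd Y \<cdot> (Ide K ?a \<boxdot> q))"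
  have [simp]: "arr r" "Dom K r = ?a \<boxtimes> s" "Cod K r = s" by (simp_all add: r_def)
  have pr: "p \<cdot> r = snd X \<cdot> (Ide K ?a \<boxdot> p)" and qr: "q \<cdot> r = snd Y \<cdot> (Ide K ?a \<boxdot> q)"
    unfolding r_def by (simp_all add: comp_eq[OF d(1)] comp_eq[OF d(2)] comp_eq[OF d(3)] comp_eq[OF d(4)])
  let ?u = "var 0 ?a" and ?v = "var 1 ?a" and ?m = "var 2 s"
  have pa: "app p (app r (u \<star> m)) = act X u (app p m)" "app q (app r (u \<star> m)) = act Y u (app q m)"
    if "el u" "el m" "ob u = ?a" "ob m = s" "disj u m" for u m
    using arg_cong[OF pr, of "\<lambda>f. app f (u \<star> m)"] arg_cong[OF qr, of "\<lambda>f. app f (u \<star> m)"] that by simp_all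
  have ms: "md (s, r)"
  proof -
    have "r \<cdot> (Mul A \<boxdot> Ide K s) = r \<cdot> (Ide K ?a \<boxdot> r) \<cdot> Assoc K ?a ?a s"
    proof (rule biproduct_joint[OF b])
      show "p \<cdot> (r \<cdot> (Mul A \<boxdot> Ide K s)) = p \<cdot> (r \<cdot> (Ide K ?a \<boxdot> r) \<cdot> Assoc K ?a ?a s)"
        by (rule ext[of _ "(?u \<star> ?v) \<star> ?m"]) (auto simp: pa)
      show "q \<cdot> (r \<cdot> (Mul A \<boxdot> Ide K s)) = q \<cdot> (r \<cdot> (Ide K ?a \<boxdot> r) \<cdot> Assoc K ?a ?a s)"
        by (rule ext[of _ "(?u \<star> ?v) \<star> ?m"]) (auto simp: pa)
    qed auto
    moreover have "r \<cdot> (One A \<boxdot> Ide K s) = Lunit K s"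
    proof (rule biproduct_joint[OF b])
      show "p \<cdot> (r \<cdot> (One A \<boxdot> Ide K s)) = p \<cdot> Lunit K s"
        by (rule ext[of _ "pt \<star> ?m"]) (auto simp: pa)
      show "q \<cdot> (r \<cdot> (One A \<boxdot> Ide K s)) = q \<cdot> Lunit K s"
        by (rule ext[of _ "pt \<star> ?m"]) (auto simp: pa)
    qed auto
    ultimately show ?thesis by (simp add: is_module_def Let_def in_Hom)
  qed
  have "lin (s, r) X p" "lin (s, r) Y q" using pr qr by (simp_all add: linear_def in_Hom)
  moreover have "i \<cdot> snd X = r \<cdot> (Ide K ?a \<boxdot> i)" "j \<cdot> snd Y = r \<cdot> (Ide K ?a \<boxdot> j)"
    unfolding r_def by simp_all
  then have "lin X (s, r) i" "lin Y (s, r) j" by (simp_all add: linear_def in_Hom)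
  ultimately have "biproduct M X Y (s, r) (X, (s, r), i) (Y, (s, r), j) ((s, r), X, p) ((s, r), Y, q)"
    using ms e by (auto simp: biproduct_def Mod_Hom)
  then show "\<exists>s i1 i2 p1 p2. biproduct M X Y s i1 i2 p1 p2" by blast
qed

theorem idempotent_complete_Mod: "idempotent_complete_smc M"
proof (intro idempotent_complete_smc.intro additive_Mod monoidal_Mod idempotent_complete_smc_axioms.intro)
  fix F G H X X' Y Y' assume "F \<in> Hom M X X'" "G \<in> Hom M X X'" "H \<in> Hom M Y Y'"
  then obtain f g h where [simp]: "F = (X, X', f)" "G = (X, X', g)" "H = (Y, Y', h)" "md X" "md X'" "md Y" "md Y'"
    and l: "lin X X' f" "lin X X' g" "lin Y Y' h" by (auto simp: Mod_Hom)
  have c: "lin X X' (f \<boxplus> g)" using l by (auto intro: lin_plus)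
  note [simp] = tmap[OF l(1,3)] tmap[OF l(2,3)] tmap[OF c l(3)] linear_typ[OF l(1)] linear_typ[OF l(2)] linear_typ[OF l(3)]
  have t: "tmap X X' Y Y' f' h \<cdot> qt X Y = qt X' Y' \<cdot> (f' \<boxdot> h)" if "lin X X' f'" for f'
  proof -
    note [simp] = tmap[OF that l(3)] linear_typ[OF that]
    show ?thesis by (rule ext[of _ "var 0 (fst X) \<star> var 1 (fst Y)"]) auto
  qed
  have g: "gen (tn X Y (var 0 (fst X)) (var 1 (fst Y)))" by simp
  have "tmap X X' Y Y' (f \<boxplus> g) h \<cdot> qt X Y = (tmap X X' Y Y' f h \<boxplus> tmap X X' Y Y' g h) \<cdot> qt X Y"
    using t[OF l(1)] t[OF l(2)] t[OF c] by simp
  then have "app (tmap X X' Y Y' (f \<boxplus> g) h \<cdot> qt X Y) (var 0 (fst X) \<star> var 1 (fst Y)) = app ((tmap X X' Y Y' f h \<boxplus> tmap X X' Y Y' g h) \<cdot> qt X Y) (var 0 (fst X) \<star> var 1 (fst Y))"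
    by simp
  then have "tmap X X' Y Y' (f \<boxplus> g) h = tmap X X' Y Y' f h \<boxplus> tmap X X' Y Y' g h"
    by (intro ext[OF _ g]) (simp_all del: comp_plus)
  then show "TensA M (Plus M F G) H = Plus M (TensA M F H) (TensA M G H)" by simp
next
  fix H F G Y Y' X X' assume "H \<in> Hom M Y Y'" "F \<in> Hom M X X'" "G \<in> Hom M X X'"
  then obtain f g h where [simp]: "F = (X, X', f)" "G = (X, X', g)" "H = (Y, Y', h)" "md X" "md X'" "md Y" "md Y'"
    and l: "lin X X' f" "lin X X' g" "lin Y Y' h" by (auto simp: Mod_Hom)
  have c: "lin X X' (f \<boxplus> g)" using l by (auto intro: lin_plus)
  note [simp] = tmap[OF l(3,1)] tmap[OF l(3,2)] tmap[OF l(3) c] linear_typ[OF l(1)] linear_typ[OF l(2)] linear_typ[OF l(3)]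
  have t: "tmap Y Y' X X' h f' \<cdot> qt Y X = qt Y' X' \<cdot> (h \<boxdot> f')" if "lin X X' f'" for f'
  proof -
    note [simp] = tmap[OF l(3) that] linear_typ[OF that]
    show ?thesis by (rule ext[of _ "var 0 (fst Y) \<star> var 1 (fst X)"]) auto
  qed
  have g: "gen (tn Y X (var 0 (fst Y)) (var 1 (fst X)))" by simp
  have "tmap Y Y' X X' h (f \<boxplus> g) \<cdot> qt Y X = (tmap Y Y' X X' h f \<boxplus> tmap Y Y' X X' h g) \<cdot> qt Y X"
    using t[OF l(1)] t[OF l(2)] t[OF c] by simp
  then have "app (tmap Y Y' X X' h (f \<boxplus> g) \<cdot> qt Y X) (var 0 (fst Y) \<star> var 1 (fst X)) = app ((tmap Y Y' X X' h f \<boxplus> tmap Y Y' X X' h g) \<cdot> qt Y X) (var 0 (fst Y) \<star> var 1 (fst X))"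
    by simp
  then have "tmap Y Y' X X' h (f \<boxplus> g) = tmap Y Y' X X' h f \<boxplus> tmap Y Y' X X' h g"
    by (intro ext[OF _ g]) (simp_all del: comp_plus)
  then show "TensA M H (Plus M F G) = Plus M (TensA M H F) (TensA M H G)" by simp
next
  fix E X assume "E \<in> Hom M X X" and EE: "Comp M E E = E"
  then obtain e where [simp]: "E = (X, X, e)" "md X" and l: "lin X X e" by (auto simp: Mod_Hom)
  have ee: "e \<cdot> e = e" using EE by simp
  note [simp] = linear_typ[OF l]
  let ?a = "Car A"
  obtain x1 x2 i j p q where b: "biproduct K x1 x2 (fst X) i j p q" and eip: "e = i \<cdot> p"
    using idempotent_split[of e "fst X"] ee by (auto simp: in_Hom)
  then have [simp]: "x1 \<in> Obj K" "x2 \<in> Obj K" "arr i" "Cod K i = fst X" "Dom K i = x1" "arr p" "Dom K p = fst X" "Cod K p = x1"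
    "arr j" "Cod K j = fst X" "Dom K j = x2" "arr q" "Dom K q = fst X" "Cod K q = x2"
    and s: "(i \<cdot> p) \<boxplus> (j \<cdot> q) = Ide K (fst X)"
    and d [simp]: "p \<cdot> i = Ide K x1" "q \<cdot> j = Ide K x2" "q \<cdot> i = Z x1 x2" "p \<cdot> j = Z x2 x1"
    by (auto simp: biproduct_def in_Hom)
  \<comment> \<open>The splitting in \<open>K\<close> gives no linearity for the second summand. Its
    idempotent is 1 - e, and this is linear because \<open>e\<close> is.\<close>
  have lj: "lin X X (j \<cdot> q)"
  proof -
    obtain g where g: "lin X X g" "e \<boxplus> g = Z (fst X) (fst X)" using lin_neg[OF l] by auto
    note [simp] = linear_typ[OF g(1)]
    have "e \<boxplus> (Ide K (fst X) \<boxplus> g) = Ide K (fst X) \<boxplus> (e \<boxplus> g)"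
      using plus_assoc[of e "Ide K (fst X)" g] plus_assoc[of "Ide K (fst X)" e g] plus_commute[of e "Ide K (fst X)"] by simp
    also have "\<dots> = e \<boxplus> (j \<cdot> q)" using g s by (simp add: eip)
    finally have "Ide K (fst X) \<boxplus> g = j \<cdot> q" by (rule plus_cancel[rotated -1]) auto
    then show ?thesis using lin_plus[OF lin_ide[of X] g(1)] by simp
  qed
  \<comment> \<open>A summand receives the action of \<open>X\<close> compressed by \<open>h\<close>
    and \<open>k\<close>. That this is an action, and that \<open>h\<close> and \<open>k\<close> are
    linear for it, comes from linearity of the idempotent \<open>h \<cdot> k\<close>.\<close>
  have split: "md (y, k \<cdot> snd X \<cdot> (Ide K ?a \<boxdot> h)) \<and> lin X (y, k \<cdot> snd X \<cdot> (Ide K ?a \<boxdot> h)) k \<and> lin (y, k \<cdot> snd X \<cdot> (Ide K ?a \<boxdot> h)) X h"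
    if hk: "lin X X (h \<cdot> k)" and [simp]: "arr h" "arr k" "Dom K h = y" "Cod K h = fst X" "Dom K k = fst X" "Cod K k = y" "y \<in> Obj K"
      and kh: "k \<cdot> h = Ide K y" for y h k
  proof -
    define r where "r = k \<cdot> snd X \<cdot> (Ide K ?a \<boxdot> h)"
    have [simp]: "arr r" "Dom K r = ?a \<boxtimes> y" "Cod K r = y" by (simp_all add: r_def)
    have 1: "k \<cdot> snd X = r \<cdot> (Ide K ?a \<boxdot> k)"
    proof -
      have "r \<cdot> (Ide K ?a \<boxdot> k) = k \<cdot> (snd X \<cdot> (Ide K ?a \<boxdot> (h \<cdot> k)))" by (simp add: r_def)
      also have "snd X \<cdot> (Ide K ?a \<boxdot> (h \<cdot> k)) = (h \<cdot> k) \<cdot> snd X" using hk unfolding linear_def by metis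
      also have "k \<cdot> ((h \<cdot> k) \<cdot> snd X) = k \<cdot> snd X" by (simp add: comp_eq[OF kh])
      finally show ?thesis by simp
    qed
    have 2: "h \<cdot> r = snd X \<cdot> (Ide K ?a \<boxdot> h)"
    proof -
      have "h \<cdot> r = ((h \<cdot> k) \<cdot> snd X) \<cdot> (Ide K ?a \<boxdot> h)" by (simp add: r_def)
      also have "(h \<cdot> k) \<cdot> snd X = snd X \<cdot> (Ide K ?a \<boxdot> (h \<cdot> k))" using hk unfolding linear_def by metis
      also have "(snd X \<cdot> (Ide K ?a \<boxdot> (h \<cdot> k))) \<cdot> (Ide K ?a \<boxdot> h) = snd X \<cdot> (Ide K ?a \<boxdot> h)" by (simp add: kh)
      finally show ?thesis .
    qed
    have a: "app r (u \<star> app k m) = app k (act X u m)" if "el u" "el m" "ob u = ?a" "ob m = fst X" "disj u m" for u m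
      using arg_cong[OF 1, of "\<lambda>f. app f (u \<star> m)"] that by simp
    have g: "gen (app k (var 2 (fst X)))" by (rule gen_app[where s = h]) (auto simp: kh)
    have "md (y, r)"
      by (rule is_moduleI[where u = "var 0 ?a" and v = "var 1 ?a" and m = "app k (var 2 (fst X))"])
        (auto simp: g a)
    then show ?thesis using 1 2 unfolding r_def[symmetric] by (auto simp: linear_def in_Hom)
  qed
  let ?X1 = "(x1, p \<cdot> snd X \<cdot> (Ide K ?a \<boxdot> i))" and ?X2 = "(x2, q \<cdot> snd X \<cdot> (Ide K ?a \<boxdot> j))"
  have "md ?X1 \<and> lin X ?X1 p \<and> lin ?X1 X i" by (rule split) (use l eip in auto)
  moreover have "md ?X2 \<and> lin X ?X2 q \<and> lin ?X2 X j" by (rule split) (use lj in auto)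
  ultimately have "biproduct M ?X1 ?X2 X (?X1, X, i) (?X2, X, j) (X, ?X1, p) (X, ?X2, q) \<and> E = Comp M (?X1, X, i) (X, ?X1, p)"
    using s by (simp add: biproduct_def Mod_Hom eip)
  then show "\<exists>x1 x2 i1 i2 p1 p2. biproduct M x1 x2 X i1 i2 p1 p2 \<and> E = Comp M i1 p1" by blast
qed

section \<open>Algebras as rings in the category of modules\<close>

abbreviation alg where "alg \<equiv> alg_to_mod K A"

definition mdl where "mdl R \<phi> = (Car R, Mul R \<cdot> (\<phi> \<boxdot> Ide K (Car R)))"

lemma fst_mdl [simp]: "fst (mdl R \<phi>) = Car R"
  by (simp add: mdl_def)

lemma mdl_act:
  assumes p: "ring_mor K A R \<phi>"
  shows "\<lbrakk>el u; el x; ob u = Car A; ob x = Car R; disj u x\<rbrakk> \<Longrightarrow> act (mdl R \<phi>) u x = rmul R (app \<phi> u) x"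
    "md (mdl R \<phi>)"
proof -
  note [simp] = ring_mor_typ[OF p] ring_mor_app[OF p]
  show *: "\<lbrakk>el u; el x; ob u = Car A; ob x = Car R; disj u x\<rbrakk> \<Longrightarrow> act (mdl R \<phi>) u x = rmul R (app \<phi> u) x" for u x
    by (simp add: mdl_def)
  show "md (mdl R \<phi>)"
    by (rule is_moduleI[where u = "var 0 (Car A)" and v = "var 1 (Car A)" and m = "var 2 (Car R)"])
      (simp_all add: mdl_def ring_assoc)
qed

definition mmap where
  "mmap R \<phi> = (THE u. u \<in> Hom K (fst (mt (mdl R \<phi>) (mdl R \<phi>))) (Car R) \<and> u \<cdot> qt (mdl R \<phi>) (mdl R \<phi>) = Mul R)"

lemma mmap:
  assumes p: "ring_mor K A R \<phi>"
  shows "arr (mmap R \<phi>)" "Dom K (mmap R \<phi>) = fst (mt (mdl R \<phi>) (mdl R \<phi>))" "Cod K (mmap R \<phi>) = Car R"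
    "\<lbrakk>el x; el y; ob x = Car R; ob y = Car R; disj x y\<rbrakk> \<Longrightarrow> app (mmap R \<phi>) (tn (mdl R \<phi>) (mdl R \<phi>) x y) = rmul R x y"
    "lin (mt (mdl R \<phi>) (mdl R \<phi>)) (mdl R \<phi>) (mmap R \<phi>)"
    "mmap R \<phi> \<cdot> qt (mdl R \<phi>) (mdl R \<phi>) = Mul R"
proof -
  note [simp] = ring_mor_typ[OF p] ring_mor_app[OF p] mdl_act[OF p]
  let ?X = "mdl R \<phi>"
  let ?u = "var 0 (Car A)" and ?x = "var 1 (Car R)" and ?y = "var 2 (Car R)"
  have b: "app (Mul R) (act ?X ?u ?x \<star> ?y) = app (Mul R) (?x \<star> act ?X ?u ?y)"
    by (simp add: ring_ac)
  have e: "mmap R \<phi> = (THE u. u \<in> Hom K (fst (mt ?X ?X)) (Cod K (Mul R)) \<and> u \<cdot> qt ?X ?X = Mul R)"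
    by (simp add: mmap_def)
  have d: "arr (mmap R \<phi>)" "Dom K (mmap R \<phi>) = fst (mt ?X ?X)" "Cod K (mmap R \<phi>) = Cod K (Mul R)" "mmap R \<phi> \<cdot> qt ?X ?X = Mul R"
    "\<lbrakk>el m'; el n'; ob m' = fst ?X; ob n' = fst ?X; disj m' n'\<rbrakk> \<Longrightarrow> app (mmap R \<phi>) (tn ?X ?X m' n') = app (Mul R) (m' \<star> n')" for m' n'
    by (rule descends[OF _ _ _ _ _ _ _ _ _ _ _ _ _ b e]; simp)+
  from d show [simp]: "arr (mmap R \<phi>)" "Dom K (mmap R \<phi>) = fst (mt ?X ?X)" "Cod K (mmap R \<phi>) = Car R" "mmap R \<phi> \<cdot> qt ?X ?X = Mul R"
    by auto
  show **: "\<lbrakk>el x; el y; ob x = Car R; ob y = Car R; disj x y\<rbrakk> \<Longrightarrow> app (mmap R \<phi>) (tn ?X ?X x y) = rmul R x y" for x y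
    using d(5)[of x y] by simp
  show "lin (mt ?X ?X) ?X (mmap R \<phi>)"
    by (rule linearI[where u = ?u and m = "tn ?X ?X ?x ?y"]) (auto simp: ** ring_assoc)
qed

lemma alg_sel:
  assumes "ring_mor K A R \<phi>"
  shows "Car (alg R \<phi>) = mdl R \<phi>" "Mul (alg R \<phi>) = (mt (mdl R \<phi>) (mdl R \<phi>), mdl R \<phi>, mmap R \<phi>)"
    "One (alg R \<phi>) = (U, mdl R \<phi>, \<phi>)"
  by (simp_all add: alg_to_mod_def Let_def descend_def mmap_def mdl_def)

lemma lin_struct:
  assumes p: "ring_mor K A R \<phi>" shows "lin U (mdl R \<phi>) \<phi>"
proof -
  note [simp] = ring_mor_typ[OF p] ring_mor_app[OF p] mdl_act[OF p]
  show ?thesis by (rule linearI[where u = "var 0 (Car A)" and m = "var 1 (Car A)"]) auto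
qed

lemma is_ring_alg:
  assumes p: "ring_mor K A R \<phi>" shows "is_ring M (alg R \<phi>)"
proof -
  let ?X = "mdl R \<phi>" and ?m = "mmap R \<phi>"
  let ?x = "var 1 (Car R)" and ?y = "var 2 (Car R)" and ?z = "var 3 (Car R)" and ?u = "var 0 (Car A)"
  note s = alg_sel[OF p]
  have l [simp]: "lin ?X ?X (Ide K (Car R))" using lin_ide[OF mdl_act(2)[OF p]] by simp
  note [simp] = ring_mor_typ[OF p] ring_mor_app[OF p] mdl_act[OF p] mmap[OF p] lin_struct[OF p] lmap rmap smap amap
    tmap[OF mmap(5)[OF p] l] tmap[OF l mmap(5)[OF p]] tmap[OF lin_struct[OF p] l] tmap[OF l lin_struct[OF p]]
  have 1: "?m \<cdot> tmap (mt ?X ?X) ?X ?X ?X ?m (Ide K (Car R)) = ?m \<cdot> tmap ?X ?X (mt ?X ?X) ?X (Ide K (Car R)) ?m \<cdot> amap ?X ?X ?X"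
    by (rule ext[of _ "tn (mt ?X ?X) ?X (tn ?X ?X ?x ?y) ?z"]) (auto simp: ring_assoc)
  have 2: "?m \<cdot> tmap U ?X ?X ?X \<phi> (Ide K (Car R)) = lmap ?X"
    by (rule ext[of _ "tn U ?X ?u ?x"]) auto
  have 3: "?m \<cdot> tmap ?X ?X U ?X (Ide K (Car R)) \<phi> = rmap ?X"
    by (rule ext[of _ "tn ?X U ?x ?u"]) (auto simp: ring_ac)
  have 4: "?m \<cdot> smap ?X ?X = ?m"
    by (rule ext[of _ "tn ?X ?X ?x ?y"]) (auto simp: ring_ac)
  show ?thesis using 1 2 3 4 by (simp add: is_ring_def s Let_def Mod_Hom)
qed

text \<open>Composition with the quotient map turns the multiplication over \<open>A\<close> into
  one in \<open>K\<close>. The unit law of \<open>C\<close> forces the action of \<open>A\<close> to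
  be multiplication by the structure map, so the algebra obtained gives back \<open>C\<close> on the
  nose and rings in \<open>Mod\<close> may be replaced by algebras through rewriting.\<close>

lemma ring_Mod_alg:
  assumes C: "is_ring M C"
  shows "ring_mor K A (mod_to_ring K A C) (und (One C))" "alg (mod_to_ring K A C) (und (One C)) = C"
proof -
  define X where "X = Car C"
  have X [simp]: "md X" using C by (simp add: is_ring_def Let_def X_def)
  have "Mul C \<in> Hom M (mt X X) X" "One C \<in> Hom M U X" using C by (simp_all add: is_ring_def Let_def X_def)
  then obtain m \<phi> where m: "Mul C = (mt X X, X, m)" and o: "One C = (U, X, \<phi>)" and lm: "lin (mt X X) X m" and lp: "lin U X \<phi>"
    unfolding Mod_Hom by blast
  have l [simp]: "lin X X (Ide K (fst X))" by simp
  note [simp] = linear_typ[OF lm] linear_typ[OF lp] lin_app[OF lm] lin_app[OF lp] lmap smap amap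
     tmap[OF lm l] tmap[OF l lm] tmap[OF lp l]
  have 1: "m \<cdot> tmap (mt X X) X X X m (Ide K (fst X)) = m \<cdot> tmap X X (mt X X) X (Ide K (fst X)) m \<cdot> amap X X X"
    and 2: "m \<cdot> tmap U X X X \<phi> (Ide K (fst X)) = lmap X" and 3: "m \<cdot> smap X X = m"
    using C by (simp_all add: is_ring_def Let_def flip: X_def) (simp_all add: m o)
  define R where "R = mod_to_ring K A C"
  have R: "Car R = fst X" "Mul R = m \<cdot> qt X X" "One R = \<phi> \<cdot> One A"
    by (simp_all add: R_def mod_to_ring_def m o flip: X_def)
  note [simp] = R
  have as: "app m (tn X X (app m (tn X X x y)) z) = app m (tn X X x (app m (tn X X y z)))"
    if "el x" "el y" "el z" "ob x = fst X" "ob y = fst X" "ob z = fst X" "disj x y" "disj x z" "disj y z" for x y z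
    using arg_cong[OF 1, of "\<lambda>f. app f (tn (mt X X) X (tn X X x y) z)"] that by simp
  have un: "app m (tn X X (app \<phi> u) x) = act X u x"
    if "el x" "el u" "ob x = fst X" "ob u = Car A" "disj u x" for x u
    using arg_cong[OF 2, of "\<lambda>f. app f (tn U X u x)"] that by simp
  have cm: "app m (tn X X y x) = app m (tn X X x y)"
    if "el x" "el y" "ob x = fst X" "ob y = fst X" "disj x y" for x y
    using arg_cong[OF 3, of "\<lambda>f. app f (tn X X x y)"] that by simp
  have r: "is_ring K R"
    by (rule is_ringI[where a = "var 0 (fst X)" and b = "var 1 (fst X)" and c = "var 2 (fst X)"])
      (use cm[of "var 0 (fst X)" "var 1 (fst X)"] in \<open>simp_all add: as un\<close>)
  have pm: "ring_mor K A R \<phi>"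
    by (rule ring_morI[where a = "var 0 (Car A)" and b = "var 1 (Car A)"]) (use r lin_app[OF lp, of "var 0 (Car A)" "var 1 (Car A)"] in \<open>auto simp: un\<close>)
  show "ring_mor K A (mod_to_ring K A C) (und (One C))" using pm by (simp add: R_def[symmetric] o del: R)
  have X': "mdl R \<phi> = X"
  proof -
    have "m \<cdot> qt X X \<cdot> (\<phi> \<boxdot> Ide K (fst X)) = snd X"
      by (rule ext[of _ "var 0 (Car A) \<star> var 1 (fst X)"]) (auto simp: un)
    then show ?thesis by (simp add: mdl_def prod_eq_iff)
  qed
  have "mmap R \<phi> = m"
  proof (rule ext[of _ "tn X X (var 0 (fst X)) (var 1 (fst X))"])
    show "app (mmap R \<phi>) (tn X X (var 0 (fst X)) (var 1 (fst X))) = app m (tn X X (var 0 (fst X)) (var 1 (fst X)))"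
      using mmap(4)[OF pm, of "var 0 (fst X)" "var 1 (fst X)"] by (simp add: X')
  qed (use mmap[OF pm] in \<open>auto simp: X'\<close>)
  then have "alg R \<phi> = C" using alg_sel[OF pm] m o X' by (simp add: X_def)
  then show "alg (mod_to_ring K A C) (und (One C)) = C" by (simp add: R_def[symmetric] o)
qed

text \<open>A multiplicative arrow that respects the structure maps is automatically linear, the
  action being multiplication by scalars; and preserving the unit in \<open>Mod\<close> is the same
  as respecting the structure maps.\<close>

lemma ring_mor_alg:
  assumes p: "ring_mor K A R \<phi>" and q: "ring_mor K A S \<psi>"
  shows "ring_mor M (alg R \<phi>) (alg S \<psi>) F \<longleftrightarrow> (\<exists>f. F = (mdl R \<phi>, mdl S \<psi>, f) \<and> ring_mor K R S f \<and> f \<cdot> \<phi> = \<psi>)"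
proof
  let ?X = "mdl R \<phi>" and ?Y = "mdl S \<psi>"
  note [simp] = ring_mor_typ[OF p] ring_mor_typ[OF q] mdl_act[OF p] mdl_act[OF q] mmap[OF p] mmap[OF q]
  let ?x = "var 0 (Car R)" and ?y = "var 1 (Car R)"
  { assume F: "ring_mor M (alg R \<phi>) (alg S \<psi>) F"
    then have "F \<in> Hom M ?X ?Y" by (simp add: ring_mor_def alg_sel[OF p] alg_sel[OF q])
    then obtain f where f: "F = (?X, ?Y, f)" and l: "lin ?X ?Y f" unfolding Mod_Hom by blast
    note [simp] = linear_typ[OF l] tmap[OF l l]
    have 1: "f \<cdot> mmap R \<phi> = mmap S \<psi> \<cdot> tmap ?X ?Y ?X ?Y f f" and 2: "f \<cdot> \<phi> = \<psi>"
      using F by (simp_all add: ring_mor_def alg_sel[OF p] alg_sel[OF q] f)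
    have "app (f \<cdot> mmap R \<phi>) (tn ?X ?X ?x ?y) = app (mmap S \<psi> \<cdot> tmap ?X ?Y ?X ?Y f f) (tn ?X ?X ?x ?y)" by (simp only: 1)
    then have m: "app f (rmul R ?x ?y) = rmul S (app f ?x) (app f ?y)" by simp
    have "f \<cdot> One R = (f \<cdot> \<phi>) \<cdot> One A" by simp
    then have "f \<cdot> One R = One S" unfolding 2 by simp
    then have "app f (rone R) = rone S" using app_comp[of pt "One R" f] by simp
    with m have "ring_mor K R S f"
      by (intro ring_morI[where a = ?x and b = ?y]) auto
    with f 2 show "\<exists>f. F = (?X, ?Y, f) \<and> ring_mor K R S f \<and> f \<cdot> \<phi> = \<psi>" by blast }
  { assume "\<exists>f. F = (?X, ?Y, f) \<and> ring_mor K R S f \<and> f \<cdot> \<phi> = \<psi>"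
    then obtain f where f: "F = (?X, ?Y, f)" and r: "ring_mor K R S f" and fp: "f \<cdot> \<phi> = \<psi>" by blast
    note [simp] = ring_mor_typ[OF r] ring_mor_app[OF r]
    have fpa: "app f (app \<phi> u) = app \<psi> u" if "el u" "ob u = Car A" for u
      using arg_cong[OF fp, of "\<lambda>f. app f u"] that by simp
    have l: "lin ?X ?Y f"
      by (rule linearI[where u = "var 0 (Car A)" and m = "var 1 (Car R)"]) (auto simp: fpa)
    note [simp] = tmap[OF l l]
    have "f \<cdot> mmap R \<phi> = mmap S \<psi> \<cdot> tmap ?X ?Y ?X ?Y f f"
      by (rule ext[of _ "tn ?X ?X ?x ?y"]) auto
    then show "ring_mor M (alg R \<phi>) (alg S \<psi>) F"
      using is_ring_alg[OF p] is_ring_alg[OF q] l fp by (simp add: ring_mor_def alg_sel[OF p] alg_sel[OF q] f Mod_Hom) }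
qed

lemma nonzero_alg:
  assumes p: "ring_mor K A R \<phi>" shows "nonzero M (alg R \<phi>) \<longleftrightarrow> nonzero K R"
  using Mod_zero_object[OF mdl_act(2)[OF p]] by (simp add: nonzero_def alg_sel[OF p])

lemma unit_ring_alg: "unit_ring M = alg A (Ide K (Car A))"
proof -
  have p: "ring_mor K A A (Ide K (Car A))" by (rule ring_mor_ide) simp
  have X: "mdl A (Ide K (Car A)) = U" by (simp add: mdl_def)
  have "lmap U = mmap A (Ide K (Car A))" by (simp add: lmap_def mmap_def X)
  then have "Car (unit_ring M) = Car (alg A (Ide K (Car A)))" "Mul (unit_ring M) = Mul (alg A (Ide K (Car A)))"
    "One (unit_ring M) = One (alg A (Ide K (Car A)))"
    unfolding alg_sel[OF p] X by (simp_all add: unit_ring_def)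
  then show ?thesis by simp
qed

text \<open>Both multiplications are the descent of (a \<otimes> x)(b \<otimes> y) = ab \<otimes>
  xy. The ring data are equal, not merely isomorphic, so statements on algebras transfer to
  \<open>ext_ring\<close> by rewriting.\<close>

lemma ext_ring_alg:
  assumes R [simp]: "is_ring K R" shows "ext_ring K A R = alg (tens_ring K A R) (inl A R)"
proof -
  let ?W = "tens_ring K A R" and ?X = "mdl (tens_ring K A R) (inl A R)"
  have p: "ring_mor K A ?W (inl A R)" by (rule inl_mor) auto
  note [simp] = mdl_act[OF p]
  have "(Mul A \<boxdot> Ide K (Car R)) \<cdot> inv_arr K (Assoc K (Car A) (Car A) (Car R)) = snd ?X"
    unfolding mdl_def by (rule ext[of _ "var 0 (Car A) \<star> (var 1 (Car A) \<star> var 2 (Car R))"]) auto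
  then have X: "ext_obj K A (Car R) = ?X" by (simp add: ext_obj_def prod_eq_iff)
  let ?k = "(Mul A \<boxdot> Ide K (Car R \<boxtimes> Car R)) \<cdot> mid_swap K (Car A) (Car R) (Car A) (Car R)"
  let ?Y = "ext_obj K A (Car R \<boxtimes> Car R)"
  let ?x = "var 1 (Car A) \<star> var 2 (Car R)" and ?y = "var 3 (Car A) \<star> var 4 (Car R)" and ?u = "var 0 (Car A)"
  have b: "app ?k (act ?X ?u ?x \<star> ?y) = app ?k (?x \<star> act ?X ?u ?y)"
    by (simp add: ring_ac)
  define t where "t = (THE u. u \<in> Hom K (fst (mt ?X ?X)) (Cod K ?k) \<and> u \<cdot> qt ?X ?X = ?k)"
  have d: "arr t" "Dom K t = fst (mt ?X ?X)" "Cod K t = Cod K ?k" "t \<cdot> qt ?X ?X = ?k"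
    by (rule descends[OF _ _ _ _ _ _ _ _ _ _ _ _ _ b t_def]; simp)+
  have t: "ext_tens K A (Car R) (Car R) = (mt ?X ?X, ?Y, t)"
    unfolding ext_tens_def X descend_def t_def by (simp add: ext_obj_def)
  note [simp] = d(1-2) d(3)[simplified]
  have "((Ide K (Car A) \<boxdot> Mul R) \<cdot> t) \<cdot> qt ?X ?X = Mul ?W"
    by (rule ext[of _ "?x \<star> ?y"]) (use d(4) arg_cong[OF d(4), of "\<lambda>f. app f (?x \<star> ?y)"] in \<open>auto\<close>)
  moreover have "mmap ?W (inl A R) \<cdot> qt ?X ?X = Mul ?W" using mmap[OF p] by simp
  ultimately have "app (((Ide K (Car A) \<boxdot> Mul R) \<cdot> t) \<cdot> qt ?X ?X) (?x \<star> ?y) = app (mmap ?W (inl A R) \<cdot> qt ?X ?X) (?x \<star> ?y)"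
    by metis
  moreover have g: "gen (tn ?X ?X ?x ?y)" by simp
  ultimately have "(Ide K (Car A) \<boxdot> Mul R) \<cdot> t = mmap ?W (inl A R)"
    using mmap(1-3)[OF p] by (intro ext[OF _ g]) auto
  then have "Mul (ext_ring K A R) = Mul (alg ?W (inl A R))"
    by (simp add: ext_ring_def alg_sel[OF p] t ext_arr_def X Mod_sel(5))
  moreover have "One (ext_ring K A R) = (U, ?X, inl A R)"
    by (simp add: ext_ring_def ext_arr_def ext_unit_def X inl_def Mod_sel(5))
  then have "One (ext_ring K A R) = One (alg ?W (inl A R))" by (simp add: alg_sel[OF p])
  moreover have "Car (ext_ring K A R) = Car (alg ?W (inl A R))"
    by (simp add: ext_ring_def alg_sel[OF p] X)
  ultimately show ?thesis by simp
qed

lemma app_inv_amap [simp]: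
  assumes [simp]: "md X" "md Y" "md V" "el m" "el n" "el p" "ob m = fst X" "ob n = fst Y" "ob p = fst V" "disj m n" "disj m p" "disj n p"
  shows "app (inv_arr K (amap X Y V)) (tn X (mt Y V) m (tn Y V n p)) = tn (mt X Y) V (tn X Y m n) p"
proof -
  have "app (inv_arr K (amap X Y V)) (app (amap X Y V) (tn (mt X Y) V (tn X Y m n) p)) = tn (mt X Y) V (tn X Y m n) p"
    by (rule app_inv) (simp_all add: amap_iso amap)
  then show ?thesis by (simp add: amap del: app_inv)
qed

lemma inv_amap [simp]:
  assumes [simp]: "md X" "md Y" "md V"
  shows "arr (inv_arr K (amap X Y V))" "Dom K (inv_arr K (amap X Y V)) = fst (mt X (mt Y V))" "Cod K (inv_arr K (amap X Y V)) = fst (mt (mt X Y) V)"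
  using amap_iso[of X Y V] amap[of X Y V] by simp_all

text \<open>The identities are stated for arrows because they are evaluated at \<sigma>(x), which
  need not be a simple tensor.\<close>

lemma mul_assoc_Mod:
  assumes p: "ring_mor K A R \<phi>"
  shows "tmap (mdl R \<phi>) (mdl R \<phi>) (mt (mdl R \<phi>) (mdl R \<phi>)) (mdl R \<phi>) (Ide K (Car R)) (mmap R \<phi>) \<cdot> amap (mdl R \<phi>) (mdl R \<phi>) (mdl R \<phi>) \<cdot>
      qt (mt (mdl R \<phi>) (mdl R \<phi>)) (mdl R \<phi>) \<cdot> (qt (mdl R \<phi>) (mdl R \<phi>) \<boxdot> Ide K (Car R))
     = qt (mdl R \<phi>) (mdl R \<phi>) \<cdot> (Ide K (Car R) \<boxdot> Mul R) \<cdot> Assoc K (Car R) (Car R) (Car R)" (is ?a)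
    and "tmap (mt (mdl R \<phi>) (mdl R \<phi>)) (mdl R \<phi>) (mdl R \<phi>) (mdl R \<phi>) (mmap R \<phi>) (Ide K (Car R)) \<cdot> inv_arr K (amap (mdl R \<phi>) (mdl R \<phi>) (mdl R \<phi>)) \<cdot>
      qt (mdl R \<phi>) (mt (mdl R \<phi>) (mdl R \<phi>)) \<cdot> (Ide K (Car R) \<boxdot> qt (mdl R \<phi>) (mdl R \<phi>))
     = qt (mdl R \<phi>) (mdl R \<phi>) \<cdot> (Mul R \<boxdot> Ide K (Car R)) \<cdot> inv_arr K (Assoc K (Car R) (Car R) (Car R))" (is ?b)
proof -
  have l [simp]: "lin (mdl R \<phi>) (mdl R \<phi>) (Ide K (Car R))" using lin_ide[OF mdl_act(2)[OF p]] by simp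
  note [simp] = ring_mor_typ[OF p] mdl_act[OF p] mmap[OF p] amap tmap[OF l mmap(5)[OF p]] tmap[OF mmap(5)[OF p] l]
  let ?x = "var 0 (Car R)" and ?y = "var 1 (Car R)" and ?z = "var 2 (Car R)"
  show ?a by (rule ext[of _ "(?x \<star> ?y) \<star> ?z"]) auto
  show ?b by (rule ext[of _ "?x \<star> (?y \<star> ?z)"]) auto
qed

text \<open>The section over \<open>A\<close> is a section in \<open>K\<close> followed by the
  quotient map to the tensor product over \<open>A\<close>.\<close>

lemma separable_alg:
  assumes p: "ring_mor K A R \<phi>" and R: "separable_ring K R"
  shows "separable_ring M (alg R \<phi>)"
proof -
  let ?X = "mdl R \<phi>" and ?r = "Car R"
  let ?u = "var 0 (Car A)" and ?x = "var 1 ?r" and ?y = "var 2 ?r"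
  have l [simp]: "lin ?X ?X (Ide K ?r)" using lin_ide[OF mdl_act(2)[OF p]] by simp
  note [simp] = ring_mor_typ[OF p] mdl_act[OF p] mmap[OF p] amap tmap[OF l mmap(5)[OF p]] tmap[OF mmap(5)[OF p] l]
  obtain \<sigma> where s0: "\<sigma> \<in> Hom K ?r (?r \<boxtimes> ?r)" and s1: "Mul R \<cdot> \<sigma> = Ide K ?r"
    and s2: "(Ide K ?r \<boxdot> Mul R) \<cdot> Assoc K ?r ?r ?r \<cdot> (\<sigma> \<boxdot> Ide K ?r) = \<sigma> \<cdot> Mul R"
    and s3: "\<sigma> \<cdot> Mul R = (Mul R \<boxdot> Ide K ?r) \<cdot> inv_arr K (Assoc K ?r ?r ?r) \<cdot> (Ide K ?r \<boxdot> \<sigma>)"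
    using R by (auto simp: separable_ring_def Let_def)
  have [simp]: "arr \<sigma>" "Dom K \<sigma> = ?r" "Cod K \<sigma> = ?r \<boxtimes> ?r" using s0 by (auto simp: in_Hom)
  define f where "f = qt ?X ?X \<cdot> \<sigma>"
  have [simp]: "arr f" "Dom K f = ?r" "Cod K f = fst (mt ?X ?X)" by (simp_all add: f_def)
  have fa: "app f x = app (qt ?X ?X) (app \<sigma> x)" if "el x" "ob x = ?r" for x using that by (simp add: f_def)
  have s2a: "app (Ide K ?r \<boxdot> Mul R) (app (Assoc K ?r ?r ?r) (app \<sigma> x \<star> y)) = app \<sigma> (rmul R x y)"
    if "el x" "ob x = ?r" "el y" "ob y = ?r" "disj x y" for x y
    using arg_cong[OF s2, of "\<lambda>f. app f (x \<star> y)"] that by simp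
  have s3a: "app (Mul R \<boxdot> Ide K ?r) (app (inv_arr K (Assoc K ?r ?r ?r)) (x \<star> app \<sigma> y)) = app \<sigma> (rmul R x y)"
    if "el x" "ob x = ?r" "el y" "ob y = ?r" "disj x y" for x y
    using arg_cong[OF s3, of "\<lambda>f. app f (x \<star> y)"] that by simp
  have aq: "snd (mt ?X ?X) \<cdot> (Ide K (Car A) \<boxdot> qt ?X ?X) = qt ?X ?X \<cdot> (Mul R \<boxdot> Ide K ?r) \<cdot> inv_arr K (Assoc K ?r ?r ?r) \<cdot> (\<phi> \<boxdot> Ide K (?r \<boxtimes> ?r))"
    by (rule ext[of _ "?u \<star> (?x \<star> ?y)"]) auto
  have lf: "lin ?X (mt ?X ?X) f"
  proof (rule linearI[where u = ?u and m = ?x])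
    have "app (snd (mt ?X ?X) \<cdot> (Ide K (Car A) \<boxdot> qt ?X ?X)) (?u \<star> app \<sigma> ?x) = app (qt ?X ?X \<cdot> (Mul R \<boxdot> Ide K ?r) \<cdot> inv_arr K (Assoc K ?r ?r ?r) \<cdot> (\<phi> \<boxdot> Ide K (?r \<boxtimes> ?r))) (?u \<star> app \<sigma> ?x)"
      by (simp only: aq)
    then show "app f (act ?X ?u ?x) = act (mt ?X ?X) ?u (app f ?x)" by (simp add: fa s3a)
  qed auto
  note [simp] = tmap[OF lf l] tmap[OF l lf]
  have m1: "mmap R \<phi> \<cdot> f = Ide K ?r"
    unfolding f_def by (simp add: comp_eq[OF mmap(6)[OF p]] s1)
  have m2: "tmap ?X ?X (mt ?X ?X) ?X (Ide K ?r) (mmap R \<phi>) \<cdot> amap ?X ?X ?X \<cdot> tmap ?X (mt ?X ?X) ?X ?X f (Ide K ?r) = f \<cdot> mmap R \<phi>"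
  proof (rule ext[of _ "tn ?X ?X ?x ?y"])
    show "app (tmap ?X ?X (mt ?X ?X) ?X (Ide K ?r) (mmap R \<phi>) \<cdot> amap ?X ?X ?X \<cdot> tmap ?X (mt ?X ?X) ?X ?X f (Ide K ?r)) (tn ?X ?X ?x ?y)
        = app (f \<cdot> mmap R \<phi>) (tn ?X ?X ?x ?y)"
      using arg_cong[OF mul_assoc_Mod(1)[OF p], of "\<lambda>f. app f (app \<sigma> ?x \<star> ?y)"] by (simp add: fa s2a)
  qed auto
  have m3: "f \<cdot> mmap R \<phi> = tmap (mt ?X ?X) ?X ?X ?X (mmap R \<phi>) (Ide K ?r) \<cdot> inv_arr K (amap ?X ?X ?X) \<cdot> tmap ?X ?X ?X (mt ?X ?X) (Ide K ?r) f"
  proof (rule ext[of _ "tn ?X ?X ?x ?y"])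
    show "app (f \<cdot> mmap R \<phi>) (tn ?X ?X ?x ?y) = app (tmap (mt ?X ?X) ?X ?X ?X (mmap R \<phi>) (Ide K ?r) \<cdot> inv_arr K (amap ?X ?X ?X) \<cdot> tmap ?X ?X ?X (mt ?X ?X) (Ide K ?r) f) (tn ?X ?X ?x ?y)"
      using arg_cong[OF mul_assoc_Mod(2)[OF p], of "\<lambda>f. app f (?x \<star> app \<sigma> ?y)"] by (simp add: fa s3a)
  qed auto
  have ia: "inv_arr M (mt (mt ?X ?X) ?X, mt ?X (mt ?X ?X), amap ?X ?X ?X) = (mt ?X (mt ?X ?X), mt (mt ?X ?X) ?X, inv_arr K (amap ?X ?X ?X))"
    by (rule iso_Mod(2)) (simp_all add: amap_iso)
  show ?thesis unfolding separable_ring_def Let_def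
    using is_ring_alg[OF p] m1 m2 m3 lf
    by (intro conjI bexI[of _ "(?X, mt ?X ?X, f)"]) (simp_all add: alg_sel[OF p] Mod_Hom ia)
qed

text \<open>Separability is transitive: a section over the separable \<open>A\<close> is lifted to R
  \<otimes> R by the section \<open>s\<close> of the quotient map. Since \<open>s\<close> comes from
  the action of \<epsilon>, it is compatible with multiplication by \<open>R\<close> on the outer
  sides, and the lift stays bilinear.\<close>

lemma separable_of_alg:
  assumes p: "ring_mor K A R \<phi>" and R: "separable_ring M (alg R \<phi>)"
  shows "separable_ring K R"
proof -
  let ?X = "mdl R \<phi>" and ?r = "Car R"
  let ?u = "var 0 (Car A)" and ?v = "var 3 (Car A)" and ?x = "var 5 ?r" and ?y = "var 2 ?r" and ?z = "var 4 ?r"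
  have l [simp]: "lin ?X ?X (Ide K ?r)" using lin_ide[OF mdl_act(2)[OF p]] by simp
  note [simp] = ring_mor_typ[OF p] mdl_act[OF p] mmap[OF p] amap tmap[OF l mmap(5)[OF p]] tmap[OF mmap(5)[OF p] l]
  have ia: "inv_arr M (mt (mt ?X ?X) ?X, mt ?X (mt ?X ?X), amap ?X ?X ?X) = (mt ?X (mt ?X ?X), mt (mt ?X ?X) ?X, inv_arr K (amap ?X ?X ?X))"
    by (rule iso_Mod(2)) (simp_all add: amap_iso)
  obtain F where F: "F \<in> Hom M ?X (mt ?X ?X)" and F1: "Comp M (Mul (alg R \<phi>)) F = Ide M ?X"
    and F2: "Comp M (Comp M (TensA M (Ide M ?X) (Mul (alg R \<phi>))) (Assoc M ?X ?X ?X)) (TensA M F (Ide M ?X)) = Comp M F (Mul (alg R \<phi>))"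
    and F3: "Comp M F (Mul (alg R \<phi>)) = Comp M (Comp M (TensA M (Mul (alg R \<phi>)) (Ide M ?X)) (inv_arr M (Assoc M ?X ?X ?X))) (TensA M (Ide M ?X) F)"
    using R unfolding separable_ring_def Let_def alg_sel(1)[OF p] Mod_sel(9) by blast
  obtain f where f: "F = (?X, mt ?X ?X, f)" and lf: "lin ?X (mt ?X ?X) f" using F unfolding Mod_Hom by blast
  note [simp] = tmap[OF lf l] tmap[OF l lf] linear_typ[OF lf]
  have m1: "mmap R \<phi> \<cdot> f = Ide K ?r" using F1 by (simp add: f alg_sel[OF p])
  have m2: "tmap ?X ?X (mt ?X ?X) ?X (Ide K ?r) (mmap R \<phi>) \<cdot> amap ?X ?X ?X \<cdot> tmap ?X (mt ?X ?X) ?X ?X f (Ide K ?r) = f \<cdot> mmap R \<phi>"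
    using F2 by (simp add: f alg_sel[OF p])
  have m3: "f \<cdot> mmap R \<phi> = tmap (mt ?X ?X) ?X ?X ?X (mmap R \<phi>) (Ide K ?r) \<cdot> inv_arr K (amap ?X ?X ?X) \<cdot> tmap ?X ?X ?X (mt ?X ?X) (Ide K ?r) f"
    using F3 by (simp add: f alg_sel[OF p] ia)
  have m2a: "app (tmap ?X ?X (mt ?X ?X) ?X (Ide K ?r) (mmap R \<phi>)) (app (amap ?X ?X ?X) (tn (mt ?X ?X) ?X (app f ?x) ?y)) = app f (rmul R ?x ?y)"
    using arg_cong[OF m2, of "\<lambda>f. app f (tn ?X ?X ?x ?y)"] by simp
  have m3a: "app f (rmul R ?x ?y) = app (tmap (mt ?X ?X) ?X ?X ?X (mmap R \<phi>) (Ide K ?r)) (app (inv_arr K (amap ?X ?X ?X)) (tn ?X (mt ?X ?X) ?x (app f ?y)))"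
    using arg_cong[OF m3, of "\<lambda>f. app f (tn ?X ?X ?x ?y)"] by simp
  obtain s where s [simp]: "arr s" "Dom K s = fst (mt ?X ?X)" "Cod K s = ?r \<boxtimes> ?r" "s \<cdot> qt ?X ?X = bal ?X ?X" "qt ?X ?X \<cdot> s = Ide K (fst (mt ?X ?X))"
    using ex_section[of ?X ?X] by auto
  have sa: "app s (tn ?X ?X x y) = app (bal ?X ?X) (x \<star> y)" if "el x" "el y" "ob x = ?r" "ob y = ?r" "disj x y" for x y
  proof -
    have "app (s \<cdot> qt ?X ?X) (x \<star> y) = app s (tn ?X ?X x y)" using that by (intro app_comp) auto
    then show ?thesis by (simp only: s(4))
  qed
  have g: "gen (tn ?X ?X ?x ?y)" by simp
  \<comment> \<open>The action of u \<otimes> v on two factors commutes with multiplying on the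
    right, (ux \<otimes> vy) z = ux \<otimes> v(yz). It is proved for variables u and v as an
    equation of arrows, and \<epsilon>, no simple tensor in general, is inserted afterwards.\<close>
  have c1: "(Ide K ?r \<boxdot> Mul R) \<cdot> Assoc K ?r ?r ?r \<cdot> (act2 ?X ?X \<boxdot> Ide K ?r)
     = act2 ?X ?X \<cdot> (Ide K (Car A \<boxtimes> Car A) \<boxdot> ((Ide K ?r \<boxdot> Mul R) \<cdot> Assoc K ?r ?r ?r)) \<cdot> Assoc K (Car A \<boxtimes> Car A) (?r \<boxtimes> ?r) ?r"
    by (rule ext[of _ "((?u \<star> ?v) \<star> (?x \<star> ?y)) \<star> ?z"]) (auto simp: ring_assoc)
  have b1: "(Ide K ?r \<boxdot> Mul R) \<cdot> Assoc K ?r ?r ?r \<cdot> (s \<boxdot> Ide K ?r) = s \<cdot> tmap ?X ?X (mt ?X ?X) ?X (Ide K ?r) (mmap R \<phi>) \<cdot> amap ?X ?X ?X \<cdot> qt (mt ?X ?X) ?X"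
  proof (rule ext[of _ "tn ?X ?X ?x ?y \<star> ?z"])
    show "app ((Ide K ?r \<boxdot> Mul R) \<cdot> Assoc K ?r ?r ?r \<cdot> (s \<boxdot> Ide K ?r)) (tn ?X ?X ?x ?y \<star> ?z)
      = app (s \<cdot> tmap ?X ?X (mt ?X ?X) ?X (Ide K ?r) (mmap R \<phi>) \<cdot> amap ?X ?X ?X \<cdot> qt (mt ?X ?X) ?X) (tn ?X ?X ?x ?y \<star> ?z)"
      using arg_cong[OF c1, of "\<lambda>f. app f ((app eps pt \<star> (?x \<star> ?y)) \<star> ?z)"] by (simp add: sa)
  qed auto
  have c2: "(Mul R \<boxdot> Ide K ?r) \<cdot> inv_arr K (Assoc K ?r ?r ?r) \<cdot> (Ide K ?r \<boxdot> act2 ?X ?X) \<cdot> Assoc K ?r (Car A \<boxtimes> Car A) (?r \<boxtimes> ?r) \<cdot> (Swap K (Car A \<boxtimes> Car A) ?r \<boxdot> Ide K (?r \<boxtimes> ?r))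
     = act2 ?X ?X \<cdot> (Ide K (Car A \<boxtimes> Car A) \<boxdot> ((Mul R \<boxdot> Ide K ?r) \<cdot> inv_arr K (Assoc K ?r ?r ?r))) \<cdot> Assoc K (Car A \<boxtimes> Car A) ?r (?r \<boxtimes> ?r)"
    by (rule ext[of _ "((?u \<star> ?v) \<star> ?x) \<star> (?y \<star> ?z)"]) (auto simp: ring_ac)
  have b2: "(Mul R \<boxdot> Ide K ?r) \<cdot> inv_arr K (Assoc K ?r ?r ?r) \<cdot> (Ide K ?r \<boxdot> s) = s \<cdot> tmap (mt ?X ?X) ?X ?X ?X (mmap R \<phi>) (Ide K ?r) \<cdot> inv_arr K (amap ?X ?X ?X) \<cdot> qt ?X (mt ?X ?X)"
  proof (rule ext[of _ "?z \<star> tn ?X ?X ?x ?y"])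
    show "app ((Mul R \<boxdot> Ide K ?r) \<cdot> inv_arr K (Assoc K ?r ?r ?r) \<cdot> (Ide K ?r \<boxdot> s)) (?z \<star> tn ?X ?X ?x ?y)
      = app (s \<cdot> tmap (mt ?X ?X) ?X ?X ?X (mmap R \<phi>) (Ide K ?r) \<cdot> inv_arr K (amap ?X ?X ?X) \<cdot> qt ?X (mt ?X ?X)) (?z \<star> tn ?X ?X ?x ?y)"
      using arg_cong[OF c2, of "\<lambda>f. app f ((app eps pt \<star> ?z) \<star> (?x \<star> ?y))"] by (simp add: sa)
  qed auto
  define \<sigma> where "\<sigma> = s \<cdot> f"
  have [simp]: "arr \<sigma>" "Dom K \<sigma> = ?r" "Cod K \<sigma> = ?r \<boxtimes> ?r" by (simp_all add: \<sigma>_def)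
  have fa: "app \<sigma> x = app s (app f x)" if "el x" "ob x = ?r" for x using that by (simp add: \<sigma>_def)
  have "Mul R \<cdot> s = mmap R \<phi>"
    unfolding mmap(6)[OF p, symmetric] by (simp del: mmap(6)[OF p])
  then have "Mul R \<cdot> \<sigma> = mmap R \<phi> \<cdot> f"
    unfolding \<sigma>_def using comp_eq[of "Mul R" s "mmap R \<phi>" f] by simp
  then have 1: "Mul R \<cdot> \<sigma> = Ide K ?r" using m1 by simp
  have 2: "(Ide K ?r \<boxdot> Mul R) \<cdot> Assoc K ?r ?r ?r \<cdot> (\<sigma> \<boxdot> Ide K ?r) = \<sigma> \<cdot> Mul R"
  proof (rule ext[of _ "?x \<star> ?y"])
    show "app ((Ide K ?r \<boxdot> Mul R) \<cdot> Assoc K ?r ?r ?r \<cdot> (\<sigma> \<boxdot> Ide K ?r)) (?x \<star> ?y) = app (\<sigma> \<cdot> Mul R) (?x \<star> ?y)"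
      using arg_cong[OF b1, of "\<lambda>h. app h (app f ?x \<star> ?y)"] by (simp add: fa m2a)
  qed auto
  have 3: "\<sigma> \<cdot> Mul R = (Mul R \<boxdot> Ide K ?r) \<cdot> inv_arr K (Assoc K ?r ?r ?r) \<cdot> (Ide K ?r \<boxdot> \<sigma>)"
  proof (rule ext[of _ "?x \<star> ?y"])
    show "app (\<sigma> \<cdot> Mul R) (?x \<star> ?y) = app ((Mul R \<boxdot> Ide K ?r) \<cdot> inv_arr K (Assoc K ?r ?r ?r) \<cdot> (Ide K ?r \<boxdot> \<sigma>)) (?x \<star> ?y)"
      using arg_cong[OF b2, of "\<lambda>h. app h (?x \<star> app f ?y)"] by (simp add: fa m3a)
  qed auto
  show ?thesis using 1 2 3 by (auto simp: separable_ring_def Let_def in_Hom intro!: bexI[of _ \<sigma>])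
qed

end

section \<open>Transport of products along isomorphisms, and the unit ring\<close>

context idempotent_complete_smc
begin

lemma direct_sum_iso:
  assumes ds: "direct_sum K I X r p" and hi: "iso h" and c: "Cod K h = r"
  shows "direct_sum K I X (Dom K h) (\<lambda>i. p i \<cdot> h)"
proof -
  note [simp] = iso_arr[OF hi] hi c
  let ?w = "Dom K h"
  from ds have I: "finite I" and r [simp]: "r \<in> Obj K" and pX: "\<forall>i\<in>I. X i \<in> Obj K \<and> p i \<in> Hom K r (X i)"
    by (auto simp: direct_sum_def)
  from ds obtain \<iota> where \<iota>': "\<forall>i\<in>I. \<iota> i \<in> Hom K (X i) r"
    and d': "\<forall>i\<in>I. \<forall>j\<in>I. p j \<cdot> \<iota> i = (if i = j then Ide K (X i) else Z (X i) (X j))"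
    and s: "finprod (hom_group K r r) (\<lambda>i. \<iota> i \<cdot> p i) I = Ide K r"
    unfolding direct_sum_def by blast
  have t: "arr (\<iota> i)" "Dom K (\<iota> i) = X i" "Cod K (\<iota> i) = r" "arr (p i)" "Dom K (p i) = r" "Cod K (p i) = X i"
     "X i \<in> Obj K" if "i \<in> I" for i
    using \<iota>' pX that by (auto simp: in_Hom)
  have "finprod (hom_group K ?w ?w) (\<lambda>i. inv_arr K h \<cdot> (\<iota> i \<cdot> p i) \<cdot> h) I
      = inv_arr K h \<cdot> finprod (hom_group K r r) (\<lambda>i. \<iota> i \<cdot> p i) I \<cdot> h"
    by (rule finprod_hom_map[where \<phi> = "\<lambda>g. inv_arr K h \<cdot> g \<cdot> h", symmetric]) (use I t in \<open>auto simp: in_Hom\<close>)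
  also have "\<dots> = Ide K ?w" unfolding s by simp
  finally have 1: "finprod (hom_group K ?w ?w) (\<lambda>i. inv_arr K h \<cdot> (\<iota> i \<cdot> p i) \<cdot> h) I = Ide K ?w" .
  interpret G: Group.comm_group "hom_group K ?w ?w" by (rule hom_comm_group) auto
  have 2: "finprod (hom_group K ?w ?w) (\<lambda>i. (inv_arr K h \<cdot> \<iota> i) \<cdot> (p i \<cdot> h)) I = Ide K ?w"
    unfolding 1[symmetric] by (rule G.finprod_cong') (use t in \<open>auto simp: in_Hom\<close>)
  show ?thesis
    unfolding direct_sum_def
  proof (intro conjI ballI exI[of _ "\<lambda>i. inv_arr K h \<cdot> \<iota> i"])
    fix i j assume ij: "i \<in> I" "j \<in> I"
    show "(p j \<cdot> h) \<cdot> (inv_arr K h \<cdot> \<iota> i) = (if i = j then Ide K (X i) else Z (X i) (X j))"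
      using d' t[OF ij(1)] t[OF ij(2)] ij by simp
  qed (use 2 I t in \<open>auto simp: in_Hom\<close>)
qed

lemma product_ring_iso:
  assumes pr: "product_ring K I S R p" and h: "ring_isom K W R h"
  shows "product_ring K I S W (\<lambda>i. p i \<cdot> h)"
proof -
  have hm: "ring_mor K W R h" and hi: "iso h" using h by (auto simp: ring_isom_def)
  have "direct_sum K I (\<lambda>i. Car (S i)) (Dom K h) (\<lambda>i. p i \<cdot> h)"
    by (rule direct_sum_iso[OF _ hi]) (use pr ring_mor_typ[OF hm] in \<open>auto simp: product_ring_def\<close>)
  moreover have "ring_mor K W (S i) (p i \<cdot> h)" if "i \<in> I" for i
    using pr that by (intro ring_mor_comp[OF hm]) (auto simp: product_ring_def)
  ultimately show ?thesis using ring_mor_typ[OF hm] by (simp add: product_ring_def)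
qed

lemma unit_ring_sel [simp]:
  "Car (unit_ring K) = Unity K" "Mul (unit_ring K) = Lunit K (Unity K)" "One (unit_ring K) = Ide K (Unity K)"
  by (simp_all add: unit_ring_def)

lemma is_ring_unit [simp]: "is_ring K (unit_ring K)"
  by (rule is_ringI[where a = pt and b = pt and c = pt]) simp_all

lemma unit_ring_mor: "is_ring K R \<Longrightarrow> ring_mor K (unit_ring K) R (One R)"
  by (rule ring_morI[where a = pt and b = pt]) simp_all

lemma unit_ring_mor_unique:
  assumes "ring_mor K (unit_ring K) R u" shows "u = One R"
  using ring_mor_typ[OF assms] by simp

text \<open>The unit ring is initial, so \<open>inl\<close> and \<open>inr\<close> coincide; the
  unit of its tensor square is then a separability element.\<close>

lemma separable_unit: "separable_ring K (unit_ring K)"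
proof (rule sep_elem_separable[OF is_ring_unit])
  let ?U = "unit_ring K"
  have "inl ?U ?U = inr ?U ?U"
    using unit_ring_mor_unique[OF inl_mor[OF is_ring_unit is_ring_unit]]
      unit_ring_mor_unique[OF inr_mor[OF is_ring_unit is_ring_unit]] by simp
  then show "sep_elem ?U (inv_arr K (Lunit K (Unity K)))"
    by (simp add: sep_elem_def)
qed

section \<open>Families of disjoint morphisms\<close>

text \<open>The ring condition on \<open>R\<close> stands by itself because for n = 0 the remaining
  clauses are empty.\<close>

definition disjoint_family where
  "disjoint_family A R n g \<longleftrightarrow> is_ring K R \<and> (\<forall>i<n::nat. ring_mor K A R (g i)) \<and> (\<forall>i<n. \<forall>j<n. i \<noteq> j \<longrightarrow> disjoint R (g i) (g j))"

text \<open>Geometrically \<open>T\<close> is the n-fold power of \<open>A\<close>, viewed as a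
  cover, with all diagonals removed, and the \<alpha> i are its n coordinates.\<close>

definition represents where
  "represents A n T \<alpha> \<longleftrightarrow> disjoint_family A T n \<alpha> \<and>
     (\<forall>R g. disjoint_family A R n g \<longrightarrow> (\<exists>!u. ring_mor K T R u \<and> (\<forall>i<n. u \<cdot> \<alpha> i = g i)))"

lemma disjoint_familyD:
  assumes "disjoint_family A R n g"
  shows "is_ring K R" "i < n \<Longrightarrow> ring_mor K A R (g i)" "\<lbrakk>i < n; j < n; i \<noteq> j\<rbrakk> \<Longrightarrow> disjoint R (g i) (g j)"
  using assms by (auto simp: disjoint_family_def)

lemma disjoint_family_comp:
  assumes "disjoint_family A R n g" "ring_mor K R S u" shows "disjoint_family A S n (\<lambda>i. u \<cdot> g i)"
  unfolding disjoint_family_def using disjoint_familyD[OF assms(1)] ring_mor_comp[OF _ assms(2)] disjoint_comp[OF _ assms(2)]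
    ring_mor_typ[OF assms(2)] by blast

lemma representsD:
  assumes "represents A n T \<alpha>"
  shows "disjoint_family A T n \<alpha>"
    "disjoint_family A R n g \<Longrightarrow> \<exists>u. ring_mor K T R u \<and> (\<forall>i<n. u \<cdot> \<alpha> i = g i)"
    "\<lbrakk>ring_mor K T R u; ring_mor K T R v; \<And>i. i < n \<Longrightarrow> u \<cdot> \<alpha> i = v \<cdot> \<alpha> i\<rbrakk> \<Longrightarrow> u = v"
proof -
  show 1: "disjoint_family A T n \<alpha>" using assms by (auto simp: represents_def)
  show "disjoint_family A R n g \<Longrightarrow> \<exists>u. ring_mor K T R u \<and> (\<forall>i<n. u \<cdot> \<alpha> i = g i)" using assms unfolding represents_def by blast
  assume *: "ring_mor K T R u" "ring_mor K T R v" "\<And>i. i < n \<Longrightarrow> u \<cdot> \<alpha> i = v \<cdot> \<alpha> i"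
  have "disjoint_family A R n (\<lambda>i. u \<cdot> \<alpha> i)" by (rule disjoint_family_comp[OF 1 *(1)])
  then have "\<exists>!w. ring_mor K T R w \<and> (\<forall>i<n. w \<cdot> \<alpha> i = u \<cdot> \<alpha> i)" using assms by (simp add: represents_def)
  then show "u = v" using * by auto
qed

text \<open>An (n+2)-tuple of disjoint morphisms is a pair of (n+1)-tuples with the same first n
  entries and disjoint last entries. The shared entries mean that the classifying morphisms out of
  \<open>T1\<close> agree on \<open>T0\<close>; disjointness of the last entries means that these
  classifying morphisms are disjoint.\<close>

lemma represents_step:
  assumes 0: "represents A n T0 \<alpha>" and 1: "represents A (Suc n) T1 \<beta>" and \<phi>: "ring_mor K T0 T1 \<phi>"
    and \<phi>\<alpha>: "\<And>i. i < n \<Longrightarrow> \<phi> \<cdot> \<alpha> i = \<beta> i"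
    and k: "ring_mor K T1 T2 k" and k2: "ring_mor K T1 T2 k2" and kk: "k2 \<cdot> \<phi> = k \<cdot> \<phi>" and d: "disjoint T2 k k2"
    and U: "\<And>R g1 g2. \<lbrakk>ring_mor K T1 R g1; ring_mor K T1 R g2; g1 \<cdot> \<phi> = g2 \<cdot> \<phi>; disjoint R g1 g2\<rbrakk>
       \<Longrightarrow> \<exists>!u. ring_mor K T2 R u \<and> u \<cdot> k = g1 \<and> u \<cdot> k2 = g2"
  shows "\<exists>\<gamma>. represents A (Suc (Suc n)) T2 \<gamma> \<and> (\<forall>i<Suc n. k \<cdot> \<beta> i = \<gamma> i)"
proof (intro exI conjI)
  \<comment> \<open>\<open>k\<close> carries the entries 0 to n. Entry n + 1 is the last entry of
    the second tuple, carried by \<open>k2\<close>.\<close>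
  let ?\<gamma> = "\<lambda>i. if i < Suc n then k \<cdot> \<beta> i else k2 \<cdot> \<beta> n"
  show "\<forall>i<Suc n. k \<cdot> \<beta> i = ?\<gamma> i" by simp
  note f0 = disjoint_familyD[OF representsD(1)[OF 0]] and f1 = disjoint_familyD[OF representsD(1)[OF 1]]
  note [simp] = ring_mor_typ[OF \<phi>] ring_mor_typ[OF k] ring_mor_typ[OF k2]
  have \<alpha>t: "arr (\<alpha> i)" "Cod K (\<alpha> i) = Car T0" if "i < n" for i using ring_mor_typ[OF f0(2)[OF that]] by auto
  have \<beta>t: "arr (\<beta> i)" "Cod K (\<beta> i) = Car T1" if "i < Suc n" for i using ring_mor_typ[OF f1(2)[OF that]] by auto
  have eq: "k2 \<cdot> \<beta> i = k \<cdot> \<beta> i" if "i < n" for i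
  proof -
    have "k2 \<cdot> \<beta> i = (k2 \<cdot> \<phi>) \<cdot> \<alpha> i" using \<phi>\<alpha>[OF that] \<alpha>t[OF that] by simp
    also have "\<dots> = k \<cdot> (\<phi> \<cdot> \<alpha> i)" unfolding kk using \<alpha>t[OF that] by simp
    finally show ?thesis using \<phi>\<alpha>[OF that] by simp
  qed
  \<comment> \<open>Where the two last entries coincide, all n + 1 entries do, so
    \<open>u \<cdot> k\<close> and \<open>u \<cdot> k2\<close> classify the same tuple and are
    equal.\<close>
  have dn: "disjoint T2 (k \<cdot> \<beta> n) (k2 \<cdot> \<beta> n)" unfolding disjoint_def
  proof (intro allI impI, elim conjE)
    fix S u assume u: "ring_mor K T2 S u" and e: "u \<cdot> (k \<cdot> \<beta> n) = u \<cdot> (k2 \<cdot> \<beta> n)"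
    note [simp] = ring_mor_typ[OF u]
    have "u \<cdot> k = u \<cdot> k2"
    proof (rule representsD(3)[OF 1 ring_mor_comp[OF k u] ring_mor_comp[OF k2 u]])
      fix i assume "i < Suc n"
      then show "(u \<cdot> k) \<cdot> \<beta> i = (u \<cdot> k2) \<cdot> \<beta> i" using eq e \<beta>t[of i] by (cases "i = n") auto
    qed
    then show "zero_ring S" using disjointD[OF d u] by simp
  qed
  have df: "disjoint_family A T2 (Suc (Suc n)) ?\<gamma>"
    unfolding disjoint_family_def
  proof (intro conjI allI impI)
    fix i assume "i < Suc (Suc n)"
    then show "ring_mor K A T2 (?\<gamma> i)"
      using ring_mor_comp[OF f1(2) k] ring_mor_comp[OF f1(2) k2] by auto
  next
    have a: "disjoint T2 (k \<cdot> \<beta> i) (k \<cdot> \<beta> j)" if "i < Suc n" "j < Suc n" "i \<noteq> j" for i j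
      using disjoint_comp[OF f1(3) k f1(2) f1(2)] that by auto
    have b: "disjoint T2 (k \<cdot> \<beta> i) (k2 \<cdot> \<beta> n)" if "i < Suc n" for i
    proof (cases "i = n")
      case False
      then have "disjoint T2 (k2 \<cdot> \<beta> i) (k2 \<cdot> \<beta> n)"
        using disjoint_comp[OF f1(3) k2 f1(2) f1(2), of i n] that by auto
      then show ?thesis using eq[of i] False that by simp
    qed (use dn in simp)
    fix i j assume "i < Suc (Suc n)" "j < Suc (Suc n)" "i \<noteq> j"
    then show "disjoint T2 (?\<gamma> i) (?\<gamma> j)" using a b disjoint_sym[OF b] by auto
  qed simp
  show "represents A (Suc (Suc n)) T2 ?\<gamma>" unfolding represents_def
  proof (intro conjI allI impI df)
    fix R g assume g: "disjoint_family A R (Suc (Suc n)) g"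
    note fg = disjoint_familyD[OF g]
    have g': "disjoint_family A R (Suc n) g" using g by (auto simp: disjoint_family_def)
    then obtain g1 where g1: "ring_mor K T1 R g1" and g1b: "\<And>i. i < Suc n \<Longrightarrow> g1 \<cdot> \<beta> i = g i" using representsD(2)[OF 1] by blast
    \<comment> \<open>The second tuple omits entry n and puts entry n + 1 in its place.\<close>
    have "disjoint_family A R (Suc n) (\<lambda>i. if i < n then g i else g (Suc n))"
      unfolding disjoint_family_def using fg by auto
    then obtain g2 where g2: "ring_mor K T1 R g2" and g2b: "\<And>i. i < Suc n \<Longrightarrow> g2 \<cdot> \<beta> i = (if i < n then g i else g (Suc n))"
      using representsD(2)[OF 1] by blast
    note [simp] = ring_mor_typ[OF g1] ring_mor_typ[OF g2]
    have e: "g1 \<cdot> \<phi> = g2 \<cdot> \<phi>"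
    proof (rule representsD(3)[OF 0 ring_mor_comp[OF \<phi> g1] ring_mor_comp[OF \<phi> g2]])
      fix i assume "i < n"
      then show "(g1 \<cdot> \<phi>) \<cdot> \<alpha> i = (g2 \<cdot> \<phi>) \<cdot> \<alpha> i"
        using \<phi>\<alpha>[of i] \<alpha>t[of i] g1b[of i] g2b[of i] by simp
    qed
    have "disjoint R g1 g2" unfolding disjoint_def
    proof (intro allI impI, elim conjE)
      fix S u assume u: "ring_mor K R S u" and e: "u \<cdot> g1 = u \<cdot> g2"
      note [simp] = ring_mor_typ[OF u]
      have "u \<cdot> g n = (u \<cdot> g1) \<cdot> \<beta> n" using g1b[of n] \<beta>t[of n] by simp
      also have "\<dots> = u \<cdot> g (Suc n)" unfolding e using g2b[of n] \<beta>t[of n] by simp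
      finally show "zero_ring S" using disjointD[OF fg(3)[of n "Suc n"] u] by simp
    qed
    from U[OF g1 g2 e this] obtain u where u: "ring_mor K T2 R u" "u \<cdot> k = g1" "u \<cdot> k2 = g2"
      and uu: "\<And>v. ring_mor K T2 R v \<and> v \<cdot> k = g1 \<and> v \<cdot> k2 = g2 \<Longrightarrow> v = u" by blast
    show "\<exists>!u. ring_mor K T2 R u \<and> (\<forall>i<Suc (Suc n). u \<cdot> ?\<gamma> i = g i)"
    proof (rule ex1I[of _ u])
      note [simp] = ring_mor_typ[OF u(1)]
      have "u \<cdot> ?\<gamma> i = g i" if "i < Suc (Suc n)" for i
      proof (cases "i < Suc n")
        case True
        then show ?thesis using g1b[of i] \<beta>t[of i] u(2) comp_eq[of u k g1 "\<beta> i"] by simp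
      next
        case False
        then have "i = Suc n" using that by simp
        then show ?thesis using g2b[of n] \<beta>t[of n] u(3) comp_eq[of u k2 g2 "\<beta> n"] by simp
      qed
      then show "ring_mor K T2 R u \<and> (\<forall>i<Suc (Suc n). u \<cdot> ?\<gamma> i = g i)" using u by blast
    next
      fix v assume "ring_mor K T2 R v \<and> (\<forall>i<Suc (Suc n). v \<cdot> ?\<gamma> i = g i)"
      then have v: "ring_mor K T2 R v" and vg: "\<And>i. i < Suc (Suc n) \<Longrightarrow> v \<cdot> ?\<gamma> i = g i" by auto
      note [simp] = ring_mor_typ[OF v]
      have "v \<cdot> k = g1"
      proof (rule representsD(3)[OF 1 ring_mor_comp[OF k v] g1])
        fix i assume "i < Suc n"
        then show "(v \<cdot> k) \<cdot> \<beta> i = g1 \<cdot> \<beta> i" using vg[of i] g1b[of i] \<beta>t[of i] by simp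
      qed
      moreover have "v \<cdot> k2 = g2"
      proof (rule representsD(3)[OF 1 ring_mor_comp[OF k2 v] g2])
        fix i assume i: "i < Suc n"
        show "(v \<cdot> k2) \<cdot> \<beta> i = g2 \<cdot> \<beta> i"
        proof (cases "i = n")
          case True
          then show ?thesis using vg[of "Suc n"] g2b[of n] \<beta>t[of n] by simp
        next
          case False
          then show ?thesis using vg[of i] g2b[of i] \<beta>t[of i] eq[of i] i by simp
        qed
      qed
      ultimately show "v = u" using uu v by blast
    qed
  qed
qed

end

section \<open>Products, splitting and derived rings over a base ring\<close>

context sep_ring
begin

lemma finprod_Mod:
  assumes "finite I" "\<And>i. i \<in> I \<Longrightarrow> lin X Y (f i)" and [simp]: "md X" "md Y"
  shows "finprod (hom_group M X Y) (\<lambda>i. (X, Y, f i)) I = (X, Y, finprod (hom_group K (fst X) (fst Y)) f I)"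
proof -
  interpret A: comm_group "hom_group K (fst X) (fst Y)" by (rule hom_comm_group) auto
  interpret B: comm_group "hom_group M X Y" by (rule additive_category.hom_comm_group[OF additive_Mod]) auto
  have "(\<forall>i\<in>I. lin X Y (f i)) \<longrightarrow> ?thesis" using assms(1)
  proof (induction I rule: finite_induct)
    case empty
    have "one (hom_group M X Y) = (X, Y, Z (fst X) (fst Y))" by (simp add: hom_group_def)
    then show ?case by simp
  next
    case (insert i I)
    have m: "mult (hom_group M X Y) (X, Y, f) (X, Y, g) = (X, Y, f \<boxplus> g)" for f g by (simp add: hom_group_def)
    show ?case
    proof
      assume l: "\<forall>i\<in>insert i I. lin X Y (f i)"
      then have "f \<in> I \<rightarrow> carrier (hom_group K (fst X) (fst Y))" "f i \<in> carrier (hom_group K (fst X) (fst Y))"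
        by (auto simp: linear_def)
      moreover from l have "(\<lambda>i. (X, Y, f i)) \<in> I \<rightarrow> carrier (hom_group M X Y)" "(X, Y, f i) \<in> carrier (hom_group M X Y)"
        by (auto simp: hom_group_def Mod_Hom)
      ultimately show "finprod (hom_group M X Y) (\<lambda>i. (X, Y, f i)) (insert i I) = (X, Y, finprod (hom_group K (fst X) (fst Y)) f (insert i I))"
        using insert l m by (simp add: A.finprod_insert B.finprod_insert)
    qed
  qed
  then show ?thesis using assms(2) by blast
qed

lemma iso_Mod_iso: "is_iso M (X, Y, f) \<Longrightarrow> iso f"
proof -
  assume "is_iso M (X, Y, f)"
  then obtain G where G: "inverse_arrows M (X, Y, f) G" by (auto simp: is_iso_def)
  then have l: "md X" "md Y" "lin X Y f" "G \<in> Hom M Y X" and c: "Comp M G (X, Y, f) = Ide M X" "Comp M (X, Y, f) G = Ide M Y"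
    by (auto simp: inverse_arrows_def)
  then obtain g where "G = (Y, X, g)" and g: "lin Y X g" unfolding Mod_Hom by blast
  then show "iso f" using c linear_typ[OF l(3)] linear_typ[OF g] by (intro isoI[where g = g]) auto
qed

lemma product_of_Mod:
  assumes p: "ring_mor K A R \<phi>" and q: "\<And>i. i \<in> I \<Longrightarrow> ring_mor K A (S i) (\<psi> i)"
    and pr: "product_ring M I (\<lambda>i. alg (S i) (\<psi> i)) (alg R \<phi>) \<pi>"
  shows "\<And>i. i \<in> I \<Longrightarrow> \<pi> i = (mdl R \<phi>, mdl (S i) (\<psi> i), und (\<pi> i)) \<and> und (\<pi> i) \<cdot> \<phi> = \<psi> i"
    "product_ring K I S R (\<lambda>i. und (\<pi> i))"
proof -
  have pm: "ring_mor M (alg R \<phi>) (alg (S i) (\<psi> i)) (\<pi> i)" if "i \<in> I" for i using pr that by (auto simp: product_ring_def)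
  then have e: "\<pi> i = (mdl R \<phi>, mdl (S i) (\<psi> i), und (\<pi> i)) \<and> ring_mor K R (S i) (und (\<pi> i)) \<and> und (\<pi> i) \<cdot> \<phi> = \<psi> i" if "i \<in> I" for i
    using ring_mor_alg[OF p q[OF that], of "\<pi> i"] pm[OF that] by auto
  then show "\<And>i. i \<in> I \<Longrightarrow> \<pi> i = (mdl R \<phi>, mdl (S i) (\<psi> i), und (\<pi> i)) \<and> und (\<pi> i) \<cdot> \<phi> = \<psi> i" by blast
  have I: "finite I" using pr by (auto simp: product_ring_def direct_sum_def)
  from pr obtain \<iota> where \<iota>: "\<forall>i\<in>I. \<iota> i \<in> Hom M (Car (alg (S i) (\<psi> i))) (Car (alg R \<phi>))"
    and d: "\<forall>i\<in>I. \<forall>j\<in>I. Comp M (\<pi> j) (\<iota> i) = (if i = j then Ide M (Car (alg (S i) (\<psi> i))) else Zero M (Car (alg (S i) (\<psi> i))) (Car (alg (S j) (\<psi> j))))"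
    and s: "finprod (hom_group M (Car (alg R \<phi>)) (Car (alg R \<phi>))) (\<lambda>i. Comp M (\<iota> i) (\<pi> i)) I = Ide M (Car (alg R \<phi>))"
    unfolding product_ring_def direct_sum_def by blast
  have c: "Car (alg (S i) (\<psi> i)) = mdl (S i) (\<psi> i)" if "i \<in> I" for i using alg_sel[OF q[OF that]] by simp
  have \<iota>e: "\<iota> i = (mdl (S i) (\<psi> i), mdl R \<phi>, und (\<iota> i)) \<and> lin (mdl (S i) (\<psi> i)) (mdl R \<phi>) (und (\<iota> i))" if "i \<in> I" for i
    using \<iota> that c[OF that] alg_sel[OF p] by (auto simp: Mod_Hom)
  have lp: "lin (mdl R \<phi>) (mdl (S i) (\<psi> i)) (und (\<pi> i))" if "i \<in> I" for i
    using pm[OF that] e[OF that] c[OF that] by (auto simp: ring_mor_def alg_sel[OF p] Mod_Hom)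
  have lc: "lin (mdl R \<phi>) (mdl R \<phi>) (und (\<iota> i) \<cdot> und (\<pi> i))" if "i \<in> I" for i
    using lin_comp[OF lp \<iota>e[THEN conjunct2]] that mdl_act(2)[OF p] mdl_act(2)[OF q] by auto
  have cc: "Comp M (\<iota> i) (\<pi> i) = (mdl R \<phi>, mdl R \<phi>, und (\<iota> i) \<cdot> und (\<pi> i))" if "i \<in> I" for i
    using \<iota>e[OF that] e[OF that] Mod_sel(5) by metis
  interpret B: comm_group "hom_group M (mdl R \<phi>) (mdl R \<phi>)"
    by (rule additive_category.hom_comm_group[OF additive_Mod]) (use mdl_act(2)[OF p] in auto)
  have "finprod (hom_group M (mdl R \<phi>) (mdl R \<phi>)) (\<lambda>i. Comp M (\<iota> i) (\<pi> i)) I = finprod (hom_group M (mdl R \<phi>) (mdl R \<phi>)) (\<lambda>i. (mdl R \<phi>, mdl R \<phi>, und (\<iota> i) \<cdot> und (\<pi> i))) I"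
    by (rule B.finprod_cong') (use cc lc mdl_act(2)[OF p] in \<open>auto simp: hom_group_def Mod_Hom\<close>)
  then have "finprod (hom_group K (Car R) (Car R)) (\<lambda>i. und (\<iota> i) \<cdot> und (\<pi> i)) I = Ide K (Car R)"
    using s finprod_Mod[OF I lc mdl_act(2)[OF p] mdl_act(2)[OF p]] by (simp add: alg_sel[OF p])
  moreover have "und (\<pi> j) \<cdot> und (\<iota> i) = (if i = j then Ide K (Car (S i)) else Z (Car (S i)) (Car (S j)))" if ij: "i \<in> I" "j \<in> I" for i j
  proof -
    have "Comp M (\<pi> j) (\<iota> i) = (mdl (S i) (\<psi> i), mdl (S j) (\<psi> j), und (\<pi> j) \<cdot> und (\<iota> i))"
      using \<iota>e[OF ij(1)] e[OF ij(2)] Mod_sel(5) by metis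
    then show ?thesis using d ij c[OF ij(1)] c[OF ij(2)] by (auto split: if_splits)
  qed
  moreover have "und (\<iota> i) \<in> Hom K (Car (S i)) (Car R)" "und (\<pi> i) \<in> Hom K (Car R) (Car (S i))" "Car (S i) \<in> Obj K" if "i \<in> I" for i
    using linear_typ[OF \<iota>e[OF that, THEN conjunct2]] linear_typ[OF lp[OF that]] ring_mor_typ[OF q[OF that]] by (auto simp: in_Hom)
  ultimately have "direct_sum K I (\<lambda>i. Car (S i)) (Car R) (\<lambda>i. und (\<pi> i))"
    unfolding direct_sum_def using I ring_mor_typ[OF p] by (auto intro!: exI[of _ "\<lambda>i. und (\<iota> i)"])
  then show "product_ring K I S R (\<lambda>i. und (\<pi> i))" using e ring_mor_typ[OF p] by (simp add: product_ring_def)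
qed

lemma product_Mod:
  assumes p: "ring_mor K A R \<phi>" and q: "\<And>i. i \<in> I \<Longrightarrow> ring_mor K A (S i) (\<psi> i)"
    and pr: "product_ring K I S R \<pi>" and e: "\<And>i. i \<in> I \<Longrightarrow> \<pi> i \<cdot> \<phi> = \<psi> i"
  shows "product_ring M I (\<lambda>i. alg (S i) (\<psi> i)) (alg R \<phi>) (\<lambda>i. (mdl R \<phi>, mdl (S i) (\<psi> i), \<pi> i))"
proof -
  let ?X = "mdl R \<phi>" and ?Y = "\<lambda>i. mdl (S i) (\<psi> i)"
  from pr have I: "finite I" and pm: "\<And>i. i \<in> I \<Longrightarrow> ring_mor K R (S i) (\<pi> i)"
    by (auto simp: product_ring_def direct_sum_def)
  from pr obtain \<iota> where \<iota>': "\<forall>i\<in>I. \<iota> i \<in> Hom K (Car (S i)) (Car R)"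
    and d: "\<forall>i\<in>I. \<forall>j\<in>I. \<pi> j \<cdot> \<iota> i = (if i = j then Ide K (Car (S i)) else Z (Car (S i)) (Car (S j)))"
    and s: "finprod (hom_group K (Car R) (Car R)) (\<lambda>i. \<iota> i \<cdot> \<pi> i) I = Ide K (Car R)"
    unfolding product_ring_def direct_sum_def by blast
  have pm': "ring_mor M (alg R \<phi>) (alg (S i) (\<psi> i)) (?X, ?Y i, \<pi> i)" if "i \<in> I" for i
    using ring_mor_alg[OF p q[OF that]] pm[OF that] e[OF that] by blast
  have c: "Car (alg (S i) (\<psi> i)) = ?Y i" if "i \<in> I" for i using alg_sel[OF q[OF that]] by simp
  have lp: "lin ?X (?Y i) (\<pi> i)" if "i \<in> I" for i
    using pm'[OF that] c[OF that] by (auto simp: ring_mor_def alg_sel[OF p] Mod_Hom)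
  \<comment> \<open>Linearity of the injections is not given. It holds because
    \<open>\<iota> i \<cdot> \<pi> i\<close> is multiplication by an element, which commutes with
    multiplication by scalars from \<open>A\<close>.\<close>
  have li: "lin (?Y i) ?X (\<iota> i)" if i: "i \<in> I" for i
  proof -
    have \<iota> [simp]: "arr (\<iota> i)" "Dom K (\<iota> i) = Car (S i)" "Cod K (\<iota> i) = Car R" "\<pi> i \<cdot> \<iota> i = Ide K (Car (S i))"
      using \<iota>' d i by (auto simp: in_Hom)
    note [simp] = ring_mor_typ[OF pm[OF i]] ring_mor_typ[OF p] ring_mor_typ[OF q[OF i]] mdl_act[OF p]
    have mdi [simp]: "md (?Y i)" by (rule mdl_act(2)[OF q[OF i]])
    define e where "e = \<iota> i \<cdot> One (S i)"
    have ge: "glob R e" by (simp add: e_def)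
    have ip: "app (\<iota> i) (app (\<pi> i) x) = rmul R (app e pt) x" if "el x" "ob x = Car R" for x
      using arg_cong[OF product_decomp_inj(2)[OF pr \<iota>' d s i], of "\<lambda>f. app f x"] that ge
      by (simp flip: e_def)
    let ?x = "var 2 (Car R)" and ?u = "var 3 (Car A)"
    have g: "gen (app (\<pi> i) ?x)" by (rule gen_app[where s = "\<iota> i"]) simp_all
    have "app (\<iota> i) (app (\<pi> i) (act ?X ?u ?x)) = act ?X ?u (app (\<iota> i) (app (\<pi> i) ?x))"
      using ge ring_lcomm[of R "app \<phi> ?u" "app e pt" ?x] by (simp add: ip)
    moreover have "app (\<pi> i) (act ?X ?u ?x) = act (?Y i) ?u (app (\<pi> i) ?x)"
      by (rule lin_app[OF lp[OF i]]) simp_all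
    ultimately have "app (\<iota> i) (act (?Y i) ?u (app (\<pi> i) ?x)) = act ?X ?u (app (\<iota> i) (app (\<pi> i) ?x))" by metis
    then show ?thesis
      by (intro linearI[OF _ _ _ _ _ _ _ g, where u = ?u]) simp_all
  qed
  have lc: "lin ?X ?X (\<iota> i \<cdot> \<pi> i)" if "i \<in> I" for i
    using lin_comp[OF lp li] that mdl_act(2)[OF p] mdl_act(2)[OF q] by auto
  have sum: "finprod (hom_group M ?X ?X) (\<lambda>i. (?X, ?X, \<iota> i \<cdot> \<pi> i)) I = Ide M ?X"
    using finprod_Mod[OF I lc mdl_act(2)[OF p] mdl_act(2)[OF p]] s by simp
  have "direct_sum M I (\<lambda>i. Car (alg (S i) (\<psi> i))) (Car (alg R \<phi>)) (\<lambda>i. (?X, ?Y i, \<pi> i))"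
    unfolding direct_sum_def
  proof (intro conjI ballI exI[of _ "\<lambda>i. (?Y i, ?X, \<iota> i)"])
    fix i assume i: "i \<in> I"
    show "Car (alg (S i) (\<psi> i)) \<in> Obj M" "(?X, ?Y i, \<pi> i) \<in> Hom M (Car (alg R \<phi>)) (Car (alg (S i) (\<psi> i)))"
      "(?Y i, ?X, \<iota> i) \<in> Hom M (Car (alg (S i) (\<psi> i))) (Car (alg R \<phi>))"
      using c[OF i] alg_sel[OF p] mdl_act(2)[OF p] mdl_act(2)[OF q[OF i]] lp[OF i] li[OF i] by (auto simp: Mod_Hom)
    fix j assume j: "j \<in> I"
    show "Comp M (?X, ?Y j, \<pi> j) (?Y i, ?X, \<iota> i) = (if i = j then Ide M (Car (alg (S i) (\<psi> i))) else Zero M (Car (alg (S i) (\<psi> i))) (Car (alg (S j) (\<psi> j))))"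
    proof -
      have "\<pi> j \<cdot> \<iota> i = (if i = j then Ide K (Car (S i)) else Z (Car (S i)) (Car (S j)))" using d i j by blast
      then show ?thesis by (simp add: c[OF i] c[OF j])
    qed
  qed (use I sum mdl_act(2)[OF p] in \<open>auto simp: alg_sel[OF p]\<close>)
  then show ?thesis using pm' is_ring_alg[OF p] by (simp add: product_ring_def)
qed

text \<open>A projection A \<otimes> R \<rightarrow> A over \<open>A\<close> is the identity on the
  first factor. It is therefore determined by its restriction to \<open>R\<close>, an ordinary ring
  morphism in \<open>K\<close>, and modules disappear from the notion of splitting.\<close>

lemma splits_iff_product:
  assumes R [simp]: "is_ring K R"
  shows "(\<exists>P \<pi> h. product_ring M I (\<lambda>i. unit_ring M) P \<pi> \<and> ring_isom M (ext_ring K A R) P h) \<longleftrightarrow>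
    (\<exists>f. (\<forall>i\<in>I. ring_mor K R A (f i)) \<and> product_ring K I (\<lambda>i. A) (tens_ring K A R) (\<lambda>i. copair A (Ide K (Car A)) (f i)))"
proof
  let ?W = "tens_ring K A R" and ?J = "Ide K (Car A)"
  have p1: "ring_mor K A A ?J" by (rule ring_mor_ide) simp
  have pW: "ring_mor K A ?W (inl A R)" by (rule inl_mor) auto
  assume "\<exists>P \<pi> h. product_ring M I (\<lambda>i. unit_ring M) P \<pi> \<and> ring_isom M (ext_ring K A R) P h"
  then obtain P \<pi> h where pr: "product_ring M I (\<lambda>i. unit_ring M) P \<pi>" and h: "ring_isom M (ext_ring K A R) P h" by blast
  have "is_ring M P" using pr by (simp add: product_ring_def)
  then obtain S \<phi> where P: "P = alg S \<phi>" and pS: "ring_mor K A S \<phi>" using ring_Mod_alg by metis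
  have hM: "ring_mor M (alg ?W (inl A R)) (alg S \<phi>) h" and hI: "is_iso M h" using h by (simp_all add: ring_isom_def ext_ring_alg P)
  from hM obtain h' where h': "h = (mdl ?W (inl A R), mdl S \<phi>, h')" and hm: "ring_mor K ?W S h'" and hp: "h' \<cdot> inl A R = \<phi>"
    unfolding ring_mor_alg[OF pW pS] by (elim exE conjE) (rule that)
  have hi: "iso h'" using hI unfolding h' by (rule iso_Mod_iso)
  note pp = product_of_Mod[OF pS p1 pr[unfolded unit_ring_alg P]]
  let ?q = "\<lambda>i. und (\<pi> i) \<cdot> h'"
  have pq: "product_ring K I (\<lambda>i. A) ?W ?q" by (rule product_ring_iso[OF pp(2)]) (use hm hi in \<open>simp_all add: ring_isom_def\<close>)
  have qm: "ring_mor K ?W A (?q i)" if "i \<in> I" for i using pq that by (simp add: product_ring_def)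
  have q1: "?q i \<cdot> inl A R = ?J" if "i \<in> I" for i
  proof -
    have "ring_mor K S A (und (\<pi> i))" using pp(2) that by (simp add: product_ring_def)
    then have "?q i \<cdot> inl A R = und (\<pi> i) \<cdot> (h' \<cdot> inl A R)"
      using ring_mor_typ[OF \<open>ring_mor K S A (und (\<pi> i))\<close>] ring_mor_typ(3,5)[OF hm] ring_mor_typ(4)[OF hm, simplified] by simp
    then show ?thesis using hp pp(1)[OF that] by simp
  qed
  have qc: "?q i = copair A ?J (?q i \<cdot> inr A R)" if "i \<in> I" for i
    using copair_eq[OF A_ring R qm[OF that]] q1[OF that] by simp
  have "product_ring K I (\<lambda>i. A) ?W (\<lambda>i. copair A ?J (?q i \<cdot> inr A R))"
  proof -
    have 1: "direct_sum K I (\<lambda>i. Car A) (Car ?W) ?q" using pq by (simp add: product_ring_def)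
    interpret G: Group.comm_group "hom_group K (Car ?W) (Car ?W)" by (rule hom_comm_group) auto
    obtain e where "decomp I ?W e (\<lambda>i. A) ?q" using product_decomp[OF pq] by blast
    then have "decomp I ?W e (\<lambda>i. A) (\<lambda>i. copair A ?J (?q i \<cdot> inr A R))"
      unfolding decomp_def using qc by (metis (no_types, lifting))
    then show ?thesis by (rule decomp_product)
  qed
  moreover have "\<forall>i\<in>I. ring_mor K R A (?q i \<cdot> inr A R)" using ring_mor_comp[OF inr_mor[OF A_ring R] qm] by blast
  ultimately show "\<exists>f. (\<forall>i\<in>I. ring_mor K R A (f i)) \<and> product_ring K I (\<lambda>i. A) ?W (\<lambda>i. copair A ?J (f i))"
    by (intro exI[of _ "\<lambda>i. ?q i \<cdot> inr A R"]) blast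
next
  let ?W = "tens_ring K A R" and ?J = "Ide K (Car A)"
  have p1: "ring_mor K A A ?J" by (rule ring_mor_ide) simp
  have pW: "ring_mor K A ?W (inl A R)" by (rule inl_mor) auto
  assume "\<exists>f. (\<forall>i\<in>I. ring_mor K R A (f i)) \<and> product_ring K I (\<lambda>i. A) ?W (\<lambda>i. copair A ?J (f i))"
  then obtain f where f: "\<And>i. i \<in> I \<Longrightarrow> ring_mor K R A (f i)" and pr: "product_ring K I (\<lambda>i. A) ?W (\<lambda>i. copair A ?J (f i))" by blast
  have "product_ring M I (\<lambda>i. alg A ?J) (alg ?W (inl A R)) (\<lambda>i. (mdl ?W (inl A R), mdl A ?J, copair A ?J (f i)))"
    by (rule product_Mod[OF pW p1 pr]) (use copair_in[OF p1 f] in auto)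
  moreover have "ring_isom M (alg ?W (inl A R)) (alg ?W (inl A R)) (Ide M (mdl ?W (inl A R)))"
    unfolding ring_isom_def
  proof
    have "ring_mor K ?W ?W (Ide K (Car ?W))" by (rule ring_mor_ide) simp
    moreover have "Ide K (Car ?W) \<cdot> inl A R = inl A R" by simp
    ultimately show "ring_mor M (alg ?W (inl A R)) (alg ?W (inl A R)) (Ide M (mdl ?W (inl A R)))"
      unfolding ring_mor_alg[OF pW pW] Mod_sel(6) fst_mdl by blast
    show "is_iso M (Ide M (mdl ?W (inl A R)))" unfolding Mod_sel(6)
      by (rule iso_Mod(1)) (use mdl_act(2)[OF pW] lin_ide[OF mdl_act(2)[OF pW]] in auto)
  qed
  ultimately show "\<exists>P \<pi> h. product_ring M I (\<lambda>i. unit_ring M) P \<pi> \<and> ring_isom M (ext_ring K A R) P h"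
    unfolding unit_ring_alg ext_ring_alg[OF R] by blast
qed

text \<open>The relative form of \<open>derived_ring_represents\<close>: morphisms of algebras into
  a common target are morphisms out of \<open>R\<close> that agree on \<open>A\<close>. Disjointness
  means the same in \<open>Mod\<close> and in \<open>K\<close>, because the target of a ring
  morphism out of an \<open>A\<close>-algebra is itself an \<open>A\<close>-algebra.\<close>

lemma derived_over:
  assumes p: "ring_mor K A R \<phi>" and d: "derived_ring M (alg R \<phi>) C k"
  shows "separable_ring K (mod_to_ring K A C)" "ring_mor K R (mod_to_ring K A C) (und k)"
    "\<exists>k2. ring_mor K R (mod_to_ring K A C) k2 \<and> k2 \<cdot> \<phi> = und k \<cdot> \<phi> \<and> disjoint (mod_to_ring K A C) (und k) k2 \<and>
      (\<forall>S g1 g2. ring_mor K R S g1 \<and> ring_mor K R S g2 \<and> g1 \<cdot> \<phi> = g2 \<cdot> \<phi> \<and> disjoint S g1 g2 \<longrightarrow>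
        (\<exists>!u. ring_mor K (mod_to_ring K A C) S u \<and> u \<cdot> und k = g1 \<and> u \<cdot> k2 = g2))"
proof -
  have sC: "separable_ring M C" and km: "ring_mor M (alg R \<phi>) C k" using d by (auto simp: derived_ring_def)
  have C: "is_ring M C" using sC by (simp add: separable_ring_def)
  define S \<psi> where "S = mod_to_ring K A C" and "\<psi> = und (One C)"
  have q: "ring_mor K A S \<psi>" and CS: "alg S \<psi> = C" using ring_Mod_alg[OF C] by (simp_all add: S_def \<psi>_def)
  show "separable_ring K (mod_to_ring K A C)" using separable_of_alg[OF q] sC CS by (simp add: S_def)
  obtain k' where k: "k = (mdl R \<phi>, mdl S \<psi>, k')" and k'm: "ring_mor K R S k'" and k'p: "k' \<cdot> \<phi> = \<psi>"
    using km ring_mor_alg[OF p q] CS by auto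
  then show "ring_mor K R (mod_to_ring K A C) (und k)" by (simp add: S_def)
  note D = idempotent_complete_smc.derived_ring_represents[OF idempotent_complete_Mod d]
  obtain K2 where K2: "ring_mor M (alg R \<phi>) C K2" and K2d: "idempotent_complete_smc.disjoint M C k K2"
    and K2u: "\<And>T g1 g2. ring_mor M (alg R \<phi>) T g1 \<Longrightarrow> ring_mor M (alg R \<phi>) T g2 \<Longrightarrow> idempotent_complete_smc.disjoint M T g1 g2 \<Longrightarrow>
       \<exists>!u. ring_mor M C T u \<and> Comp M u k = g1 \<and> Comp M u K2 = g2" using D by blast
  obtain k2 where k2: "K2 = (mdl R \<phi>, mdl S \<psi>, k2)" and k2m: "ring_mor K R S k2" and k2p: "k2 \<cdot> \<phi> = \<psi>"
    using K2 ring_mor_alg[OF p q] CS by auto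
  note Md = idempotent_complete_smc.disjoint_def[OF idempotent_complete_Mod]
  have zr: "idempotent_complete_smc.zero_ring M (alg T \<chi>) \<longleftrightarrow> zero_ring T" if "ring_mor K A T \<chi>" for T \<chi>
    using idempotent_complete_smc.zero_ring_iff[OF idempotent_complete_Mod is_ring_alg[OF that]] nonzero_alg[OF that]
      zero_ring_iff[OF ring_mor_typ(2)[OF that]] by simp
  note [simp] = ring_mor_typ[OF p] ring_mor_typ[OF k'm] ring_mor_typ[OF k2m]
  have dis: "disjoint S k' k2" unfolding disjoint_def
  proof (intro allI impI, elim conjE)
    fix T u assume u: "ring_mor K S T u" and e: "u \<cdot> k' = u \<cdot> k2"
    have t: "ring_mor K A T (u \<cdot> \<psi>)" by (rule ring_mor_comp[OF q u])
    have "ring_mor M C (alg T (u \<cdot> \<psi>)) (mdl S \<psi>, mdl T (u \<cdot> \<psi>), u)"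
      unfolding CS[symmetric] ring_mor_alg[OF q t] using u by blast
    moreover have "Comp M (mdl S \<psi>, mdl T (u \<cdot> \<psi>), u) k = Comp M (mdl S \<psi>, mdl T (u \<cdot> \<psi>), u) K2"
      using e by (simp add: k k2)
    ultimately have "idempotent_complete_smc.zero_ring M (alg T (u \<cdot> \<psi>))" using K2d unfolding Md by blast
    then show "zero_ring T" using zr[OF t] by simp
  qed
  have univ: "\<exists>!u. ring_mor K S T u \<and> u \<cdot> k' = g1 \<and> u \<cdot> k2 = g2"
    if g1: "ring_mor K R T g1" and g2: "ring_mor K R T g2" and e: "g1 \<cdot> \<phi> = g2 \<cdot> \<phi>" and dj: "disjoint T g1 g2" for T g1 g2
  proof -
    \<comment> \<open>The test ring becomes an \<open>A\<close>-algebra through the common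
      restriction of \<open>g1\<close> and \<open>g2\<close>.\<close>
    let ?\<chi> = "g1 \<cdot> \<phi>"
    have t: "ring_mor K A T ?\<chi>" by (rule ring_mor_comp[OF p g1])
    let ?G1 = "(mdl R \<phi>, mdl T ?\<chi>, g1)" and ?G2 = "(mdl R \<phi>, mdl T ?\<chi>, g2)"
    have G: "ring_mor M (alg R \<phi>) (alg T ?\<chi>) ?G1" "ring_mor M (alg R \<phi>) (alg T ?\<chi>) ?G2"
      unfolding ring_mor_alg[OF p t] using g1 g2 e by auto
    have "idempotent_complete_smc.disjoint M (alg T ?\<chi>) ?G1 ?G2" unfolding Md
    proof (intro allI impI, elim conjE)
      fix V u assume u: "ring_mor M (alg T ?\<chi>) V u" and eq: "Comp M u ?G1 = Comp M u ?G2"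
      have "is_ring M V" using u by (simp add: ring_mor_def)
      then obtain V' \<xi> where V: "V = alg V' \<xi>" and v: "ring_mor K A V' \<xi>" using ring_Mod_alg by metis
      obtain u' where u': "u = (mdl T ?\<chi>, mdl V' \<xi>, u')" "ring_mor K T V' u'" using u ring_mor_alg[OF t v] V by auto
      then have "u' \<cdot> g1 = u' \<cdot> g2" using eq by simp
      then have "zero_ring V'" using disjointD[OF dj u'(2)] by simp
      then show "idempotent_complete_smc.zero_ring M V" using zr[OF v] V by simp
    qed
    from K2u[OF G this] obtain u where u: "ring_mor M C (alg T ?\<chi>) u" "Comp M u k = ?G1" "Comp M u K2 = ?G2"
      and uu: "\<And>v. ring_mor M C (alg T ?\<chi>) v \<and> Comp M v k = ?G1 \<and> Comp M v K2 = ?G2 \<Longrightarrow> v = u" by blast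
    obtain u' where u': "u = (mdl S \<psi>, mdl T ?\<chi>, u')" "ring_mor K S T u'" using u(1) ring_mor_alg[OF q t] CS by auto
    show ?thesis
    proof (rule ex1I[of _ u'])
      show "ring_mor K S T u' \<and> u' \<cdot> k' = g1 \<and> u' \<cdot> k2 = g2" using u u' by (simp add: k k2)
      fix v assume v: "ring_mor K S T v \<and> v \<cdot> k' = g1 \<and> v \<cdot> k2 = g2"
      then have vm: "ring_mor K S T v" by simp
      note [simp] = ring_mor_typ[OF vm]
      have "v \<cdot> \<psi> = v \<cdot> (k' \<cdot> \<phi>)" by (simp add: k'p)
      also have "\<dots> = (v \<cdot> k') \<cdot> \<phi>" by simp
      finally have "v \<cdot> \<psi> = ?\<chi>" using v by simp
      then have "ring_mor M C (alg T ?\<chi>) (mdl S \<psi>, mdl T ?\<chi>, v)"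
        unfolding CS[symmetric] ring_mor_alg[OF q t] using vm by blast
      then have "(mdl S \<psi>, mdl T ?\<chi>, v) = u" using v by (intro uu) (simp add: k k2)
      then show "v = u'" using u' by simp
    qed
  qed
  show "\<exists>k2. ring_mor K R (mod_to_ring K A C) k2 \<and> k2 \<cdot> \<phi> = und k \<cdot> \<phi> \<and> disjoint (mod_to_ring K A C) (und k) k2 \<and>
      (\<forall>S g1 g2. ring_mor K R S g1 \<and> ring_mor K R S g2 \<and> g1 \<cdot> \<phi> = g2 \<cdot> \<phi> \<and> disjoint S g1 g2 \<longrightarrow>
        (\<exists>!u. ring_mor K (mod_to_ring K A C) S u \<and> u \<cdot> und k = g1 \<and> u \<cdot> k2 = g2))"
    using k2m k2p k'p dis univ unfolding S_def[symmetric] by (intro exI[of _ k2]) (simp add: k)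
qed

end

context idempotent_complete_smc
begin

section \<open>The degree\<close>

text \<open>A^{[n+2]} is built from A^{[n+1]} as an algebra over A^{[n]}, so the induction carries
  two consecutive members, the map between them and the compatibility of their universal
  tuples.\<close>

lemma degree_tower_represents:
  assumes sep: "separable_ring K A" and tw: "degree_tower K A T \<phi>"
  shows "separable_ring K (T n) \<and> separable_ring K (T (Suc n)) \<and> ring_mor K (T n) (T (Suc n)) (\<phi> n) \<and>
    (\<exists>\<alpha> \<beta>. represents A n (T n) \<alpha> \<and> represents A (Suc n) (T (Suc n)) \<beta> \<and> (\<forall>i<n. \<phi> n \<cdot> \<alpha> i = \<beta> i))"
proof (induction n)
  case 0
  have A [simp]: "is_ring K A" using sep by (simp add: separable_ring_def)
  have t: "T 0 = unit_ring K" "T (Suc 0) = A" "\<phi> 0 = One A" using tw by (auto simp: degree_tower_def)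
  have "represents A 0 (unit_ring K) (\<lambda>_. undefined)"
    unfolding represents_def
  proof (intro conjI allI impI)
    fix R g assume "disjoint_family A R 0 g"
    then have R: "is_ring K R" by (simp add: disjoint_family_def)
    show "\<exists>!u. ring_mor K (unit_ring K) R u \<and> (\<forall>i<0. u \<cdot> undefined = g i)"
    proof (rule ex1I[of _ "One R"])
      show "u = One R" if "ring_mor K (unit_ring K) R u \<and> (\<forall>i<0. u \<cdot> undefined = g i)" for u
        using that unit_ring_mor_unique by blast
    qed (simp add: unit_ring_mor[OF R])
  qed (simp add: disjoint_family_def)
  moreover have "represents A (Suc 0) A (\<lambda>_. Ide K (Car A))"
    unfolding represents_def
  proof (intro conjI allI impI)
    fix R g assume "disjoint_family A R (Suc 0) g"
    then have "ring_mor K A R (g 0)" by (simp add: disjoint_family_def)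
    then show "\<exists>!u. ring_mor K A R u \<and> (\<forall>i<Suc 0. u \<cdot> Ide K (Car A) = g i)"
      by (intro ex1I[of _ "g 0"]) (auto simp: ring_mor_typ)
  qed (simp add: disjoint_family_def ring_mor_ide)
  ultimately show ?case using t sep separable_unit unit_ring_mor[OF A] by auto
next
  case (Suc n)
  then obtain \<alpha> \<beta> where r: "represents A n (T n) \<alpha>" "represents A (Suc n) (T (Suc n)) \<beta>" "\<And>i. i < n \<Longrightarrow> \<phi> n \<cdot> \<alpha> i = \<beta> i"
    and s: "separable_ring K (T n)" "separable_ring K (T (Suc n))" and m: "ring_mor K (T n) (T (Suc n)) (\<phi> n)" by blast
  interpret B: sep_ring K "T n" by unfold_locales (rule s(1))
  obtain C k where d: "derived_ring (Mod K (T n)) (alg_to_mod K (T n) (T (Suc n)) (\<phi> n)) C k"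
    and T2: "T (Suc (Suc n)) = mod_to_ring K (T n) C" and p2: "\<phi> (Suc n) = und k"
    using tw unfolding degree_tower_def by (metis Suc_eq_plus1 add_2_eq_Suc')
  note o = B.derived_over[OF m d]
  obtain k2 where k2: "ring_mor K (T (Suc n)) (mod_to_ring K (T n) C) k2" "k2 \<cdot> \<phi> n = und k \<cdot> \<phi> n"
      "disjoint (mod_to_ring K (T n) C) (und k) k2"
    and u: "\<And>S g1 g2. ring_mor K (T (Suc n)) S g1 \<Longrightarrow> ring_mor K (T (Suc n)) S g2 \<Longrightarrow> g1 \<cdot> \<phi> n = g2 \<cdot> \<phi> n \<Longrightarrow> disjoint S g1 g2 \<Longrightarrow>
        \<exists>!u. ring_mor K (mod_to_ring K (T n) C) S u \<and> u \<cdot> und k = g1 \<and> u \<cdot> k2 = g2"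
    using o(3) by blast
  obtain \<gamma> where "represents A (Suc (Suc n)) (mod_to_ring K (T n) C) \<gamma>" "\<forall>i<Suc n. und k \<cdot> \<beta> i = \<gamma> i"
    using represents_step[OF r(1,2) m r(3) o(2) k2 u] by blast
  then show ?case using r(2) s(2) o(1,2) T2 p2 by auto
qed

text \<open>Each member is chosen in a category that depends on earlier choices. Dependent choice
  therefore runs over triples of two consecutive rings and their structure map; \<open>P\<close>
  keeps the rings separable, so that the next step can be taken, and \<open>Q\<close> links one
  triple to the next.\<close>

lemma ex_degree_tower:
  assumes sep: "separable_ring K A" shows "\<exists>T \<phi>. degree_tower K A T \<phi>"
proof -
  have A: "is_ring K A" using sep by (simp add: separable_ring_def)
  define P where "P = (\<lambda>(n::nat) (R, S, f). separable_ring K R \<and> separable_ring K S \<and> ring_mor K R S f \<and>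
     (n = 0 \<longrightarrow> R = unit_ring K \<and> S = A \<and> f = One A))"
  define Q where "Q = (\<lambda>(n::nat) (R, S, f) (R', S', f'). R' = S \<and> (\<exists>C k. derived_ring (Mod K R) (alg_to_mod K R S f) C k \<and>
      S' = mod_to_ring K R C \<and> f' = und k))"
  have "\<exists>s. \<forall>n. P n (s n) \<and> Q n (s n) (s (Suc n))"
  proof (rule dependent_nat_choice)
    show "\<exists>x. P 0 x" using sep separable_unit unit_ring_mor[OF A] by (auto simp: P_def)
    fix x n assume "P n x"
    then obtain R S f where x: "x = (R, S, f)" and s: "separable_ring K R" "separable_ring K S" and m: "ring_mor K R S f"
      by (cases x) (auto simp: P_def)
    interpret B: sep_ring K R by unfold_locales (rule s(1))
    obtain C k where d: "derived_ring (Mod K R) (alg_to_mod K R S f) C k"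
      using idempotent_complete_smc.ex_derived_ring[OF B.idempotent_complete_Mod B.separable_alg[OF m s(2)]] by blast
    have "P (Suc n) (S, mod_to_ring K R C, und k)" using s(2) B.derived_over(1,2)[OF m d] by (simp add: P_def)
    moreover have "Q n x (S, mod_to_ring K R C, und k)" using d unfolding Q_def x prod.case by blast
    ultimately show "\<exists>y. P (Suc n) y \<and> Q n x y" by blast
  qed
  then obtain s where P: "\<And>n. P n (s n)" and Q: "\<And>n. Q n (s n) (s (Suc n))" by blast
  have c: "fst (s (Suc n)) = fst (snd (s n))" for n using Q[of n] by (auto simp: Q_def split: prod.splits)
  have "degree_tower K A (\<lambda>n. fst (s n)) (\<lambda>n. snd (snd (s n)))"
    unfolding degree_tower_def
  proof (intro conjI allI)
    have "fst (s 0) = unit_ring K \<and> fst (snd (s 0)) = A \<and> snd (snd (s 0)) = One A"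
      using P[of 0] by (auto simp: P_def split: prod.splits)
    then show "fst (s 0) = unit_ring K" "fst (s 1) = A" "snd (snd (s 0)) = One A" using c[of 0] by auto
    fix n
    obtain R S f where sn: "s n = (R, S, f)" by (cases "s n")
    obtain C k where d: "derived_ring (Mod K R) (alg_to_mod K R S f) C k"
      and e: "fst (snd (s (Suc n))) = mod_to_ring K R C" "snd (snd (s (Suc n))) = und k"
      using Q[of n] unfolding Q_def sn by (auto split: prod.splits)
    show "\<exists>C k. derived_ring (Mod K (fst (s n))) (alg_to_mod K (fst (s n)) (fst (s (n + 1))) (snd (snd (s n)))) C k \<and>
         fst (s (n + 2)) = mod_to_ring K (fst (s n)) C \<and> snd (snd (s (n + 1))) = und k"
      using d e c[of n] c[of "Suc n"] sn by (intro exI[of _ C] exI[of _ k]) simp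
  qed
  then show ?thesis by blast
qed

text \<open>If A^{[n]} is nonzero it carries a disjoint n-tuple itself. Conversely such a tuple in
  \<open>R\<close> yields a morphism from A^{[n]} to \<open>R\<close>, and a zero ring maps only to
  zero rings.\<close>

lemma tower_props:
  assumes sep: "separable_ring K A" and tw: "degree_tower K A T \<phi>"
  shows "separable_ring K (T n)" "\<exists>\<alpha>. represents A n (T n) \<alpha>"
    "nonzero K (T n) \<longleftrightarrow> (\<exists>R g. disjoint_family A R n g \<and> \<not> zero_ring R)"
proof -
  note r = degree_tower_represents[OF sep tw, of n]
  show s: "separable_ring K (T n)" using r by blast
  show "\<exists>\<alpha>. represents A n (T n) \<alpha>" using r by blast
  then obtain \<alpha> where a: "represents A n (T n) \<alpha>" by blast
  have [simp]: "is_ring K (T n)" using s by (simp add: separable_ring_def)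
  show "nonzero K (T n) \<longleftrightarrow> (\<exists>R g. disjoint_family A R n g \<and> \<not> zero_ring R)"
    using representsD(1)[OF a] representsD(2)[OF a] zero_ring_mor zero_ring_iff[of "T n"] by (metis \<open>is_ring K (T n)\<close>)
qed

text \<open>The condition on each member of the tower mentions only families of morphisms, so the
  existential over towers drops out.\<close>

lemma has_degree_iff:
  assumes sep: "separable_ring K A"
  shows "has_degree K A d \<longleftrightarrow> (\<exists>R g. disjoint_family A R d g \<and> \<not> zero_ring R) \<and>
    (\<forall>R g. disjoint_family A R (Suc d) g \<longrightarrow> zero_ring R)"
  using tower_props(3)[OF sep] ex_degree_tower[OF sep] unfolding has_degree_def by (metis Suc_eq_plus1)

lemma disjoint_family_mono: "disjoint_family A R n g \<Longrightarrow> m \<le> n \<Longrightarrow> disjoint_family A R m g"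
  unfolding disjoint_family_def using order_less_le_trans by blast

text \<open>Disjoint families can be shortened, so the lengths that occur over nonzero rings form an
  initial segment and its end is unique.\<close>

lemma deg_eq:
  assumes sep: "separable_ring K A" and d: "has_degree K A d" shows "deg K A = d"
  unfolding deg_def
proof (rule the_equality)
  show "has_degree K A d" by (rule d)
next
  fix e assume e: "has_degree K A e"
  have "\<not> d < e" "\<not> e < d"
    using d e unfolding has_degree_iff[OF sep] by (meson Suc_leI disjoint_family_mono)+
  then show "e = d" by simp
qed

text \<open>The degree is the largest length of a disjoint family over a nonzero ring. The given
  \<open>R\<close> carries the empty family, so that a largest length exists below the
  bound.\<close>

lemma finite_degreeI:
  assumes sep: "separable_ring K A" and R: "is_ring K R" "\<not> zero_ring R"
    and b: "\<And>R g n. \<lbrakk>disjoint_family A R n g; \<not> zero_ring R\<rbrakk> \<Longrightarrow> n \<le> (N::nat)"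
  shows "finite_degree K A"
proof -
  let ?P = "\<lambda>n::nat. \<exists>R g. disjoint_family A R n g \<and> \<not> zero_ring R"
  have 0: "?P 0" using R by (intro exI[of _ R] exI[of _ undefined]) (simp add: disjoint_family_def)
  define d where "d = (GREATEST n. ?P n)"
  have "?P d" unfolding d_def by (rule GreatestI_nat[of ?P, OF 0]) (use b in blast)
  moreover have "\<not> ?P (Suc d)"
  proof
    assume "?P (Suc d)"
    then have "Suc d \<le> d" unfolding d_def by (rule Greatest_le_nat) (use b in blast)
    then show False by simp
  qed
  ultimately have "has_degree K A d" unfolding has_degree_iff[OF sep] by blast
  then show ?thesis by (auto simp: finite_degree_def)
qed

section \<open>Splitting\<close>

text \<open>The isomorphism $B \otimes A \cong B^I$ over \<open>B\<close> amounts to a family of ring morphisms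
  $A \to B$ indexed by \<open>I\<close>, its components on the second factor.\<close>

definition split_by where
  "split_by I B A f \<longleftrightarrow> is_ring K A \<and> is_ring K B \<and> (\<forall>i\<in>I. ring_mor K A B (f i)) \<and>
     (\<exists>e. decomp I (tens_ring K B A) e (\<lambda>i. B) (\<lambda>i. copair B (Ide K (Car B)) (f i)))"

lemma splits_iff:
  "splits K B A \<longleftrightarrow> separable_ring K A \<and> finite_degree K A \<and> separable_ring K B \<and> finite_degree K B \<and>
     (\<exists>f. split_by {..<deg K A} B A f)"
proof (cases "separable_ring K A \<and> separable_ring K B")
  case True
  interpret B: sep_ring K B by unfold_locales (use True in blast)
  have A: "is_ring K A" using True by (simp add: separable_ring_def)
  have "(\<exists>f. split_by {..<deg K A} B A f) \<longleftrightarrow> (\<exists>f. (\<forall>i\<in>{..<deg K A}. ring_mor K A B (f i)) \<and>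
      product_ring K {..<deg K A} (\<lambda>i. B) (tens_ring K B A) (\<lambda>i. copair B (Ide K (Car B)) (f i)))"
    unfolding split_by_def using A B.A_ring decomp_product product_decomp by blast
  then show ?thesis unfolding splits_def B.splits_iff_product[OF A, symmetric] by blast
qed (auto simp: splits_def)

text \<open>The pair \<open>u\<close>, \<open>g\<close> is a point of B \<otimes> A, which is a
  product of copies of \<open>B\<close>. After shrinking it lies on the copy with some index i,
  where the second component is \<open>f i\<close>.\<close>

lemma split_by_point:
  assumes s: "split_by I B A f" and u: "ring_mor K B R u" and g: "ring_mor K A R g" and nz: "\<not> zero_ring R"
  shows "\<exists>i\<in>I. \<exists>S v. ring_mor K R S v \<and> \<not> zero_ring S \<and> v \<cdot> g = v \<cdot> (u \<cdot> f i)"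
proof -
  have A: "is_ring K A" and B: "is_ring K B" and fm: "\<And>i. i \<in> I \<Longrightarrow> ring_mor K A B (f i)" using s by (auto simp: split_by_def)
  obtain e where d: "decomp I (tens_ring K B A) e (\<lambda>i. B) (\<lambda>i. copair B (Ide K (Car B)) (f i))" using s by (auto simp: split_by_def)
  note c = copair_mor[OF u g]
  obtain i S v w where i: "i \<in> I" and v: "ring_mor K R S v" and S: "\<not> zero_ring S" and w: "ring_mor K B S w"
    and e: "w \<cdot> copair B (Ide K (Car B)) (f i) = v \<cdot> copair R u g"
    using decomp_point[OF d c nz] by blast
  have p1: "ring_mor K B B (Ide K (Car B))" by (rule ring_mor_ide[OF B])
  note c2 = copair_mor[OF p1 fm[OF i]]
  note [simp] = A B ring_mor_typ[OF u] ring_mor_typ[OF g] ring_mor_typ[OF v] ring_mor_typ[OF w] ring_mor_typ[OF fm[OF i]]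
    ring_mor_typ(3,5)[OF c] ring_mor_typ(4)[OF c, simplified] ring_mor_typ(3,5)[OF c2] ring_mor_typ(4)[OF c2, simplified]
    copair_in[OF u g] copair_in[OF p1 fm[OF i]]
  have "(w \<cdot> copair B (Ide K (Car B)) (f i)) \<cdot> inl B A = (v \<cdot> copair R u g) \<cdot> inl B A"
    "(w \<cdot> copair B (Ide K (Car B)) (f i)) \<cdot> inr B A = (v \<cdot> copair R u g) \<cdot> inr B A" unfolding e by simp_all
  then have "w = v \<cdot> u" "w \<cdot> f i = v \<cdot> g" by simp_all
  then have "v \<cdot> g = v \<cdot> (u \<cdot> f i)" by simp
  then show ?thesis using i v S by blast
qed

lemma split_by_point_indecomposable:
  assumes s: "split_by I B A f" and u: "ring_mor K B R u" and g: "ring_mor K A R g" and R: "indecomposable K R"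
  shows "\<exists>i\<in>I. g = u \<cdot> f i"
proof -
  have A: "is_ring K A" and B: "is_ring K B" and fm: "\<And>i. i \<in> I \<Longrightarrow> ring_mor K A B (f i)" using s by (auto simp: split_by_def)
  obtain e where d: "decomp I (tens_ring K B A) e (\<lambda>i. B) (\<lambda>i. copair B (Ide K (Car B)) (f i))" using s by (auto simp: split_by_def)
  note c = copair_mor[OF u g]
  obtain i w where i: "i \<in> I" and w: "ring_mor K B R w" and e: "w \<cdot> copair B (Ide K (Car B)) (f i) = copair R u g"
    using decomp_point_indecomposable[OF d c R] by blast
  have p1: "ring_mor K B B (Ide K (Car B))" by (rule ring_mor_ide[OF B])
  note c2 = copair_mor[OF p1 fm[OF i]]
  note [simp] = A B ring_mor_typ[OF u] ring_mor_typ[OF g] ring_mor_typ[OF w] ring_mor_typ[OF fm[OF i]]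
    ring_mor_typ(3,5)[OF c] ring_mor_typ(4)[OF c, simplified] ring_mor_typ(3,5)[OF c2] ring_mor_typ(4)[OF c2, simplified]
    copair_in[OF u g] copair_in[OF p1 fm[OF i]]
  have "(w \<cdot> copair B (Ide K (Car B)) (f i)) \<cdot> inl B A = copair R u g \<cdot> inl B A"
    "(w \<cdot> copair B (Ide K (Car B)) (f i)) \<cdot> inr B A = copair R u g \<cdot> inr B A" unfolding e by simp_all
  then have "w = u" "w \<cdot> f i = g" by simp_all
  then show ?thesis using i by blast
qed

text \<open>Finitely many morphisms are treated one after the other, each shrinking the ring;
  identifications already made survive further composition.\<close>

lemma split_by_points:
  assumes s: "split_by I B A f" and "finite J" and u: "ring_mor K B R u" and nz: "\<not> zero_ring R"
    and "\<And>j. j \<in> J \<Longrightarrow> ring_mor K A R (g j)"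
  shows "\<exists>S v c. ring_mor K R S v \<and> \<not> zero_ring S \<and> (\<forall>j\<in>J. c j \<in> I \<and> v \<cdot> g j = v \<cdot> (u \<cdot> f (c j)))"
  using assms(2,5)
proof (induction J rule: finite_induct)
  case empty
  then show ?case using nz ring_mor_ide[OF ring_mor_typ(2)[OF u]] by blast
next
  case (insert j J)
  then obtain S v c where v: "ring_mor K R S v" and S: "\<not> zero_ring S"
    and c: "\<And>j. j \<in> J \<Longrightarrow> c j \<in> I \<and> v \<cdot> g j = v \<cdot> (u \<cdot> f (c j))" by blast
  have gj: "ring_mor K A R (g j)" using insert by simp
  obtain i S' v' where i: "i \<in> I" and v': "ring_mor K S S' v'" and S': "\<not> zero_ring S'" and e: "v' \<cdot> (v \<cdot> g j) = v' \<cdot> ((v \<cdot> u) \<cdot> f i)"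
    using split_by_point[OF s ring_mor_comp[OF u v] ring_mor_comp[OF gj v] S] by blast
  have fm: "ring_mor K A B (f i)" if "i \<in> I" for i using s that by (auto simp: split_by_def)
  note [simp] = ring_mor_typ[OF u] ring_mor_typ[OF v] ring_mor_typ[OF v'] ring_mor_typ[OF gj] ring_mor_typ[OF fm[OF i]]
  have "(v' \<cdot> v) \<cdot> g j = (v' \<cdot> v) \<cdot> (u \<cdot> f i)" using e by simp
  moreover have "(v' \<cdot> v) \<cdot> g k = (v' \<cdot> v) \<cdot> (u \<cdot> f (c k))" if k: "k \<in> J" for k
  proof -
    have "ring_mor K A R (g k)" using insert k by simp
    note [simp] = ring_mor_typ[OF this] ring_mor_typ[OF fm[OF c[OF k, THEN conjunct1]]]
    show ?thesis using c[OF k] by simp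
  qed
  ultimately show ?case using i c insert(2) ring_mor_comp[OF v v'] S'
    by (intro exI[of _ S'] exI[of _ "v' \<cdot> v"] exI[of _ "c(j := i)"]) auto
qed

text \<open>Where \<open>f i\<close> and \<open>f j\<close> agree, the projections to the copies i
  and j agree as well, and the idempotent of copy i is sent both to 1 and to 0.\<close>

lemma split_by_disjoint:
  assumes s: "split_by I B A f" and ij: "i \<in> I" "j \<in> I" "i \<noteq> j"
  shows "disjoint B (f i) (f j)"
  unfolding disjoint_def
proof (intro allI impI, elim conjE)
  fix S u assume u: "ring_mor K B S u" and eq: "u \<cdot> f i = u \<cdot> f j"
  have A: "is_ring K A" and B: "is_ring K B" and fm: "\<And>i. i \<in> I \<Longrightarrow> ring_mor K A B (f i)" using s by (auto simp: split_by_def)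
  obtain e where d: "decomp I (tens_ring K B A) e (\<lambda>i. B) (\<lambda>i. copair B (Ide K (Car B)) (f i))" using s by (auto simp: split_by_def)
  have p1: "ring_mor K B B (Ide K (Car B))" by (rule ring_mor_ide[OF B])
  let ?ci = "copair B (Ide K (Car B)) (f i)" and ?cj = "copair B (Ide K (Car B)) (f j)"
  note ci = copair_mor[OF p1 fm[OF ij(1)]] and cj = copair_mor[OF p1 fm[OF ij(2)]]
  note [simp] = A B ring_mor_typ[OF u] ring_mor_typ[OF fm[OF ij(1)]] ring_mor_typ[OF fm[OF ij(2)]]
    ring_mor_typ(3,5)[OF ci] ring_mor_typ(4)[OF ci, simplified] ring_mor_typ(3,5)[OF cj] ring_mor_typ(4)[OF cj, simplified]
    copair_in[OF p1 fm[OF ij(1)]] copair_in[OF p1 fm[OF ij(2)]]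
  have "u \<cdot> ?ci = u \<cdot> ?cj"
    by (rule copair_unique[OF B A ring_mor_comp[OF ci u] ring_mor_comp[OF cj u]]) (use eq in auto)
  note f = is_factorD[OF decompD(3)[OF d ij(1)]]
  have [simp]: "arr (e i)" "Dom K (e i) = Unity K" "Cod K (e i) = Car B \<boxtimes> Car A" using f(2) by auto
  have "u \<cdot> (?ci \<cdot> e i) = (u \<cdot> ?ci) \<cdot> e i" by simp
  also have "\<dots> = u \<cdot> (?cj \<cdot> e i)" unfolding \<open>u \<cdot> ?ci = u \<cdot> ?cj\<close> by simp
  finally show "zero_ring S" using f(3) decompD(6)[OF d ij] by (simp add: zero_ring_def)
qed

lemma decomp_sum_idem:
  assumes R [simp]: "is_ring K R" and I: "finite I" and ge: "\<And>i. i \<in> I \<Longrightarrow> glob R (e i)"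
    and ee: "\<And>i. i \<in> I \<Longrightarrow> gmul R (e i) (e i) = e i"
    and o: "\<And>i j. \<lbrakk>i \<in> I; j \<in> I; i \<noteq> j\<rbrakk> \<Longrightarrow> gmul R (e i) (e j) = Z (Unity K) (Car R)"
  shows "glob R (finsum (Gam R) e I)" "i \<in> I \<Longrightarrow> gmul R (e i) (finsum (Gam R) e I) = e i"
    "gmul R (finsum (Gam R) e I) (finsum (Gam R) e I) = finsum (Gam R) e I"
proof -
  interpret cring "Gam R" by (rule cring_Gam) simp
  let ?E = "finsum (Gam R) e I"
  have e: "e \<in> I \<rightarrow> carrier (Gam R)" using ge by (auto simp: in_Hom)
  have E: "?E \<in> carrier (Gam R)" by (rule finsum_closed[OF e])
  then show "glob R ?E" by (simp add: in_Hom)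
  have 1: "e i \<otimes>\<^bsub>Gam R\<^esub> ?E = e i" if i: "i \<in> I" for i
  proof -
    have ei: "e i \<in> carrier (Gam R)" using e i by auto
    have "e i \<otimes>\<^bsub>Gam R\<^esub> ?E = finsum (Gam R) (\<lambda>j. e i \<otimes>\<^bsub>Gam R\<^esub> e j) I" by (rule finsum_rdistr[OF I ei e])
    also have "\<dots> = finsum (Gam R) (\<lambda>j. if i = j then e j else \<zero>\<^bsub>Gam R\<^esub>) I"
    proof (rule finsum_cong')
      show "(\<lambda>j. if i = j then e j else \<zero>\<^bsub>Gam R\<^esub>) \<in> I \<rightarrow> carrier (Gam R)"
        using e zero_closed by (auto simp del: Gam_sel)
    qed (use ee o i in auto)
    also have "\<dots> = e i" by (rule add.finprod_singleton[OF i I]) (use e in simp)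
    finally show ?thesis .
  qed
  then show "i \<in> I \<Longrightarrow> gmul R (e i) ?E = e i" by simp
  have "?E \<otimes>\<^bsub>Gam R\<^esub> ?E = finsum (Gam R) (\<lambda>j. e j \<otimes>\<^bsub>Gam R\<^esub> ?E) I" by (rule finsum_ldistr[OF I E e])
  also have "\<dots> = ?E" by (rule finsum_cong'[OF refl e]) (use 1 in auto)
  finally show "gmul R ?E ?E = ?E" by simp
qed

text \<open>The idempotents describe the loci in B \<otimes> A where \<open>inr\<close> agrees with
  \<open>f i\<close>. Disjointness makes them orthogonal; the hypothesis that no morphism to a
  nonzero ring avoids all the \<open>f i\<close> makes the complement of their sum vanish.\<close>

lemma split_byI:
  assumes sep: "separable_ring K A" and B: "is_ring K B" and I: "finite I" and fm: "\<And>i. i \<in> I \<Longrightarrow> ring_mor K A B (f i)"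
    and dj: "\<And>i j. \<lbrakk>i \<in> I; j \<in> I; i \<noteq> j\<rbrakk> \<Longrightarrow> disjoint B (f i) (f j)"
    and mx: "\<And>R u h. \<lbrakk>ring_mor K B R u; ring_mor K A R h; \<And>i. i \<in> I \<Longrightarrow> disjoint R (u \<cdot> f i) h\<rbrakk> \<Longrightarrow> zero_ring R"
  shows "split_by I B A f"
proof -
  have A [simp]: "is_ring K A" using sep by (simp add: separable_ring_def)
  note [simp] = B
  let ?W = "tens_ring K B A" and ?J = "Ide K (Car B)"
  have W: "is_ring K ?W" by simp
  have p1: "ring_mor K B B ?J" by (rule ring_mor_ide[OF B])
  note il = inl_mor[OF B A] and ir = inr_mor[OF B A]
  have "\<forall>i\<in>I. \<exists>e. equalizes ?W e (inl B A \<cdot> f i) (inr B A)"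
    using separable_equalizes[OF sep ring_mor_comp[OF fm il] ir] by blast
  then obtain e where e: "\<And>i. i \<in> I \<Longrightarrow> equalizes ?W (e i) (inl B A \<cdot> f i) (inr B A)" by metis
  have ge: "glob ?W (e i)" and ee: "gmul ?W (e i) (e i) = e i" if "i \<in> I" for i using equalizesD[OF e[OF that]] by auto
  have ft: "arr (f i)" "Dom K (f i) = Car A" "Cod K (f i) = Car B" if "i \<in> I" for i using ring_mor_typ[OF fm[OF that]] by auto
  have fac: "is_factor ?W (e i) B (copair B ?J (f i))" if i: "i \<in> I" for i
  proof (rule factorI[where s = "inl B A"])
    let ?c = "copair B ?J (f i)"
    note c = copair_mor[OF p1 fm[OF i]] and ci = copair_in[OF p1 fm[OF i]]
    note [simp] = ft[OF i] ring_mor_typ(3,5)[OF c] ring_mor_typ(4)[OF c, simplified] ci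
    show "ring_mor K ?W B ?c" "glob ?W (e i)" "?c \<cdot> inl B A = Ide K (Car B)" by (rule c, rule ge[OF i], rule ci)
    have "?c \<cdot> (inl B A \<cdot> f i) = (?c \<cdot> inl B A) \<cdot> f i" by (rule comp_assoc'[symmetric]) simp_all
    then show "?c \<cdot> e i = One B" using equalizesD(3)[OF e[OF i] c] by simp
    obtain S p where p: "is_factor ?W (e i) S p" using ex_factor[OF W ge[OF i] ee[OF i]] by blast
    then obtain \<iota> where k: "arr \<iota>" "Dom K \<iota> = Car S" "Cod K \<iota> = Car ?W" "\<iota> \<cdot> p = scal ?W (e i)"
      and pm: "ring_mor K ?W S p" by (auto simp: is_factor_def)
    note [simp] = k(1,2) k(3)[simplified] ring_mor_typ(3,5)[OF pm] ring_mor_typ(4)[OF pm, simplified]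
    have pe: "p \<cdot> (inl B A \<cdot> f i) = p \<cdot> inr B A" using equalizesD(3)[OF e[OF i] pm] is_factorD(3)[OF p] by simp
    have "p = (p \<cdot> inl B A) \<cdot> ?c"
    proof (rule copair_unique[OF B A pm])
      show "ring_mor K ?W S ((p \<cdot> inl B A) \<cdot> ?c)" by (rule ring_mor_comp[OF c ring_mor_comp[OF il pm]])
      have "((p \<cdot> inl B A) \<cdot> ?c) \<cdot> inl B A = (p \<cdot> inl B A) \<cdot> (?c \<cdot> inl B A)" by (rule comp_assoc') simp_all
      then show "p \<cdot> inl B A = ((p \<cdot> inl B A) \<cdot> ?c) \<cdot> inl B A" by simp
      have "((p \<cdot> inl B A) \<cdot> ?c) \<cdot> inr B A = (p \<cdot> inl B A) \<cdot> (?c \<cdot> inr B A)" by (rule comp_assoc') simp_all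
      then show "p \<cdot> inr B A = ((p \<cdot> inl B A) \<cdot> ?c) \<cdot> inr B A" using pe by simp
    qed
    then have "\<iota> \<cdot> p = \<iota> \<cdot> ((p \<cdot> inl B A) \<cdot> ?c)" by simp
    also have "\<dots> = (\<iota> \<cdot> p) \<cdot> inl B A \<cdot> ?c" by simp
    finally show "scal ?W (e i) \<cdot> inl B A \<cdot> ?c = scal ?W (e i)" unfolding k(4) by simp
  qed simp_all
  have orth: "gmul ?W (e i) (e j) = Z (Unity K) (Car ?W)" if ij: "i \<in> I" "j \<in> I" "i \<noteq> j" for i j
  proof -
    note gi = ge[OF ij(1)] ee[OF ij(1)] and gj = ge[OF ij(2)] ee[OF ij(2)]
    note gg = gmul_one_iff(1)[OF W gi(1) gj(1) gi(2) gj(2)]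
    \<comment> \<open>Over the factor cut out by the product of two of the idempotents both become
      1, so \<open>f i\<close> and \<open>f j\<close> agree there and the factor is zero.\<close>
    obtain S q where q: "is_factor ?W (gmul ?W (e i) (e j)) S q" using ex_factor[OF W _ gg] gi gj by (auto simp del: tens_ring_sel)
    note qm = is_factorD(1)[OF q]
    note [simp] = ring_mor_typ(3,5)[OF qm] ring_mor_typ(4)[OF qm, simplified] ft[OF ij(1)] ft[OF ij(2)]
    have S: "is_ring K S" using ring_mor_typ[OF qm] by simp
    have one: "gmul S (q \<cdot> e i) (q \<cdot> e j) = One S" using is_factorD(3)[OF q] ring_mor_gmul[OF qm gi(1) gj(1)] by simp
    have idem: "gmul S (q \<cdot> e i) (q \<cdot> e i) = q \<cdot> e i" "gmul S (q \<cdot> e j) (q \<cdot> e j) = q \<cdot> e j"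
      using ring_mor_gmul[OF qm gi(1) gi(1)] ring_mor_gmul[OF qm gj(1) gj(1)] gi gj by simp_all
    have "glob S (q \<cdot> e i)" "glob S (q \<cdot> e j)" using gi gj by simp_all
    then have "q \<cdot> e i = One S" "q \<cdot> e j = One S" using gmul_one_iff(2)[OF S _ _ idem] one by blast+
    then have "q \<cdot> (inl B A \<cdot> f i) = q \<cdot> (inl B A \<cdot> f j)"
      using equalizesD(3)[OF e[OF ij(1)] qm] equalizesD(3)[OF e[OF ij(2)] qm] by simp
    then have "(q \<cdot> inl B A) \<cdot> f i = (q \<cdot> inl B A) \<cdot> f j" by simp
    then have "zero_ring S" using disjointD[OF dj[OF ij] ring_mor_comp[OF il qm]] by simp
    then show ?thesis using factor_zero_iff[OF q] by simp
  qed
  let ?E = "finsum (Gam ?W) e I"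
  have E: "glob ?W ?E" "\<And>i. i \<in> I \<Longrightarrow> gmul ?W (e i) ?E = e i" "gmul ?W ?E ?E = ?E"
    by (rule decomp_sum_idem[OF W I]; use ge ee orth in blast)+
  note c = compl_props[OF W E(1)]
  \<comment> \<open>Over the complement of the sum every idempotent vanishes, so \<open>inr\<close>
    is disjoint from all the \<open>f i\<close> there.\<close>
  obtain S q where q: "is_factor ?W (compl ?W ?E) S q" using ex_factor[OF W c(1) c(4)[OF E(3)]] by blast
  note qm = is_factorD(1)[OF q]
  note [simp] = ring_mor_typ(3,5)[OF qm] ring_mor_typ(4)[OF qm, simplified]
  have S [simp]: "is_ring K S" using ring_mor_typ[OF qm] by simp
  have gqE: "glob S (q \<cdot> ?E)" using E(1) by simp
  have qE: "q \<cdot> ?E = Z (Unity K) (Car S)"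
    using c(5)[OF qm] is_factorD(3)[OF q] compl_props(7)[OF S gqE] by simp
  have qe: "q \<cdot> e i = Z (Unity K) (Car S)" if i: "i \<in> I" for i
  proof -
    interpret cring "Gam S" by (rule cring_Gam) simp
    have "q \<cdot> e i = gmul S (q \<cdot> e i) (q \<cdot> ?E)" using ring_mor_gmul[OF qm ge[OF i] E(1)] E(2)[OF i] by simp
    also have "\<dots> = (q \<cdot> e i) \<otimes>\<^bsub>Gam S\<^esub> \<zero>\<^bsub>Gam S\<^esub>" using qE by simp
    also have "\<dots> = \<zero>\<^bsub>Gam S\<^esub>" by (rule r_null) (use ge[OF i] in \<open>simp add: in_Hom\<close>)
    finally show ?thesis by simp
  qed
  have "zero_ring S"
  proof (rule mx[OF ring_mor_comp[OF il qm] ring_mor_comp[OF ir qm]])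
    fix i assume i: "i \<in> I"
    note [simp] = ft[OF i]
    show "disjoint S ((q \<cdot> inl B A) \<cdot> f i) (q \<cdot> inr B A)" unfolding disjoint_def
    proof (intro allI impI, elim conjE)
      fix X v assume v: "ring_mor K S X v" and eq: "v \<cdot> ((q \<cdot> inl B A) \<cdot> f i) = v \<cdot> (q \<cdot> inr B A)"
      note [simp] = ring_mor_typ[OF v]
      have ge': "arr (e i)" "Dom K (e i) = Unity K" "Cod K (e i) = Car B \<boxtimes> Car A" using ge[OF i] by auto
      have "(v \<cdot> q) \<cdot> (inl B A \<cdot> f i) = (v \<cdot> q) \<cdot> inr B A" using eq by simp
      then have "(v \<cdot> q) \<cdot> e i = One X" using equalizesD(3)[OF e[OF i] ring_mor_comp[OF qm v]] by simp
      then show "zero_ring X" using qe[OF i] ge' by (simp add: zero_ring_def)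
    qed
  qed
  then have "compl ?W ?E = Z (Unity K) (Car ?W)" using factor_zero_iff[OF q] by simp
  then have "?E = One ?W" using c(6) by simp
  then have "decomp I ?W e (\<lambda>i. B) (\<lambda>i. copair B ?J (f i))" using W I fac orth by (simp add: decomp_def del: tens_ring_sel)
  then show ?thesis using A B fm by (auto simp: split_by_def)
qed

lemma retract_iso:
  assumes sep: "separable_ring K C" and C: "indecomposable K C" and f: "ring_mor K C B f" and s: "ring_mor K B C s"
    and fs: "f \<cdot> s = Ide K (Car B)" and B: "\<not> zero_ring B"
  shows "is_iso K f"
proof -
  note [simp] = ring_mor_typ[OF f] ring_mor_typ[OF s]
  have Cr: "is_ring K C" by simp
  obtain e where e: "equalizes C e (Ide K (Car C)) (s \<cdot> f)"
    using separable_equalizes[OF sep ring_mor_ide[OF Cr] ring_mor_comp[OF f s]] by blast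
  \<comment> \<open>As \<open>s\<close> is a section, \<open>f\<close> cannot tell
    \<open>s \<cdot> f\<close> from the identity; so it sends the equalising idempotent to 1, which
    is why that idempotent is nonzero.\<close>
  have "f \<cdot> (s \<cdot> f) = f" using comp_eq[OF fs, of f] by simp
  then have fe: "f \<cdot> e = One B" using equalizesD(3)[OF e f] by simp
  have "e \<noteq> Z (Unity K) (Car C)" using fe B by (auto simp: zero_ring_def)
  then have "e = One C" using indecomposable_idem[OF C] equalizesD[OF e] by blast
  then have "s \<cdot> f = Ide K (Car C)" using equalizesD(3)[OF e ring_mor_ide[OF Cr]] by simp
  then show ?thesis using fs by (intro isoI[where g = s]) simp_all
qed

text \<open>Over a suitable nonzero ring every member of the family becomes one of the morphisms
  indexed by \<open>I\<close>, and disjoint members cannot become the same one.\<close>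

lemma split_by_card:
  assumes s: "split_by I B A f" and I: "finite I" and u: "ring_mor K B R u" and nz: "\<not> zero_ring R"
    and g: "disjoint_family A R n g"
  shows "n \<le> card I"
proof -
  obtain S v c where v: "ring_mor K R S v" and S: "\<not> zero_ring S"
    and c: "\<And>j. j < n \<Longrightarrow> c j \<in> I \<and> v \<cdot> g j = v \<cdot> (u \<cdot> f (c j))"
    using split_by_points[OF s _ u nz, of "{..<n}" g] disjoint_familyD[OF g] by blast
  have "inj_on c {..<n}"
  proof (rule inj_onI, rule ccontr)
    fix i j assume ij: "i \<in> {..<n}" "j \<in> {..<n}" "c i = c j" "i \<noteq> j"
    then have "v \<cdot> g i = v \<cdot> g j" using c by simp
    then show False using disjointD[OF disjoint_familyD(3)[OF g] v] ij S by auto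
  qed
  then show ?thesis using card_inj_on_le[of c "{..<n}" I] c I by auto
qed

section \<open>Quasi-Galois rings are splitting rings\<close>

lemma quasi_galois_split_by:
  assumes "quasi_galois K B \<Gamma>" shows "split_by \<Gamma> B B (\<lambda>\<gamma>. \<gamma>)"
proof -
  from assms have B: "is_ring K B" and "subgroup \<Gamma> (aut_group K B)" by (auto simp: quasi_galois_def)
  then have G: "ring_mor K B B \<gamma>" if "\<gamma> \<in> \<Gamma>" for \<gamma>
    using subgroup.mem_carrier[of \<Gamma> "aut_group K B" \<gamma>] that by (simp add: aut_group_def ring_isom_def)
  obtain P \<pi> \<Lambda> where pr: "product_ring K \<Gamma> (\<lambda>\<gamma>. B) P \<pi>" and L: "\<Lambda> \<in> Hom K (Car B \<boxtimes> Car B) (Car P)" "iso \<Lambda>"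
    and e: "\<And>\<gamma>. \<gamma> \<in> \<Gamma> \<Longrightarrow> \<pi> \<gamma> \<cdot> \<Lambda> = copair B (Ide K (Car B)) \<gamma>"
    using assms by (auto simp: quasi_galois_def copair_def)
  have "direct_sum K \<Gamma> (\<lambda>\<gamma>. Car B) (Dom K \<Lambda>) (\<lambda>\<gamma>. \<pi> \<gamma> \<cdot> \<Lambda>)"
    by (rule direct_sum_iso[OF _ L(2)]) (use pr L in \<open>auto simp: product_ring_def in_Hom\<close>)
  moreover have "ring_mor K (tr B) B (\<pi> \<gamma> \<cdot> \<Lambda>)" if "\<gamma> \<in> \<Gamma>" for \<gamma>
    unfolding e[OF that] by (rule copair_mor[OF ring_mor_ide[OF B] G[OF that]])
  ultimately have "product_ring K \<Gamma> (\<lambda>\<gamma>. B) (tr B) (\<lambda>\<gamma>. \<pi> \<gamma> \<cdot> \<Lambda>)" using L B by (simp add: product_ring_def in_Hom)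
  then obtain x where "decomp \<Gamma> (tr B) x (\<lambda>\<gamma>. B) (\<lambda>\<gamma>. \<pi> \<gamma> \<cdot> \<Lambda>)" using product_decomp by blast
  then have "decomp \<Gamma> (tr B) x (\<lambda>\<gamma>. B) (\<lambda>\<gamma>. copair B (Ide K (Car B)) \<gamma>)"
    using e unfolding decomp_def by metis
  then show ?thesis using B G by (auto simp: split_by_def)
qed

text \<open>The Galois condition indexes the copies by a group, splitting by the numbers below the
  degree; this passes from one to the other.\<close>

lemma split_by_reindex:
  assumes s: "split_by I B A f" and h: "bij_betw h J I" and J: "finite J"
  shows "split_by J B A (\<lambda>j. f (h j))"
proof -
  obtain e where d: "decomp I (tens_ring K B A) e (\<lambda>i. B) (\<lambda>i. copair B (Ide K (Car B)) (f i))" using s by (auto simp: split_by_def)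
  have hI: "h j \<in> I" if "j \<in> J" for j using h that by (auto simp: bij_betw_def)
  have inj: "h i \<noteq> h j" if "i \<in> J" "j \<in> J" "i \<noteq> j" for i j using h that by (auto simp: bij_betw_def inj_on_def)
  have im: "I = h ` J" and ih: "inj_on h J" using h by (auto simp: bij_betw_def)
  note dd = decompD[OF d]
  interpret cring "Gam (tens_ring K B A)" by (rule cring_Gam[OF dd(1)])
  have "e \<in> h ` J \<rightarrow> carrier (Gam (tens_ring K B A))"
    unfolding im[symmetric] using is_factorD(2)[OF dd(3)] by (auto simp: in_Hom)
  then have "finsum (Gam (tens_ring K B A)) e (h ` J) = finsum (Gam (tens_ring K B A)) (\<lambda>j. e (h j)) J"
    by (rule add.finprod_reindex[OF _ ih])
  then have "decomp J (tens_ring K B A) (\<lambda>j. e (h j)) (\<lambda>i. B) (\<lambda>j. copair B (Ide K (Car B)) (f (h j)))"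
    unfolding decomp_def using dd(1) J dd(3)[OF hI] dd(4)[OF hI hI inj] dd(5) im by auto
  then show ?thesis using s hI by (auto simp: split_by_def)
qed

text \<open>The degree of \<open>B\<close> is the order of \<Gamma>: the elements of \<Gamma> form a
  disjoint family in \<open>B\<close>, and \<open>split_by_card\<close> forbids longer ones. For a
  competitor \<open>C\<close> mapping to \<open>B\<close> by \<open>f\<close>, the identity of
  \<open>B\<close> is \<open>f\<close> after one of the morphisms B \<rightarrow> C that split
  \<open>B\<close> over \<open>C\<close>; this is the section to which \<open>retract_iso\<close>
  applies.\<close>

lemma quasi_galois_splitting:
  assumes sep: "separable_ring K B" and ind: "indecomposable K B" and fin: "finite_degree K B" and q: "quasi_galois K B \<Gamma>"
  shows "splitting_ring K B B"
proof -
  note s = quasi_galois_split_by[OF q]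
  have G: "finite \<Gamma>" using q by (simp add: quasi_galois_def)
  have B [simp]: "is_ring K B" using ind by (simp add: indecomposable_def)
  have nz: "\<not> zero_ring B" by (rule indecomposable_nonzero[OF ind])
  obtain d where d: "has_degree K B d" using fin by (auto simp: finite_degree_def)
  have deg: "deg K B = d" by (rule deg_eq[OF sep d])
  obtain h where h: "bij_betw h {..<card \<Gamma>} \<Gamma>" using ex_bij_betw_nat_finite[OF G] by (auto simp: atLeast0LessThan)
  have s': "split_by {..<card \<Gamma>} B B h" using split_by_reindex[OF s h] by simp
  have "disjoint_family B B (card \<Gamma>) h"
    using split_by_disjoint[OF s'] s' by (auto simp: disjoint_family_def split_by_def)
  then have 1: "card \<Gamma> \<le> d"
    using d nz disjoint_family_mono unfolding has_degree_iff[OF sep] by (meson not_less_eq_eq)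
  have 2: "d \<le> card \<Gamma>"
  proof (cases "d = 0")
    case False
    obtain R g where g: "disjoint_family B R d g" "\<not> zero_ring R" using d unfolding has_degree_iff[OF sep] by blast
    then show ?thesis using split_by_card[OF s G disjoint_familyD(2)[OF g(1)] g(2) g(1)] False by blast
  qed simp
  have "splits K B B" unfolding splits_iff using sep fin s' 1 2 deg by auto
  moreover have "is_iso K f" if C: "indecomposable K C" "splits K C B" and f: "ring_mor K C B f" for C f
  proof -
    obtain g where g: "split_by {..<deg K B} C B g" and sC: "separable_ring K C" using C(2) unfolding splits_iff by blast
    obtain i where i: "i < deg K B" "Ide K (Car B) = f \<cdot> g i"
      using split_by_point_indecomposable[OF g f ring_mor_ide[OF B] ind] by blast
    have "ring_mor K B C (g i)" using g i by (auto simp: split_by_def)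
    then show ?thesis using retract_iso[OF sC C(1) f _ _ nz] i by simp
  qed
  ultimately show ?thesis using ind by (auto simp: splitting_ring_def)
qed

section \<open>Splitting rings are quasi-Galois\<close>

lemma aut_group_group: assumes [simp]: "is_ring K B" shows "group (aut_group K B)"
proof (rule groupI)
  fix f g h assume "f \<in> carrier (aut_group K B)" "g \<in> carrier (aut_group K B)" "h \<in> carrier (aut_group K B)"
  then have m: "ring_mor K B B f" "ring_mor K B B g" "ring_mor K B B h" by (auto simp: aut_group_def ring_isom_def)
  show "f \<otimes>\<^bsub>aut_group K B\<^esub> g \<otimes>\<^bsub>aut_group K B\<^esub> h = f \<otimes>\<^bsub>aut_group K B\<^esub> (g \<otimes>\<^bsub>aut_group K B\<^esub> h)"
    using ring_mor_typ[OF m(1)] ring_mor_typ[OF m(2)] ring_mor_typ[OF m(3)] by (simp add: aut_group_def)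
next
  fix f g assume "f \<in> carrier (aut_group K B)" "g \<in> carrier (aut_group K B)"
  then show "f \<otimes>\<^bsub>aut_group K B\<^esub> g \<in> carrier (aut_group K B)"
    using ring_mor_comp[of B B g B f] iso_comp[of g f] ring_mor_typ by (auto simp: aut_group_def ring_isom_def)
next
  fix f assume f: "f \<in> carrier (aut_group K B)"
  then have m: "ring_mor K B B f" "iso f" by (auto simp: aut_group_def ring_isom_def)
  show "\<one>\<^bsub>aut_group K B\<^esub> \<otimes>\<^bsub>aut_group K B\<^esub> f = f" using ring_mor_typ[OF m(1)] by (simp add: aut_group_def)
  show "\<exists>g\<in>carrier (aut_group K B). g \<otimes>\<^bsub>aut_group K B\<^esub> f = \<one>\<^bsub>aut_group K B\<^esub>"
    using ring_mor_inv[OF m] ring_mor_typ[OF m(1)] m(2)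
    by (intro bexI[of _ "inv_arr K f"]) (auto simp: aut_group_def ring_isom_def)
qed (auto simp: aut_group_def ring_isom_def ring_mor_ide)

lemma quasi_galoisI:
  assumes ind: "indecomposable K B" and fin: "finite \<Gamma>" and G: "\<And>\<gamma>. \<gamma> \<in> \<Gamma> \<longleftrightarrow> ring_mor K B B \<gamma>"
    and i: "\<And>\<gamma>. \<gamma> \<in> \<Gamma> \<Longrightarrow> iso \<gamma>" and s: "split_by \<Gamma> B B (\<lambda>\<gamma>. \<gamma>)"
  shows "quasi_galois K B \<Gamma>"
proof -
  have B [simp]: "is_ring K B" using ind by (simp add: indecomposable_def)
  have "\<Gamma> = carrier (aut_group K B)" using G i by (auto simp: aut_group_def ring_isom_def)
  then have "subgroup \<Gamma> (aut_group K B)" using group.subgroup_self[OF aut_group_group[OF B]] by simp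
  moreover have pr: "product_ring K \<Gamma> (\<lambda>\<gamma>. B) (tr B) (\<lambda>\<gamma>. copair B (Ide K (Car B)) \<gamma>)"
    using s decomp_product by (auto simp: split_by_def)
  moreover have "copair B (Ide K (Car B)) \<gamma> \<cdot> Ide K (Car B \<boxtimes> Car B) = Mul B \<cdot> (Ide K (Car B) \<boxdot> \<gamma>)" if "\<gamma> \<in> \<Gamma>" for \<gamma>
    using ring_mor_typ[of B B \<gamma>] G that by (simp add: copair_def)
  ultimately show ?thesis unfolding quasi_galois_def
    using ind fin by (auto simp: indecomposable_def in_Hom intro!: exI[of _ "tr B"] exI[of _ "\<lambda>\<gamma>. copair B (Ide K (Car B)) \<gamma>"] exI[of _ "Ide K (Car B \<boxtimes> Car B)"])
qed

text \<open>A morphism out of \<open>E\<close> is a d-tuple of morphisms out of \<open>A\<close>.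
  Over a suitable nonzero ring each entry is one of the d composites of \<open>G 0\<close> with the
  \<alpha> i, so every member of the family gives a self-map of a d-element set, and disjoint
  members give different ones. \<open>G 0\<close> acts as base point, hence the separate case n =
  0.\<close>

lemma represents_card:
  assumes r: "represents A d E \<alpha>" and s: "split_by {..<d} E A \<alpha>" and g: "disjoint_family E R n G" and nz: "\<not> zero_ring R"
  shows "n \<le> d ^ d"
proof (cases "n = 0")
  case False
  then have u: "ring_mor K E R (G 0)" using disjoint_familyD[OF g] by simp
  have am: "ring_mor K A E (\<alpha> i)" if "i < d" for i using disjoint_familyD[OF representsD(1)[OF r]] that by blast
  have Gm: "ring_mor K E R (G j)" if "j < n" for j using disjoint_familyD[OF g] that by blast
  have "ring_mor K A R (case p of (j, i) \<Rightarrow> G j \<cdot> \<alpha> i)" if "p \<in> {..<n} \<times> {..<d}" for p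
    using that by (cases p) (simp add: ring_mor_comp[OF am Gm])
  then obtain S v c where v: "ring_mor K R S v" and S: "\<not> zero_ring S"
    and c': "\<forall>p\<in>{..<n} \<times> {..<d}. c p \<in> {..<d} \<and> v \<cdot> (case p of (j, i) \<Rightarrow> G j \<cdot> \<alpha> i) = v \<cdot> (G 0 \<cdot> \<alpha> (c p))"
    using split_by_points[OF s _ u nz, of "{..<n} \<times> {..<d}" "\<lambda>(j, i). G j \<cdot> \<alpha> i"] by blast
  have c: "c (j, i) < d \<and> v \<cdot> (G j \<cdot> \<alpha> i) = v \<cdot> (G 0 \<cdot> \<alpha> (c (j, i)))" if "j < n" "i < d" for j i
    using bspec[OF c', of "(j, i)"] that by simp
  let ?h = "\<lambda>j. restrict (\<lambda>i. c (j, i)) {..<d}"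
  have "inj_on ?h {..<n}"
  proof (rule inj_onI, rule ccontr)
    fix j k assume jk: "j \<in> {..<n}" "k \<in> {..<n}" "?h j = ?h k" "j \<noteq> k"
    note [simp] = ring_mor_typ[OF v]
    have "v \<cdot> G j = v \<cdot> G k"
    proof (rule representsD(3)[OF r ring_mor_comp[OF Gm v] ring_mor_comp[OF Gm v]])
      fix i assume i: "i < d"
      have "c (j, i) = c (k, i)" using fun_cong[OF jk(3), of i] i by simp
      then have "v \<cdot> (G j \<cdot> \<alpha> i) = v \<cdot> (G k \<cdot> \<alpha> i)" using c[of j i] c[of k i] jk i by simp
      then show "(v \<cdot> G j) \<cdot> \<alpha> i = (v \<cdot> G k) \<cdot> \<alpha> i"
        using ring_mor_typ[OF am[OF i]] ring_mor_typ[OF Gm[of j]] ring_mor_typ[OF Gm[of k]] jk by simp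
    qed (use jk in auto)
    then show False using disjointD[OF disjoint_familyD(3)[OF g] v] jk S by auto
  qed
  moreover have "?h ` {..<n} \<subseteq> {..<d} \<rightarrow>\<^sub>E {..<d}" by (auto simp: c split: if_splits)
  ultimately have "card {..<n} \<le> card ({..<d} \<rightarrow>\<^sub>E {..<d})" by (intro card_inj_on_le[of ?h]) (auto intro: finite_PiE)
  then show ?thesis by (simp add: card_PiE)
qed simp

lemma splitting_quasi_galois:
  assumes nice: "nice K" and ind: "indecomposable K B" and A0: "nonzero K A"
    and spl: "splitting_ring K B A"
  shows "\<exists>\<Gamma>. quasi_galois K B \<Gamma>"
proof -
  have B [simp]: "is_ring K B" using ind by (simp add: indecomposable_def)
  have nzB: "\<not> zero_ring B" by (rule indecomposable_nonzero[OF ind])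
  have sB: "splits K B A" using spl by (simp add: splitting_ring_def)
  then have sepA: "separable_ring K A" and finA: "finite_degree K A" and sepB: "separable_ring K B" and finB: "finite_degree K B"
    by (auto simp: splits_iff)
  have minimal: "iso f" if "indecomposable K C" "splits K C A" "ring_mor K C B f" for C f
    using spl that unfolding splitting_ring_def by blast
  obtain d where d: "has_degree K A d" using finA by (auto simp: finite_degree_def)
  have deg: "deg K A = d" by (rule deg_eq[OF sepA d])
  obtain f where f: "split_by {..<d} B A f" using sB unfolding splits_iff deg by blast
  have fd: "disjoint_family A B d f"
    using split_by_disjoint[OF f] f by (auto simp: disjoint_family_def split_by_def)
  \<comment> \<open>A morphism disjoint from all d members would be the (d+1)-st member of a
    disjoint family; the degree allows this only over the zero ring.\<close>
  have split: "split_by {..<d} C A g" if g: "disjoint_family A C d g" for C g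
  proof (rule split_byI[OF sepA])
    fix R u h assume u: "ring_mor K C R u" and h: "ring_mor K A R h" and dj: "\<And>i. i \<in> {..<d} \<Longrightarrow> disjoint R (u \<cdot> g i) h"
    have "disjoint_family A R (Suc d) (\<lambda>i. if i < d then u \<cdot> g i else h)"
      using disjoint_familyD[OF disjoint_family_comp[OF g u]] h dj disjoint_sym[OF dj]
      unfolding disjoint_family_def by (auto simp: less_Suc_eq)
    then show "zero_ring R" using d unfolding has_degree_iff[OF sepA] by blast
  qed (use disjoint_familyD[OF g] in auto)
  obtain T \<phi> where tw: "degree_tower K A T \<phi>" using ex_degree_tower[OF sepA] by blast
  define E where "E = T d"
  have sepE: "separable_ring K E" unfolding E_def by (rule tower_props(1)[OF sepA tw])
  then have E [simp]: "is_ring K E" by (simp add: separable_ring_def)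
  obtain \<alpha> where r: "represents A d E \<alpha>" using tower_props(2)[OF sepA tw] unfolding E_def by blast
  note \<alpha>d = representsD(1)[OF r]
  note \<alpha>s = split[OF \<alpha>d]
  \<comment> \<open>Niceness decomposes only rings of finite degree; the bound on disjoint families
    out of \<open>E\<close> is d^d.\<close>
  have finE: "finite_degree K E"
    by (rule finite_degreeI[OF sepE B nzB]) (rule represents_card[OF r \<alpha>s])
  obtain w where w: "ring_mor K E B w" and wf: "\<And>i. i < d \<Longrightarrow> w \<cdot> \<alpha> i = f i" using representsD(2)[OF r fd] by blast
  from nice sepE finE obtain n As P \<pi> h where ci: "\<forall>i<n. indecomposable K (As i)"
    and pr: "product_ring K {..<(n::nat)} As P \<pi>" and h: "ring_isom K E P h" unfolding nice_def by blast
  obtain e where dc: "decomp {..<n} E e As (\<lambda>i. \<pi> i \<cdot> h)" using product_decomp[OF product_ring_iso[OF pr h]] by blast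
  obtain j v where j: "j < n" and we: "w \<cdot> e j = One B" and v: "ring_mor K (As j) B v" and vp: "v \<cdot> (\<pi> j \<cdot> h) = w"
    using decomp_point_indecomposable[OF dc w ind] by auto
  let ?C = "As j" and ?p = "\<pi> j \<cdot> h"
  have fac: "is_factor E (e j) ?C ?p" by (rule decompD(3)[OF dc]) (use j in simp)
  note pm = is_factorD(1)[OF fac]
  have indC: "indecomposable K ?C" using ci j by blast
  have sepC: "separable_ring K ?C" by (rule separable_factor[OF sepE fac])
  \<comment> \<open>The projection is epi, so composing with it turns disjoint families out of the
    factor into disjoint families out of \<open>E\<close>, and the same bound holds.\<close>
  have finC: "finite_degree K ?C"
  proof (rule finite_degreeI[OF sepC B nzB])
    fix R g m assume g: "disjoint_family ?C R m g" and R: "\<not> zero_ring R"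
    have "disjoint_family E R m (\<lambda>i. g i \<cdot> ?p)" unfolding disjoint_family_def
    proof (intro conjI allI impI)
      show "is_ring K R" using disjoint_familyD[OF g] by blast
      show "ring_mor K E R (g i \<cdot> ?p)" if "i < m" for i using ring_mor_comp[OF pm] disjoint_familyD[OF g] that by blast
      fix i k assume ik: "i < m" "k < m" "i \<noteq> k"
      note gi = disjoint_familyD(2)[OF g ik(1)] and gk = disjoint_familyD(2)[OF g ik(2)]
      show "disjoint R (g i \<cdot> ?p) (g k \<cdot> ?p)" unfolding disjoint_def
      proof (intro allI impI, elim conjE)
        fix S u assume u: "ring_mor K R S u" and eq: "u \<cdot> (g i \<cdot> ?p) = u \<cdot> (g k \<cdot> ?p)"
        have "u \<cdot> g i = u \<cdot> g k"
        proof (rule is_factorD(5)[OF fac])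
          have "(u \<cdot> g i) \<cdot> ?p = u \<cdot> (g i \<cdot> ?p)" "(u \<cdot> g k) \<cdot> ?p = u \<cdot> (g k \<cdot> ?p)"
            by (rule comp_assoc'; use ring_mor_typ[OF u] ring_mor_typ[OF gi] ring_mor_typ[OF gk] ring_mor_typ[OF pm] in simp)+
          then show "(u \<cdot> g i) \<cdot> ?p = (u \<cdot> g k) \<cdot> ?p" using eq by simp
        qed (use ring_mor_typ[OF u] ring_mor_typ[OF gi] ring_mor_typ[OF gk] in simp_all)
        then show "zero_ring S" using disjointD[OF disjoint_familyD(3)[OF g ik] u] by simp
      qed
    qed
    then show "m \<le> d ^ d" by (rule represents_card[OF r \<alpha>s _ R])
  qed
  have "splits K ?C A" unfolding splits_iff deg
    using sepA finA sepC finC split[OF disjoint_family_comp[OF \<alpha>d pm]] by blast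
  then have "iso v" using minimal[OF indC _ v] by simp
  then have facB: "is_factor E (e j) B w" using factor_iso[OF fac v] vp by simp
  have epi: "x = y" if "ring_mor K B R x" "ring_mor K B R y" "x \<cdot> w = y \<cdot> w" for R x y
    by (rule is_factorD(5)[OF facB]) (use that ring_mor_typ[OF that(1)] ring_mor_typ[OF that(2)] in simp_all)
  define \<Gamma> where "\<Gamma> = {\<gamma>. ring_mor K B B \<gamma>}"
  have fm: "ring_mor K A B (f i)" if "i < d" for i using disjoint_familyD[OF fd] that by blast
  note [simp] = ring_mor_typ[OF w]
  have \<alpha>t: "arr (\<alpha> i)" "Cod K (\<alpha> i) = Car E" if "i < d" for i using ring_mor_typ[OF disjoint_familyD(2)[OF \<alpha>d that]] by auto
  \<comment> \<open>An endomorphism of \<open>B\<close> sends each \<open>f i\<close> to some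
    \<open>f k\<close>. Since \<open>w\<close> is epi and a morphism out of \<open>E\<close> is
    determined by its entries, this index map determines the endomorphism; so \<Gamma> is
    finite.\<close>
  have "\<forall>\<gamma>\<in>\<Gamma>. \<forall>i<d. \<exists>k<d. \<gamma> \<cdot> f i = f k"
  proof (intro ballI allI impI)
    fix \<gamma> i assume "\<gamma> \<in> \<Gamma>" "i < d"
    then obtain k where "k < d" "\<gamma> \<cdot> f i = Ide K (Car B) \<cdot> f k"
      using split_by_point_indecomposable[OF f ring_mor_ide[OF B] ring_mor_comp[OF fm] ind] by (auto simp: \<Gamma>_def)
    then show "\<exists>k<d. \<gamma> \<cdot> f i = f k" using ring_mor_typ[OF fm[of k]] by auto
  qed
  then obtain c where c: "\<And>\<gamma> i. \<gamma> \<in> \<Gamma> \<Longrightarrow> i < d \<Longrightarrow> c \<gamma> i < d \<and> \<gamma> \<cdot> f i = f (c \<gamma> i)" by metis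
  have "inj_on (\<lambda>\<gamma>. restrict (c \<gamma>) {..<d}) \<Gamma>"
  proof (rule inj_onI)
    fix x y assume xy: "x \<in> \<Gamma>" "y \<in> \<Gamma>" "restrict (c x) {..<d} = restrict (c y) {..<d}"
    then have m: "ring_mor K B B x" "ring_mor K B B y" by (auto simp: \<Gamma>_def)
    have "x \<cdot> w = y \<cdot> w"
    proof (rule representsD(3)[OF r ring_mor_comp[OF w m(1)] ring_mor_comp[OF w m(2)]])
      fix i assume i: "i < d"
      have "c x i = c y i" using fun_cong[OF xy(3), of i] i by simp
      then have "x \<cdot> f i = y \<cdot> f i" using c[OF xy(1) i] c[OF xy(2) i] by simp
      then show "(x \<cdot> w) \<cdot> \<alpha> i = (y \<cdot> w) \<cdot> \<alpha> i"
        using wf[OF i] \<alpha>t[OF i] ring_mor_typ[OF m(1)] ring_mor_typ[OF m(2)] by simp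
    qed
    then show "x = y" using epi m by blast
  qed
  moreover have "(\<lambda>\<gamma>. restrict (c \<gamma>) {..<d}) ` \<Gamma> \<subseteq> {..<d} \<rightarrow>\<^sub>E {..<d}"
    by (rule image_subsetI) (simp add: PiE_iff extensional_def c)
  ultimately have finG: "finite \<Gamma>" by (rule inj_on_finite) (simp add: finite_PiE)
  have "split_by \<Gamma> B B (\<lambda>\<gamma>. \<gamma>)"
  proof (rule split_byI[OF sepB B finG])
    show "ring_mor K B B \<gamma>" if "\<gamma> \<in> \<Gamma>" for \<gamma> using that by (simp add: \<Gamma>_def)
    show "disjoint B x y" if "x \<in> \<Gamma>" "y \<in> \<Gamma>" "x \<noteq> y" for x y
      using equal_or_disjoint[OF sepB ind] that by (auto simp: \<Gamma>_def)
    fix R u h assume u: "ring_mor K B R u" and h: "ring_mor K B R h" and dj: "\<And>\<gamma>. \<gamma> \<in> \<Gamma> \<Longrightarrow> disjoint R (u \<cdot> \<gamma>) h"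
    show "zero_ring R"
    proof (rule ccontr)
      assume R: "\<not> zero_ring R"
      obtain S x k where x: "ring_mor K R S x" and S: "\<not> zero_ring S"
        and k: "\<And>i. i < d \<Longrightarrow> k i < d \<and> x \<cdot> (h \<cdot> f i) = x \<cdot> (u \<cdot> f (k i))"
        using split_by_points[OF f _ u R, of "{..<d}" "\<lambda>i. h \<cdot> f i"] ring_mor_comp[OF fm h]
        by (meson finite_lessThan lessThan_iff)
      note [simp] = ring_mor_typ[OF u] ring_mor_typ[OF h] ring_mor_typ[OF x]
      \<comment> \<open>\<open>k\<close> is injective: equal indices would make two disjoint
        morphisms agree over the nonzero \<open>S\<close>. The reindexed tuple is therefore disjoint
        in \<open>B\<close> itself and is classified by some \<open>w'\<close>.\<close>
      have "disjoint_family A B d (\<lambda>i. f (k i))" unfolding disjoint_family_def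
      proof (intro conjI allI impI)
        fix i l assume il: "i < d" "l < d" "i \<noteq> l"
        have "k i \<noteq> k l"
        proof
          assume "k i = k l"
          then have "x \<cdot> (h \<cdot> f i) = x \<cdot> (h \<cdot> f l)" using k il by simp
          then have "(x \<cdot> h) \<cdot> f i = (x \<cdot> h) \<cdot> f l" using ring_mor_typ[OF fm[OF il(1)]] ring_mor_typ[OF fm[OF il(2)]] by simp
          then show False using disjointD[OF disjoint_familyD(3)[OF fd il] ring_mor_comp[OF h x]] S by simp
        qed
        then show "disjoint B (f (k i)) (f (k l))" using disjoint_familyD(3)[OF fd] k il by blast
      qed (use fm k in auto)
      then obtain w' where w': "ring_mor K E B w'" and w'f: "\<And>i. i < d \<Longrightarrow> w' \<cdot> \<alpha> i = f (k i)" using representsD(2)[OF r] by blast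
      note [simp] = ring_mor_typ[OF w']
      have eq: "(x \<cdot> h) \<cdot> w = (x \<cdot> u) \<cdot> w'"
      proof (rule representsD(3)[OF r ring_mor_comp[OF w ring_mor_comp[OF h x]] ring_mor_comp[OF w' ring_mor_comp[OF u x]]])
        fix i assume i: "i < d"
        show "((x \<cdot> h) \<cdot> w) \<cdot> \<alpha> i = ((x \<cdot> u) \<cdot> w') \<cdot> \<alpha> i"
          using wf[OF i] w'f[OF i] k[OF i] \<alpha>t[OF i] by simp
      qed
      have ge: "arr (e j)" "Dom K (e j) = Unity K" "Cod K (e j) = Car E" using is_factorD(2)[OF fac] by auto
      \<comment> \<open>To descend along the factor \<open>w\<close>, the morphism \<open>w'\<close>
        must send the idempotent \<open>e j\<close> to 1. Over \<open>S\<close> it does, so its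
        value in \<open>B\<close> is a nonzero idempotent, and \<open>B\<close> is
        indecomposable.\<close>
      have "((x \<cdot> h) \<cdot> w) \<cdot> e j = ((x \<cdot> u) \<cdot> w') \<cdot> e j" by (simp only: eq)
      then have 1: "x \<cdot> (u \<cdot> (w' \<cdot> e j)) = One S" using we ge by simp
      have "w' \<cdot> e j \<noteq> Z (Unity K) (Car B)" using 1 S by (auto simp: zero_ring_def)
      moreover have "gmul B (w' \<cdot> e j) (w' \<cdot> e j) = w' \<cdot> e j"
        using ring_mor_gmul[OF w'] is_factorD(2,4)[OF fac] by metis
      ultimately have "w' \<cdot> e j = One B" using indecomposable_idem[OF ind, of "w' \<cdot> e j"] ge by auto
      then obtain \<gamma> where g: "ring_mor K B B \<gamma>" "\<gamma> \<cdot> w = w'" using factor_lift[OF facB w'] by blast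
      note [simp] = ring_mor_typ[OF g(1)]
      have "(x \<cdot> h) \<cdot> w = (x \<cdot> (u \<cdot> \<gamma>)) \<cdot> w" using eq by (simp flip: g(2))
      then have "x \<cdot> h = x \<cdot> (u \<cdot> \<gamma>)"
        by (rule epi[OF ring_mor_comp[OF h x] ring_mor_comp[OF ring_mor_comp[OF g(1) u] x]])
      then have "zero_ring S" using disjointD[OF dj[of \<gamma>] x] g by (simp add: \<Gamma>_def)
      then show False using S by simp
    qed
  qed
  \<comment> \<open>Endomorphisms of \<open>B\<close> are invertible by minimality, with
    \<open>B\<close> itself as the competing ring.\<close>
  then have "quasi_galois K B \<Gamma>"
    by (intro quasi_galoisI[OF ind finG]) (auto simp: \<Gamma>_def intro: minimal[OF ind sB])
  then show ?thesis by blast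
qed

end

theorem corollary6p10:
  fixes K :: "('o, 'm) smc" and B :: "('o, 'm) ring_data"
  assumes "idempotent_complete_smc K"
    and "nice K"
    and "separable_ring K B"
    and "indecomposable K B"
    and "finite_degree K B"
  shows "(\<exists>\<Gamma>. quasi_galois K B \<Gamma>) \<longleftrightarrow>
    (\<exists>A. nonzero K A \<and> separable_ring K A \<and> finite_degree K A \<and> splitting_ring K B A)"
proof -
  interpret idempotent_complete_smc K by (rule assms(1))
  \<comment> \<open>For the forward direction \<open>B\<close> serves as the ring to be split; it is
    nonzero because it is indecomposable.\<close>
  show ?thesis
    using quasi_galois_splitting[OF assms(3-5)] splitting_quasi_galois[OF assms(2,4)] assms(3-5)
    by (auto simp: indecomposable_def)
qed

end
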